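(* Let $(\Omega,\mu,T,\alpha)$ be a topologically mixing, measure-preserving Gibbs-Markov system, let $\phi,\psi\in\tilde L$ be real-valued functions whose distributions $\mu_\phi,\mu_\psi$ have no atoms and whose distribution functions $F_\phi,F_\psi$ are Lipschitz continuous, and let $\phi_m,\psi_n\in L$ be real-valued with $\|\phi-\phi_m\|_2\to0$ and $\|\psi-\psi_n\|_2\to0$. Let $n=n(m)$ be positive integers such that for some $\lambda\in(0,1)$, $\lambda\leq n/m\leq\lambda^{-1}$. With $W_{m,n}$, $A$, $D$ and $\sigma_m$ as defined in the context, assume that, as $m\to\infty$ with $n=n(m)$, $$\operatorname{Var}(A)=o(\sigma_m^2),$$ $$\|\phi-\phi_m\|_1=o(n^{-1}m^{-1}\sigma_m),\qquad\|\psi-\psi_n\|_1=o(n^{-1}m^{-1}\sigma_m),$$ $$D_\alpha\phi_m=o(m^2),\qquad D_\alpha\psi_n=o(n^2),$$ and $$\liminf_{m\to\infty}\sigma_mm^{-3/2}>0.$$ Then, as $m\to\infty$, $$\frac1{\sigma_m}\big(W_{m,n(m)}-D\big)\Rightarrow\mathcal N(0,1)$$ (convergence in distribution under $\mu$).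
   Context: Gibbs-Markov systems. Let $(\Omega,\mathcal B,\mu,T)$ be a nonsingular transformation of a standard probability space and $\alpha=\{a_i:i\in I\}$ a countable partition of $\Omega$ mod $\mu$. Write $\sigma(\cdot)$ for the generated $\sigma$-algebra and $T\alpha=\{Ta:a\in\alpha\}$. For $x,y\in\Omega$ let $s(x,y)=\min\{n+1: n\geq 0,\ T^n(x)\text{ and }T^n(y)\text{ belong to different elements of }\alpha\}$ ($=\infty$ if there is no such $n$), and for $r\in(0,1)$ let $r(x,y)=r^{s(x,y)}$. $(\Omega,\mu,T,\alpha)$ is a Gibbs-Markov system if, modulo $\mu$: (1) $\sigma(\{T^{-n}\alpha:n\geq0\})=\mathcal B$; (2) for every $a\in\alpha$, $Ta\in\sigma(\alpha)$ and $T|_a$ is invertible and two-sided nonsingular; (3) $\inf_{a\in\alpha}\mu(Ta)>0$; (4) for $n\geq1$ and $a\in\bigvee_{i=0}^{n-1}T^{-i}\alpha$, let $v_a:T^na\to a$ be the nonsingular inverse branch of $T^n$ and $v_a'$ its Radon-Nikodym derivative; there exist $r\in(0,1)$ and $M>0$ such that for all such $n,a$ and all $x,y\in T^na$, $\left|\frac{v_a'(x)}{v_a'(y)}-1\right|\leq M\,r(x,y)$. The number $r$ (hence the metric $r(\cdot,\cdot)$) is fixed as part of the system. Measure-preserving means $\mu\circ T^{-1}=\mu$. Topologically mixing means: for any $a,b\in\alpha$ there is $n_{a,b}\in\mathbb N$ such that $b\subset T^na$ for every $n>n_{a,b}$. Function spaces. For a partition $\rho$ of $\Omega$ and $f:\Omega\to\mathbb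 C$ let $D_\rho f=\sup_{b\in\rho}\sup_{x,y\in b,\,x\neq y}\frac{|f(x)-f(y)|}{r(x,y)}$ (suprema understood $\mu$-almost everywhere). Fix a partition $\beta$ with $\sigma(\beta)=\sigma(T\alpha)$. Put $\|f\|=\|f\|_\infty+D_\beta f$ and let $L$ be the Banach space of functions $f$ with $\|f\|<\infty$. $\tilde L$ is the set of measurable $f:\Omega\to\mathbb R$ for which there are $f_n\in L$ with $\|f-f_n\|_2\to0$. $\|\cdot\|_q$ is the $L^q(\mu)$ norm. Two-sample rank statistic. Put $X_i=\phi\circ T^i$ and $Y_k=\psi\circ T^k$. For a function $\chi$, $\mu_\chi$ denotes its distribution under $\mu$; $F_\phi,F_\psi$ are the distribution functions of $\phi,\psi$. Given $X_1,\dots,X_m,Y_1,\dots,Y_n$, let $R_i$ be the rank of $X_i$ among all $n+m$ observations, i.e. $R_i=\#\{k\leq n:Y_k\leq X_i\}+\#\{k\leq m:X_k\leq X_i\}$, and let $W_{m,n}=\sum_{i=1}^mR_i$ (two-sample Wilcoxon rank sum statistic). Define $$A=\sum_{i=1}^m\sum_{k=1}^n\Big(\mathbf 1_{\{Y_k\leq X_i\}}-\int\mathbf 1_{\{Y_k\leq t\}}\mu_\phi(dt)-\int\mathbf 1_{\{t\leq X_i\}}\mu_\psi(dt)+\iint\mathbf 1_{\{s\leq t\}}\mu_\phi(dt)\mu_\psi(ds)\Big),$$ $$D=mn\iint\mathbf 1_{\{s\leq t\}}\mu_\phi(dt)\mu_\psi(ds)+\frac{m(m-1)}2,$$ $$\tilde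 B_n=\sum_{k=1}^n\big(1-F_\phi(\psi_n\circ T^k)\big)-n\int(1-F_\phi(s))\,\mu_{\psi_n}(ds),\qquad\tilde C_m=\sum_{k=1}^mF_\psi(\phi_m\circ T^k)-m\int F_\psi(s)\,\mu_{\phi_m}(ds),$$ $$\sigma_m^2=m^2\operatorname{Var}(\tilde B_{n(m)})+n(m)^2\operatorname{Var}(\tilde C_m)+2n(m)m\operatorname{Cov}(\tilde B_{n(m)},\tilde C_m).$$ *)

theory Defs
  imports "HOL-Probability.Probability"
begin

section \<open>Standard spaces, nonsingular maps and notions modulo null sets\<close>

text \<open>Standard Borel: measurably isomorphic to a Borel subset of the real line.\<close>

definition standard_borel :: "'a measure \<Rightarrow> bool" where
  "standard_borel M \<longleftrightarrow>
     (\<exists>B f g. B \<in> sets (borel :: real measure) \<and>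
        f \<in> measurable M (restrict_space borel B) \<and>
        g \<in> measurable (restrict_space borel B) M \<and>
        (\<forall>x\<in>space M. g (f x) = x) \<and> (\<forall>y\<in>B. f (g y) = y))"

definition nonsingular :: "'a measure \<Rightarrow> ('a \<Rightarrow> 'a) \<Rightarrow> bool" where
  "nonsingular M T \<longleftrightarrow> T \<in> measurable M M \<and>
     (\<forall>A\<in>sets M. emeasure M (T -` A \<inter> space M) = 0 \<longleftrightarrow> emeasure M A = 0)"

definition measure_preserving :: "'a measure \<Rightarrow> ('a \<Rightarrow> 'a) \<Rightarrow> bool" where
  "measure_preserving M T \<longleftrightarrow> T \<in> measurable M M \<and> distr M M T = M"

definition eq_mod :: "'a measure \<Rightarrow> 'a set \<Rightarrow> 'a set \<Rightarrow> bool" where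
  "eq_mod M A B \<longleftrightarrow> (AE x in M. x \<in> A \<longleftrightarrow> x \<in> B)"

definition subset_mod :: "'a measure \<Rightarrow> 'a set \<Rightarrow> 'a set \<Rightarrow> bool" where
  "subset_mod M A B \<longleftrightarrow> (AE x in M. x \<in> A \<longrightarrow> x \<in> B)"

definition sigma_eq_mod :: "'a measure \<Rightarrow> 'a set set \<Rightarrow> 'a set set \<Rightarrow> bool" where
  "sigma_eq_mod M \<F> \<G> \<longleftrightarrow>
     (\<forall>A\<in>sigma_sets (space M) \<F>. \<exists>B\<in>sigma_sets (space M) \<G>. eq_mod M A B) \<and>
     (\<forall>B\<in>sigma_sets (space M) \<G>. \<exists>A\<in>sigma_sets (space M) \<F>. eq_mod M A B)"

text \<open>As usual for partitions modulo a measure, the members are not null.\<close>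

definition partition_mod :: "'a measure \<Rightarrow> 'a set set \<Rightarrow> bool" where
  "partition_mod M \<alpha> \<longleftrightarrow> countable \<alpha> \<and>
     (\<forall>a\<in>\<alpha>. a \<in> sets M \<and> emeasure M a > 0) \<and>
     (\<forall>a\<in>\<alpha>. \<forall>b\<in>\<alpha>. a \<noteq> b \<longrightarrow> emeasure M (a \<inter> b) = 0) \<and>
     (AE x in M. x \<in> \<Union>\<alpha>)"

text \<open>The image \<open>S A\<close> modulo null sets. The literal image \<open>S ` A\<close> is not invariant under changing
  \<open>A\<close> on a null set, since a null part of \<open>A\<close> may have a large image; hence all sufficiently
  large null sets are removed from \<open>A\<close> first. The set obtained is unique up to null sets, and it
  exists whenever \<open>S\<close> is nonsingular on a standard space.\<close>

definition image_mod :: "'a measure \<Rightarrow> ('a \<Rightarrow> 'a) \<Rightarrow> 'a set \<Rightarrow> 'a set" where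
  "image_mod M S A = (SOME E. E \<in> sets M \<and>
     (\<exists>N\<in>null_sets M. \<forall>N'\<in>null_sets M. N \<subseteq> N' \<longrightarrow> eq_mod M E (S ` (A - N'))))"

text \<open>\<open>v : S A \<rightarrow> A\<close> is, modulo null sets, the inverse of the restriction of \<open>S\<close> to \<open>A\<close>, and both
  this restriction and \<open>v\<close> are nonsingular.\<close>

definition inverse_branch ::
  "'a measure \<Rightarrow> ('a \<Rightarrow> 'a) \<Rightarrow> 'a set \<Rightarrow> ('a \<Rightarrow> 'a) \<Rightarrow> bool" where
  "inverse_branch M S A v \<longleftrightarrow>
     image_mod M S A \<in> sets M \<and>
     v \<in> measurable (restrict_space M (image_mod M S A)) M \<and>
     (AE x in M. x \<in> A \<longrightarrow> S x \<in> image_mod M S A \<and> v (S x) = x) \<and>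
     (AE y in M. y \<in> image_mod M S A \<longrightarrow> v y \<in> A \<and> S (v y) = y) \<and>
     (\<forall>C\<in>sets M. C \<subseteq> image_mod M S A \<longrightarrow>
        (emeasure M (S -` C \<inter> A) = 0 \<longleftrightarrow> emeasure M C = 0)) \<and>
     (\<forall>B\<in>sets M. B \<subseteq> A \<longrightarrow>
        (emeasure M (v -` B \<inter> image_mod M S A) = 0 \<longleftrightarrow> emeasure M B = 0))"

text \<open>If \<open>v\<close> is the inverse branch of \<open>S\<close> on \<open>A\<close>, then \<open>\<mu> (v B) = \<mu> (A \<inter> S\<^sup>-\<^sup>1 B)\<close> for
  \<open>B \<subseteq> S A\<close>. Hence the Radon-Nikodym derivative \<open>v' = d(\<mu> \<circ> v)/d\<mu>\<close> is that of the image under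
  \<open>S\<close> of \<open>\<mu>\<close> restricted to \<open>A\<close>.\<close>

definition branch_deriv :: "'a measure \<Rightarrow> ('a \<Rightarrow> 'a) \<Rightarrow> 'a set \<Rightarrow> 'a \<Rightarrow> real" where
  "branch_deriv M S A y = enn2real (RN_deriv M (distr (restrict_space M A) M S) y)"


section \<open>Gibbs-Markov systems\<close>

definition sep_time :: "('a \<Rightarrow> 'a) \<Rightarrow> 'a set set \<Rightarrow> 'a \<Rightarrow> 'a \<Rightarrow> enat" where
  "sep_time T \<alpha> x y =
     (INF n\<in>{n. \<exists>a\<in>\<alpha>. \<exists>b\<in>\<alpha>. a \<noteq> b \<and> (T ^^ n) x \<in> a \<and> (T ^^ n) y \<in> b}. enat (n + 1))"

definition sep_dist :: "('a \<Rightarrow> 'a) \<Rightarrow> 'a set set \<Rightarrow> real \<Rightarrow> 'a \<Rightarrow> 'a \<Rightarrow> real" where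
  "sep_dist T \<alpha> r x y = (case sep_time T \<alpha> x y of enat k \<Rightarrow> r ^ k | \<infinity> \<Rightarrow> 0)"

text \<open>The (non-null) elements of the join of \<open>T\<^sup>-\<^sup>i \<alpha>\<close> for \<open>i < n\<close>.\<close>

definition cylinders :: "'a measure \<Rightarrow> ('a \<Rightarrow> 'a) \<Rightarrow> 'a set set \<Rightarrow> nat \<Rightarrow> 'a set set" where
  "cylinders M T \<alpha> n = {A. emeasure M A > 0 \<and>
     (\<exists>c. (\<forall>i<n. c i \<in> \<alpha>) \<and> A = {x \<in> space M. \<forall>i<n. (T ^^ i) x \<in> c i})}"

locale gibbs_markov = prob_space M
  for M :: "'a measure" and T :: "'a \<Rightarrow> 'a" and \<alpha> :: "'a set set" and r :: real +
  assumes standard: "standard_borel M"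
    and nonsingular: "nonsingular M T"
    and partition: "partition_mod M \<alpha>"
    and generating:
      "sigma_eq_mod M {(T ^^ n) -` a \<inter> space M | n a. a \<in> \<alpha>} (sets M)"
    and image_in_sigma: "\<And>a. a \<in> \<alpha> \<Longrightarrow> \<exists>S\<in>sigma_sets (space M) \<alpha>. eq_mod M (image_mod M T a) S"
    and invertible: "\<And>a. a \<in> \<alpha> \<Longrightarrow> \<exists>v. inverse_branch M T a v"
    and big_images: "(INF a\<in>\<alpha>. measure M (image_mod M T a)) > 0"
    and r_pos: "0 < r" and r_less_1: "r < 1"
    and distortion:
      "\<exists>K>0. \<forall>n\<ge>1. \<forall>a\<in>cylinders M T \<alpha> n. \<exists>N\<in>null_sets M.
         \<forall>x\<in>image_mod M (T ^^ n) a - N. \<forall>y\<in>image_mod M (T ^^ n) a - N.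
           \<bar>branch_deriv M (T ^^ n) a x / branch_deriv M (T ^^ n) a y - 1\<bar> \<le> K * sep_dist T \<alpha> r x y"

definition topologically_mixing :: "'a measure \<Rightarrow> ('a \<Rightarrow> 'a) \<Rightarrow> 'a set set \<Rightarrow> bool" where
  "topologically_mixing M T \<alpha> \<longleftrightarrow>
     (\<forall>a\<in>\<alpha>. \<forall>b\<in>\<alpha>. \<exists>n\<^sub>0. \<forall>n>n\<^sub>0. subset_mod M b (image_mod M (T ^^ n) a))"


section \<open>Function spaces\<close>

text \<open>The infimum over null sets makes the suprema essential ones. In \<open>ennreal\<close> a quotient with
  denominator \<open>0\<close> is \<open>\<infinity>\<close> unless the numerator is \<open>0\<close> as well.\<close>

definition lip_seminorm :: "'a measure \<Rightarrow> ('a \<Rightarrow> 'a) \<Rightarrow> 'a set set \<Rightarrow> real \<Rightarrow> 'a set set \<Rightarrow>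
    ('a \<Rightarrow> 'b::real_normed_vector) \<Rightarrow> ennreal" where
  "lip_seminorm M T \<alpha> r \<rho> f =
     (INF N\<in>null_sets M. SUP b\<in>\<rho>. SUP (x, y)\<in>{(x, y). x \<in> b - N \<and> y \<in> b - N \<and> x \<noteq> y}.
        ennreal (norm (f x - f y)) / ennreal (sep_dist T \<alpha> r x y))"

text \<open>\<open>\<beta>\<close> is the partition with \<open>\<sigma>(\<beta>) = \<sigma>(T\<alpha>)\<close>, see \<open>image_partition\<close>.\<close>

definition L_norm :: "'a measure \<Rightarrow> ('a \<Rightarrow> 'a) \<Rightarrow> 'a set set \<Rightarrow> real \<Rightarrow> 'a set set \<Rightarrow>
    ('a \<Rightarrow> complex) \<Rightarrow> ennreal" where
  "L_norm M T \<alpha> r \<beta> f = esssup M (\<lambda>x. ennreal (norm (f x))) + lip_seminorm M T \<alpha> r \<beta> f"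

definition L_space :: "'a measure \<Rightarrow> ('a \<Rightarrow> 'a) \<Rightarrow> 'a set set \<Rightarrow> real \<Rightarrow> 'a set set \<Rightarrow>
    ('a \<Rightarrow> complex) set" where
  "L_space M T \<alpha> r \<beta> = {f \<in> borel_measurable M. L_norm M T \<alpha> r \<beta> f < \<infinity>}"

definition image_partition :: "'a measure \<Rightarrow> ('a \<Rightarrow> 'a) \<Rightarrow> 'a set set \<Rightarrow> 'a set set \<Rightarrow> bool" where
  "image_partition M T \<alpha> \<beta> \<longleftrightarrow> partition_mod M \<beta> \<and> sigma_eq_mod M \<beta> (image_mod M T ` \<alpha>)"

text \<open>The \<open>L\<^sup>q\<close> norm as a value in \<open>[0, \<infinity>]\<close>; it is infinite for functions outside \<open>L\<^sup>q\<close>.\<close>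

definition Lq_norm :: "'a measure \<Rightarrow> real \<Rightarrow> ('a \<Rightarrow> 'b::real_normed_vector) \<Rightarrow> ennreal" where
  "Lq_norm M q f = (let I = \<integral>\<^sup>+x. ennreal (norm (f x) powr q) \<partial>M
     in if I = \<infinity> then \<infinity> else ennreal (enn2real I powr (1 / q)))"

definition L_tilde :: "'a measure \<Rightarrow> ('a \<Rightarrow> 'a) \<Rightarrow> 'a set set \<Rightarrow> real \<Rightarrow> 'a set set \<Rightarrow>
    ('a \<Rightarrow> real) set" where
  "L_tilde M T \<alpha> r \<beta> = {f \<in> borel_measurable M.
     \<exists>g. (\<forall>n. g n \<in> L_space M T \<alpha> r \<beta>) \<and>
         (\<lambda>n. Lq_norm M 2 (\<lambda>x. complex_of_real (f x) - g n x)) \<longlonglongrightarrow> 0}"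

text \<open>Little-o for sequences with values in \<open>[0, \<infinity>]\<close>, avoiding a conversion to \<open>real\<close>.\<close>

definition ennreal_smallo :: "(nat \<Rightarrow> ennreal) \<Rightarrow> (nat \<Rightarrow> real) \<Rightarrow> bool" where
  "ennreal_smallo u g \<longleftrightarrow> (\<forall>c>0. \<forall>\<^sub>F m in sequentially. u m \<le> ennreal (c * \<bar>g m\<bar>))"


section \<open>The two-sample rank statistic\<close>

definition covariance :: "'a measure \<Rightarrow> ('a \<Rightarrow> real) \<Rightarrow> ('a \<Rightarrow> real) \<Rightarrow> real" where
  "covariance M X Y = (\<integral>x. (X x - (\<integral>x. X x \<partial>M)) * (Y x - (\<integral>x. Y x \<partial>M)) \<partial>M)"

abbreviation law :: "'a measure \<Rightarrow> ('a \<Rightarrow> real) \<Rightarrow> real measure" where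
  "law M f \<equiv> distr M borel f"

definition rank_in_sample ::
  "('a \<Rightarrow> 'a) \<Rightarrow> ('a \<Rightarrow> real) \<Rightarrow> ('a \<Rightarrow> real) \<Rightarrow> nat \<Rightarrow> nat \<Rightarrow> nat \<Rightarrow> 'a \<Rightarrow> nat" where
  "rank_in_sample T \<phi> \<psi> m n i x =
     card {k \<in> {1..n}. \<psi> ((T ^^ k) x) \<le> \<phi> ((T ^^ i) x)} +
     card {k \<in> {1..m}. \<phi> ((T ^^ k) x) \<le> \<phi> ((T ^^ i) x)}"

definition wilcoxon ::
  "('a \<Rightarrow> 'a) \<Rightarrow> ('a \<Rightarrow> real) \<Rightarrow> ('a \<Rightarrow> real) \<Rightarrow> nat \<Rightarrow> nat \<Rightarrow> 'a \<Rightarrow> real" where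
  "wilcoxon T \<phi> \<psi> m n x = (\<Sum>i=1..m. real (rank_in_sample T \<phi> \<psi> m n i x))"

definition stat_A ::
  "'a measure \<Rightarrow> ('a \<Rightarrow> 'a) \<Rightarrow> ('a \<Rightarrow> real) \<Rightarrow> ('a \<Rightarrow> real) \<Rightarrow> nat \<Rightarrow> nat \<Rightarrow> 'a \<Rightarrow> real" where
  "stat_A M T \<phi> \<psi> m n x = (\<Sum>i=1..m. \<Sum>k=1..n.
     of_bool (\<psi> ((T ^^ k) x) \<le> \<phi> ((T ^^ i) x))
     - (\<integral>t. of_bool (\<psi> ((T ^^ k) x) \<le> t) \<partial>law M \<phi>)
     - (\<integral>t. of_bool (t \<le> \<phi> ((T ^^ i) x)) \<partial>law M \<psi>)
     + (\<integral>s. (\<integral>t. of_bool (s \<le> t) \<partial>law M \<phi>) \<partial>law M \<psi>))"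

definition stat_D :: "'a measure \<Rightarrow> ('a \<Rightarrow> real) \<Rightarrow> ('a \<Rightarrow> real) \<Rightarrow> nat \<Rightarrow> nat \<Rightarrow> real" where
  "stat_D M \<phi> \<psi> m n =
     real m * real n * (\<integral>s. (\<integral>t. of_bool (s \<le> t) \<partial>law M \<phi>) \<partial>law M \<psi>)
     + real m * (real m - 1) / 2"

definition stat_B :: "'a measure \<Rightarrow> ('a \<Rightarrow> 'a) \<Rightarrow> ('a \<Rightarrow> real) \<Rightarrow> (nat \<Rightarrow> 'a \<Rightarrow> real) \<Rightarrow>
    nat \<Rightarrow> 'a \<Rightarrow> real" where
  "stat_B M T \<phi> \<psi>s n x =
     (\<Sum>k=1..n. 1 - cdf (law M \<phi>) (\<psi>s n ((T ^^ k) x)))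
     - real n * (\<integral>s. 1 - cdf (law M \<phi>) s \<partial>law M (\<psi>s n))"

definition stat_C :: "'a measure \<Rightarrow> ('a \<Rightarrow> 'a) \<Rightarrow> ('a \<Rightarrow> real) \<Rightarrow> (nat \<Rightarrow> 'a \<Rightarrow> real) \<Rightarrow>
    nat \<Rightarrow> 'a \<Rightarrow> real" where
  "stat_C M T \<psi> \<phi>s m x =
     (\<Sum>k=1..m. cdf (law M \<psi>) (\<phi>s m ((T ^^ k) x)))
     - real m * (\<integral>s. cdf (law M \<psi>) s \<partial>law M (\<phi>s m))"

definition stat_sigma :: "'a measure \<Rightarrow> ('a \<Rightarrow> 'a) \<Rightarrow> ('a \<Rightarrow> real) \<Rightarrow> ('a \<Rightarrow> real) \<Rightarrow>
    (nat \<Rightarrow> 'a \<Rightarrow> real) \<Rightarrow> (nat \<Rightarrow> 'a \<Rightarrow> real) \<Rightarrow> (nat \<Rightarrow> nat) \<Rightarrow> nat \<Rightarrow> real" where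
  "stat_sigma M T \<phi> \<psi> \<phi>s \<psi>s n m = sqrt (
     (real m)\<^sup>2 * prob_space.variance M (stat_B M T \<phi> \<psi>s (n m))
     + (real (n m))\<^sup>2 * prob_space.variance M (stat_C M T \<psi> \<phi>s m)
     + 2 * real (n m) * real m *
         covariance M (stat_B M T \<phi> \<psi>s (n m)) (stat_C M T \<psi> \<phi>s m))"

end

theory Submission
  imports Defs "HOL-Real_Asymp.Real_Asymp"
begin

text \<open>
  The branch densities on long cylinders are almost constant and, by topological mixing and the
  big image property, dominate a common multiple of \<open>\<mu>\<close> restricted to one element of \<open>\<alpha>\<close> after a
  fixed time. Comparing two cylinders along a common future word gives
  \<open>\<Delta>\<^bsub>J+i+j\<^esub> \<le> (1 - \<epsilon>) \<Delta>\<^sub>j + 2 K r\<^sup>i\<close> for the largest discrepancy \<open>\<Delta>\<close> between conditional laws,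
  hence uniform mixing at a stretched exponential rate, which suffices throughout.

  The Hoeffding decomposition writes \<open>W - D\<close> as \<open>m B + n C\<close> plus \<open>A\<close>, ties and approximation
  errors. The linear part is a sum of bounded functions whose regularity constants grow
  polynomially in \<open>m\<close> and whose variance is at least of order \<open>m\<close>, so Bernstein blocks separated
  by gaps of a small power of \<open>m\<close> give the normal limit. All remainders vanish in \<open>L\<^sup>1\<close>.
  Since \<open>A\<close> need not be centred and \<open>X\<^sub>i = X\<^sub>k\<close> may have positive probability, this requires
  bounds on \<open>E A\<close> and on the expected number of ties, again by mixing.
\<close>

text \<open>Conditional laws are compared directly because this asks no regularity of the later
  observable: after the gap it may be any bounded measurable function, in particular the indicator
  of an inequality. Only the earlier observable is approximated on cylinders, uniformly up to a null
  set. The stretched exponential arises from running k rounds of contraction with separating words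
  of length k, about k^2 steps in all, for an error \<open>\<theta> ^ k\<close>. With memory length
  k of order m^(1/20) the gaps have order m^(1/10), while a k-th power still beats every power of m;
  polynomially growing regularity constants are therefore harmless. Blocks of length m^(2/5) stay
  below the standard deviation of the normalized sum, which is at least of order m^(1/2), and the
  gaps, of order m^(3/5) in number, have total variance at most of order m^(4/5). A recurring
  obstacle is that all set relations of the system hold only modulo null sets. Images are therefore
  phrased as surjectivity that persists after the removal of any null set.\<close>

lemma AE_null_cover:
  assumes "AE x in M. P x"
  obtains N where "N \<in> null_sets M" "{x\<in>space M. \<not> P x} \<subseteq> N"
proof -
  obtain N where N: "\<And>x. x \<in> space M - N \<Longrightarrow> P x" "N \<in> null_sets M"
    using AE_E3[OF assms] by metis
  then have "{x\<in>space M. \<not> P x} \<subseteq> N" by blast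
  with N(2) show ?thesis by (rule that)
qed

section \<open>Patching over countable partitions modulo null sets\<close>

text \<open>This is how an estimate proved on each cylinder becomes one on the whole space. The
  index set may be infinite, so the estimate is added over finitely many pieces and then passed to
  the limit along their increasing unions.\<close>

lemma (in finite_measure) piecewise_integral_bound:
  fixes f :: "'a \<Rightarrow> 'b::{banach, second_countable_topology}" and h :: "'a \<Rightarrow> real"
  assumes I: "countable I" and B: "\<And>i. i \<in> I \<Longrightarrow> B i \<in> sets M"
    and part: "AE x in M. \<exists>!i. i \<in> I \<and> x \<in> B i"
    and f: "integrable M f" and h: "integrable M h"
    and le: "\<And>i. i \<in> I \<Longrightarrow> norm (LINT x:B i|M. f x) \<le> (LINT x:B i|M. h x)"
  shows "norm (\<integral>x. f x \<partial>M) \<le> (\<integral>x. h x \<partial>M)"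
proof -
  obtain Z where Z: "Z \<in> null_sets M" "{x\<in>space M. \<not> (\<exists>!i. i \<in> I \<and> x \<in> B i)} \<subseteq> Z"
    by (rule AE_null_cover[OF part])
  \<comment> \<open>The pieces are recoded by natural numbers and stripped of the null set where
    membership is not unique, which makes them disjoint everywhere. Codes outside the image of
    \<open>I\<close> get the empty set.\<close>
  define A where "A k = (if k \<in> to_nat_on I ` I then B (from_nat_into I k) - Z else {})" for k
  have A[measurable]: "A k \<in> sets M" for k
  proof (cases "k \<in> to_nat_on I ` I")
    case True
    then have "from_nat_into I k \<in> I" using I by auto
    then show ?thesis using B Z(1) unfolding A_def by (metis sets.Diff null_setsD2 sets.empty_sets)
  qed (simp add: A_def)
  have inA: "\<exists>i\<in>I. k = to_nat_on I i \<and> x \<in> B i \<and> x \<notin> Z" if "x \<in> A k" for x k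
    using that I unfolding A_def by (auto split: if_splits)
  have disj: "disjoint_family A"
  proof -
    have "x \<notin> A l" if "x \<in> A k" "k \<noteq> l" for x k l
    proof
      assume l: "x \<in> A l"
      obtain i j where ij: "i \<in> I" "j \<in> I" "k = to_nat_on I i" "l = to_nat_on I j"
        "x \<in> B i" "x \<in> B j" "x \<notin> Z"
        using inA[OF \<open>x \<in> A k\<close>] inA[OF l] by blast
      moreover have "x \<in> space M" using A that sets.sets_into_space by blast
      ultimately have "i = j" using Z(2) by blast
      then show False using ij that by simp
    qed
    then show ?thesis by (auto simp: disjoint_family_on_def)
  qed
  have cover: "(\<Union>k. A k) = space M - Z"
  proof -
    have "x \<in> (\<Union>k. A k)" if x: "x \<in> space M" "x \<notin> Z" for x
    proof -
      obtain i where i: "i \<in> I" "x \<in> B i" using Z(2) x by blast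
      then have "x \<in> A (to_nat_on I i)" using x I by (auto simp: A_def)
      then show ?thesis by blast
    qed
    moreover have "A k \<subseteq> space M - Z" for k
      using sets.sets_into_space[OF A[of k]] by (auto simp: A_def split: if_splits)
    ultimately show ?thesis by blast
  qed
  have fA: "set_integrable M (A k) f" and hA: "set_integrable M (A k) h" for k
    unfolding set_integrable_def
    by (rule integrable_mult_indicator[OF A f], rule integrable_mult_indicator[OF A h])
  have le': "norm (LINT x:A k|M. f x) \<le> (LINT x:A k|M. h x)" for k
  proof (cases "k \<in> to_nat_on I ` I")
    case True
    then obtain i where i: "i \<in> I" "k = to_nat_on I i" by auto
    have Ak: "A k = B i - Z" using i I by (auto simp: A_def)
    have nz: "B i - (B i - Z) \<union> (B i - Z - B i) \<in> null_sets M"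
    proof -
      have "B i - (B i - Z) \<union> (B i - Z - B i) = B i \<inter> Z" by blast
      then show ?thesis using null_set_Int1[OF Z(1) B[OF i(1)]] by simp
    qed
    have "(LINT x:B i|M. f x) = (LINT x:A k|M. f x)" "(LINT x:B i|M. h x) = (LINT x:A k|M. h x)"
      using set_integral_null_delta[OF f B[OF i(1)] A[of k, unfolded Ak] nz]
        set_integral_null_delta[OF h B[OF i(1)] A[of k, unfolded Ak] nz] unfolding Ak by auto
    then show ?thesis using le[OF i(1)] by simp
  next
    case False
    then show ?thesis by (simp add: A_def set_lebesgue_integral_def)
  qed
  define U where "U N = (\<Union>k<N. A k)" for N :: nat
  have UA: "(\<Union>N. U N) = (\<Union>k. A k)" by (auto simp: U_def)
  have Uinc: "incseq U" unfolding U_def incseq_def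
    by (intro allI impI UN_mono) auto
  have [measurable]: "U N \<in> sets M" for N by (simp add: U_def)
  have fin: "norm (LINT x:U N|M. f x) \<le> (LINT x:U N|M. h x)" for N
  proof -
    have d: "disjoint_family_on A {..<N}" using disj by (auto simp: disjoint_family_on_def)
    have "norm (LINT x:U N|M. f x) = norm (\<Sum>k<N. LINT x:A k|M. f x)"
      unfolding U_def using d fA by (subst set_integral_finite_Union) auto
    also have "\<dots> \<le> (\<Sum>k<N. norm (LINT x:A k|M. f x))" by (rule norm_sum)
    also have "\<dots> \<le> (\<Sum>k<N. LINT x:A k|M. h x)" using le' by (intro sum_mono)
    also have "\<dots> = (LINT x:U N|M. h x)"
      unfolding U_def using d hA by (subst set_integral_finite_Union) auto
    finally show ?thesis .
  qed
  have null: "space M - Z - space M \<union> (space M - (space M - Z)) \<in> null_sets M"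
  proof -
    have "space M - Z - space M \<union> (space M - (space M - Z)) = space M \<inter> Z" by blast
    then show ?thesis using null_set_Int1[OF Z(1) sets.top] by simp
  qed
  have Zc: "space M - Z \<in> sets M" using Z(1) by auto
  have all: "(LINT x:(\<Union>N. U N)|M. f x) = (\<integral>x. f x \<partial>M)" "(LINT x:(\<Union>N. U N)|M. h x) = (\<integral>x. h x \<partial>M)"
    using set_integral_null_delta[OF f Zc sets.top null] set_integral_space[OF f]
      set_integral_null_delta[OF h Zc sets.top null] set_integral_space[OF h] UA cover by simp_all
  have sf: "set_integrable M (\<Union>N. U N) f" and sh: "set_integrable M (\<Union>N. U N) h"
    unfolding set_integrable_def
    by (rule integrable_mult_indicator[OF _ f], measurable, rule integrable_mult_indicator[OF _ h], measurable)
  have "(\<lambda>N. norm (LINT x:U N|M. f x)) \<longlonglongrightarrow> norm (\<integral>x. f x \<partial>M)"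
    unfolding all(1)[symmetric] using Uinc sf by (intro tendsto_norm set_integral_cont_up) auto
  moreover have "(\<lambda>N. (LINT x:U N|M. h x)) \<longlonglongrightarrow> (\<integral>x. h x \<partial>M)"
    unfolding all(2)[symmetric] using Uinc sh by (intro set_integral_cont_up) auto
  ultimately show ?thesis by (rule LIMSEQ_le) (use fin in blast)
qed

text \<open>Reading off the value at the least code of a set containing x gives a total function.
  The range condition therefore holds at every point, including those outside all pieces, where
  \<open>LEAST\<close> is arbitrary; later this keeps such functions in
  \<open>unit_funs\<close>.\<close>

lemma measurable_piecewise_constant:
  fixes c :: "'i \<Rightarrow> 'b::topological_space"
  assumes I: "countable I" "I \<noteq> {}" and B: "\<And>i. i \<in> I \<Longrightarrow> B i \<in> sets M"
    and part: "AE x in M. \<exists>!i. i \<in> I \<and> x \<in> B i"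
  obtains h where "h \<in> borel_measurable M" "\<And>x. h x \<in> c ` I"
    "AE x in M. \<forall>i\<in>I. x \<in> B i \<longrightarrow> h x = c i"
proof
  let ?e = "from_nat_into I"
  define h where "h x = c (?e (LEAST k. x \<in> B (?e k)))" for x
  have [measurable]: "B (?e k) \<in> sets M" for k using B I from_nat_into by metis
  have "(\<lambda>x. LEAST k. x \<in> B (?e k)) \<in> measurable M (count_space UNIV)" by measurable
  then have "(\<lambda>k. c (?e k)) \<circ> (\<lambda>x. LEAST k. x \<in> B (?e k)) \<in> borel_measurable M"
    by (rule measurable_comp) auto
  then show "h \<in> borel_measurable M" by (simp add: h_def[abs_def] comp_def)
  show "h x \<in> c ` I" for x using from_nat_into[OF I(2)] by (auto simp: h_def)
  show "AE x in M. \<forall>i\<in>I. x \<in> B i \<longrightarrow> h x = c i"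
    using part
  proof eventually_elim
    case (elim x)
    show ?case
    proof (intro ballI impI)
      fix i assume i: "i \<in> I" "x \<in> B i"
      then obtain k where k: "?e k = i" using I from_nat_into_surj by metis
      have "x \<in> B (?e (LEAST k. x \<in> B (?e k)))" by (rule LeastI[of _ k]) (use k i in simp)
      moreover have "?e (LEAST k. x \<in> B (?e k)) \<in> I" using from_nat_into[OF I(2)] by blast
      ultimately have "?e (LEAST k. x \<in> B (?e k)) = i" using elim i by blast
      then show "h x = c i" by (simp add: h_def)
    qed
  qed
qed

section \<open>Images under nonsingular maps\<close>

lemma nonsingular_AE:
  assumes S: "S \<in> measurable M M"
    and null: "\<And>A. A \<in> null_sets M \<Longrightarrow> S -` A \<inter> space M \<in> null_sets M"
    and P: "AE x in M. P x"
  shows "AE x in M. P (S x)"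
proof -
  obtain N where N: "N \<in> null_sets M" "{x\<in>space M. \<not> P x} \<subseteq> N"
    by (rule AE_null_cover[OF P])
  show ?thesis
    using null[OF N(1)] by (rule AE_I') (use N(2) measurable_space[OF S] in auto)
qed

text \<open>The set \<open>E\<close> is the image of \<open>A\<close> under \<open>S\<close> in the sense of \<open>image_mod\<close>. In contrast to
  the definition there, this form is preserved under composition.\<close>

definition onto_mod :: "'a measure \<Rightarrow> ('a \<Rightarrow> 'a) \<Rightarrow> 'a set \<Rightarrow> 'a set \<Rightarrow> bool" where
  "onto_mod M S A E \<longleftrightarrow> (AE x in M. x \<in> A \<longrightarrow> S x \<in> E) \<and>
     (\<forall>N\<in>null_sets M. AE y in M. y \<in> E \<longrightarrow> y \<in> S ` (A - N))"

lemma onto_modD1: "onto_mod M S A E \<Longrightarrow> AE x in M. x \<in> A \<longrightarrow> S x \<in> E"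
  and onto_modD2: "onto_mod M S A E \<Longrightarrow> N \<in> null_sets M \<Longrightarrow> AE y in M. y \<in> E \<longrightarrow> y \<in> S ` (A - N)"
  by (auto simp: onto_mod_def)

text \<open>\<open>image_mod\<close> is a choice, so only its defining property is available.
  Removing the union of the two exceptional null sets makes both candidates agree with the same
  literal image, hence with each other.\<close>

lemma image_mod_eq:
  assumes E: "E \<in> sets M" and onto: "onto_mod M S A E" and A: "A \<subseteq> space M"
  shows "image_mod M S A \<in> sets M" "eq_mod M (image_mod M S A) E"
proof -
  let ?P = "\<lambda>E N. \<forall>N'\<in>null_sets M. N \<subseteq> N' \<longrightarrow> eq_mod M E (S ` (A - N'))"
  let ?Q = "\<lambda>E. E \<in> sets M \<and> (\<exists>N\<in>null_sets M. ?P E N)"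
  obtain N where N: "N \<in> null_sets M" "{x\<in>space M. \<not> (x \<in> A \<longrightarrow> S x \<in> E)} \<subseteq> N"
    by (rule AE_null_cover[OF onto_modD1[OF onto]])
  have PE: "?P E N"
  proof (intro ballI impI)
    fix N' assume N': "N' \<in> null_sets M" "N \<subseteq> N'"
    have "S ` (A - N') \<subseteq> E" using N N' A by blast
    with onto_modD2[OF onto N'(1)] show "eq_mod M E (S ` (A - N'))"
      unfolding eq_mod_def by auto
  qed
  have Q: "?Q (image_mod M S A)"
    unfolding image_mod_def by (rule someI[of ?Q E]) (use E N PE in blast)
  then show "image_mod M S A \<in> sets M" by simp
  from Q obtain N2 where N2: "N2 \<in> null_sets M" "?P (image_mod M S A) N2" by auto
  have "eq_mod M E (S ` (A - (N \<union> N2)))" "eq_mod M (image_mod M S A) (S ` (A - (N \<union> N2)))"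
    using PE N2 N(1) by auto
  then show "eq_mod M (image_mod M S A) E"
    unfolding eq_mod_def by (auto elim: AE_mp)
qed

text \<open>The inverse branch pulls a null subset of A back to a null subset of the image. Outside
  it, \<open>v y\<close> is a preimage of y that avoids the removed null set.\<close>

lemma onto_mod_inverse_branch:
  assumes "inverse_branch M S A v" "A \<in> sets M"
  shows "image_mod M S A \<in> sets M" "onto_mod M S A (image_mod M S A)"
proof -
  let ?E = "image_mod M S A"
  have E[measurable]: "?E \<in> sets M" and v: "v \<in> measurable (restrict_space M ?E) M"
    and 1: "AE x in M. x \<in> A \<longrightarrow> S x \<in> ?E \<and> v (S x) = x"
    and 2: "AE y in M. y \<in> ?E \<longrightarrow> v y \<in> A \<and> S (v y) = y"
    and 3: "\<And>B. B \<in> sets M \<Longrightarrow> B \<subseteq> A \<Longrightarrow> emeasure M B = 0 \<Longrightarrow> emeasure M (v -` B \<inter> ?E) = 0"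
    using assms(1) by (auto simp: inverse_branch_def)
  show "?E \<in> sets M" by fact
  show "onto_mod M S A ?E"
    unfolding onto_mod_def
  proof (intro conjI ballI)
    show "AE x in M. x \<in> A \<longrightarrow> S x \<in> ?E" using 1 by auto
    fix N assume N: "N \<in> null_sets M"
    have NA: "N \<inter> A \<in> null_sets M" using null_set_Int2[OF N assms(2)] by (simp add: Int_commute)
    have "v -` (N \<inter> A) \<inter> space (restrict_space M ?E) \<in> sets (restrict_space M ?E)"
      using v NA by (intro measurable_sets) auto
    then have "v -` (N \<inter> A) \<inter> ?E \<in> sets M"
      using sets.sets_into_space[OF E] E by (auto simp: sets_restrict_space_iff space_restrict_space Int_absorb2 Int_absorb1)
    then have "v -` (N \<inter> A) \<inter> ?E \<in> null_sets M"
      using 3[of "N \<inter> A"] NA by auto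
    from AE_not_in[OF this] 2 show "AE y in M. y \<in> ?E \<longrightarrow> y \<in> S ` (A - N)"
    proof eventually_elim
      case (elim y)
      show ?case
      proof
        assume "y \<in> ?E"
        with elim have "v y \<in> A - N" "S (v y) = y" by auto
        then show "y \<in> S ` (A - N)" by (metis imageI)
      qed
    qed
  qed
qed

text \<open>The points of E missed by the first map after the removal of N form a null set, and this
  is the null set to remove before the second map.\<close>

lemma onto_mod_comp:
  assumes 1: "onto_mod M S A E" and 2: "onto_mod M S' E E'" and E: "E \<subseteq> space M"
    and S: "\<And>P. AE x in M. P x \<Longrightarrow> AE x in M. P (S x)"
  shows "onto_mod M (S' \<circ> S) A E'"
  unfolding onto_mod_def
proof (intro conjI ballI)
  show "AE x in M. x \<in> A \<longrightarrow> (S' \<circ> S) x \<in> E'"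
    using onto_modD1[OF 1] S[OF onto_modD1[OF 2]] by auto
  fix N assume N: "N \<in> null_sets M"
  obtain Z where Z: "Z \<in> null_sets M" "{y\<in>space M. \<not> (y \<in> E \<longrightarrow> y \<in> S ` (A - N))} \<subseteq> Z"
    by (rule AE_null_cover[OF onto_modD2[OF 1 N]])
  have "E - Z \<subseteq> S ` (A - N)" using Z(2) E by blast
  then have sub: "S' ` (E - Z) \<subseteq> (S' \<circ> S) ` (A - N)" by auto
  show "AE y in M. y \<in> E' \<longrightarrow> y \<in> (S' \<circ> S) ` (A - N)"
    using onto_modD2[OF 2 Z(1)] by eventually_elim (use sub in blast)
qed

lemma onto_mod_restrict:
  assumes 1: "onto_mod M S A E" and B: "B = A \<inter> S -` t \<inter> space M" and A: "A \<subseteq> space M"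
  shows "onto_mod M S B (E \<inter> t)"
  unfolding onto_mod_def
proof (intro conjI ballI)
  show "AE x in M. x \<in> B \<longrightarrow> S x \<in> E \<inter> t" using onto_modD1[OF 1] B by auto
  fix N assume N: "N \<in> null_sets M"
  show "AE y in M. y \<in> E \<inter> t \<longrightarrow> y \<in> S ` (B - N)"
    using onto_modD2[OF 1 N] by eventually_elim (use A B in blast)
qed

lemma onto_mod_cong:
  assumes 1: "onto_mod M S A E" and E: "AE x in M. x \<in> E \<longleftrightarrow> x \<in> E'"
    and S: "\<And>P. AE x in M. P x \<Longrightarrow> AE x in M. P (S x)"
  shows "onto_mod M S A E'"
  unfolding onto_mod_def
proof (intro conjI ballI)
  show "AE x in M. x \<in> A \<longrightarrow> S x \<in> E'" using onto_modD1[OF 1] S[OF E] by auto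
  show "AE y in M. y \<in> E' \<longrightarrow> y \<in> S ` (A - N)" if "N \<in> null_sets M" for N
    using onto_modD2[OF 1 that] E by auto
qed

lemma onto_mod_UN:
  assumes I: "countable I" and 1: "\<And>i. i \<in> I \<Longrightarrow> onto_mod M S (A i) (E i)"
  shows "onto_mod M S (\<Union>i\<in>I. A i) (\<Union>i\<in>I. E i)"
  unfolding onto_mod_def
proof (intro conjI ballI)
  have "AE x in M. \<forall>i\<in>I. x \<in> A i \<longrightarrow> S x \<in> E i"
    using onto_modD1[OF 1] I by (simp add: AE_ball_countable)
  then show "AE x in M. x \<in> (\<Union>i\<in>I. A i) \<longrightarrow> S x \<in> (\<Union>i\<in>I. E i)" by auto
  fix N assume N: "N \<in> null_sets M"
  have "AE y in M. \<forall>i\<in>I. y \<in> E i \<longrightarrow> y \<in> S ` (A i - N)"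
    using onto_modD2[OF 1 N] I by (simp add: AE_ball_countable)
  then show "AE y in M. y \<in> (\<Union>i\<in>I. E i) \<longrightarrow> y \<in> S ` ((\<Union>i\<in>I. A i) - N)"
    by eventually_elim blast
qed

section \<open>Words and cylinders\<close>

definition words :: "'a set set \<Rightarrow> nat \<Rightarrow> 'a set list set" where
  "words \<alpha> n = {w. set w \<subseteq> \<alpha> \<and> length w = n}"

definition cyl :: "'a measure \<Rightarrow> ('a \<Rightarrow> 'a) \<Rightarrow> 'a set list \<Rightarrow> 'a set" where
  "cyl M T w = {x \<in> space M. \<forall>i<length w. (T ^^ i) x \<in> w ! i}"

lemma words_append: "u \<in> words \<alpha> m \<Longrightarrow> w \<in> words \<alpha> n \<Longrightarrow> u @ w \<in> words \<alpha> (m + n)"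
  by (auto simp: words_def)

lemma countable_words: "countable \<alpha> \<Longrightarrow> countable (words \<alpha> n)"
  by (rule countable_subset[OF _ countable_lists[of \<alpha>]]) (auto simp: words_def in_lists_conv_set)

lemma words_SucE:
  assumes "w \<in> words \<alpha> (Suc n)"
  obtains a v where "w = a # v" "a \<in> \<alpha>" "v \<in> words \<alpha> n"
  using assms by (cases w) (auto simp: words_def)

lemma words_Suc_rev:
  assumes "w \<in> words \<alpha> (Suc n)"
  obtains a v where "w = v @ [a]" "a \<in> \<alpha>" "v \<in> words \<alpha> n"
  using assms by (cases w rule: rev_cases) (auto simp: words_def)

lemma all_less_add_iff: "(\<forall>i<m + n. P i) \<longleftrightarrow> (\<forall>i<m. P i) \<and> (\<forall>i<n. P (m + i))" for m n :: nat
  by (metis add_less_cancel_left le_add_diff_inverse not_le trans_less_add1)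

lemma cyl_append:
  assumes T: "T \<in> measurable M M"
  shows "cyl M T (u @ w) = cyl M T u \<inter> (T ^^ length u) -` cyl M T w \<inter> space M"
proof -
  have shift: "(T ^^ (length u + i)) x = (T ^^ i) ((T ^^ length u) x)" for i x
    by (subst add.commute) (simp add: funpow_add)
  have split: "(\<forall>i<length (u @ w). (T ^^ i) x \<in> (u @ w) ! i) \<longleftrightarrow>
    (\<forall>i<length u. (T ^^ i) x \<in> u ! i) \<and> (\<forall>i<length w. (T ^^ i) ((T ^^ length u) x) \<in> w ! i)" for x
    unfolding length_append all_less_add_iff
    by (simp only: shift nth_append_length_plus) (simp add: nth_append)
  show ?thesis
  proof (rule set_eqI)
    fix x
    show "x \<in> cyl M T (u @ w) \<longleftrightarrow> x \<in> cyl M T u \<inter> (T ^^ length u) -` cyl M T w \<inter> space M"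
    proof (cases "x \<in> space M")
      case True
      then have "(T ^^ length u) x \<in> space M"
        by (rule measurable_space[OF measurable_compose_n[OF T]])
      with True show ?thesis
        unfolding cyl_def mem_Collect_eq split by (simp only: Int_iff vimage_eq mem_Collect_eq simp_thms)
    qed (simp only: cyl_def Int_iff mem_Collect_eq simp_thms)
  qed
qed

lemma cyl_single: "a \<in> sets M \<Longrightarrow> cyl M T [a] = a"
  using sets.sets_into_space by (auto simp: cyl_def)

lemma cyl_sets:
  assumes "T \<in> measurable M M" "set w \<subseteq> sets M"
  shows "cyl M T w \<in> sets M"
proof -
  have [measurable]: "(T ^^ k) \<in> measurable M M" for k
    using assms(1) by (rule measurable_compose_n)
  have [measurable]: "w ! i \<in> sets M" if "i < length w" for i using assms(2) that by auto
  have "{x \<in> space M. \<forall>i\<in>{..<length w}. (T ^^ i) x \<in> w ! i} \<in> sets M"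
    by measurable
  then show ?thesis by (simp add: cyl_def)
qed

lemma cyl_in_cylinders:
  assumes "w \<in> words \<alpha> n" "emeasure M (cyl M T w) > 0"
  shows "cyl M T w \<in> cylinders M T \<alpha> n"
  unfolding cylinders_def
  using assms by (auto simp: cyl_def words_def intro!: exI[of _ "nth w"] )

section \<open>Itineraries and the Markov property\<close>

context gibbs_markov
begin

lemma T_meas[measurable]: "T \<in> measurable M M"
  using nonsingular by (simp add: nonsingular_def)

lemma Tn_meas[measurable]: "T ^^ n \<in> measurable M M"
  by (rule measurable_compose_n) simp

lemma AE_T: "AE x in M. P x \<Longrightarrow> AE x in M. P (T x)"
  by (rule nonsingular_AE[OF T_meas])
    (use nonsingular in \<open>auto simp: nonsingular_def intro!: null_setsI\<close>)

lemma AE_Tn: "AE x in M. P x \<Longrightarrow> AE x in M. P ((T ^^ n) x)"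
proof (induction n)
  case (Suc n)
  from AE_T[OF Suc.IH[OF Suc.prems]] show ?case by (simp add: funpow_swap1)
qed simp

lemma \<alpha>_countable: "countable \<alpha>" and \<alpha>_sets[measurable]: "a \<in> \<alpha> \<Longrightarrow> a \<in> sets M"
  and \<alpha>_pos: "a \<in> \<alpha> \<Longrightarrow> emeasure M a > 0"
  using partition by (auto simp: partition_mod_def)

lemma \<alpha>_AE: "AE x in M. \<exists>!a. a \<in> \<alpha> \<and> x \<in> a"
proof -
  have "AE x in M. x \<notin> a \<inter> b" if "a \<in> \<alpha>" "b \<in> \<alpha>" "a \<noteq> b" for a b
    using partition that by (intro AE_not_in) (auto simp: partition_mod_def intro!: null_setsI)
  then have "AE x in M. \<forall>a\<in>\<alpha>. \<forall>b\<in>\<alpha>. a \<noteq> b \<longrightarrow> x \<notin> a \<inter> b"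
    by (simp add: AE_ball_countable[OF \<alpha>_countable])
  moreover have "AE x in M. x \<in> \<Union>\<alpha>" using partition by (simp add: partition_mod_def)
  ultimately show ?thesis by eventually_elim blast
qed

lemma cyl_AE: "AE x in M. \<exists>!w. w \<in> words \<alpha> n \<and> x \<in> cyl M T w"
proof -
  have "AE x in M. \<forall>i. \<exists>!a. a \<in> \<alpha> \<and> (T ^^ i) x \<in> a"
    unfolding AE_all_countable using AE_Tn[OF \<alpha>_AE] by blast
  then show ?thesis
    using AE_space
  proof eventually_elim
    case (elim x)
    then obtain c where c: "\<And>i. c i \<in> \<alpha>" "\<And>i. (T ^^ i) x \<in> c i"
      and u: "\<And>i a. a \<in> \<alpha> \<Longrightarrow> (T ^^ i) x \<in> a \<Longrightarrow> a = c i" by metis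
    show ?case
    proof (rule ex1I[of _ "map c [0..<n]"])
      show "map c [0..<n] \<in> words \<alpha> n \<and> x \<in> cyl M T (map c [0..<n])"
        using c elim by (auto simp: words_def cyl_def)
      show "w = map c [0..<n]" if "w \<in> words \<alpha> n \<and> x \<in> cyl M T w" for w
        by (rule nth_equalityI) (use that u in \<open>auto simp: words_def cyl_def subset_eq\<close>)
    qed
  qed
qed

lemma cyl_meas: "w \<in> words \<alpha> n \<Longrightarrow> cyl M T w \<in> sets M"
  by (rule cyl_sets) (auto simp: words_def)

definition im :: "'a set \<Rightarrow> 'a set" where "im a = image_mod M T a"

lemma im_sets[measurable]: "a \<in> \<alpha> \<Longrightarrow> im a \<in> sets M"
  and im_onto: "a \<in> \<alpha> \<Longrightarrow> onto_mod M T a (im a)"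
  using invertible onto_mod_inverse_branch \<alpha>_sets unfolding im_def by blast+

text \<open>The sets that contain or miss t up to a null set form a \<sigma>-algebra, and it
  contains \<alpha> since distinct elements of \<alpha> meet in null sets. Together with
  \<open>image_in_sigma\<close> this yields the Markov property: an image that meets t covers
  t.\<close>

lemma sigma_dichotomy:
  assumes "S \<in> sigma_sets (space M) \<alpha>" "t \<in> \<alpha>"
  shows "(AE x in M. x \<in> t \<longrightarrow> x \<in> S) \<or> (AE x in M. x \<in> t \<longrightarrow> x \<notin> S)"
  using assms(1)
proof induction
  case (Basic a)
  show ?case
  proof (cases "a = t")
    case False
    have "AE x in M. x \<in> t \<longrightarrow> x \<notin> a" using \<alpha>_AE
      by eventually_elim (use Basic assms(2) False in blast)
    then show ?thesis ..
  qed simp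
next
  case (Compl a)
  from Compl.IH show ?case
  proof
    assume "AE x in M. x \<in> t \<longrightarrow> x \<in> a"
    then have "AE x in M. x \<in> t \<longrightarrow> x \<notin> space M - a" by eventually_elim auto
    then show ?thesis ..
  next
    assume "AE x in M. x \<in> t \<longrightarrow> x \<notin> a"
    then have "AE x in M. x \<in> t \<longrightarrow> x \<in> space M - a" using AE_space by eventually_elim auto
    then show ?thesis ..
  qed
next
  case (Union A)
  show ?case
  proof (cases "\<exists>i. AE x in M. x \<in> t \<longrightarrow> x \<in> A i")
    case True
    then obtain i where "AE x in M. x \<in> t \<longrightarrow> x \<in> A i" ..
    then have "AE x in M. x \<in> t \<longrightarrow> x \<in> (\<Union>i. A i)" by eventually_elim auto
    then show ?thesis ..
  next
    case False
    then have "AE x in M. \<forall>i. x \<in> t \<longrightarrow> x \<notin> A i"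
      unfolding AE_all_countable using Union.IH by blast
    then have "AE x in M. x \<in> t \<longrightarrow> x \<notin> (\<Union>i. A i)" by eventually_elim auto
    then show ?thesis ..
  qed
qed simp

lemma im_dichotomy:
  assumes "a \<in> \<alpha>" "t \<in> \<alpha>"
  shows "(AE x in M. x \<in> t \<longrightarrow> x \<in> im a) \<or> (AE x in M. x \<in> t \<longrightarrow> x \<notin> im a)"
proof -
  obtain S where S: "S \<in> sigma_sets (space M) \<alpha>" "AE x in M. x \<in> im a \<longleftrightarrow> x \<in> S"
    using image_in_sigma[OF assms(1)] unfolding eq_mod_def im_def by blast
  from sigma_dichotomy[OF S(1) assms(2)] show ?thesis
  proof
    assume "AE x in M. x \<in> t \<longrightarrow> x \<in> S"
    then have "AE x in M. x \<in> t \<longrightarrow> x \<in> im a" using S(2) by eventually_elim auto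
    then show ?thesis ..
  next
    assume "AE x in M. x \<in> t \<longrightarrow> x \<notin> S"
    then have "AE x in M. x \<in> t \<longrightarrow> x \<notin> im a" using S(2) by eventually_elim auto
    then show ?thesis ..
  qed
qed

lemma im_subset:
  assumes "a \<in> \<alpha>" "t \<in> \<alpha>" "\<not> (AE x in M. x \<notin> t \<inter> im a)"
  shows "AE x in M. x \<in> t \<longrightarrow> x \<in> im a"
  using im_dichotomy[OF assms(1,2)] assms(3) by auto

text \<open>Along a word of positive measure every transition covers the next letter, so the image
  is determined by the last letter alone. In the induction the longer cylinder is mapped onto the
  letter a by the previous iterate, and one more application of T gives its image.\<close>

lemma onto_mod_cyl:
  assumes "u \<in> words \<alpha> n" "a \<in> \<alpha>" "emeasure M (cyl M T (u @ [a])) > 0"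
  shows "onto_mod M (T ^^ Suc n) (cyl M T (u @ [a])) (im a)"
  using assms
proof (induction n arbitrary: u a)
  case 0
  then have "cyl M T (u @ [a]) = a"
    using sets.sets_into_space[OF \<alpha>_sets] by (auto simp: words_def cyl_def)
  then show ?case using im_onto 0 by simp
next
  case (Suc n)
  then obtain v b where u: "u = v @ [b]" "b \<in> \<alpha>" "v \<in> words \<alpha> n"
    by (auto elim: words_Suc_rev)
  have um: "cyl M T u \<in> sets M" using Suc.prems cyl_meas by blast
  have cy: "cyl M T (u @ [a]) = cyl M T u \<inter> (T ^^ Suc n) -` a \<inter> space M"
    using cyl_append[OF T_meas, of u "[a]"] cyl_single[OF \<alpha>_sets[OF Suc.prems(2)]] Suc.prems(1)
    by (simp add: words_def)
  have "emeasure M (cyl M T (u @ [a])) \<le> emeasure M (cyl M T u)"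
    by (rule emeasure_mono) (use um in \<open>auto simp: cy\<close>)
  then have "emeasure M (cyl M T u) > 0" using Suc.prems(3) by simp
  then have IH: "onto_mod M (T ^^ Suc n) (cyl M T u) (im b)"
    unfolding u(1) by (rule Suc.IH[OF u(3,2)])
  then have 1: "onto_mod M (T ^^ Suc n) (cyl M T (u @ [a])) (im b \<inter> a)"
    using sets.sets_into_space[OF um] by (rule onto_mod_restrict[OF _ cy])
  \<comment> \<open>A null overlap would, by nonsingularity of the iterate, force the cylinder
    itself to be null.\<close>
  have "\<not> (AE x in M. x \<notin> a \<inter> im b)"
  proof
    assume "AE x in M. x \<notin> a \<inter> im b"
    then have "AE x in M. (T ^^ Suc n) x \<notin> a \<inter> im b" by (rule AE_Tn)
    with onto_modD1[OF 1] have "AE x in M. x \<notin> cyl M T (u @ [a])"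
      by eventually_elim auto
    then have "emeasure M (cyl M T (u @ [a])) = 0"
      using AE_iff_null_sets[of "cyl M T (u @ [a])" M] Suc.prems cyl_meas words_append[of u \<alpha> _ "[a]" 1]
      by (auto simp: words_def)
    then show False using Suc.prems(3) by simp
  qed
  then have "AE x in M. x \<in> a \<longrightarrow> x \<in> im b"
    using im_subset u(2) Suc.prems(2) by blast
  then have "AE x in M. x \<in> im b \<inter> a \<longleftrightarrow> x \<in> a" by eventually_elim auto
  then have "onto_mod M (T ^^ Suc n) (cyl M T (u @ [a])) a"
    using onto_mod_cong[OF 1] AE_Tn by blast
  from onto_mod_comp[OF this im_onto[OF Suc.prems(2)] sets.sets_into_space[OF \<alpha>_sets[OF Suc.prems(2)]] AE_Tn]
  have "onto_mod M (T \<circ> T ^^ Suc n) (cyl M T (u @ [a])) (im a)" .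
  then show ?case by (simp only: funpow.simps(2))
qed

end

text \<open>The bounds hold everywhere and not only almost everywhere, so composition with iterates
  of T stays in the class without an exceptional set.\<close>

definition unit_funs :: "'a measure \<Rightarrow> ('a \<Rightarrow> real) set" where
  "unit_funs M = {g \<in> borel_measurable M. \<forall>x. 0 \<le> g x \<and> g x \<le> 1}"

lemma unit_funsD:
  assumes "g \<in> unit_funs M"
  shows "g \<in> borel_measurable M" "0 \<le> g x" "g x \<le> 1"
  using assms by (auto simp: unit_funs_def)

lemma (in finite_measure) unit_funs_integrable: "g \<in> unit_funs M \<Longrightarrow> integrable M g"
  by (rule integrable_const_bound[of _ 1]) (auto simp: unit_funs_def)

lemma unit_funs_comp: "g \<in> unit_funs M \<Longrightarrow> S \<in> measurable M M \<Longrightarrow> (\<lambda>x. g (S x)) \<in> unit_funs M"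
  by (auto simp: unit_funs_def)

lemma unit_funs_indicator: "A \<in> sets M \<Longrightarrow> g \<in> unit_funs M \<Longrightarrow> (\<lambda>x. indicator A x * g x) \<in> unit_funs M"
  by (auto simp: unit_funs_def split: split_indicator)

section \<open>Densities of inverse branches\<close>

context gibbs_markov
begin

definition branch_dens :: "'a set list \<Rightarrow> 'a \<Rightarrow> real" where
  "branch_dens w = branch_deriv M (T ^^ length w) (cyl M T w)"

text \<open>Elements of \<alpha> may overlap in null sets, and a point in an overlap could count as
  separated from points with the same word. The uniqueness assumptions exclude this.\<close>

lemma sep_dist_le:
  assumes w: "w \<in> words \<alpha> n" "x \<in> cyl M T w" "y \<in> cyl M T w"
    and u: "\<And>i a b. i < n \<Longrightarrow> a \<in> \<alpha> \<Longrightarrow> b \<in> \<alpha> \<Longrightarrow> (T ^^ i) x \<in> a \<Longrightarrow> (T ^^ i) x \<in> b \<Longrightarrow> a = b"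
      "\<And>i a b. i < n \<Longrightarrow> a \<in> \<alpha> \<Longrightarrow> b \<in> \<alpha> \<Longrightarrow> (T ^^ i) y \<in> a \<Longrightarrow> (T ^^ i) y \<in> b \<Longrightarrow> a = b"
  shows "sep_dist T \<alpha> r x y \<le> r ^ n"
proof -
  \<comment> \<open>\<open>sep_time\<close> counts from one, so agreement on n letters gives the
    exponent n + 1; the weaker power r^n is enough.\<close>
  have le: "enat (n + 1) \<le> sep_time T \<alpha> x y"
    unfolding sep_time_def
  proof (rule INF_greatest, clarify)
    fix k a b assume ab: "a \<in> \<alpha>" "b \<in> \<alpha>" "a \<noteq> b" "(T ^^ k) x \<in> a" "(T ^^ k) y \<in> b"
    have "\<not> k < n"
    proof
      assume k: "k < n"
      have "w ! k \<in> \<alpha>" "(T ^^ k) x \<in> w ! k" "(T ^^ k) y \<in> w ! k"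
        using w k by (auto simp: words_def cyl_def)
      then have "a = w ! k" "b = w ! k" using u(1)[OF k ab(1) _ ab(4)] u(2)[OF k ab(2) _ ab(5)] by auto
      then show False using ab by simp
    qed
    then show "enat (n + 1) \<le> enat (k + 1)" by simp
  qed
  show ?thesis
  proof (cases "sep_time T \<alpha> x y")
    case (enat k)
    then have "n \<le> k" using le by simp
    then have "r ^ k \<le> r ^ n" using r_pos r_less_1 by (intro power_decreasing) auto
    then show ?thesis using enat by (simp add: sep_dist_def)
  next
    case infinity
    then show ?thesis using r_pos by (simp add: sep_dist_def)
  qed
qed

lemma sep_dist_le_1: "sep_dist T \<alpha> r x y \<le> 1"
  using r_pos r_less_1 by (auto simp: sep_dist_def power_le_one split: enat.splits)

lemma AE_unique: "AE x in M. \<forall>i a b. a \<in> \<alpha> \<longrightarrow> b \<in> \<alpha> \<longrightarrow> (T ^^ i) x \<in> a \<longrightarrow> (T ^^ i) x \<in> b \<longrightarrow> a = b"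
proof -
  have "AE x in M. \<forall>i. \<exists>!a. a \<in> \<alpha> \<and> (T ^^ i) x \<in> a"
    unfolding AE_all_countable using AE_Tn[OF \<alpha>_AE] by blast
  then show ?thesis by eventually_elim blast
qed

lemma emeasure_pos_iff: "emeasure M A > 0 \<longleftrightarrow> measure M A > 0"
  by (simp add: emeasure_eq_measure)

text \<open>\<open>branch_dens w\<close> is the transfer operator of \<open>T ^^ n\<close> applied
  to the indicator of the cylinder, and the third statement is its duality. The pushforward is a
  finite measure, so its Radon-Nikodym derivative is finite almost everywhere and
  \<open>enn2real\<close> loses nothing.\<close>

lemma branch_density:
  assumes w: "w \<in> words \<alpha> n"
  shows "branch_dens w \<in> borel_measurable M" "\<And>x. 0 \<le> branch_dens w x"
    "\<And>g. g \<in> unit_funs M \<Longrightarrow>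
      integrable M (\<lambda>y. branch_dens w y * g y) \<and> (LINT x:cyl M T w|M. g ((T ^^ n) x)) = (\<integral>y. branch_dens w y * g y \<partial>M)"
proof -
  let ?A = "cyl M T w" and ?S = "T ^^ n"
  let ?N = "distr (restrict_space M ?A) M ?S"
  have A: "?A \<in> sets M" using cyl_meas[OF w] .
  have Am: "?A \<inter> space M \<in> sets M" using A by auto
  have S: "?S \<in> measurable (restrict_space M ?A) M"
    by (intro measurable_restrict_space1) simp
  interpret R: finite_measure "restrict_space M ?A"
    using A by (intro finite_measureI) (simp add: emeasure_restrict_space space_restrict_space)
  have finN: "finite_measure ?N" by (rule R.finite_measure_distr[OF S])
  have ac: "absolutely_continuous M ?N"
    unfolding absolutely_continuous_def
  proof
    fix Z assume Z: "Z \<in> null_sets M"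
    have "AE x in M. x \<notin> Z" using Z by (rule AE_not_in)
    then have "AE x in M. ?S x \<notin> Z" by (rule AE_Tn)
    then have "AE x in restrict_space M ?A. ?S x \<notin> Z"
      using Am by (subst AE_restrict_space_iff) auto
    then have "AE x in ?N. x \<notin> Z"
      using Z S by (subst AE_distr_iff) auto
    then show "Z \<in> null_sets ?N" using Z by (subst AE_iff_null_sets) auto
  qed
  obtain D where D: "D \<in> borel_measurable M" "AE x in M. RN_deriv M ?N x = ennreal (D x)" "\<And>x. 0 \<le> D x"
    using real_RN_deriv[OF finN ac] by auto
  have eq: "AE x in M. branch_dens w x = D x"
    using D(2) w by (auto simp: branch_dens_def branch_deriv_def words_def D(3) elim: eventually_mono)
  show m: "branch_dens w \<in> borel_measurable M" unfolding branch_dens_def branch_deriv_def[abs_def] by measurable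
  show nn: "0 \<le> branch_dens w x" for x by (simp add: branch_dens_def branch_deriv_def)
  have dens: "density M (\<lambda>x. ennreal (branch_dens w x)) = ?N"
  proof -
    have "density M (\<lambda>x. ennreal (branch_dens w x)) = density M (RN_deriv M ?N)"
      using D(2) eq m by (intro density_cong) (auto elim: eventually_mono AE_mp)
    then show ?thesis using density_RN_deriv[OF ac] by simp
  qed
  fix g :: "'a \<Rightarrow> real" assume "g \<in> unit_funs M"
  then have g: "g \<in> borel_measurable M" and gb: "\<And>x. 0 \<le> g x \<and> g x \<le> 1" by (auto simp: unit_funs_def)
  have gN: "integrable ?N g"
  proof -
    interpret N: finite_measure ?N by fact
    show ?thesis by (rule N.integrable_const_bound[of _ 1]) (use g gb in auto)
  qed
  then have "integrable M (\<lambda>y. branch_dens w y * g y)"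
    unfolding dens[symmetric] using g m nn by (subst (asm) integrable_density) auto
  moreover have "(LINT x:?A|M. g (?S x)) = (\<integral>y. g y \<partial>?N)"
    using S g A by (subst integral_distr) (auto simp: integral_restrict_space set_lebesgue_integral_def)
  moreover have "(\<integral>y. g y \<partial>?N) = (\<integral>y. branch_dens w y * g y \<partial>M)"
    unfolding dens[symmetric] using g m nn by (subst integral_density) auto
  ultimately show "integrable M (\<lambda>y. branch_dens w y * g y) \<and> (LINT x:?A|M. g (?S x)) = (\<integral>y. branch_dens w y * g y \<partial>M)"
    by simp
qed

end

section \<open>Distortion of inverse branches\<close>

context gibbs_markov
begin

text \<open>If the image of a missed b, the image of the cylinder would miss b as well and, by
  nonsingularity, the continued cylinder would be null.\<close>

lemma cyl_pos_image:
  assumes "u \<in> words \<alpha> n" "a \<in> \<alpha>" "b \<in> \<alpha>" "measure M (cyl M T ((u @ [a]) @ [b])) > 0"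
  shows "AE x in M. x \<in> b \<longrightarrow> x \<in> im a"
proof (rule im_subset[OF assms(2,3)])
  let ?w = "u @ [a]"
  have w: "?w \<in> words \<alpha> (Suc n)" using assms by (auto simp: words_def)
  have wb: "?w @ [b] \<in> words \<alpha> (Suc (Suc n))" using assms by (auto simp: words_def)
  have cy: "cyl M T (?w @ [b]) = cyl M T ?w \<inter> (T ^^ Suc n) -` b \<inter> space M"
    using cyl_append[OF T_meas, of ?w "[b]"] cyl_single[OF \<alpha>_sets[OF assms(3)]] w
    by (simp add: words_def)
  have "measure M (cyl M T (?w @ [b])) \<le> measure M (cyl M T ?w)"
    by (rule finite_measure_mono[OF _ cyl_meas[OF w]]) (use cy in blast)
  then have pos: "emeasure M (cyl M T ?w) > 0" using assms(4) by (simp add: emeasure_pos_iff)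
  note 1 = onto_modD1[OF onto_mod_cyl[OF assms(1,2) pos]]
  show "\<not> (AE x in M. x \<notin> b \<inter> im a)"
  proof
    assume "AE x in M. x \<notin> b \<inter> im a"
    then have "AE x in M. (T ^^ Suc n) x \<notin> b \<inter> im a" by (rule AE_Tn)
    with 1 have "AE x in M. x \<notin> cyl M T (?w @ [b])"
      unfolding cy by eventually_elim auto
    then have "cyl M T (?w @ [b]) \<in> null_sets M"
      using AE_iff_null_sets[OF cyl_meas[OF wb]] by simp
    then show False using assms(4) by (auto simp: measure_eq_0_null_sets)
  qed
qed

text \<open>The quotient in the distortion condition does not control the numerator where the
  denominator vanishes, since division by zero yields zero. The product form requires the zeros of
  the density on the image to be null. At the same time \<open>image_mod\<close> of the iterate is
  replaced by \<open>im\<close> of the last letter.\<close>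

lemma branch_dens_ratio:
  "\<exists>K>0. \<forall>n. \<forall>u\<in>words \<alpha> n. \<forall>a\<in>\<alpha>. measure M (cyl M T (u @ [a])) > 0 \<longrightarrow>
    (\<exists>N\<in>null_sets M. \<forall>x\<in>im a - N. \<forall>y\<in>im a - N.
      \<bar>branch_dens (u @ [a]) x - branch_dens (u @ [a]) y\<bar> \<le> K * sep_dist T \<alpha> r x y * branch_dens (u @ [a]) y)"
proof -
  obtain K where K: "K > 0" and dist: "\<And>n a. n \<ge> 1 \<Longrightarrow> a \<in> cylinders M T \<alpha> n \<Longrightarrow> \<exists>N\<in>null_sets M.
         \<forall>x\<in>image_mod M (T ^^ n) a - N. \<forall>y\<in>image_mod M (T ^^ n) a - N.
           \<bar>branch_deriv M (T ^^ n) a x / branch_deriv M (T ^^ n) a y - 1\<bar> \<le> K * sep_dist T \<alpha> r x y"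
    using distortion by metis
  have "\<exists>N\<in>null_sets M. \<forall>x\<in>im a - N. \<forall>y\<in>im a - N.
      \<bar>branch_dens (u @ [a]) x - branch_dens (u @ [a]) y\<bar> \<le> K * sep_dist T \<alpha> r x y * branch_dens (u @ [a]) y"
    if u: "u \<in> words \<alpha> n" and a: "a \<in> \<alpha>" and pos: "measure M (cyl M T (u @ [a])) > 0" for n u a
  proof -
    let ?w = "u @ [a]" let ?C = "cyl M T ?w"
    have w: "?w \<in> words \<alpha> (Suc n)" and len: "length ?w = Suc n" using u a by (auto simp: words_def)
    have pos': "emeasure M ?C > 0" using pos by (simp add: emeasure_pos_iff)
    have onto: "onto_mod M (T ^^ Suc n) ?C (im a)" by (rule onto_mod_cyl[OF u a pos'])
    have C: "?C \<in> sets M" using cyl_meas[OF w] .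
    obtain N1 where N1: "N1 \<in> null_sets M"
      "\<And>x y. x \<in> image_mod M (T ^^ Suc n) ?C - N1 \<Longrightarrow> y \<in> image_mod M (T ^^ Suc n) ?C - N1 \<Longrightarrow>
        \<bar>branch_dens ?w x / branch_dens ?w y - 1\<bar> \<le> K * sep_dist T \<alpha> r x y"
      using dist[OF _ cyl_in_cylinders[OF w pos']] unfolding branch_dens_def len by auto
    have eq: "AE x in M. x \<in> image_mod M (T ^^ Suc n) ?C \<longleftrightarrow> x \<in> im a"
      using image_mod_eq(2)[OF im_sets[OF a] onto] sets.sets_into_space[OF C] by (simp add: eq_mod_def)
    obtain N2 where N2: "N2 \<in> null_sets M"
      "{x\<in>space M. \<not> (x \<in> image_mod M (T ^^ Suc n) ?C \<longleftrightarrow> x \<in> im a)} \<subseteq> N2"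
      by (rule AE_null_cover[OF eq])
    \<comment> \<open>By the change of variables the preimage of this set in the cylinder is null.
      Removing the preimage leaves the map onto almost all of the image, so the set itself is
      null.\<close>
    let ?Z = "{y \<in> space M. branch_dens ?w y = 0} \<inter> im a"
    note bd = branch_density[OF w]
    have Zm: "?Z \<in> sets M" using bd(1) im_sets[OF a] by measurable
    have "?Z \<in> null_sets M"
    proof -
      have uf: "indicator ?Z \<in> unit_funs M"
        using Zm by (auto simp: unit_funs_def split: split_indicator)
      have "(LINT x:?C|M. indicator ?Z ((T ^^ Suc n) x)) = (\<integral>y. branch_dens ?w y * indicator ?Z y \<partial>M)"
        using bd(3)[OF uf] by simp
      also have "\<dots> = 0" by (rule integral_eq_zero_AE) (auto split: split_indicator)
      finally have "(LINT x:?C|M. indicator ?Z ((T ^^ Suc n) x)) = (0::real)" .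
      moreover have "(LINT x:?C|M. indicator ?Z ((T ^^ Suc n) x)) = measure M (?C \<inter> (T ^^ Suc n) -` ?Z \<inter> space M)"
        unfolding set_lebesgue_integral_def
        by (subst Bochner_Integration.integral_cong[where g="indicator (?C \<inter> (T ^^ Suc n) -` ?Z \<inter> space M)"])
          (auto simp: Int_absorb2 split: split_indicator)
      ultimately have m0: "measure M (?C \<inter> (T ^^ Suc n) -` ?Z \<inter> space M) = 0" by simp
      have meas: "?C \<inter> ((T ^^ Suc n) -` ?Z \<inter> space M) \<in> sets M"
        by (rule sets.Int[OF C measurable_sets[OF Tn_meas Zm]])
      have "?C \<inter> (T ^^ Suc n) -` ?Z \<inter> space M \<in> null_sets M"
        using m0 meas by (simp add: Int_assoc null_sets_def emeasure_eq_measure)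
      from onto_modD2[OF onto this] have "AE y in M. y \<notin> ?Z"
        using AE_space
      proof eventually_elim
        case (elim y)
        show ?case
        proof
          assume y: "y \<in> ?Z"
          then obtain x where "y = (T ^^ Suc n) x" "x \<in> ?C" "x \<notin> ?C \<inter> (T ^^ Suc n) -` ?Z \<inter> space M"
            using elim by blast
          then show False using y sets.sets_into_space[OF C] by blast
        qed
      qed
      then show ?thesis using AE_iff_null_sets[OF Zm] by simp
    qed
    then have "N1 \<union> N2 \<union> ?Z \<in> null_sets M" using N1 N2 by auto
    moreover have "\<bar>branch_dens ?w x - branch_dens ?w y\<bar> \<le> K * sep_dist T \<alpha> r x y * branch_dens ?w y"
      if x: "x \<in> im a - (N1 \<union> N2 \<union> ?Z)" and y: "y \<in> im a - (N1 \<union> N2 \<union> ?Z)" for x y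
    proof -
      have sp: "x \<in> space M" "y \<in> space M" using x y sets.sets_into_space[OF im_sets[OF a]] by auto
      then have "x \<in> image_mod M (T ^^ Suc n) ?C - N1" "y \<in> image_mod M (T ^^ Suc n) ?C - N1"
        using N2(2) x y by auto
      from N1(2)[OF this] have le: "\<bar>branch_dens ?w x / branch_dens ?w y - 1\<bar> \<le> K * sep_dist T \<alpha> r x y" .
      have yp: "branch_dens ?w y > 0" using y sp bd(2)[of y] by (auto simp: less_le)
      have "\<bar>branch_dens ?w x - branch_dens ?w y\<bar> = \<bar>branch_dens ?w x / branch_dens ?w y - 1\<bar> * branch_dens ?w y"
      proof -
        have "branch_dens ?w x - branch_dens ?w y = (branch_dens ?w x / branch_dens ?w y - 1) * branch_dens ?w y"
          using yp by (simp add: left_diff_distrib)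
        then show ?thesis using yp by (metis abs_mult abs_of_pos)
      qed
      also have "\<dots> \<le> K * sep_dist T \<alpha> r x y * branch_dens ?w y"
        using le yp by (intro mult_right_mono) auto
      finally show ?thesis .
    qed
    ultimately show ?thesis by blast
  qed
  then show ?thesis using K by blast
qed

definition K :: real where
  "K = (SOME K. K > 0 \<and> (\<forall>n. \<forall>u\<in>words \<alpha> n. \<forall>a\<in>\<alpha>. measure M (cyl M T (u @ [a])) > 0 \<longrightarrow>
    (\<exists>N\<in>null_sets M. \<forall>x\<in>im a - N. \<forall>y\<in>im a - N.
      \<bar>branch_dens (u @ [a]) x - branch_dens (u @ [a]) y\<bar> \<le> K * sep_dist T \<alpha> r x y * branch_dens (u @ [a]) y)))"

lemma K: "K > 0" "u \<in> words \<alpha> n \<Longrightarrow> a \<in> \<alpha> \<Longrightarrow> measure M (cyl M T (u @ [a])) > 0 \<Longrightarrow>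
    \<exists>N\<in>null_sets M. \<forall>x\<in>im a - N. \<forall>y\<in>im a - N.
      \<bar>branch_dens (u @ [a]) x - branch_dens (u @ [a]) y\<bar> \<le> K * sep_dist T \<alpha> r x y * branch_dens (u @ [a]) y"
  using someI_ex[OF branch_dens_ratio, folded K_def] by blast+

text \<open>Distances are at most 1, so on the image the density is at most 1 + K times its value at
  y. Its integral there is the measure of the cylinder, and the image has measure at most 1.\<close>

lemma branch_dens_lower:
  assumes u: "u \<in> words \<alpha> n" and a: "a \<in> \<alpha>" and pos: "measure M (cyl M T (u @ [a])) > 0"
  shows "AE y in M. y \<in> im a \<longrightarrow> measure M (cyl M T (u @ [a])) \<le> (1 + K) * branch_dens (u @ [a]) y"
proof -
  let ?w = "u @ [a]" let ?C = "cyl M T ?w"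
  have w: "?w \<in> words \<alpha> (Suc n)" using u a by (auto simp: words_def)
  have pos': "emeasure M ?C > 0" using pos by (simp add: emeasure_pos_iff)
  note bd = branch_density[OF w]
  have C: "?C \<in> sets M" using cyl_meas[OF w] .
  obtain N where N: "N \<in> null_sets M" "\<And>x y. x \<in> im a - N \<Longrightarrow> y \<in> im a - N \<Longrightarrow>
      \<bar>branch_dens ?w x - branch_dens ?w y\<bar> \<le> K * sep_dist T \<alpha> r x y * branch_dens ?w y"
    using K(2)[OF u a pos] by blast
  have uf: "indicator (im a) \<in> unit_funs M"
    using im_sets[OF a] by (auto simp: unit_funs_def split: split_indicator)
  have "measure M ?C = (LINT x:?C|M. indicator (im a) ((T ^^ Suc n) x))"
  proof -
    have "(LINT x:?C|M. indicator (im a) ((T ^^ Suc n) x)) = (LINT x:?C|M. (1::real))"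
      by (rule set_lebesgue_integral_cong_AE)
        (use C im_sets[OF a] onto_modD1[OF onto_mod_cyl[OF u a pos']] in \<open>auto elim: eventually_mono\<close>)
    then show ?thesis using C by (simp add: set_lebesgue_integral_def)
  qed
  also have "\<dots> = (\<integral>y. branch_dens ?w y * indicator (im a) y \<partial>M)" using bd(3)[OF uf] by simp
  finally have eq: "measure M ?C = (\<integral>y. branch_dens ?w y * indicator (im a) y \<partial>M)" .
  have int: "integrable M (\<lambda>y. branch_dens ?w y * indicator (im a) y)" using bd(3)[OF uf] by simp
  have "measure M ?C \<le> (1 + K) * branch_dens ?w y" if y: "y \<in> im a - N" for y
  proof -
    have "(\<integral>z. branch_dens ?w z * indicator (im a) z \<partial>M) \<le> (\<integral>z. (1 + K) * branch_dens ?w y \<partial>M)"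
    proof (rule integral_mono_AE[OF int])
      show "AE z in M. branch_dens ?w z * indicator (im a) z \<le> (1 + K) * branch_dens ?w y"
        using AE_not_in[OF N(1)]
      proof eventually_elim
        case (elim z)
        show ?case
        proof (cases "z \<in> im a")
          case True
          have "branch_dens ?w z - branch_dens ?w y \<le> K * sep_dist T \<alpha> r z y * branch_dens ?w y"
            using N(2)[of z y] True elim y by auto
          also have "\<dots> \<le> K * 1 * branch_dens ?w y"
            using sep_dist_le_1 K(1) bd(2) by (intro mult_mono mult_nonneg_nonneg) (auto simp: sep_dist_def split: enat.splits intro: less_imp_le[OF r_pos] zero_le_power)
          finally show ?thesis using True by (simp add: algebra_simps)
        next
          case False
          then show ?thesis using K(1) bd(2)[of y] by simp
        qed
      qed
    qed simp
    then show ?thesis unfolding eq by (simp add: prob_space)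
  qed
  with AE_not_in[OF N(1)] show ?thesis by (auto elim: eventually_mono)
qed

text \<open>The density integrates over \<open>cyl M T (b # v)\<close> to the measure of the joined
  cylinder, so the comparison is with its mean there. Within a cylinder of length i + 1 distances
  are at most r^(i+1), which bounds the relative deviation from the mean.\<close>

lemma branch_dens_variation:
  assumes u: "u \<in> words \<alpha> n" and a: "a \<in> \<alpha>" and b: "b \<in> \<alpha>" and v: "v \<in> words \<alpha> i"
    and pos: "measure M (cyl M T ((u @ [a]) @ (b # v))) > 0"
  shows "AE y in M. y \<in> cyl M T (b # v) \<longrightarrow>
    \<bar>measure M (cyl M T (b # v)) * branch_dens (u @ [a]) y - measure M (cyl M T ((u @ [a]) @ (b # v)))\<bar>
      \<le> K * r ^ Suc i * measure M (cyl M T ((u @ [a]) @ (b # v)))"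
proof -
  let ?w = "u @ [a]" let ?C = "cyl M T ?w" let ?d = "b # v" let ?D = "cyl M T ?d" let ?E = "cyl M T (?w @ ?d)"
  have w: "?w \<in> words \<alpha> (Suc n)" using u a by (auto simp: words_def)
  have d: "?d \<in> words \<alpha> (Suc i)" using v b by (auto simp: words_def)
  note bd = branch_density[OF w]
  have C: "?C \<in> sets M" and D: "?D \<in> sets M" using cyl_meas w d by auto
  have E: "?E = ?C \<inter> (T ^^ Suc n) -` ?D \<inter> space M"
    using cyl_append[OF T_meas, of ?w ?d] u by (simp add: words_def)
  have "?E = cyl M T (?w @ [b]) \<inter> (T ^^ length (?w @ [b])) -` cyl M T v \<inter> space M"
    using cyl_append[OF T_meas, of "?w @ [b]" v] by simp
  then have "?E \<subseteq> cyl M T (?w @ [b])" "?E \<subseteq> ?C" unfolding E by blast+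
  moreover have "cyl M T (?w @ [b]) \<in> sets M"
    by (rule cyl_meas[of _ "Suc (Suc n)"]) (use w b in \<open>auto simp: words_def\<close>)
  ultimately have pos1: "measure M (cyl M T (?w @ [b])) > 0" "measure M ?C > 0"
    using pos finite_measure_mono[of ?E] C by (smt (verit))+
  have sub: "AE x in M. x \<in> b \<longrightarrow> x \<in> im a" by (rule cyl_pos_image[OF u a b pos1(1)])
  have Db: "?D \<subseteq> b" by (auto simp: cyl_def)
  obtain N where N: "N \<in> null_sets M" "\<And>x y. x \<in> im a - N \<Longrightarrow> y \<in> im a - N \<Longrightarrow>
      \<bar>branch_dens ?w x - branch_dens ?w y\<bar> \<le> K * sep_dist T \<alpha> r x y * branch_dens ?w y"
    using K(2)[OF u a pos1(2)] by blast
  \<comment> \<open>Besides avoiding the exceptional set of the distortion bound, points need a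
    unique itinerary, as \<open>sep_dist_le\<close> demands.\<close>
  have "AE x in M. x \<in> ?D \<longrightarrow> x \<in> im a - N \<and>
     (\<forall>i a b. a \<in> \<alpha> \<longrightarrow> b \<in> \<alpha> \<longrightarrow> (T ^^ i) x \<in> a \<longrightarrow> (T ^^ i) x \<in> b \<longrightarrow> a = b)" (is "AE x in M. x \<in> ?D \<longrightarrow> ?good x")
    using sub AE_not_in[OF N(1)] AE_unique by eventually_elim (use Db in blast)
  then have good: "AE x in M. x \<in> ?D \<longrightarrow> ?good x" .
  have uf: "indicator ?D \<in> unit_funs M"
    using D by (auto simp: unit_funs_def split: split_indicator)
  have "measure M ?E = (LINT x:?C|M. indicator ?D ((T ^^ Suc n) x))"
    unfolding set_lebesgue_integral_def
    by (subst Bochner_Integration.integral_cong[where g="indicator ?E"])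
      (use C E in \<open>auto simp: Int_absorb2 split: split_indicator\<close>)
  also have "\<dots> = (\<integral>y. branch_dens ?w y * indicator ?D y \<partial>M)" using bd(3)[OF uf] by simp
  finally have eq: "measure M ?E = (\<integral>y. branch_dens ?w y * indicator ?D y \<partial>M)" .
  have int: "integrable M (\<lambda>y. branch_dens ?w y * indicator ?D y)" using bd(3)[OF uf] by simp
  have intD: "integrable M (\<lambda>y. indicator ?D y * c)" for c :: real
    using D by (intro integrable_mult_left) (auto simp: emeasure_eq_measure)
  show ?thesis
    using good
  proof eventually_elim
    case (elim y)
    show ?case
    proof
      assume y: "y \<in> ?D"
      have "\<bar>measure M ?D * branch_dens ?w y - measure M ?E\<bar> =
        \<bar>\<integral>z. indicator ?D z * branch_dens ?w y - branch_dens ?w z * indicator ?D z \<partial>M\<bar>"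
        unfolding eq using int intD D by (subst Bochner_Integration.integral_diff) auto
      also have "\<dots> \<le> (\<integral>z. \<bar>indicator ?D z * branch_dens ?w y - branch_dens ?w z * indicator ?D z\<bar> \<partial>M)"
        by (rule integral_abs_bound)
      also have "\<dots> \<le> (\<integral>z. K * r ^ Suc i * (branch_dens ?w z * indicator ?D z) \<partial>M)"
      proof (rule integral_mono_AE)
        show "AE z in M. \<bar>indicator ?D z * branch_dens ?w y - branch_dens ?w z * indicator ?D z\<bar>
          \<le> K * r ^ Suc i * (branch_dens ?w z * indicator ?D z)"
          using good
        proof eventually_elim
          case (elim z)
          show ?case
          proof (cases "z \<in> ?D")
            case True
            have gy: "?good y" and gz: "?good z" using \<open>y \<in> ?D \<longrightarrow> ?good y\<close> y elim True by auto
            have "sep_dist T \<alpha> r y z \<le> r ^ Suc i"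
              by (rule sep_dist_le[OF d y True];
                rule gy[THEN conjunct2, rule_format] gz[THEN conjunct2, rule_format]; assumption)
            have "\<bar>branch_dens ?w y - branch_dens ?w z\<bar> \<le> K * sep_dist T \<alpha> r y z * branch_dens ?w z"
              using N(2)[OF conjunct1[OF gy] conjunct1[OF gz]] .
            also have "\<dots> \<le> K * r ^ Suc i * branch_dens ?w z"
              using \<open>sep_dist T \<alpha> r y z \<le> r ^ Suc i\<close> K(1) bd(2)
              by (intro mult_right_mono mult_left_mono) auto
            finally show ?thesis using True by simp
          qed simp
        qed
      qed (use int intD in auto)
      also have "\<dots> = K * r ^ Suc i * measure M ?E" unfolding eq by simp
      finally show "\<bar>measure M ?D * branch_dens ?w y - measure M ?E\<bar> \<le> K * r ^ Suc i * measure M ?E" .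
    qed
  qed
qed

end

lemma set_integral_null_set:
  assumes "A \<in> null_sets M"
  shows "(LINT x:A|M. f x) = 0"
  unfolding set_lebesgue_integral_def
  by (rule integral_eq_zero_AE) (use AE_not_in[OF assms] in \<open>auto elim: eventually_mono\<close>)

lemma set_integral_cyl_append:
  assumes "T \<in> measurable M M"
  shows "(LINT x:cyl M T (u @ w)|M. f x) =
    (LINT x:cyl M T u|M. indicator (cyl M T w) ((T ^^ length u) x) *\<^sub>R f x)"
  unfolding set_lebesgue_integral_def cyl_append[OF assms]
  by (rule Bochner_Integration.integral_cong) (auto split: split_indicator)

context gibbs_markov
begin

lemma set_integrable_const: "A \<in> sets M \<Longrightarrow> set_integrable M A (\<lambda>x. c :: real)"
  unfolding set_integrable_def real_scaleR_def
  by (intro integrable_mult_left) (auto simp: emeasure_eq_measure)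

lemma unit_funs_Tn: "g \<in> unit_funs M \<Longrightarrow> (\<lambda>x. g ((T ^^ n) x)) \<in> unit_funs M"
  by (rule unit_funs_comp) auto

text \<open>Divided by both measures, this says that the laws of the future given
  \<open>w @ d\<close> and given \<open>d\<close> differ by at most K r^i: the distant past is
  forgotten at the rate of one factor r per letter of d. Without division the estimate also covers
  null cylinders.\<close>

lemma conditional_comparison:
  assumes w: "w \<in> words \<alpha> n" "n \<ge> 1" and d: "d \<in> words \<alpha> i" "i \<ge> 1" and g: "g \<in> unit_funs M"
  shows "\<bar>measure M (cyl M T d) * (LINT x:cyl M T (w @ d)|M. g ((T ^^ (n + i)) x))
      - measure M (cyl M T (w @ d)) * (LINT x:cyl M T d|M. g ((T ^^ i) x))\<bar>
    \<le> K * r ^ i * measure M (cyl M T (w @ d)) * measure M (cyl M T d)"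
proof (cases "measure M (cyl M T (w @ d)) > 0")
  case False
  have "cyl M T (w @ d) \<in> sets M" using cyl_meas[OF words_append[OF w(1) d(1)]] .
  then have "cyl M T (w @ d) \<in> null_sets M" "measure M (cyl M T (w @ d)) = 0"
    using False measure_nonneg[of M "cyl M T (w @ d)"] by (auto simp: null_sets_def emeasure_eq_measure)
  then show ?thesis by (simp add: set_integral_null_set)
next
  case True
  have w': "w \<in> words \<alpha> (Suc (n - 1))" and d': "d \<in> words \<alpha> (Suc (i - 1))" using w d by auto
  obtain a u where ua: "w = u @ [a]" "a \<in> \<alpha>" "u \<in> words \<alpha> (n - 1)"
    by (rule words_Suc_rev[OF w'])
  obtain b v where bv: "d = b # v" "b \<in> \<alpha>" "v \<in> words \<alpha> (i - 1)"
    by (rule words_SucE[OF d'])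
  let ?D = "cyl M T d" and ?E = "cyl M T (w @ d)"
  have D: "?D \<in> sets M" using cyl_meas d by blast
  have var: "AE y in M. y \<in> ?D \<longrightarrow> \<bar>measure M ?D * branch_dens w y - measure M ?E\<bar> \<le> K * r ^ i * measure M ?E"
    using branch_dens_variation[OF ua(3,2) bv(2,3)] True d(2) unfolding ua(1) bv(1) by simp
  let ?h = "\<lambda>x. indicator ?D x * g ((T ^^ i) x)"
  have h: "?h \<in> unit_funs M" using unit_funs_indicator[OF D unit_funs_Tn[OF g]] .
  have len: "length w = n" using w by (simp add: words_def)
  have fa: "(T ^^ (n + i)) x = (T ^^ i) ((T ^^ n) x)" for x
    by (subst add.commute) (simp add: funpow_add)
  have 1: "(LINT x:?E|M. g ((T ^^ (n + i)) x)) = (\<integral>y. branch_dens w y * ?h y \<partial>M)"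
  proof -
    have "(LINT x:?E|M. g ((T ^^ (n + i)) x)) = (LINT x:cyl M T w|M. ?h ((T ^^ n) x))"
      using set_integral_cyl_append[OF T_meas, where u=w and w=d and f="\<lambda>x. g ((T ^^ (n + i)) x)"]
      by (simp only: len fa real_scaleR_def)
    then show ?thesis using branch_density(3)[OF w(1) h] by metis
  qed
  have i1: "integrable M (\<lambda>y. branch_dens w y * ?h y)" using branch_density(3)[OF w(1) h] by simp
  have i2: "integrable M ?h" using unit_funs_integrable[OF h] .
  have i3: "integrable M (indicator ?D :: 'a \<Rightarrow> real)" using D by (auto simp: emeasure_eq_measure)
  have e: "measure M ?D * (LINT x:?E|M. g ((T ^^ (n + i)) x)) - measure M ?E * (LINT x:?D|M. g ((T ^^ i) x))
     = (\<integral>y. measure M ?D * (branch_dens w y * ?h y) - measure M ?E * ?h y \<partial>M)"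
    unfolding 1 unfolding set_lebesgue_integral_def using i1 i2 by simp
  have "\<bar>measure M ?D * (LINT x:?E|M. g ((T ^^ (n + i)) x)) - measure M ?E * (LINT x:?D|M. g ((T ^^ i) x))\<bar>
    = \<bar>\<integral>y. measure M ?D * (branch_dens w y * ?h y) - measure M ?E * ?h y \<partial>M\<bar>" unfolding e ..
  also have "\<dots> \<le> (\<integral>y. \<bar>measure M ?D * (branch_dens w y * ?h y) - measure M ?E * ?h y\<bar> \<partial>M)"
    by (rule integral_abs_bound)
  also have "\<dots> \<le> (\<integral>y. K * r ^ i * measure M ?E * indicator ?D y \<partial>M)"
  proof (rule integral_mono_AE)
    show "AE y in M. \<bar>measure M ?D * (branch_dens w y * ?h y) - measure M ?E * ?h y\<bar> \<le> K * r ^ i * measure M ?E * indicator ?D y"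
      using var
    proof eventually_elim
      case (elim y)
      show ?case
      proof (cases "y \<in> ?D")
        case True
        have gy: "0 \<le> g ((T ^^ i) y)" "g ((T ^^ i) y) \<le> 1" using unit_funsD(2,3)[OF g] by auto
        have "\<bar>measure M ?D * (branch_dens w y * ?h y) - measure M ?E * ?h y\<bar>
          = \<bar>measure M ?D * branch_dens w y - measure M ?E\<bar> * g ((T ^^ i) y)"
        proof -
          have "measure M ?D * (branch_dens w y * ?h y) - measure M ?E * ?h y
            = (measure M ?D * branch_dens w y - measure M ?E) * g ((T ^^ i) y)"
            using True by (simp add: left_diff_distrib)
          then show ?thesis using gy(1) by (simp only: abs_mult abs_of_nonneg)
        qed
        also have "\<dots> \<le> K * r ^ i * measure M ?E * 1"
          using elim True gy by (intro mult_mono) auto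
        finally show ?thesis using True by simp
      qed simp
    qed
  qed (use i1 i2 i3 in auto)
  finally show ?thesis using D by simp
qed

text \<open>The lower bound on the density in integrated form: every part of the image receives mass
  from the cylinder at least proportionally to \<mu>. It is applied twice in
  \<open>doeblin\<close>.\<close>

lemma branch_integral_lower:
  assumes u: "u \<in> words \<alpha> n" and a: "a \<in> \<alpha>" and pos: "measure M (cyl M T (u @ [a])) > 0"
    and B: "B \<in> sets M" "AE x in M. x \<in> B \<longrightarrow> x \<in> im a" and g: "g \<in> unit_funs M"
  shows "measure M (cyl M T (u @ [a])) / (1 + K) * (LINT x:B|M. g x)
    \<le> (LINT x:cyl M T (u @ [a])|M. g ((T ^^ Suc n) x))"
proof -
  let ?w = "u @ [a]"
  have w: "?w \<in> words \<alpha> (Suc n)" using u a by (auto simp: words_def)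
  note bd = branch_density[OF w]
  have gB: "(\<lambda>x. indicator B x * g x) \<in> unit_funs M" by (rule unit_funs_indicator[OF B(1) g])
  have "measure M (cyl M T ?w) / (1 + K) * (LINT x:B|M. g x) =
    (\<integral>x. measure M (cyl M T ?w) / (1 + K) * (indicator B x * g x) \<partial>M)"
    by (simp add: set_lebesgue_integral_def)
  also have "\<dots> \<le> (\<integral>y. branch_dens ?w y * g y \<partial>M)"
  proof (rule integral_mono_AE)
    show "integrable M (\<lambda>x. measure M (cyl M T ?w) / (1 + K) * (indicator B x * g x))"
      using unit_funs_integrable[OF gB] by simp
    show "integrable M (\<lambda>y. branch_dens ?w y * g y)" using bd(3)[OF g] by simp
    show "AE x in M. measure M (cyl M T ?w) / (1 + K) * (indicator B x * g x) \<le> branch_dens ?w x * g x"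
      using B(2) branch_dens_lower[OF u a pos]
    proof eventually_elim
      case (elim x)
      have gx: "0 \<le> g x" using unit_funsD(2)[OF g] by auto
      show ?case
      proof (cases "x \<in> B")
        case True
        then have "measure M (cyl M T ?w) / (1 + K) \<le> branch_dens ?w x"
          using elim K(1) by (simp add: field_simps)
        from mult_right_mono[OF this gx] show ?thesis using True by simp
      qed (use gx bd(2)[of x] in simp)
    qed
  qed
  also have "\<dots> = (LINT x:cyl M T ?w|M. g ((T ^^ Suc n) x))" using bd(3)[OF g] by simp
  finally show ?thesis .
qed

lemma \<alpha>_nonempty: "\<alpha> \<noteq> {}"
proof
  assume "\<alpha> = {}"
  with \<alpha>_AE have "AE x in M. False" by (auto elim: eventually_mono)
  then show False by simp
qed

text \<open>Mixing speaks of \<open>image_mod\<close> of iterates, which \<open>image_mod_eq\<close>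
  can evaluate only from a known image. The dichotomy for single images makes this image a union of
  elements of \<alpha>.\<close>

lemma iterate_onto:
  assumes s: "s \<in> \<alpha>"
  shows "\<exists>R\<subseteq>\<alpha>. onto_mod M (T ^^ n) s (\<Union>R)"
proof (induction n)
  case 0
  have "onto_mod M (T ^^ 0) s (\<Union>{s})"
    unfolding onto_mod_def
  proof (intro conjI ballI)
    fix N assume "N \<in> null_sets M"
    from AE_not_in[OF this] show "AE y in M. y \<in> \<Union>{s} \<longrightarrow> y \<in> (T ^^ 0) ` (s - N)"
      by eventually_elim simp
  qed simp
  then show ?case using s by (intro exI[of _ "{s}"] conjI) blast+
next
  case (Suc n)
  obtain R where R: "R \<subseteq> \<alpha>" "onto_mod M (T ^^ n) s (\<Union>R)" using Suc.IH by blast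
  have cR: "countable R" using R(1) \<alpha>_countable countable_subset by blast
  let ?E = "\<Union>a\<in>R. im a"
  have "onto_mod M T (\<Union>a\<in>R. a) ?E"
    by (rule onto_mod_UN[OF cR]) (use R im_onto in blast)
  then have 1: "onto_mod M T (\<Union>R) ?E" by simp
  have "\<Union>R \<subseteq> space M" using R(1) sets.sets_into_space[OF \<alpha>_sets] by blast
  from onto_mod_comp[OF R(2) 1 this AE_Tn]
  have 2: "onto_mod M (T ^^ Suc n) s ?E" by (simp only: funpow.simps(2))
  \<comment> \<open>The elements covered by the new image. The others are missed by it up to null
    sets, because each \<open>im a\<close> covers or misses an element and R is countable.\<close>
  define R' where "R' = {t\<in>\<alpha>. AE x in M. x \<in> t \<longrightarrow> x \<in> ?E}"
  have "AE x in M. x \<in> t \<longrightarrow> (x \<in> ?E \<longleftrightarrow> t \<in> R')" if t: "t \<in> \<alpha>" for t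
  proof (cases "\<exists>a\<in>R. AE x in M. x \<in> t \<longrightarrow> x \<in> im a")
    case True
    then obtain a where a: "a \<in> R" "AE x in M. x \<in> t \<longrightarrow> x \<in> im a" by blast
    from a(2) have ae: "AE x in M. x \<in> t \<longrightarrow> x \<in> ?E" by eventually_elim (use a(1) in blast)
    then have "t \<in> R'" using t by (simp add: R'_def)
    with ae show ?thesis by (auto elim: eventually_mono)
  next
    case False
    have "AE x in M. x \<in> t \<longrightarrow> x \<notin> im a" if a: "a \<in> R" for a
    proof -
      have "a \<in> \<alpha>" using R(1) a by blast
      from im_dichotomy[OF this t] False a show ?thesis by blast
    qed
    then have "AE x in M. \<forall>a\<in>R. x \<in> t \<longrightarrow> x \<notin> im a"
      by (subst AE_ball_countable[OF cR]) blast
    then have ae: "AE x in M. x \<in> t \<longrightarrow> x \<notin> ?E" by eventually_elim blast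
    have "t \<notin> R'"
    proof
      assume "t \<in> R'"
      then have "AE x in M. x \<in> t \<longrightarrow> x \<in> ?E" by (simp add: R'_def)
      with ae have "AE x in M. x \<notin> t" by eventually_elim blast
      then show False using \<alpha>_pos[OF t] AE_iff_null_sets[OF \<alpha>_sets[OF t]] by auto
    qed
    with ae show ?thesis by (auto elim: eventually_mono)
  qed
  then have "AE x in M. \<forall>t\<in>\<alpha>. x \<in> t \<longrightarrow> (x \<in> ?E \<longleftrightarrow> t \<in> R')"
    by (subst AE_ball_countable[OF \<alpha>_countable]) blast
  then have "AE x in M. x \<in> ?E \<longleftrightarrow> x \<in> \<Union>R'"
    using \<alpha>_AE
  proof eventually_elim
    case (elim x)
    then obtain t where t: "t \<in> \<alpha>" "x \<in> t" by blast
    have "R' \<subseteq> \<alpha>" by (auto simp: R'_def)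
    then show ?case using elim t by blast
  qed
  then have "onto_mod M (T ^^ Suc n) s (\<Union>R')" by (rule onto_mod_cong[OF 2 _ AE_Tn])
  moreover have "R' \<subseteq> \<alpha>" by (auto simp: R'_def)
  ultimately show ?case by (intro exI[of _ R'] conjI)
qed

end

section \<open>Minorization after a fixed time\<close>

locale mixing_gibbs_markov = gibbs_markov +
  assumes preserving: "measure_preserving M T" and mixing: "topologically_mixing M T \<alpha>"
begin

text \<open>Mixing, a statement about sets, is turned into a path of letters that starts with s and
  whose last image covers t. One such word is enough, since bounded distortion converts its measure
  into a lower bound for a density.\<close>

lemma mixing_word:
  assumes s: "s \<in> \<alpha>" and t: "t \<in> \<alpha>"
  shows "\<exists>n0. \<forall>n\<ge>n0. \<exists>u\<in>words \<alpha> n. \<exists>c\<in>\<alpha>. measure M (cyl M T (u @ [c])) > 0 \<and>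
    cyl M T (u @ [c]) \<subseteq> s \<and> (AE x in M. x \<in> t \<longrightarrow> x \<in> im c)"
proof -
  obtain n0 where n0: "\<And>n. n > n0 \<Longrightarrow> subset_mod M t (image_mod M (T ^^ n) s)"
    using mixing s t unfolding topologically_mixing_def by blast
  have "\<exists>u\<in>words \<alpha> n. \<exists>c\<in>\<alpha>. measure M (cyl M T (u @ [c])) > 0 \<and>
    cyl M T (u @ [c]) \<subseteq> s \<and> (AE x in M. x \<in> t \<longrightarrow> x \<in> im c)" if n: "n \<ge> n0" for n
  proof -
    let ?S = "T ^^ Suc n"
    obtain R where R: "R \<subseteq> \<alpha>" "onto_mod M ?S s (\<Union>R)" using iterate_onto[OF s] by blast
    have "countable R" using R(1) \<alpha>_countable countable_subset by blast
    then have UR: "\<Union>R \<in> sets M" using R(1) \<alpha>_sets by (intro sets.countable_Union) auto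
    have "AE x in M. x \<in> t \<longrightarrow> x \<in> image_mod M ?S s" using n0[of "Suc n"] n by (simp add: subset_mod_def)
    moreover have "AE x in M. x \<in> image_mod M ?S s \<longleftrightarrow> x \<in> \<Union>R"
      using image_mod_eq(2)[OF UR R(2) sets.sets_into_space[OF \<alpha>_sets[OF s]]] by (simp add: eq_mod_def)
    ultimately have tR: "AE x in M. x \<in> t \<longrightarrow> x \<in> \<Union>R" by eventually_elim blast
    \<comment> \<open>The part of s that reaches t. Were it null, the iterate would still have to
      reach almost all of t from the rest of s.\<close>
    let ?Z = "s \<inter> (?S -` t \<inter> space M)"
    have Z: "?Z \<in> sets M" by (rule sets.Int[OF \<alpha>_sets[OF s] measurable_sets[OF Tn_meas \<alpha>_sets[OF t]]])
    have "?Z \<notin> null_sets M"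
    proof
      assume "?Z \<in> null_sets M"
      from onto_modD2[OF R(2) this] tR have "AE y in M. y \<notin> t"
      proof eventually_elim
        case (elim y)
        show ?case
        proof
          assume y: "y \<in> t"
          then obtain x where "y = ?S x" "x \<in> s - ?Z" using elim by blast
          then show False using y sets.sets_into_space[OF \<alpha>_sets[OF s]] by blast
        qed
      qed
      then show False using \<alpha>_pos[OF t] AE_iff_null_sets[OF \<alpha>_sets[OF t]] by auto
    qed
    have "\<exists>w\<in>words \<alpha> (Suc n). ?Z \<inter> cyl M T w \<notin> null_sets M"
    proof (rule ccontr)
      assume no: "\<not> ?thesis"
      have "AE x in M. x \<notin> ?Z \<inter> cyl M T w" if "w \<in> words \<alpha> (Suc n)" for w
        by (rule AE_not_in) (use no that in blast)
      then have "AE x in M. \<forall>w\<in>words \<alpha> (Suc n). x \<notin> ?Z \<inter> cyl M T w"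
        by (subst AE_ball_countable[OF countable_words[OF \<alpha>_countable]]) blast
      with cyl_AE[of "Suc n"] have "AE x in M. x \<notin> ?Z" by eventually_elim blast
      then show False using \<open>?Z \<notin> null_sets M\<close> AE_iff_null_sets[OF Z] by simp
    qed
    then obtain w where w: "w \<in> words \<alpha> (Suc n)" "?Z \<inter> cyl M T w \<notin> null_sets M" by blast
    obtain c u where uc: "w = u @ [c]" "c \<in> \<alpha>" "u \<in> words \<alpha> n" using w(1) by (rule words_Suc_rev)
    obtain b v where bv: "w = b # v" "b \<in> \<alpha>" "v \<in> words \<alpha> n" using w(1) by (rule words_SucE)
    have W: "cyl M T w \<in> sets M" using cyl_meas[OF w(1)] .
    have null_sub: "?Z \<inter> cyl M T w \<in> null_sets M" if "A \<in> null_sets M" "?Z \<inter> cyl M T w \<subseteq> A" for A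
      using null_sets_subset[OF that(1) sets.Int[OF Z W] that(2)] .
    \<comment> \<open>Distinct elements of \<alpha> meet in null sets, so a word whose cylinder
      meets s in positive measure begins with s.\<close>
    have "b = s"
    proof (rule ccontr)
      assume "b \<noteq> s"
      then have "b \<inter> s \<in> null_sets M" using partition bv s
        by (auto simp: partition_mod_def intro!: null_setsI)
      moreover have "cyl M T w \<subseteq> b" using bv by (auto simp: cyl_def)
      ultimately show False using null_sub w(2) by blast
    qed
    then have sub: "cyl M T w \<subseteq> s" using bv by (auto simp: cyl_def)
    have len: "length w = Suc n" using w by (simp add: words_def)
    have cy: "cyl M T (w @ [t]) = cyl M T w \<inter> ?S -` t \<inter> space M"
      using cyl_append[OF T_meas, of w "[t]"] unfolding cyl_single[OF \<alpha>_sets[OF t]] len .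
    have wt: "w @ [t] \<in> words \<alpha> (Suc (Suc n))" using w t by (auto simp: words_def)
    have pos: "measure M A > 0" if "A \<in> sets M" "?Z \<inter> cyl M T w \<subseteq> A" for A
    proof (rule ccontr)
      assume "\<not> measure M A > 0"
      then have "measure M A = 0" using measure_nonneg[of M A] by linarith
      then have "A \<in> null_sets M" using that(1) by (simp add: null_sets_def emeasure_eq_measure)
      then show False using null_sub that(2) w(2) by blast
    qed
    have p1: "measure M (cyl M T (w @ [t])) > 0"
      by (rule pos[OF cyl_meas[OF wt]]) (use cy in blast)
    have p2: "measure M (cyl M T w) > 0" by (rule pos[OF W]) blast
    have "AE x in M. x \<in> t \<longrightarrow> x \<in> im c"
      using cyl_pos_image[OF uc(3,2) t] p1 unfolding uc(1) by blast
    then show ?thesis using uc p2 sub by blast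
  qed
  then show ?thesis by blast
qed

lemma finite_part_big:
  assumes "\<delta> > 0"
  obtains \<alpha>0 where "finite \<alpha>0" "\<alpha>0 \<subseteq> \<alpha>" "measure M (\<Union>\<alpha>0) > 1 - \<delta>"
proof -
  let ?e = "from_nat_into \<alpha>"
  note ne = \<alpha>_nonempty
  define A where "A n = (\<Union>k<n. ?e k)" for n :: nat
  have e: "?e k \<in> \<alpha>" for k using from_nat_into[OF ne] .
  have Am: "range A \<subseteq> sets M" using \<alpha>_sets[OF e] unfolding A_def by blast
  have inc: "incseq A" unfolding A_def incseq_def by (intro allI impI UN_mono) auto
  have UA: "(\<Union>n. A n) = \<Union>\<alpha>"
  proof -
    have "(\<Union>n. A n) = (\<Union>k. ?e k)" by (auto simp: A_def)
    also have "\<dots> = \<Union>\<alpha>" using range_from_nat_into[OF ne \<alpha>_countable] by simp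
    finally show ?thesis .
  qed
  have U: "\<Union>\<alpha> \<in> sets M" using \<alpha>_countable \<alpha>_sets by (intro sets.countable_Union) auto
  have "measure M (\<Union>\<alpha>) = 1"
    using prob_Collect_eq_1[of "\<lambda>x. x \<in> \<Union>\<alpha>"] U partition prob_eq_1[OF U]
    by (auto simp: partition_mod_def)
  then have "(\<lambda>n. measure M (A n)) \<longlonglongrightarrow> 1"
    using finite_Lim_measure_incseq[OF Am inc] UA by simp
  then have "\<forall>\<^sub>F n in sequentially. measure M (A n) > 1 - \<delta>"
    using assms by (intro order_tendstoD) auto
  then obtain n where "measure M (A n) > 1 - \<delta>" by (auto simp: eventually_sequentially)
  then show ?thesis using that[of "?e ` {..<n}"] e by (auto simp: A_def)
qed

text \<open>Finitely many elements carry mass above 1 - \<delta>, with \<delta> the infimum of the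
  image masses, so every image covers one of them. From each of these finitely many elements a word
  of one common length leads to an image that covers t, which makes J and \<kappa> independent of
  w.\<close>

lemma doeblin:
  "\<exists>J \<kappa> t. \<kappa> > 0 \<and> t \<in> \<alpha> \<and> (\<forall>n. \<forall>w\<in>words \<alpha> n. \<forall>g\<in>unit_funs M. n \<ge> 1 \<longrightarrow> measure M (cyl M T w) > 0 \<longrightarrow>
     \<kappa> * measure M (cyl M T w) * (LINT x:t|M. g x) \<le> (LINT x:cyl M T w|M. g ((T ^^ (n + J)) x)))"
proof -
  define \<delta> where "\<delta> = (INF a\<in>\<alpha>. measure M (im a))"
  have \<delta>: "\<delta> > 0" using big_images by (simp add: \<delta>_def im_def)
  have \<delta>_le: "\<delta> \<le> measure M (im a)" if "a \<in> \<alpha>" for a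
    unfolding \<delta>_def by (rule cINF_lower[OF _ that]) (auto intro!: bdd_belowI[of _ 0])
  obtain \<alpha>0 where \<alpha>0: "finite \<alpha>0" "\<alpha>0 \<subseteq> \<alpha>" "measure M (\<Union>\<alpha>0) > 1 - \<delta>"
    by (rule finite_part_big[OF \<delta>])
  \<comment> \<open>If \<open>im a\<close> covered none of the chosen elements, it would by the
    dichotomy be disjoint from all of them, and the two masses would add up to more than 1.\<close>
  have meet: "\<exists>s\<in>\<alpha>0. AE x in M. x \<in> s \<longrightarrow> x \<in> im a" if a: "a \<in> \<alpha>" for a
  proof (rule ccontr)
    assume no: "\<not> ?thesis"
    have c0: "countable \<alpha>0" using \<alpha>0(1) by (rule countable_finite)
    have "AE x in M. \<forall>s\<in>\<alpha>0. x \<in> s \<longrightarrow> x \<notin> im a"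
      using no im_dichotomy[OF a] \<alpha>0(2) by (subst AE_ball_countable[OF c0]) blast
    then have ae: "AE x in M. x \<notin> \<Union>\<alpha>0 \<inter> im a" by eventually_elim blast
    have U0: "\<Union>\<alpha>0 \<in> sets M" using \<alpha>0 \<alpha>_sets by (intro sets.finite_Union) auto
    have "\<Union>\<alpha>0 \<inter> im a \<in> null_sets M"
      using ae AE_iff_null_sets[of "\<Union>\<alpha>0 \<inter> im a" M] U0 im_sets[OF a] by auto
    then have "measure M (\<Union>\<alpha>0 \<union> im a) = measure M (\<Union>\<alpha>0) + measure M (im a)"
      using U0 im_sets[OF a] by (subst measure_Un3) (auto simp: fmeasurable_eq_sets measure_eq_0_null_sets)
    then show False using prob_le_1[of "\<Union>\<alpha>0 \<union> im a"] \<alpha>0(3) \<delta>_le[OF a] by simp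
  qed
  obtain t where t: "t \<in> \<alpha>" using \<alpha>_nonempty by blast
  have ne: "\<alpha>0 \<noteq> {}" using meet t by blast
  define good where "good s n u c \<longleftrightarrow> u \<in> words \<alpha> n \<and> c \<in> \<alpha> \<and> measure M (cyl M T (u @ [c])) > 0 \<and>
    cyl M T (u @ [c]) \<subseteq> s \<and> (AE x in M. x \<in> t \<longrightarrow> x \<in> im c)" for s n u c
  have "\<exists>n0. \<forall>n\<ge>n0. \<exists>u c. good s n u c" if "s \<in> \<alpha>0" for s
    using mixing_word[of s t] \<alpha>0(2) t that unfolding good_def Bex_def by blast
  then obtain n0 where n0: "\<And>s n. s \<in> \<alpha>0 \<Longrightarrow> n \<ge> n0 s \<Longrightarrow> \<exists>u c. good s n u c" by metis
  \<comment> \<open>A sum of finitely many natural thresholds dominates each of them.\<close>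
  define j where "j = (\<Sum>s\<in>\<alpha>0. n0 s)"
  have "\<exists>u c. good s j u c" if s: "s \<in> \<alpha>0" for s
    by (rule n0[OF s]) (use member_le_sum[of s \<alpha>0 n0] \<alpha>0(1) s in \<open>auto simp: j_def\<close>)
  then obtain u c where good: "\<And>s. s \<in> \<alpha>0 \<Longrightarrow> good s j (u s) (c s)" by metis
  note uc = good[unfolded good_def]
  \<comment> \<open>One factor 1 / (1 + K) is lost on entering s at the end of w, another on
    entering t at the end of the connecting word.\<close>
  define k where "k s = measure M (cyl M T (u s @ [c s])) / (1 + K) / (1 + K)" for s
  define \<kappa> where "\<kappa> = Min (k ` \<alpha>0)"
  have \<kappa>: "\<kappa> > 0" unfolding \<kappa>_def using \<alpha>0(1) ne uc K(1) by (subst Min_gr_iff) (auto simp: k_def)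
  have \<kappa>_le: "\<kappa> \<le> k s" if "s \<in> \<alpha>0" for s unfolding \<kappa>_def using \<alpha>0(1) that by (intro Min_le) auto
  have main: "\<kappa> * measure M (cyl M T w) * (LINT x:t|M. g x) \<le> (LINT x:cyl M T w|M. g ((T ^^ (n + Suc j)) x))"
    if w: "w \<in> words \<alpha> n" and g: "g \<in> unit_funs M" and n: "n \<ge> 1" and pos: "measure M (cyl M T w) > 0" for n w g
  proof -
    have w': "w \<in> words \<alpha> (Suc (n - 1))" using w n by simp
    obtain a v where va: "w = v @ [a]" "a \<in> \<alpha>" "v \<in> words \<alpha> (n - 1)"
      by (rule words_Suc_rev[OF w'])
    obtain s where s: "s \<in> \<alpha>0" "AE x in M. x \<in> s \<longrightarrow> x \<in> im a" using meet[OF va(2)] by blast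
    note U = uc[OF s(1)]
    let ?g = "\<lambda>x. g ((T ^^ Suc j) x)"
    have gg: "?g \<in> unit_funs M" by (rule unit_funs_Tn[OF g])
    have sM: "s \<in> sets M" using s \<alpha>0(2) \<alpha>_sets by blast
    have Cm: "cyl M T (u s @ [c s]) \<in> sets M" by (rule cyl_meas[of _ "Suc j"]) (use U in \<open>auto simp: words_def\<close>)
    have fa: "(T ^^ (n + Suc j)) x = (T ^^ Suc j) ((T ^^ n) x)" for x
      by (subst add.commute) (simp only: funpow_add comp_apply)
    have gt: "0 \<le> (LINT x:t|M. g x)"
      unfolding set_lebesgue_integral_def
      by (rule Bochner_Integration.integral_nonneg) (use unit_funsD(2)[OF g] in \<open>simp add: indicator_def\<close>)
    have "\<kappa> * measure M (cyl M T w) * (LINT x:t|M. g x) \<le> k s * measure M (cyl M T w) * (LINT x:t|M. g x)"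
      using \<kappa>_le[OF s(1)] gt by (intro mult_right_mono) auto
    also have "\<dots> = measure M (cyl M T w) / (1 + K) * (measure M (cyl M T (u s @ [c s])) / (1 + K) * (LINT x:t|M. g x))"
      by (simp add: k_def)
    also have "\<dots> \<le> measure M (cyl M T w) / (1 + K) * (LINT x:cyl M T (u s @ [c s])|M. ?g x)"
      using U t g K(1) by (intro mult_left_mono branch_integral_lower) auto
    also have "\<dots> \<le> measure M (cyl M T w) / (1 + K) * (LINT x:s|M. ?g x)"
    proof -
      have "(LINT x:cyl M T (u s @ [c s])|M. ?g x) \<le> (LINT x:s|M. ?g x)"
        unfolding set_lebesgue_integral_def
      proof (rule integral_mono)
        fix x have "0 \<le> ?g x" by (rule unit_funsD(2)[OF g])
        then show "indicat_real (cyl M T (u s @ [c s])) x *\<^sub>R ?g x \<le> indicat_real s x *\<^sub>R ?g x"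
          using U by (auto split: split_indicator)
      qed (rule integrable_mult_indicator[OF Cm unit_funs_integrable[OF gg]],
          rule integrable_mult_indicator[OF sM unit_funs_integrable[OF gg]])
      then show ?thesis using K(1) by (intro mult_left_mono) auto
    qed
    also have "\<dots> \<le> (LINT x:cyl M T w|M. ?g ((T ^^ Suc (n - 1)) x))"
      unfolding va(1) by (rule branch_integral_lower[OF va(3,2) pos[unfolded va(1)] sM s(2) gg])
    also have "\<dots> = (LINT x:cyl M T w|M. g ((T ^^ (n + Suc j)) x))"
      unfolding fa using n by simp
    finally show ?thesis .
  qed
  \<comment> \<open>The connecting word has j + 1 letters, hence \<open>Suc j\<close> as the waiting
    time.\<close>
  show ?thesis
  proof (rule exI[of _ "Suc j"], rule exI[of _ \<kappa>], rule exI[of _ t], intro conjI allI ballI impI)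
    show "\<kappa> > 0" by (rule \<kappa>)
    show "t \<in> \<alpha>" by (rule t)
    fix n w g
    assume 1: "w \<in> words \<alpha> n" and 2: "g \<in> unit_funs M" and 3: "1 \<le> n" and 4: "measure M (cyl M T w) > 0"
    show "\<kappa> * measure M (cyl M T w) * (LINT x:t|M. g x) \<le> (LINT x:cyl M T w|M. g ((T ^^ (n + Suc j)) x))"
      by (rule main[OF 1 2 3 4])
  qed
qed

end

section \<open>Uniform mixing\<close>

context mixing_gibbs_markov
begin

lemma distr_Tn: "distr M M (T ^^ n) = M"
proof (induction n)
  case 0
  then show ?case by (simp add: distr_id2 id_def)
next
  case (Suc n)
  have "distr M M (T ^^ Suc n) = distr (distr M M (T ^^ n)) M T"
    by (subst distr_distr[OF T_meas Tn_meas]) (simp only: funpow.simps(2))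
  also have "\<dots> = M" using Suc preserving by (simp only: measure_preserving_def)
  finally show ?case .
qed

lemma integral_Tn:
  fixes f :: "'a \<Rightarrow> 'b::{banach, second_countable_topology}"
  assumes "f \<in> borel_measurable M"
  shows "(\<integral>x. f ((T ^^ n) x) \<partial>M) = (\<integral>x. f x \<partial>M)"
  using integral_distr[OF Tn_meas[of n] assms] unfolding distr_Tn by simp

text \<open>Conditional means need words of positive measure; almost every point still lies in the
  cylinder of exactly one of them.\<close>

definition pwords :: "nat \<Rightarrow> 'a set list set" where
  "pwords n = {w \<in> words \<alpha> n. measure M (cyl M T w) > 0}"

lemma pwordsD: "w \<in> pwords n \<Longrightarrow> w \<in> words \<alpha> n" "w \<in> pwords n \<Longrightarrow> measure M (cyl M T w) > 0"
  "w \<in> pwords n \<Longrightarrow> length w = n"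
  by (auto simp: pwords_def words_def)

lemma countable_pwords: "countable (pwords n)"
  by (rule countable_subset[OF _ countable_words[OF \<alpha>_countable, of n]]) (auto simp: pwords_def)

lemma measure_pos_or_null: "A \<in> sets M \<Longrightarrow> measure M A > 0 \<or> A \<in> null_sets M"
  using measure_nonneg[of M A] by (auto simp: null_sets_def emeasure_eq_measure less_le)

lemma pwords_AE: "AE x in M. \<exists>!w. w \<in> pwords n \<and> x \<in> cyl M T w"
proof -
  have "AE x in M. w \<notin> pwords n \<longrightarrow> x \<notin> cyl M T w" if w: "w \<in> words \<alpha> n" for w
  proof (cases "w \<in> pwords n")
    case False
    then have "cyl M T w \<in> null_sets M"
      using w measure_pos_or_null[OF cyl_meas[OF w]] by (auto simp: pwords_def)
    from AE_not_in[OF this] show ?thesis by (auto elim: eventually_mono)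
  qed simp
  then have "AE x in M. \<forall>w\<in>words \<alpha> n. w \<notin> pwords n \<longrightarrow> x \<notin> cyl M T w"
    by (subst AE_ball_countable[OF countable_words[OF \<alpha>_countable]]) blast
  with cyl_AE[of n] show ?thesis
  proof eventually_elim
    case (elim x)
    then obtain w where w: "w \<in> words \<alpha> n" "x \<in> cyl M T w" by blast
    show ?case
    proof (rule ex1I[of _ w])
      show "w \<in> pwords n \<and> x \<in> cyl M T w" using w elim by blast
      show "v = w" if "v \<in> pwords n \<and> x \<in> cyl M T v" for v
        using that w elim(1) pwordsD(1)[of v n] by blast
    qed
  qed
qed

lemma pwords_nonempty: "pwords n \<noteq> {}"
proof
  assume "pwords n = {}"
  with pwords_AE[of n] have "AE x in M. False" by (auto elim: eventually_mono)
  then show False by simp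
qed

text \<open>The time j is counted from the end of the word, so that words of different lengths can
  be compared.\<close>

definition cond_mean :: "'a set list \<Rightarrow> nat \<Rightarrow> ('a \<Rightarrow> real) \<Rightarrow> real" where
  "cond_mean w j g = (LINT x:cyl M T w|M. g ((T ^^ (length w + j)) x)) / measure M (cyl M T w)"

lemma funpow_add_apply: "(T ^^ (m + n)) x = (T ^^ n) ((T ^^ m) x)"
  by (subst add.commute) (simp add: funpow_add)

lemma cond_mean_shift: "cond_mean w (j + l) g = cond_mean w j (\<lambda>x. g ((T ^^ l) x))"
  unfolding cond_mean_def add.assoc[symmetric] funpow_add_apply[of "length w + j" l] ..

lemma set_integrable_unit_fun: "g \<in> unit_funs M \<Longrightarrow> A \<in> sets M \<Longrightarrow> set_integrable M A g"
  unfolding set_integrable_def by (rule integrable_mult_indicator[OF _ unit_funs_integrable])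

lemma cond_mean_linear:
  assumes w: "w \<in> pwords n" and g: "g \<in> unit_funs M"
  shows "cond_mean w j (\<lambda>x. g x - c) = cond_mean w j g - c" "cond_mean w j (\<lambda>x. c - g x) = c - cond_mean w j g"
proof -
  let ?g = "\<lambda>x. g ((T ^^ (length w + j)) x)"
  have C: "cyl M T w \<in> sets M" using cyl_meas[OF pwordsD(1)[OF w]] .
  have i: "set_integrable M (cyl M T w) ?g" using set_integrable_unit_fun[OF unit_funs_Tn[OF g] C] .
  have ic: "set_integrable M (cyl M T w) (\<lambda>x. c)"
    by (rule set_integrable_const[OF C])
  have lc: "(LINT x:cyl M T w|M. c) = measure M (cyl M T w) * c" using C by (simp add: set_lebesgue_integral_def)
  show "cond_mean w j (\<lambda>x. g x - c) = cond_mean w j g - c" "cond_mean w j (\<lambda>x. c - g x) = c - cond_mean w j g"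
    unfolding cond_mean_def set_integral_diff(2)[OF i ic] set_integral_diff(2)[OF ic i] lc
    using pwordsD(2)[OF w] by (simp_all add: field_simps)
qed

lemma cond_mean_bounds:
  assumes w: "w \<in> pwords n" and g: "g \<in> unit_funs M"
  shows "0 \<le> cond_mean w j g" "cond_mean w j g \<le> 1"
proof -
  have ge: "0 \<le> cond_mean w j h" if h: "\<And>x. 0 \<le> h x" for h
    unfolding cond_mean_def set_lebesgue_integral_def
    by (intro divide_nonneg_nonneg Bochner_Integration.integral_nonneg) (simp_all add: h indicator_def)
  show "0 \<le> cond_mean w j g" by (rule ge[OF unit_funsD(2)[OF g]])
  have "0 \<le> cond_mean w j (\<lambda>x. 1 - g x)" by (rule ge) (use unit_funsD(3)[OF g] in simp)
  then show "cond_mean w j g \<le> 1" unfolding cond_mean_linear(2)[OF w g] by simp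
qed

section \<open>Contraction of the distance between conditional laws\<close>

lemma cyl_append_null:
  assumes d: "d \<in> words \<alpha> i" "cyl M T d \<in> null_sets M" and u: "u \<in> words \<alpha> n"
  shows "cyl M T (u @ d) \<in> null_sets M"
proof -
  have "AE x in M. (T ^^ length u) x \<notin> cyl M T d" using AE_not_in[OF d(2)] by (rule AE_Tn)
  then have "AE x in M. x \<notin> cyl M T (u @ d)"
    unfolding cyl_append[OF T_meas] by eventually_elim blast
  then show ?thesis using AE_iff_null_sets[OF cyl_meas[OF words_append[OF u d(1)]]] by simp
qed

text \<open>An approximate Markov property. The function h is the conditional mean given the block d
  of length i that follows a gap of J letters, and by \<open>conditional_comparison\<close> all that
  precedes this block changes the conditional mean by at most K r^i.\<close>

lemma cond_mean_conditional:
  assumes u: "u \<in> pwords n" "n \<ge> 1" and i: "i \<ge> 1" and g: "g \<in> unit_funs M" and h: "h \<in> unit_funs M"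
    and hc: "AE x in M. \<forall>d\<in>pwords i. x \<in> cyl M T d \<longrightarrow> h x = cond_mean d j g"
  shows "\<bar>cond_mean u (J + i + j) g - cond_mean u J h\<bar> \<le> K * r ^ i"
proof -
  let ?C = "cyl M T u"
  let ?g = "\<lambda>x. g ((T ^^ (n + (J + i + j))) x)" and ?h = "\<lambda>x. h ((T ^^ (n + J)) x)"
  let ?f = "\<lambda>x. indicator ?C x * (?g x - ?h x)"
  have C: "?C \<in> sets M" using cyl_meas[OF pwordsD(1)[OF u(1)]] .
  have len: "length u = n" using pwordsD(3)[OF u(1)] .
  have ig: "set_integrable M A ?g" "set_integrable M A ?h" if "A \<in> sets M" for A
    using set_integrable_unit_fun[OF unit_funs_Tn[OF g] that] set_integrable_unit_fun[OF unit_funs_Tn[OF h] that] by auto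
  have if': "integrable M ?f"
    using set_integral_diff(1)[OF ig(1)[OF C] ig(2)[OF C]] unfolding set_integrable_def by simp
  have hc': "AE x in M. \<forall>d\<in>pwords i. (T ^^ (n + J)) x \<in> cyl M T d \<longrightarrow> ?h x = cond_mean d j g"
    using AE_Tn[OF hc] .
  let ?B = "\<lambda>w. (T ^^ n) -` cyl M T w \<inter> space M"
  have Bm: "?B w \<in> sets M" if "w \<in> words \<alpha> (J + i)" for w
    using measurable_sets[OF Tn_meas cyl_meas[OF that]] .
  have eq: "indicator (?B w) x * indicator ?C x = (indicator (cyl M T (u @ w)) x :: real)" for w x
    unfolding cyl_append[OF T_meas] len by (auto split: split_indicator)
  have piece: "norm (LINT x:?B w|M. ?f x) \<le> (LINT x:?B w|M. K * r ^ i * indicator ?C x)"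
    if w: "w \<in> words \<alpha> (J + i)" for w
  proof -
    let ?E = "cyl M T (u @ w)"
    have uw: "u @ w \<in> words \<alpha> (n + (J + i))" using words_append[OF pwordsD(1)[OF u(1)] w] .
    have E: "?E \<in> sets M" using cyl_meas[OF uw] .
    have "(LINT x:?B w|M. ?f x) = (LINT x:?E|M. ?g x - ?h x)"
      unfolding set_lebesgue_integral_def by (simp only: real_scaleR_def mult.assoc[symmetric] eq)
    also have "\<dots> = (LINT x:?E|M. ?g x) - (LINT x:?E|M. ?h x)" by (rule set_integral_diff(2)[OF ig[OF E]])
    finally have L: "(LINT x:?B w|M. ?f x) = (LINT x:?E|M. ?g x) - (LINT x:?E|M. ?h x)" .
    have "(LINT x:?B w|M. K * r ^ i * indicator ?C x) = (\<integral>x. K * r ^ i * indicator ?E x \<partial>M)"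
      unfolding set_lebesgue_integral_def
      by (simp only: real_scaleR_def mult.left_commute[of _ "K * r ^ i"] eq)
    also have "\<dots> = K * r ^ i * measure M ?E" using E by simp
    finally have R: "(LINT x:?B w|M. K * r ^ i * indicator ?C x) = K * r ^ i * measure M ?E" .
    show ?thesis
    proof (cases "?E \<in> null_sets M")
      case True
      then show ?thesis unfolding L R by (simp add: set_integral_null_set measure_eq_0_null_sets)
    next
      case False
      \<comment> \<open>v fills the gap of length J, and d is the block on which h is
        evaluated.\<close>
      define v d where "v = take J w" and "d = drop J w"
      have vd: "v \<in> words \<alpha> J" "d \<in> words \<alpha> i" "u @ w = (u @ v) @ d"
        using w set_take_subset[of J w] set_drop_subset[of J w] by (auto simp: words_def v_def d_def)
      have uv: "u @ v \<in> words \<alpha> (n + J)" using words_append[OF pwordsD(1)[OF u(1)] vd(1)] .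
      have luv: "length (u @ v) = n + J" using uv by (simp add: words_def)
      have ld: "length d = i" using vd(2) by (simp add: words_def)
      have "cyl M T d \<notin> null_sets M" using cyl_append_null[OF vd(2) _ uv] False vd(3) by auto
      then have dp: "measure M (cyl M T d) > 0" using measure_pos_or_null[OF cyl_meas[OF vd(2)]] by blast
      then have d: "d \<in> pwords i" using vd by (simp add: pwords_def)
      have E': "?E = cyl M T (u @ v) \<inter> (T ^^ (n + J)) -` cyl M T d \<inter> space M"
        unfolding vd(3) cyl_append[OF T_meas, of "u @ v" d] luv ..
      \<comment> \<open>On this cylinder the orbit passes through d after the gap, so there h is a
        constant conditional mean.\<close>
      have "(LINT x:?E|M. ?h x) = (LINT x:?E|M. cond_mean d j g)"
      proof (rule set_lebesgue_integral_cong_AE[OF E])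
        show "AE x\<in>?E in M. ?h x = cond_mean d j g"
          using hc' by eventually_elim (use d E' in blast)
      qed (use unit_funsD(1)[OF unit_funs_Tn[OF h]] in auto)
      also have "\<dots> = measure M ?E * cond_mean d j g" using E by (simp add: set_lebesgue_integral_def)
      finally have Lh: "(LINT x:?E|M. ?h x) = measure M ?E * cond_mean d j g" .
      have "\<bar>measure M (cyl M T d) * (LINT x:?E|M. ?g x) - measure M ?E * (LINT x:cyl M T d|M. g ((T ^^ (i + j)) x))\<bar>
        \<le> K * r ^ i * measure M ?E * measure M (cyl M T d)"
      proof -
        have "(T ^^ (n + (J + i + j))) x = (T ^^ j) ((T ^^ (n + J + i)) x)" for x
          using funpow_add_apply[of "n + J + i" j x] by (simp only: add.assoc)
        moreover have "n + J \<ge> 1" using u(2) by simp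
        ultimately show ?thesis
          using conditional_comparison[OF uv _ vd(2) i unit_funs_Tn[OF g, of j]]
          unfolding vd(3) funpow_add_apply[of i j] by simp
      qed
      also have "(LINT x:cyl M T d|M. g ((T ^^ (i + j)) x)) = measure M (cyl M T d) * cond_mean d j g"
        unfolding cond_mean_def ld using dp by simp
      finally have "\<bar>measure M (cyl M T d) * ((LINT x:?E|M. ?g x) - measure M ?E * cond_mean d j g)\<bar>
        \<le> measure M (cyl M T d) * (K * r ^ i * measure M ?E)" by (simp add: algebra_simps)
      then have "measure M (cyl M T d) * \<bar>(LINT x:?E|M. ?g x) - measure M ?E * cond_mean d j g\<bar>
        \<le> measure M (cyl M T d) * (K * r ^ i * measure M ?E)" using dp by (simp add: abs_mult)
      then show ?thesis unfolding L R Lh real_norm_def using dp by (simp only: mult_le_cancel_left_pos)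
    qed
  qed
  have "norm (\<integral>x. ?f x \<partial>M) \<le> (\<integral>x. K * r ^ i * indicator ?C x \<partial>M)"
  proof (rule piecewise_integral_bound[OF countable_words[OF \<alpha>_countable] Bm _ if' _ piece])
    show "AE x in M. \<exists>!w. w \<in> words \<alpha> (J + i) \<and> x \<in> ?B w"
      using AE_Tn[OF cyl_AE[of "J + i"], of n] AE_space by eventually_elim simp
    show "integrable M (\<lambda>x. K * r ^ i * indicator ?C x)"
      using C by (intro integrable_mult_right) (auto simp: emeasure_eq_measure)
  qed
  also have "\<dots> = K * r ^ i * measure M ?C" using C by simp
  also have "(\<integral>x. ?f x \<partial>M) = (LINT x:?C|M. ?g x) - (LINT x:?C|M. ?h x)"
    unfolding set_integral_diff(2)[OF ig[OF C], symmetric] by (simp add: set_lebesgue_integral_def)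
  also have "\<dots> = measure M ?C * (cond_mean u (J + i + j) g - cond_mean u J h)"
    unfolding cond_mean_def len using pwordsD(2)[OF u(1)] by (simp add: field_simps)
  finally show ?thesis using pwordsD(2)[OF u(1)] by (simp add: abs_mult mult.commute)
qed

text \<open>Words are nonempty because distortion concerns at least one step. A one-sided bound
  suffices, as u and v may be exchanged.\<close>

definition discrepancy_le :: "nat \<Rightarrow> real \<Rightarrow> bool" where
  "discrepancy_le j \<delta> \<longleftrightarrow> (\<forall>n m u v g. u \<in> pwords (Suc n) \<longrightarrow> v \<in> pwords (Suc m) \<longrightarrow> g \<in> unit_funs M \<longrightarrow>
     cond_mean u j g - cond_mean v j g \<le> \<delta>)"

lemma discrepancy_leD: "discrepancy_le j \<delta> \<Longrightarrow> n \<ge> 1 \<Longrightarrow> m \<ge> 1 \<Longrightarrow> u \<in> pwords n \<Longrightarrow> v \<in> pwords m \<Longrightarrow> g \<in> unit_funs M \<Longrightarrow>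
   cond_mean u j g - cond_mean v j g \<le> \<delta>"
  unfolding discrepancy_le_def by (metis Suc_pred' less_eq_Suc_le One_nat_def)

text \<open>Waiting longer only composes g with an iterate of T, which gives another unit
  function.\<close>

lemma discrepancy_le_mono: "discrepancy_le j \<delta> \<Longrightarrow> j \<le> j' \<Longrightarrow> \<delta> \<le> \<delta>' \<Longrightarrow> discrepancy_le j' \<delta>'"
proof -
  assume c: "discrepancy_le j \<delta>" and le: "j \<le> j'" "\<delta> \<le> \<delta>'"
  then obtain l where l: "j' = j + l" using le_Suc_ex by blast
  show ?thesis unfolding discrepancy_le_def l cond_mean_shift
  proof (intro allI impI)
    fix n m u v g assume "u \<in> pwords (Suc n)" "v \<in> pwords (Suc m)" "g \<in> unit_funs M"
    then have "cond_mean u j (\<lambda>x. g ((T ^^ l) x)) - cond_mean v j (\<lambda>x. g ((T ^^ l) x)) \<le> \<delta>"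
      by (intro discrepancy_leD[OF c, of "Suc n" "Suc m"] unit_funs_Tn) simp_all
    then show "cond_mean u j (\<lambda>x. g ((T ^^ l) x)) - cond_mean v j (\<lambda>x. g ((T ^^ l) x)) \<le> \<delta>'" using le(2) by linarith
  qed
qed

lemma discrepancy_le_0: "\<delta> \<ge> 1 \<Longrightarrow> discrepancy_le j \<delta>"
  unfolding discrepancy_le_def using cond_mean_bounds by (smt (verit))

text \<open>Both words wait J steps and are then forgotten up to K r^i by reading a block of length
  i. What remains is the spread of a function h with values in an interval of length at most
  \<delta>, and the common component of both laws, \<kappa> times \<mu> on t, reduces this spread by
  the factor 1 - \<kappa> \<mu>(t).\<close>

lemma discrepancy_le_step:
  assumes t: "t \<in> \<alpha>" "\<kappa> > 0"
    and minor: "\<And>n w g. n \<ge> 1 \<Longrightarrow> w \<in> pwords n \<Longrightarrow> g \<in> unit_funs M \<Longrightarrow> \<kappa> * (LINT x:t|M. g x) \<le> cond_mean w J g"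
    and le1: "\<kappa> * measure M t \<le> 1"
    and c: "discrepancy_le j \<delta>" and i: "i \<ge> 1"
  shows "discrepancy_le (J + i + j) ((1 - \<kappa> * measure M t) * \<delta> + 2 * (K * r ^ i))"
  unfolding discrepancy_le_def
proof (intro allI impI)
  fix n m u v g assume u: "u \<in> pwords (Suc n)" and v: "v \<in> pwords (Suc m)" and g: "g \<in> unit_funs M"
  let ?S = "(\<lambda>d. cond_mean d j g) ` pwords i"
  obtain h where h: "h \<in> borel_measurable M" "\<And>x. h x \<in> ?S"
    "AE x in M. \<forall>d\<in>pwords i. x \<in> cyl M T d \<longrightarrow> h x = cond_mean d j g"
    by (rule measurable_piecewise_constant[OF countable_pwords[of i] pwords_nonempty cyl_meas[OF pwordsD(1)] pwords_AE[of i],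
      where c="\<lambda>d. cond_mean d j g"], assumption, rule that)
  have S01: "0 \<le> y" "y \<le> 1" if "y \<in> ?S" for y using that cond_mean_bounds[OF _ g] by auto
  have bdd: "bdd_below ?S" "bdd_above ?S" using S01 by (meson bdd_belowI bdd_aboveI)+
  have ne: "?S \<noteq> {}" using pwords_nonempty by simp
  \<comment> \<open>All values of h are conditional means at time j, so the length of its range is
    controlled by the old discrepancy.\<close>
  define lo hi where "lo = Inf ?S" and "hi = Sup ?S"
  have lohi: "0 \<le> lo" "hi \<le> 1" "\<And>x. lo \<le> h x" "\<And>x. h x \<le> hi"
    unfolding lo_def hi_def using S01 bdd ne h(2)
    by (auto intro!: cInf_greatest cSup_least cInf_lower cSup_upper simp del: image_eqI)
  have gap: "hi - lo \<le> \<delta>"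
  proof -
    have "y \<le> \<delta> + z" if yz: "y \<in> ?S" "z \<in> ?S" for y z
      using yz discrepancy_leD[OF c i i _ _ g] by (auto simp: algebra_simps)
    then have "y - \<delta> \<le> lo" if "y \<in> ?S" for y unfolding lo_def
      using that by (intro cInf_greatest[OF ne]) (simp add: algebra_simps)
    then have "hi \<le> lo + \<delta>" unfolding hi_def by (intro cSup_least[OF ne]) (simp add: algebra_simps)
    then show ?thesis by simp
  qed
  have hu: "h \<in> unit_funs M" using h(1) S01[OF h(2)] by (simp add: unit_funs_def)
  have h1: "(\<lambda>x. h x - lo) \<in> unit_funs M" and h2: "(\<lambda>x. hi - h x) \<in> unit_funs M"
    using h(1) lohi S01[OF h(2)] unfolding unit_funs_def by (auto intro: order.trans[OF diff_le_self] simp: algebra_simps) (smt (verit))+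
  have tm: "t \<in> sets M" using t \<alpha>_sets by simp
  have it: "set_integrable M t h" by (rule set_integrable_unit_fun[OF hu tm])
  have ic: "set_integrable M t (\<lambda>x. c)" for c :: real
    by (rule set_integrable_const[OF tm])
  have lc: "(LINT x:t|M. c) = measure M t * c" for c :: real using tm by (simp add: set_lebesgue_integral_def)
  have l1: "(LINT x:t|M. h x - lo) = (LINT x:t|M. h x) - measure M t * lo"
    unfolding set_integral_diff(2)[OF it ic] lc ..
  have l2: "(LINT x:t|M. hi - h x) = measure M t * hi - (LINT x:t|M. h x)"
    unfolding set_integral_diff(2)[OF ic it] lc ..
  \<comment> \<open>The minorization is applied to h - lo for one word and, next, to hi - h for the
    other. In the sum of both bounds the integral of h over t cancels.\<close>
  have A: "\<kappa> * ((LINT x:t|M. h x) - measure M t * lo) \<le> cond_mean v J h - lo"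
    using minor[OF _ v h1] unfolding l1 cond_mean_linear(1)[OF v hu] by simp
  have B: "\<kappa> * (measure M t * hi - (LINT x:t|M. h x)) \<le> hi - cond_mean u J h"
    using minor[OF _ u h2] unfolding l2 cond_mean_linear(2)[OF u hu] by simp
  have "cond_mean u J h - cond_mean v J h \<le> (1 - \<kappa> * measure M t) * (hi - lo)"
    using A B by (simp add: algebra_simps)
  also have "\<dots> \<le> (1 - \<kappa> * measure M t) * \<delta>" using gap le1 by (intro mult_left_mono) auto
  finally have "cond_mean u J h - cond_mean v J h \<le> (1 - \<kappa> * measure M t) * \<delta>" .
  moreover have "\<bar>cond_mean u (J + i + j) g - cond_mean u J h\<bar> \<le> K * r ^ i"
    by (rule cond_mean_conditional[OF u _ i g hu h(3)]) simp
  moreover have "\<bar>cond_mean v (J + i + j) g - cond_mean v J h\<bar> \<le> K * r ^ i"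
    by (rule cond_mean_conditional[OF v _ i g hu h(3)]) simp
  ultimately show "cond_mean u (J + i + j) g - cond_mean v (J + i + j) g \<le> (1 - \<kappa> * measure M t) * \<delta> + 2 * (K * r ^ i)"
    by linarith
qed

text \<open>By invariance the mean of g is the average of its conditional means over words of length
  one, and each of these is within \<delta> of the mean given w.\<close>

lemma mixing_from_discrepancy:
  assumes c: "discrepancy_le j \<delta>" and w: "w \<in> pwords n" "n \<ge> 1" and g: "g \<in> unit_funs M"
  shows "\<bar>cond_mean w j g - (\<integral>x. g x \<partial>M)\<bar> \<le> \<delta>"
proof -
  let ?g = "\<lambda>x. g ((T ^^ (1 + j)) x)"
  let ?f = "\<lambda>x. ?g x - cond_mean w j g"
  have ig: "integrable M ?g" using unit_funs_integrable[OF unit_funs_Tn[OF g]] .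
  have "norm (\<integral>x. ?f x \<partial>M) \<le> (\<integral>x. \<delta> \<partial>M)"
  proof (rule piecewise_integral_bound[OF countable_pwords cyl_meas[OF pwordsD(1)] pwords_AE[of 1]])
    show "integrable M ?f" using ig by simp
    fix a assume a: "a \<in> pwords 1"
    have C: "cyl M T a \<in> sets M" using cyl_meas[OF pwordsD(1)[OF a]] .
    have i: "set_integrable M (cyl M T a) ?g" using set_integrable_unit_fun[OF unit_funs_Tn[OF g] C] .
    have ic: "set_integrable M (cyl M T a) (\<lambda>x. c)" for c :: real
      by (rule set_integrable_const[OF C])
    have lc: "(LINT x:cyl M T a|M. c) = measure M (cyl M T a) * c" for c :: real
      using C by (simp add: set_lebesgue_integral_def)
    have "(LINT x:cyl M T a|M. ?g x) = measure M (cyl M T a) * cond_mean a j g"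
      unfolding cond_mean_def pwordsD(3)[OF a] using pwordsD(2)[OF a] by simp
    then have "(LINT x:cyl M T a|M. ?f x) = measure M (cyl M T a) * (cond_mean a j g - cond_mean w j g)"
      unfolding set_integral_diff(2)[OF i ic] lc by (simp add: algebra_simps)
    moreover have "\<bar>cond_mean a j g - cond_mean w j g\<bar> \<le> \<delta>"
      using discrepancy_leD[OF c _ w(2) a w(1) g] discrepancy_leD[OF c w(2) _ w(1) a g] by simp
    ultimately show "norm (LINT x:cyl M T a|M. ?f x) \<le> (LINT x:cyl M T a|M. \<delta>)"
      unfolding lc by (simp add: abs_mult mult_left_mono)
  qed auto
  also have "(\<integral>x. ?f x \<partial>M) = (\<integral>x. g x \<partial>M) - cond_mean w j g"
    using ig integral_Tn[OF unit_funsD(1)[OF g], of "1 + j"] by (simp add: prob_space del: funpow.simps)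
  finally show ?thesis by (simp add: abs_minus_commute prob_space)
qed

text \<open>k contractions, each with a block of length k, take k (J + k) \<le> 2 k^2 steps once k
  \<ge> J. With a fixed block length the bound would keep a constant error, so the blocks grow with
  the number of rounds.\<close>

theorem uniform_mixing:
  "\<exists>C \<theta>. 0 \<le> C \<and> 0 < \<theta> \<and> \<theta> < 1 \<and> (\<forall>n w g k. n \<ge> 1 \<longrightarrow> w \<in> words \<alpha> n \<longrightarrow> g \<in> unit_funs M \<longrightarrow>
    \<bar>(LINT x:cyl M T w|M. g ((T ^^ (n + 2 * k\<^sup>2)) x)) - measure M (cyl M T w) * (\<integral>x. g x \<partial>M)\<bar>
      \<le> C * \<theta> ^ k * measure M (cyl M T w))"
proof -
  obtain J \<kappa> t where \<kappa>: "\<kappa> > 0" and t: "t \<in> \<alpha>"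
    and doe: "\<And>n w g. w \<in> words \<alpha> n \<Longrightarrow> g \<in> unit_funs M \<Longrightarrow> n \<ge> 1 \<Longrightarrow> measure M (cyl M T w) > 0 \<Longrightarrow>
     \<kappa> * measure M (cyl M T w) * (LINT x:t|M. g x) \<le> (LINT x:cyl M T w|M. g ((T ^^ (n + J)) x))"
    using doeblin by metis
  have minor: "\<kappa> * (LINT x:t|M. g x) \<le> cond_mean w J g"
    if n: "n \<ge> 1" and w: "w \<in> pwords n" and g: "g \<in> unit_funs M" for n w g
    using doe[OF pwordsD(1)[OF w] g n pwordsD(2)[OF w]] pwordsD(2)[OF w]
    unfolding cond_mean_def pwordsD(3)[OF w] by (simp add: field_simps)
  define \<epsilon> where "\<epsilon> = \<kappa> * measure M t"
  have tm: "t \<in> sets M" using t \<alpha>_sets by simp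
  have \<epsilon>0: "\<epsilon> > 0" using \<kappa> \<alpha>_pos[OF t] by (simp add: \<epsilon>_def emeasure_pos_iff)
  have \<epsilon>1: "\<epsilon> \<le> 1"
  proof -
    obtain w where w: "w \<in> pwords 1" using pwords_nonempty by blast
    have one: "(\<lambda>x. 1) \<in> unit_funs M" by (simp add: unit_funs_def)
    have "\<kappa> * (LINT x:t|M. 1) \<le> 1"
      using minor[OF _ w one] cond_mean_bounds(2)[OF w one, of J] by simp
    then show ?thesis using tm by (simp add: \<epsilon>_def set_lebesgue_integral_def)
  qed
  \<comment> \<open>The additive term is the fixed point of the recursion x \<mapsto> (1 -
    \<epsilon>) x + 2 K r^i.\<close>
  have iter: "discrepancy_le (k * (J + i)) ((1 - \<epsilon>) ^ k + 2 * (K * r ^ i) / \<epsilon>)" if i: "i \<ge> 1" for i k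
  proof (induction k)
    case 0
    show ?case using \<epsilon>0 K(1) r_pos by (intro discrepancy_le_0) auto
  next
    case (Suc k)
    have "discrepancy_le (J + i + k * (J + i)) ((1 - \<epsilon>) * ((1 - \<epsilon>) ^ k + 2 * (K * r ^ i) / \<epsilon>) + 2 * (K * r ^ i))"
      unfolding \<epsilon>_def by (rule discrepancy_le_step[OF t \<kappa> minor _ _ i]) (use \<epsilon>1 Suc in \<open>auto simp: \<epsilon>_def\<close>)
    moreover have "(1 - \<epsilon>) * ((1 - \<epsilon>) ^ k + 2 * (K * r ^ i) / \<epsilon>) + 2 * (K * r ^ i) = (1 - \<epsilon>) ^ Suc k + 2 * (K * r ^ i) / \<epsilon>"
      using \<epsilon>0 by (simp add: field_simps)
    ultimately show ?case by simp
  qed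
  define \<theta> where "\<theta> = max (1 - \<epsilon>) r"
  have \<theta>: "0 < \<theta>" "\<theta> < 1" "0 \<le> 1 - \<epsilon>" "1 - \<epsilon> \<le> \<theta>" "r \<le> \<theta>"
    using \<epsilon>0 \<epsilon>1 r_pos r_less_1 by (auto simp: \<theta>_def)
  \<comment> \<open>The last summand makes the claim trivial for k \<le> J + 1, where 2 k^2 steps
    may be too few.\<close>
  define C where "C = 1 + 2 * K / \<epsilon> + 1 / \<theta> ^ (J + 1)"
  have C: "C \<ge> 0" using K(1) \<epsilon>0 \<theta> by (simp add: C_def)
  have discrepancy_le: "discrepancy_le (2 * k\<^sup>2) (C * \<theta> ^ k)" for k
  proof (cases "k \<ge> J \<and> k \<ge> 1")
    case True
    have "(1 - \<epsilon>) ^ k + 2 * (K * r ^ k) / \<epsilon> \<le> \<theta> ^ k + 2 * (K * \<theta> ^ k) / \<epsilon>"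
      using \<theta> r_pos K(1) \<epsilon>0 by (intro add_mono power_mono divide_right_mono mult_left_mono) auto
    also have "\<dots> \<le> C * \<theta> ^ k" using \<theta> by (simp add: C_def algebra_simps)
    finally have le: "(1 - \<epsilon>) ^ k + 2 * (K * r ^ k) / \<epsilon> \<le> C * \<theta> ^ k" .
    have "k * (J + k) \<le> k * (k + k)" using True by (intro mult_le_mono2 add_le_mono1) simp
    then have "k * (J + k) \<le> 2 * k\<^sup>2" by (simp add: power2_eq_square)
    then show ?thesis using discrepancy_le_mono[OF iter _ le] True by blast
  next
    case False
    then have "k \<le> J + 1" by auto
    then have "\<theta> ^ (J + 1) \<le> \<theta> ^ k" using \<theta> by (intro power_decreasing) auto
    then have "1 \<le> 1 / \<theta> ^ (J + 1) * \<theta> ^ k" using \<theta> by (simp add: field_simps)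
    also have "\<dots> \<le> C * \<theta> ^ k" using \<theta> K(1) \<epsilon>0 by (intro mult_right_mono) (auto simp: C_def)
    finally show ?thesis by (rule discrepancy_le_0)
  qed
  have "\<bar>(LINT x:cyl M T w|M. g ((T ^^ (n + 2 * k\<^sup>2)) x)) - measure M (cyl M T w) * (\<integral>x. g x \<partial>M)\<bar>
      \<le> C * \<theta> ^ k * measure M (cyl M T w)"
    if n: "n \<ge> 1" and w: "w \<in> words \<alpha> n" and g: "g \<in> unit_funs M" for n w g k
  proof (cases "cyl M T w \<in> null_sets M")
    case True
    then show ?thesis by (simp add: set_integral_null_set measure_eq_0_null_sets)
  next
    case False
    then have wp: "w \<in> pwords n" using measure_pos_or_null[OF cyl_meas[OF w]] w by (simp add: pwords_def)
    let ?m = "measure M (cyl M T w)"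
    have eq: "(LINT x:cyl M T w|M. g ((T ^^ (n + 2 * k\<^sup>2)) x)) - ?m * (\<integral>x. g x \<partial>M)
      = ?m * (cond_mean w (2 * k\<^sup>2) g - (\<integral>x. g x \<partial>M))"
      unfolding cond_mean_def pwordsD(3)[OF wp] using pwordsD(2)[OF wp] by (simp add: field_simps)
    show ?thesis unfolding eq using mixing_from_discrepancy[OF discrepancy_le wp n g, of k] pwordsD(2)[OF wp]
      by (simp add: abs_mult mult.commute)
  qed
  then show ?thesis using C \<theta>(1,2) by blast
qed

end

section \<open>Decay of correlations\<close>

text \<open>Each i has at most 2 q partners at distance below q. The same count serves the second
  moments, the mean of A and the ties.\<close>

lemma near_diagonal_sum:
  fixes a :: "nat \<Rightarrow> nat \<Rightarrow> real"
  assumes fin: "finite I" "finite J" and le1: "\<And>i j. a i j \<le> 1"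
    and far: "\<And>i j. i + q \<le> j \<or> j + q \<le> i \<Longrightarrow> a i j \<le> e" and e: "0 \<le> e"
  shows "(\<Sum>i\<in>I. \<Sum>j\<in>J. a i j) \<le> real (card I) * (2 * real q) + real (card I) * real (card J) * e"
proof -
  have "(\<Sum>j\<in>J. a i j) \<le> 2 * real q + real (card J) * e" for i
  proof -
    let ?A = "{j\<in>J. j < i + q \<and> i < j + q}"
    have "(\<Sum>j\<in>J. a i j) \<le> (\<Sum>j\<in>J. (if j \<in> ?A then 1 else 0) + e)"
    proof (rule sum_mono)
      fix j assume "j \<in> J"
      then show "a i j \<le> (if j \<in> ?A then 1 else 0) + e"
        using le1[of i j] far[of i j] e by (auto simp: not_less)
    qed
    also have "\<dots> = real (card ?A) + real (card J) * e"
      using fin by (simp add: sum.distrib sum.If_cases Int_def)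
    also have "card ?A \<le> card {i + 1 - q..<i + q}" by (rule card_mono) auto
    also have "card {i + 1 - q..<i + q} \<le> 2 * q" by simp
    finally show ?thesis by simp
  qed
  then have "(\<Sum>i\<in>I. \<Sum>j\<in>J. a i j) \<le> (\<Sum>i\<in>I. 2 * real q + real (card J) * e)" by (intro sum_mono)
  then show ?thesis by (simp add: algebra_simps)
qed

context mixing_gibbs_markov
begin

definition mixing_rate :: "real \<Rightarrow> real \<Rightarrow> bool" where
  "mixing_rate C \<theta> \<longleftrightarrow> 0 \<le> C \<and> 0 < \<theta> \<and> \<theta> < 1 \<and> (\<forall>n w g k. n \<ge> 1 \<longrightarrow> w \<in> words \<alpha> n \<longrightarrow> g \<in> unit_funs M \<longrightarrow>
    \<bar>(LINT x:cyl M T w|M. g ((T ^^ (n + 2 * k\<^sup>2)) x)) - measure M (cyl M T w) * (\<integral>x. g x \<partial>M)\<bar>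
      \<le> C * \<theta> ^ k * measure M (cyl M T w))"

definition C :: real where "C = (SOME C. \<exists>\<theta>. mixing_rate C \<theta>)"
definition \<theta> :: real where "\<theta> = (SOME \<theta>. mixing_rate C \<theta>)"

lemma mixing_rate: "mixing_rate C \<theta>"
proof -
  have "\<exists>C \<theta>. mixing_rate C \<theta>" using uniform_mixing unfolding mixing_rate_def .
  then have "\<exists>\<theta>. mixing_rate C \<theta>" unfolding C_def by (rule someI_ex)
  then show ?thesis unfolding \<theta>_def by (rule someI_ex)
qed

lemma C_\<theta>: "0 \<le> C" "0 < \<theta>" "\<theta> < 1"
  using mixing_rate by (auto simp: mixing_rate_def)

text \<open>The factor 4 pays for the passage from values in [0,1] to complex values of modulus at
  most 1: an affine change doubles the error, and the errors of real and imaginary part add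
  up.\<close>

definition rate :: "nat \<Rightarrow> real" where "rate k = 4 * C * \<theta> ^ k"

lemma rate_nonneg: "0 \<le> rate k"
  using C_\<theta> by (simp add: rate_def)

lemma cyl_mixing_unit:
  assumes "n \<ge> 1" "w \<in> words \<alpha> n" "g \<in> unit_funs M"
  shows "\<bar>(LINT x:cyl M T w|M. g ((T ^^ (n + 2 * k\<^sup>2)) x)) - measure M (cyl M T w) * (\<integral>x. g x \<partial>M)\<bar>
    \<le> rate k / 4 * measure M (cyl M T w)"
  using mixing_rate assms by (simp add: mixing_rate_def rate_def)

lemma cyl_mixing_real:
  fixes G :: "'a \<Rightarrow> real"
  assumes n: "n \<ge> 1" and w: "w \<in> words \<alpha> n" and G: "G \<in> borel_measurable M" "\<And>x. \<bar>G x\<bar> \<le> 1"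
  shows "\<bar>(LINT x:cyl M T w|M. G ((T ^^ (n + 2 * k\<^sup>2)) x)) - measure M (cyl M T w) * (\<integral>x. G x \<partial>M)\<bar>
    \<le> rate k / 2 * measure M (cyl M T w)"
proof -
  let ?h = "\<lambda>x. (1 + G x) / 2" and ?A = "cyl M T w" and ?N = "n + 2 * k\<^sup>2"
  have A: "?A \<in> sets M" using cyl_meas[OF w] .
  have "0 \<le> ?h x \<and> ?h x \<le> 1" for x using G(2)[of x] by (simp add: abs_le_iff)
  then have h: "?h \<in> unit_funs M" using G(1) by (simp add: unit_funs_def)
  have Geq: "G = (\<lambda>x. 2 * ?h x - 1)" by (auto simp: field_simps)
  have sh: "set_integrable M ?A (\<lambda>x. 2 * ?h ((T ^^ ?N) x))"
    using set_integrable_unit_fun[OF unit_funs_Tn[OF h] A] by (intro set_integrable_mult_right)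
  have iG: "integrable M G" by (rule integrable_const_bound[of _ 1]) (use G in auto)
  have ih: "integrable M ?h" using unit_funs_integrable[OF h] .
  have 1: "(LINT x:?A|M. G ((T ^^ ?N) x)) = 2 * (LINT x:?A|M. ?h ((T ^^ ?N) x)) - measure M ?A"
  proof -
    have "(LINT x:?A|M. G ((T ^^ ?N) x)) = (LINT x:?A|M. 2 * ?h ((T ^^ ?N) x) - 1)"
      by (subst Geq) simp
    also have "\<dots> = (LINT x:?A|M. 2 * ?h ((T ^^ ?N) x)) - (LINT x:?A|M. 1)"
      by (rule set_integral_diff(2)[OF sh set_integrable_const[OF A]])
    also have "(LINT x:?A|M. 1) = measure M ?A" using A by (simp add: set_lebesgue_integral_def)
    also have "(LINT x:?A|M. 2 * ?h ((T ^^ ?N) x)) = 2 * (LINT x:?A|M. ?h ((T ^^ ?N) x))"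
      by (rule set_integral_mult_right)
    finally show ?thesis .
  qed
  have 2: "(\<integral>x. G x \<partial>M) = 2 * (\<integral>x. ?h x \<partial>M) - 1"
    using iG by (simp add: prob_space add_divide_distrib)
  have "(LINT x:?A|M. G ((T ^^ ?N) x)) - measure M ?A * (\<integral>x. G x \<partial>M)
    = 2 * ((LINT x:?A|M. ?h ((T ^^ ?N) x)) - measure M ?A * (\<integral>x. ?h x \<partial>M))"
    unfolding 1 2 by (simp add: algebra_simps)
  then have "\<bar>(LINT x:?A|M. G ((T ^^ ?N) x)) - measure M ?A * (\<integral>x. G x \<partial>M)\<bar>
    = 2 * \<bar>(LINT x:?A|M. ?h ((T ^^ ?N) x)) - measure M ?A * (\<integral>x. ?h x \<partial>M)\<bar>"
    by (simp only: abs_mult abs_numeral)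
  also have "\<dots> \<le> 2 * (rate k / 4 * measure M ?A)"
    by (rule mult_left_mono[OF cyl_mixing_unit[OF n w h]]) simp
  finally show ?thesis by simp
qed

lemma cyl_mixing_complex:
  fixes G :: "'a \<Rightarrow> complex"
  assumes n: "n \<ge> 1" and w: "w \<in> words \<alpha> n" and G: "G \<in> borel_measurable M" "\<And>x. norm (G x) \<le> 1"
  shows "norm ((LINT x:cyl M T w|M. G ((T ^^ (n + 2 * k\<^sup>2)) x)) - measure M (cyl M T w) * (\<integral>x. G x \<partial>M))
    \<le> rate k * measure M (cyl M T w)"
proof -
  let ?A = "cyl M T w" and ?N = "n + 2 * k\<^sup>2"
  have A: "?A \<in> sets M" using cyl_meas[OF w] .
  let ?z = "(LINT x:?A|M. G ((T ^^ ?N) x)) - measure M ?A * (\<integral>x. G x \<partial>M)"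
  have iG: "integrable M G" by (rule integrable_const_bound[of _ 1]) (use G in auto)
  have GT: "(\<lambda>x. G ((T ^^ ?N) x)) \<in> borel_measurable M" using measurable_compose[OF Tn_meas G(1)] .
  have iGT: "integrable M (\<lambda>x. G ((T ^^ ?N) x))"
    by (rule integrable_const_bound[of _ 1]) (use GT G(2) in auto)
  have iS: "integrable M (\<lambda>x. indicat_real ?A x *\<^sub>R G ((T ^^ ?N) x))"
    by (rule integrable_mult_indicator[OF A iGT])
  have bR: "(\<lambda>x. Re (G x)) \<in> borel_measurable M" "\<bar>Re (G x)\<bar> \<le> 1" for x
    using G abs_Re_le_cmod[of "G x"] order_trans by (auto intro: order_trans[OF abs_Re_le_cmod])
  have bI: "(\<lambda>x. Im (G x)) \<in> borel_measurable M" "\<bar>Im (G x)\<bar> \<le> 1" for x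
    using G abs_Im_le_cmod[of "G x"] by (auto intro: order_trans[OF abs_Im_le_cmod])
  have "Re ?z = (LINT x:?A|M. Re (G ((T ^^ ?N) x))) - measure M ?A * (\<integral>x. Re (G x) \<partial>M)"
    unfolding set_lebesgue_integral_def using integral_Re[OF iS] integral_Re[OF iG] by simp
  then have R: "\<bar>Re ?z\<bar> \<le> rate k / 2 * measure M ?A"
    using cyl_mixing_real[OF n w bR(1) bR(2)] by simp
  have "Im ?z = (LINT x:?A|M. Im (G ((T ^^ ?N) x))) - measure M ?A * (\<integral>x. Im (G x) \<partial>M)"
    unfolding set_lebesgue_integral_def using integral_Im[OF iS] integral_Im[OF iG] by simp
  then have I: "\<bar>Im ?z\<bar> \<le> rate k / 2 * measure M ?A"
    using cyl_mixing_real[OF n w bI(1) bI(2)] by simp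
  have "norm ?z \<le> \<bar>Re ?z\<bar> + \<bar>Im ?z\<bar>" by (rule cmod_le)
  then show ?thesis using R I by linarith
qed

text \<open>Up to \<eta>, f depends only on the first n letters. One null set serves all words, so
  that cylinders can be treated separately with a common exceptional set.\<close>

definition osc :: "nat \<Rightarrow> real \<Rightarrow> ('a \<Rightarrow> 'b::real_normed_vector) \<Rightarrow> bool" where
  "osc n \<eta> f \<longleftrightarrow> f \<in> borel_measurable M \<and>
     (\<exists>N\<in>null_sets M. \<forall>w\<in>words \<alpha> n. \<forall>x\<in>cyl M T w - N. \<forall>y\<in>cyl M T w - N. norm (f x - f y) \<le> \<eta>)"

lemma oscD: "osc n \<eta> f \<Longrightarrow> f \<in> borel_measurable M" by (simp add: osc_def)

lemma oscE:
  assumes "osc n \<eta> f"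
  obtains N where "N \<in> null_sets M"
    "\<And>w x y. w \<in> words \<alpha> n \<Longrightarrow> x \<in> cyl M T w - N \<Longrightarrow> y \<in> cyl M T w - N \<Longrightarrow> norm (f x - f y) \<le> \<eta>"
  using assms unfolding osc_def by blast

lemma oscI:
  assumes "f \<in> borel_measurable M" "N \<in> null_sets M"
    "\<And>w x y. w \<in> words \<alpha> n \<Longrightarrow> x \<in> cyl M T w - N \<Longrightarrow> y \<in> cyl M T w - N \<Longrightarrow> norm (f x - f y) \<le> \<eta>"
  shows "osc n \<eta> f"
  using assms unfolding osc_def by blast

lemma cyl_take: "cyl M T w \<subseteq> cyl M T (take n w)"
  by (auto simp: cyl_def)

lemma osc_mono:
  assumes f: "osc n \<eta> f" and "n \<le> n'" "\<eta> \<le> \<eta>'"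
  shows "osc n' \<eta>' f"
proof -
  obtain N where N: "N \<in> null_sets M"
    "\<And>w x y. w \<in> words \<alpha> n \<Longrightarrow> x \<in> cyl M T w - N \<Longrightarrow> y \<in> cyl M T w - N \<Longrightarrow> norm (f x - f y) \<le> \<eta>"
    by (rule oscE[OF f], rule that)
  show ?thesis
  proof (rule oscI[OF oscD[OF f] N(1)])
    fix w x y assume w: "w \<in> words \<alpha> n'" and xy: "x \<in> cyl M T w - N" "y \<in> cyl M T w - N"
    have "take n w \<in> words \<alpha> n" using w assms(2) set_take_subset[of n w] by (auto simp: words_def)
    then have "norm (f x - f y) \<le> \<eta>" using N(2) xy cyl_take[of w n] by blast
    then show "norm (f x - f y) \<le> \<eta>'" using assms(3) by simp
  qed
qed

lemma osc_shift:
  assumes f: "osc n \<eta> f"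
  shows "osc (j + n) \<eta> (\<lambda>x. f ((T ^^ j) x))"
proof -
  obtain N where N: "N \<in> null_sets M"
    "\<And>w x y. w \<in> words \<alpha> n \<Longrightarrow> x \<in> cyl M T w - N \<Longrightarrow> y \<in> cyl M T w - N \<Longrightarrow> norm (f x - f y) \<le> \<eta>"
    by (rule oscE[OF f], rule that)
  have "AE x in M. (T ^^ j) x \<notin> N" by (rule AE_Tn[OF AE_not_in[OF N(1)]])
  then obtain N' where N': "N' \<in> null_sets M" "{x\<in>space M. \<not> (T ^^ j) x \<notin> N} \<subseteq> N'"
    by (rule AE_null_cover)
  show ?thesis
  proof (rule oscI[OF measurable_compose[OF Tn_meas oscD[OF f]] N'(1)])
    fix w x y assume w: "w \<in> words \<alpha> (j + n)" and xy: "x \<in> cyl M T w - N'" "y \<in> cyl M T w - N'"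
    define u v where "u = take j w" and "v = drop j w"
    have uv: "w = u @ v" "length u = j" "v \<in> words \<alpha> n"
      using w set_drop_subset[of j w] by (auto simp: words_def u_def v_def)
    have "x \<in> space M" "y \<in> space M" using xy by (auto simp: cyl_def)
    then have "(T ^^ j) x \<in> cyl M T v - N" "(T ^^ j) y \<in> cyl M T v - N"
      using xy N'(2) unfolding uv(1) cyl_append[OF T_meas] uv(2) by blast+
    then show "norm (f ((T ^^ j) x) - f ((T ^^ j) y)) \<le> \<eta>" using N(2) uv(3) by blast
  qed
qed

lemma osc_lipschitz:
  assumes f: "osc n \<eta> f" and G: "(\<lambda>x. G (f x)) \<in> borel_measurable M"
    and lip: "\<And>a b. norm (G a - G b) \<le> L * norm (a - b)" and L: "L \<ge> 0"
  shows "osc n (L * \<eta>) (\<lambda>x. G (f x))"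
proof -
  obtain N where N: "N \<in> null_sets M"
    "\<And>w x y. w \<in> words \<alpha> n \<Longrightarrow> x \<in> cyl M T w - N \<Longrightarrow> y \<in> cyl M T w - N \<Longrightarrow> norm (f x - f y) \<le> \<eta>"
    by (rule oscE[OF f], rule that)
  show ?thesis
  proof (rule oscI[OF G N(1)])
    fix w x y assume "w \<in> words \<alpha> n" "x \<in> cyl M T w - N" "y \<in> cyl M T w - N"
    from N(2)[OF this] have "L * norm (f x - f y) \<le> L * \<eta>" using L by (rule mult_left_mono)
    then show "norm (G (f x) - G (f y)) \<le> L * \<eta>" using lip[of "f x" "f y"] by linarith
  qed
qed

lemma osc_add:
  assumes f: "osc n a f" and g: "osc n b g"
    and m: "(\<lambda>x. f x + g x) \<in> borel_measurable M"
  shows "osc n (a + b) (\<lambda>x. f x + g x)"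
proof -
  obtain N where N: "N \<in> null_sets M"
    "\<And>w x y. w \<in> words \<alpha> n \<Longrightarrow> x \<in> cyl M T w - N \<Longrightarrow> y \<in> cyl M T w - N \<Longrightarrow> norm (f x - f y) \<le> a"
    by (rule oscE[OF f], rule that)
  obtain N' where N': "N' \<in> null_sets M"
    "\<And>w x y. w \<in> words \<alpha> n \<Longrightarrow> x \<in> cyl M T w - N' \<Longrightarrow> y \<in> cyl M T w - N' \<Longrightarrow> norm (g x - g y) \<le> b"
    by (rule oscE[OF g], rule that)
  show ?thesis
  proof (rule oscI[OF m null_sets.Un[OF N(1) N'(1)]])
    fix w x y assume w: "w \<in> words \<alpha> n" and x: "x \<in> cyl M T w - (N \<union> N')" and y: "y \<in> cyl M T w - (N \<union> N')"
    have "norm (f x - f y) \<le> a" "norm (g x - g y) \<le> b" using N(2)[OF w] N'(2)[OF w] x y by auto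
    then show "norm (f x + g x - (f y + g y)) \<le> a + b" using norm_diff_triangle_ineq[of "f x" "g x" "f y" "g y"] by linarith
  qed
qed

lemma osc_sum:
  fixes f :: "'i \<Rightarrow> 'a \<Rightarrow> real"
  assumes "finite I" "\<And>i. i \<in> I \<Longrightarrow> osc n \<eta> (f i)"
  shows "osc n (real (card I) * \<eta>) (\<lambda>x. \<Sum>i\<in>I. f i x)"
  using assms
proof (induction I)
  case empty
  show ?case by (rule oscI[of _ "{}"]) auto
next
  case (insert i I)
  have "osc n (\<eta> + real (card I) * \<eta>) (\<lambda>x. f i x + (\<Sum>i\<in>I. f i x))"
    using insert oscD by (intro osc_add borel_measurable_add) blast+
  then show ?case using insert by (simp add: algebra_simps)
qed

text \<open>On each cylinder F is replaced by one of its values at relative cost 2 \<eta>, since the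
  centred G is bounded by 2. What is left is the mixing of a cylinder with a bounded measurable
  function.\<close>

lemma decorrelation:
  fixes F G :: "'a \<Rightarrow> complex"
  assumes F: "osc n \<eta> F" "\<And>x. norm (F x) \<le> 1" and n: "n \<ge> 1"
    and G: "G \<in> borel_measurable M" "\<And>x. norm (G x) \<le> 1"
  shows "norm ((\<integral>x. F x * G ((T ^^ (n + 2 * k\<^sup>2)) x) \<partial>M) - (\<integral>x. F x \<partial>M) * (\<integral>x. G x \<partial>M)) \<le> 2 * \<eta> + rate k"
proof -
  let ?N = "n + 2 * k\<^sup>2" let ?m = "\<integral>x. G x \<partial>M"
  let ?G = "\<lambda>x. G ((T ^^ ?N) x)"
  let ?f = "\<lambda>x. F x * (?G x - ?m)"
  have Fm: "F \<in> borel_measurable M" using oscD[OF F(1)] .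
  have Gm: "?G \<in> borel_measurable M" using measurable_compose[OF Tn_meas G(1)] .
  have iG: "integrable M ?G" by (rule integrable_const_bound[of _ 1]) (use Gm G(2) in auto)
  have iF: "integrable M F" by (rule integrable_const_bound[of _ 1]) (use Fm F(2) in auto)
  have m1: "norm ?m \<le> 1"
  proof -
    have "norm ?m \<le> (\<integral>x. norm (G x) \<partial>M)" by (rule integral_norm_bound)
    also have "\<dots> \<le> (\<integral>x. 1 \<partial>M)"
      by (rule integral_mono[OF integrable_norm[OF integrable_const_bound[of _ 1]]]) (use G in auto)
    finally show ?thesis by (simp add: prob_space)
  qed
  have Gm2: "norm (?G x - ?m) \<le> 2" for x
    using norm_triangle_ineq4[of "?G x" ?m] G(2)[of "(T ^^ ?N) x"] m1 by linarith
  have iFG: "integrable M (\<lambda>x. F x * ?G x)"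
    by (rule integrable_const_bound[of _ 1])
      (use Fm Gm F(2) G(2) in \<open>auto simp: norm_mult intro!: mult_le_one\<close>)
  have iff: "integrable M ?f"
  proof -
    have "?f = (\<lambda>x. F x * ?G x - F x * ?m)" by (auto simp: algebra_simps)
    then show ?thesis using iFG iF by simp
  qed
  obtain N where N: "N \<in> null_sets M"
    "\<And>w x y. w \<in> words \<alpha> n \<Longrightarrow> x \<in> cyl M T w - N \<Longrightarrow> y \<in> cyl M T w - N \<Longrightarrow> norm (F x - F y) \<le> \<eta>"
    by (rule oscE[OF F(1)], rule that)
  have "norm (\<integral>x. ?f x \<partial>M) \<le> (\<integral>x. 2 * \<eta> + rate k \<partial>M)"
  proof (rule piecewise_integral_bound[OF countable_pwords cyl_meas[OF pwordsD(1)] pwords_AE[of n] iff])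
    fix w assume w: "w \<in> pwords n"
    let ?A = "cyl M T w"
    have A: "?A \<in> sets M" using cyl_meas[OF pwordsD(1)[OF w]] .
    \<comment> \<open>A cylinder of positive measure contains a point outside the exceptional set,
      at which F is sampled.\<close>
    have "\<not> ?A \<subseteq> N"
    proof
      assume "?A \<subseteq> N"
      then have "?A \<in> null_sets M" using null_sets_subset[OF N(1) A] by blast
      then show False using pwordsD(2)[OF w] by (simp add: measure_eq_0_null_sets)
    qed
    then obtain z where z: "z \<in> ?A - N" by blast
    have i1: "integrable M (\<lambda>x. indicat_real ?A x *\<^sub>R ((F x - F z) * (?G x - ?m)))"
    proof -
      have "(\<lambda>x. (F x - F z) * (?G x - ?m)) = (\<lambda>x. ?f x - F z * (?G x - ?m))" by (auto simp: algebra_simps)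
      then have "integrable M (\<lambda>x. (F x - F z) * (?G x - ?m))" using iff iG by simp
      then show ?thesis by (rule integrable_mult_indicator[OF A])
    qed
    have i2: "integrable M (\<lambda>x. indicat_real ?A x *\<^sub>R (?G x - ?m))"
      by (rule integrable_mult_indicator[OF A]) (use iG in simp)
    have i3: "integrable M (\<lambda>x. indicat_real ?A x *\<^sub>R ?G x)"
      by (rule integrable_mult_indicator[OF A iG])
    have i4: "integrable M (\<lambda>x. indicat_real ?A x *\<^sub>R ?m)"
      by (rule integrable_mult_indicator[OF A]) simp
    have "(LINT x:?A|M. ?f x) =
      (\<integral>x. indicat_real ?A x *\<^sub>R ((F x - F z) * (?G x - ?m)) + F z * (indicat_real ?A x *\<^sub>R (?G x - ?m)) \<partial>M)"
      unfolding set_lebesgue_integral_def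
      by (rule Bochner_Integration.integral_cong) (auto simp: algebra_simps scaleR_conv_of_real)
    also have "\<dots> = (\<integral>x. indicat_real ?A x *\<^sub>R ((F x - F z) * (?G x - ?m)) \<partial>M)
      + F z * (\<integral>x. indicat_real ?A x *\<^sub>R (?G x - ?m) \<partial>M)"
      by (simp only: Bochner_Integration.integral_add[OF i1 integrable_mult_right[OF i2]] integral_mult_right_zero)
    also have "(\<integral>x. indicat_real ?A x *\<^sub>R (?G x - ?m) \<partial>M) = (LINT x:?A|M. ?G x) - measure M ?A * ?m"
      unfolding set_lebesgue_integral_def scaleR_diff_right Bochner_Integration.integral_diff[OF i3 i4]
      using A by (simp add: scaleR_conv_of_real)
    finally have eq: "(LINT x:?A|M. ?f x) = (\<integral>x. indicat_real ?A x *\<^sub>R ((F x - F z) * (?G x - ?m)) \<partial>M)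
      + F z * ((LINT x:?A|M. ?G x) - measure M ?A * ?m)" .
    have iA: "integrable M (\<lambda>x. indicat_real ?A x * (2 * \<eta>))"
      using A by (intro integrable_mult_left) (auto simp: emeasure_eq_measure)
    have "norm (\<integral>x. indicat_real ?A x *\<^sub>R ((F x - F z) * (?G x - ?m)) \<partial>M)
      \<le> (\<integral>x. norm (indicat_real ?A x *\<^sub>R ((F x - F z) * (?G x - ?m))) \<partial>M)"
      by (rule integral_norm_bound)
    also have "\<dots> \<le> (\<integral>x. indicat_real ?A x * (2 * \<eta>) \<partial>M)"
    proof (rule integral_mono_AE[OF integrable_norm[OF i1] iA])
      show "AE x in M. norm (indicat_real ?A x *\<^sub>R ((F x - F z) * (?G x - ?m))) \<le> indicat_real ?A x * (2 * \<eta>)"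
        using AE_not_in[OF N(1)]
      proof eventually_elim
        case (elim x)
        show ?case
        proof (cases "x \<in> ?A")
          case True
          then have le: "norm (F x - F z) \<le> \<eta>" using N(2)[OF pwordsD(1)[OF w]] elim z by blast
          have "norm (F x - F z) * norm (?G x - ?m) \<le> \<eta> * 2"
            using le Gm2 order_trans[OF norm_ge_zero le] by (intro mult_mono) auto
          then show ?thesis using True by (simp add: norm_mult)
        qed simp
      qed
    qed
    also have "\<dots> = 2 * \<eta> * measure M ?A" using A by simp
    finally have a: "norm (\<integral>x. indicat_real ?A x *\<^sub>R ((F x - F z) * (?G x - ?m)) \<partial>M) \<le> 2 * \<eta> * measure M ?A" .
    have "norm (F z * ((LINT x:?A|M. ?G x) - measure M ?A * ?m)) \<le> 1 * (rate k * measure M ?A)"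
      unfolding norm_mult
      using F(2) cyl_mixing_complex[OF n pwordsD(1)[OF w] G] by (intro mult_mono) auto
    then have "norm (LINT x:?A|M. ?f x) \<le> (2 * \<eta> + rate k) * measure M ?A"
      unfolding eq using a norm_triangle_ineq[of "\<integral>x. indicat_real ?A x *\<^sub>R ((F x - F z) * (?G x - ?m)) \<partial>M" "F z * ((LINT x:?A|M. ?G x) - measure M ?A * ?m)"]
      by (simp only: distrib_right)
    also have "\<dots> = (LINT x:?A|M. 2 * \<eta> + rate k)" using A by (simp add: set_lebesgue_integral_def)
    finally show "norm (LINT x:?A|M. ?f x) \<le> (LINT x:?A|M. 2 * \<eta> + rate k)" .
  qed (assumption, rule integrable_const)
  moreover have "(\<integral>x. ?f x \<partial>M) = (\<integral>x. F x * ?G x \<partial>M) - (\<integral>x. F x \<partial>M) * ?m"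
  proof -
    have "(\<integral>x. ?f x \<partial>M) = (\<integral>x. F x * ?G x - F x * ?m \<partial>M)" by (simp add: algebra_simps)
    then show ?thesis using iFG iF by simp
  qed
  ultimately show ?thesis by (simp add: prob_space)
qed

lemma covariance_decay:
  fixes f g :: "'a \<Rightarrow> real"
  assumes f: "osc k \<eta> f" "\<And>x. \<bar>f x\<bar> \<le> 1" and k: "k \<ge> 1"
    and g: "g \<in> borel_measurable M" "\<And>x. \<bar>g x\<bar> \<le> 1" and g0: "(\<integral>x. g x \<partial>M) = 0"
    and ij: "i + (k + 2 * k\<^sup>2) \<le> j"
  shows "\<bar>\<integral>x. f ((T ^^ i) x) * g ((T ^^ j) x) \<partial>M\<bar> \<le> 2 * \<eta> + rate k"
proof -
  \<comment> \<open>Time beyond the required gap is absorbed into the second function by composing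
    it with an iterate.\<close>
  obtain l where l: "j = i + k + 2 * k\<^sup>2 + l" using ij le_Suc_ex[OF ij] by auto
  have Tj: "(T ^^ j) x = (T ^^ l) ((T ^^ (i + k + 2 * k\<^sup>2)) x)" for x unfolding l by (rule funpow_add_apply)
  let ?F = "\<lambda>x. complex_of_real (f ((T ^^ i) x))" and ?G = "\<lambda>x. complex_of_real (g ((T ^^ l) x))"
  have fi: "osc (i + k) \<eta> (\<lambda>x. f ((T ^^ i) x))" by (rule osc_shift[OF f(1)])
  have F: "osc (i + k) \<eta> ?F"
    using osc_lipschitz[OF fi, of complex_of_real 1] oscD[OF fi] by (simp add: of_real_diff[symmetric] del: of_real_diff)
  have Gm: "(\<lambda>x. g ((T ^^ l) x)) \<in> borel_measurable M" by (rule measurable_compose[OF Tn_meas g(1)])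
  have "norm ((\<integral>x. ?F x * ?G ((T ^^ (i + k + 2 * k\<^sup>2)) x) \<partial>M) - (\<integral>x. ?F x \<partial>M) * (\<integral>x. ?G x \<partial>M)) \<le> 2 * \<eta> + rate k"
    by (rule decorrelation[OF F]) (use f(2) g(2) k Gm in auto)
  moreover have "(\<integral>x. ?G x \<partial>M) = 0"
    using integral_Tn[OF g(1), of l] g0 by (simp add: integral_complex_of_real)
  moreover have "(\<integral>x. ?F x * ?G ((T ^^ (i + k + 2 * k\<^sup>2)) x) \<partial>M) = complex_of_real (\<integral>x. f ((T ^^ i) x) * g ((T ^^ j) x) \<partial>M)"
    unfolding Tj integral_complex_of_real[symmetric] by simp
  ultimately show ?thesis by simp
qed

end

section \<open>One row of the triangular array and its second moments\<close>

locale bounded_array = mixing_gibbs_markov +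
  fixes h :: "nat \<Rightarrow> 'a \<Rightarrow> real" and k :: nat and \<eta> :: real
  assumes h_osc: "\<And>j. osc k \<eta> (h j)" and h_bound: "\<And>j x. \<bar>h j x\<bar> \<le> 1"
    and h_mean: "\<And>j. (\<integral>x. h j x \<partial>M) = 0" and k: "k \<ge> 1" and \<eta>: "\<eta> \<ge> 0"
begin

text \<open>The distance at which two summands decorrelate: k letters that a summand looks ahead,
  followed by 2 k^2 steps of mixing. The price of one such separation is
  \<open>\<tau>\<close>.\<close>

definition q :: nat where "q = k + 2 * k\<^sup>2"
definition \<tau> :: real where "\<tau> = 2 * \<eta> + rate k"
definition S :: "nat set \<Rightarrow> 'a \<Rightarrow> real" where "S I x = (\<Sum>j\<in>I. h j ((T ^^ j) x))"

lemma q_pos: "q \<ge> 1" using k by (simp add: q_def)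
lemma \<tau>_nonneg: "\<tau> \<ge> 0" using \<eta> rate_nonneg by (simp add: \<tau>_def)

lemma hT_meas[measurable]: "(\<lambda>x. h j ((T ^^ i) x)) \<in> borel_measurable M"
  by (rule measurable_compose[OF Tn_meas oscD[OF h_osc]])

lemma S_meas[measurable]: "S I \<in> borel_measurable M"
  unfolding S_def[abs_def] by measurable

lemma S_bound: "\<bar>S I x\<bar> \<le> card I"
proof -
  have "\<bar>S I x\<bar> \<le> (\<Sum>j\<in>I. \<bar>h j ((T ^^ j) x)\<bar>)" unfolding S_def by (rule sum_abs)
  also have "\<dots> \<le> (\<Sum>j\<in>I. 1)" by (intro sum_mono h_bound)
  finally show ?thesis by simp
qed

lemma S_integrable: "integrable M (S I)"
  by (rule integrable_const_bound[of _ "card I"]) (use S_bound in auto)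

lemma SS_integrable: "integrable M (\<lambda>x. S I x * S J x)"
  by (rule integrable_const_bound[of _ "real (card I) * real (card J)"])
    (use S_bound in \<open>auto simp: abs_mult intro!: AE_I2 mult_mono\<close>)

lemma S_mean: "(\<integral>x. S I x \<partial>M) = 0"
proof -
  have "integrable M (\<lambda>x. h j ((T ^^ j) x))" for j
    by (rule integrable_const_bound[of _ 1]) (use h_bound in auto)
  then have "(\<integral>x. S I x \<partial>M) = (\<Sum>j\<in>I. \<integral>x. h j ((T ^^ j) x) \<partial>M)" unfolding S_def by simp
  then show ?thesis using integral_Tn[OF oscD[OF h_osc]] h_mean by simp
qed

lemma cov_near: "\<bar>\<integral>x. h i ((T ^^ i) x) * h j ((T ^^ j) x) \<partial>M\<bar> \<le> 1"
proof -
  have "\<bar>\<integral>x. h i ((T ^^ i) x) * h j ((T ^^ j) x) \<partial>M\<bar> \<le> (\<integral>x. \<bar>h i ((T ^^ i) x) * h j ((T ^^ j) x)\<bar> \<partial>M)"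
    by (rule integral_abs_bound)
  also have "\<dots> \<le> (\<integral>x. 1 \<partial>M)"
  proof (rule integral_mono)
    show b: "\<bar>h i ((T ^^ i) x) * h j ((T ^^ j) x)\<bar> \<le> 1" for x
      unfolding abs_mult by (intro mult_le_one h_bound) auto
    show "integrable M (\<lambda>x. \<bar>h i ((T ^^ i) x) * h j ((T ^^ j) x)\<bar>)"
      by (rule integrable_const_bound[of _ 1]) (use b in auto)
  qed simp
  finally show ?thesis by (simp add: prob_space)
qed

lemma cov_far:
  assumes "i + q \<le> j \<or> j + q \<le> i"
  shows "\<bar>\<integral>x. h i ((T ^^ i) x) * h j ((T ^^ j) x) \<partial>M\<bar> \<le> \<tau>"
  using assms
proof
  assume "i + q \<le> j"
  then show ?thesis unfolding \<tau>_def q_def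
    by (intro covariance_decay[OF h_osc h_bound k oscD[OF h_osc] h_bound h_mean])
next
  assume "j + q \<le> i"
  then have "\<bar>\<integral>x. h j ((T ^^ j) x) * h i ((T ^^ i) x) \<partial>M\<bar> \<le> \<tau>" unfolding \<tau>_def q_def
    by (intro covariance_decay[OF h_osc h_bound k oscD[OF h_osc] h_bound h_mean])
  then show ?thesis by (simp add: mult.commute)
qed

lemma S_cov: "(\<integral>x. S I x * S J x \<partial>M) = (\<Sum>i\<in>I. \<Sum>j\<in>J. \<integral>x. h i ((T ^^ i) x) * h j ((T ^^ j) x) \<partial>M)"
proof -
  have i: "integrable M (\<lambda>x. h i ((T ^^ i) x) * h j ((T ^^ j) x))" for i j
    by (rule integrable_const_bound[of _ 1]) (use h_bound in \<open>auto simp: abs_mult intro!: mult_le_one\<close>)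
  show ?thesis unfolding S_def sum_product using i by (simp add: Bochner_Integration.integral_sum)
qed

lemma S_second_moment:
  assumes "finite I"
  shows "(\<integral>x. (S I x)\<^sup>2 \<partial>M) \<le> real (card I) * (2 * real q) + (real (card I))\<^sup>2 * \<tau>"
proof -
  let ?c = "\<lambda>i j. \<integral>x. h i ((T ^^ i) x) * h j ((T ^^ j) x) \<partial>M"
  have "(\<Sum>i\<in>I. \<Sum>j\<in>I. ?c i j) \<le> real (card I) * (2 * real q) + real (card I) * real (card I) * \<tau>"
  proof (rule near_diagonal_sum[OF assms assms])
    show "?c i j \<le> 1" for i j using cov_near[of i j] by (simp only: abs_le_iff)
    show "?c i j \<le> \<tau>" if "i + q \<le> j \<or> j + q \<le> i" for i j
      using cov_far[OF that] by (simp only: abs_le_iff)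
  qed (rule \<tau>_nonneg)
  then show ?thesis using S_cov[of I I] by (simp add: power2_eq_square)
qed

end

section \<open>Block decomposition\<close>

lemma double_sum_abs_le: "\<bar>\<Sum>i\<in>I. \<Sum>j\<in>J. c i j\<bar> \<le> (\<Sum>i\<in>I. \<Sum>j\<in>J. \<bar>c i j :: real\<bar>)"
  using sum_abs[of "\<lambda>i. \<Sum>j\<in>J. c i j" I] sum_mono[of I "\<lambda>i. \<bar>\<Sum>j\<in>J. c i j\<bar>", OF sum_abs]
  by (rule order_trans)

lemma (in prob_space) square_mean_le:
  fixes X :: "'a \<Rightarrow> real"
  assumes "integrable M X" "integrable M (\<lambda>x. (X x)\<^sup>2)"
  shows "(\<integral>x. \<bar>X x\<bar> \<partial>M) \<le> sqrt (\<integral>x. (X x)\<^sup>2 \<partial>M)"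
proof -
  have "0 \<le> variance (\<lambda>x. \<bar>X x\<bar>)" by (rule variance_positive)
  also have "variance (\<lambda>x. \<bar>X x\<bar>) = (\<integral>x. \<bar>X x\<bar>\<^sup>2 \<partial>M) - (\<integral>x. \<bar>X x\<bar> \<partial>M)\<^sup>2"
    by (rule variance_eq) (use assms in auto)
  finally have "(\<integral>x. \<bar>X x\<bar> \<partial>M)\<^sup>2 \<le> (\<integral>x. (X x)\<^sup>2 \<partial>M)" by simp
  then show ?thesis by (rule real_le_rsqrt)
qed

lemma norm_iexp_diff: "norm (iexp a - iexp b) \<le> \<bar>a - b\<bar>"
proof -
  have "iexp a - iexp b = iexp b * (iexp (a - b) - 1)"
    by (simp add: algebra_simps exp_add[symmetric])
  then have "norm (iexp a - iexp b) = norm (iexp (a - b) - 1)" by (simp add: norm_mult)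
  also have "\<dots> \<le> \<bar>a - b\<bar>"
    using iexp_approx1[of "a - b" 0] by simp
  finally show ?thesis .
qed

lemma exp_minus_quadratic_bound:
  fixes x :: real
  assumes "0 \<le> x"
  shows "\<bar>1 - x - exp (- x)\<bar> \<le> x\<^sup>2 / 2"
proof -
  have 1: "1 - x \<le> exp (- x)" using exp_ge_add_one_self[of "-x"] by simp
  have "exp (- x) \<le> 1 - x + x\<^sup>2 / 2"
  proof -
    have "((\<lambda>y. 1 - y + y\<^sup>2 / 2 - exp (- y)) has_real_derivative (- 1 + y + exp (- y))) (at y)" for y :: real
      by (auto intro!: derivative_eq_intros)
    moreover have "0 \<le> - 1 + y + exp (- y)" for y :: real using exp_ge_add_one_self[of "- y"] by simp
    ultimately have "1 - 0 + 0\<^sup>2 / 2 - exp (- 0) \<le> 1 - x + x\<^sup>2 / 2 - exp (- x)"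
      by (intro DERIV_nonneg_imp_nondecreasing[OF assms]) blast
    then show ?thesis by simp
  qed
  with 1 show ?thesis by simp
qed

section \<open>Characteristic functions of blocks\<close>

context bounded_array
begin

lemma iexp_integrable: "f \<in> borel_measurable M \<Longrightarrow> integrable M (\<lambda>x. iexp (f x))"
  by (rule integrable_const_bound[of _ 1]) auto

text \<open>The error carries the factor v, so that summing over the blocks reproduces the total
  variance. This uses that the block sum is bounded by its number of terms p: its third absolute
  moment is at most p v, and v^2 \<le> p^2 v in the comparison of 1 - x with the
  exponential.\<close>

lemma char_single_block:
  fixes u :: real and I :: "nat set"
  defines "v \<equiv> (\<integral>x. (S I x)\<^sup>2 \<partial>M)"
  shows "norm ((\<integral>x. iexp (u * S I x) \<partial>M) - exp (- (u\<^sup>2 * v / 2)))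
    \<le> (\<bar>u\<bar> ^ 3 * card I + u ^ 4 * (real (card I))\<^sup>2) * v"
proof -
  let ?p = "real (card I)"
  have i2: "integrable M (\<lambda>x. (S I x)\<^sup>2)" using SS_integrable[of I I] by (simp add: power2_eq_square)
  have v0: "v \<ge> 0" unfolding v_def by simp
  have vp: "v \<le> ?p\<^sup>2"
  proof -
    have "v \<le> (\<integral>x. ?p\<^sup>2 \<partial>M)" unfolding v_def
      using S_bound by (intro integral_mono[OF i2]) (auto simp: abs_le_square_iff[symmetric])
    then show ?thesis by (simp add: prob_space)
  qed
  have char: "char (distr M borel (S I)) u = (\<integral>x. iexp (u * S I x) \<partial>M)"
    unfolding char_def by (subst integral_distr) auto
  have "norm ((\<integral>x. iexp (u * S I x) \<partial>M) - (1 - u\<^sup>2 * v / 2))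
    \<le> u\<^sup>2 / 6 * (\<integral>x. min (6 * (S I x)\<^sup>2) (\<bar>u\<bar> * \<bar>S I x\<bar> ^ 3) \<partial>M)"
    unfolding char[symmetric]
    by (rule char_approx3'[OF S_meas S_integrable i2 S_mean _ refl]) (simp add: S_mean v_def)
  also have "\<dots> \<le> u\<^sup>2 / 6 * (\<integral>x. \<bar>u\<bar> * ?p * (S I x)\<^sup>2 \<partial>M)"
  proof (rule mult_left_mono)
    show "(\<integral>x. min (6 * (S I x)\<^sup>2) (\<bar>u\<bar> * \<bar>S I x\<bar> ^ 3) \<partial>M) \<le> (\<integral>x. \<bar>u\<bar> * ?p * (S I x)\<^sup>2 \<partial>M)"
    proof (rule integral_mono)
      show le: "min (6 * (S I x)\<^sup>2) (\<bar>u\<bar> * \<bar>S I x\<bar> ^ 3) \<le> \<bar>u\<bar> * ?p * (S I x)\<^sup>2" for x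
      proof -
        have "\<bar>S I x\<bar> ^ 3 = \<bar>S I x\<bar> * (S I x)\<^sup>2" by (simp add: power3_eq_cube power2_eq_square abs_mult[symmetric] mult.assoc[symmetric])
        also have "\<dots> \<le> ?p * (S I x)\<^sup>2" by (rule mult_right_mono[OF S_bound]) simp
        finally have "\<bar>u\<bar> * \<bar>S I x\<bar> ^ 3 \<le> \<bar>u\<bar> * (?p * (S I x)\<^sup>2)" by (rule mult_left_mono) simp
        then show ?thesis by (simp add: mult.assoc min.coboundedI2)
      qed
      show "integrable M (\<lambda>x. \<bar>u\<bar> * ?p * (S I x)\<^sup>2)" using i2 by simp
      then show "integrable M (\<lambda>x. min (6 * (S I x)\<^sup>2) (\<bar>u\<bar> * \<bar>S I x\<bar> ^ 3))"
        by (rule Bochner_Integration.integrable_bound) (use le in \<open>auto intro!: AE_I2 order_trans[OF _ abs_ge_self]\<close>)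
    qed
  qed simp
  also have "\<dots> = \<bar>u\<bar> ^ 3 * ?p * v / 6"
    unfolding v_def by (simp add: power3_eq_cube power2_eq_square)
  finally have a: "norm ((\<integral>x. iexp (u * S I x) \<partial>M) - (1 - u\<^sup>2 * v / 2)) \<le> \<bar>u\<bar> ^ 3 * ?p * v / 6" .
  have "\<bar>1 - u\<^sup>2 * v / 2 - exp (- (u\<^sup>2 * v / 2))\<bar> \<le> (u\<^sup>2 * v / 2)\<^sup>2 / 2"
    by (rule exp_minus_quadratic_bound) (use v0 in simp)
  also have "\<dots> = u ^ 4 * v * v / 8" by (simp add: power2_eq_square power4_eq_xxxx)
  also have "\<dots> \<le> u ^ 4 * ?p\<^sup>2 * v / 8"
    using vp v0 by (simp add: mult_right_mono mult_left_mono)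
  finally have b: "\<bar>1 - u\<^sup>2 * v / 2 - exp (- (u\<^sup>2 * v / 2))\<bar> \<le> u ^ 4 * ?p\<^sup>2 * v / 8" .
  have "norm (complex_of_real (1 - u\<^sup>2 * v / 2) - exp (- (u\<^sup>2 * v / 2))) \<le> u ^ 4 * ?p\<^sup>2 * v / 8"
    using b unfolding of_real_diff[symmetric] norm_of_real by simp
  then have "norm ((\<integral>x. iexp (u * S I x) \<partial>M) - exp (- (u\<^sup>2 * v / 2))) \<le> \<bar>u\<bar> ^ 3 * ?p * v / 6 + u ^ 4 * ?p\<^sup>2 * v / 8"
    using a norm_triangle_ineq[of "(\<integral>x. iexp (u * S I x) \<partial>M) - (1 - u\<^sup>2 * v / 2)" "complex_of_real (1 - u\<^sup>2 * v / 2) - exp (- (u\<^sup>2 * v / 2))"]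
    by (simp add: algebra_simps)
  also have "\<dots> \<le> (\<bar>u\<bar> ^ 3 * ?p + u ^ 4 * ?p\<^sup>2) * v"
  proof -
    have "0 \<le> \<bar>u\<bar> ^ 3 * ?p * v" "0 \<le> u ^ 4 * ?p\<^sup>2 * v" using v0 by simp_all
    then show ?thesis unfolding distrib_right by linarith
  qed
  finally show ?thesis .
qed

definition big :: "nat \<Rightarrow> nat \<Rightarrow> nat set" where "big p l = {l * (p + q)..<l * (p + q) + p}"
definition gap :: "nat \<Rightarrow> nat \<Rightarrow> nat set" where "gap p l = {l * (p + q) + p..<Suc l * (p + q)}"

lemma card_big: "card (big p l) = p" and card_gap: "card (gap p l) = q"
  by (simp_all add: big_def gap_def)

lemma S_osc:
  assumes I: "I \<subseteq> {..b}"
  shows "osc (b + k) (real (card I) * \<eta>) (S I)"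
  unfolding S_def[abs_def]
proof (rule osc_sum)
  show "finite I" using I finite_subset by blast
  fix j assume "j \<in> I"
  then show "osc (b + k) \<eta> (\<lambda>x. h j ((T ^^ j) x))"
    using I by (intro osc_mono[OF osc_shift[OF h_osc]]) auto
qed

lemma big_before: "l < l' \<Longrightarrow> i \<in> big p l \<Longrightarrow> j \<in> big p l' \<Longrightarrow> i + q < j"
proof -
  assume a: "l < l'" "i \<in> big p l" "j \<in> big p l'"
  then have "Suc l * (p + q) \<le> l' * (p + q)" by (intro mult_le_mono1) simp
  then show ?thesis using a by (simp add: big_def)
qed

lemma disj_big: "disjoint_family (big p)"
  unfolding disjoint_family_on_def
proof (intro ballI impI)
  fix l l' :: nat assume "l \<noteq> l'"
  then show "big p l \<inter> big p l' = {}"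
    using big_before[of l l' _ p] big_before[of l' l _ p] by (cases "l < l'") force+
qed

text \<open>Adding a block costs one application of \<open>decorrelation\<close>, with the
  exponential of all earlier blocks as the regular factor. Its oscillation grows with the number of
  terms, which is the source of the factor L p.\<close>

lemma block_factorization:
  "norm ((\<integral>x. iexp (u * S (\<Union>l<L. big p l) x) \<partial>M) - (\<Prod>l<L. \<integral>x. iexp (u * S (big p l) x) \<partial>M))
    \<le> real L * (2 * (\<bar>u\<bar> * (real (L * p) * \<eta>)) + rate k)"
proof (induction L)
  case 0
  show ?case by (simp add: S_def prob_space)
next
  case (Suc L)
  let ?U = "\<Union>l<L. big p l" and ?B = "big p L"
  let ?E = "\<lambda>I. \<integral>x. iexp (u * S I x) \<partial>M"
  let ?e = "2 * (\<bar>u\<bar> * (real (L * p) * \<eta>)) + rate k"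
  let ?e' = "2 * (\<bar>u\<bar> * (real (Suc L * p) * \<eta>)) + rate k"
  have ee: "?e \<le> ?e'" using \<eta> by (intro add_right_mono mult_left_mono mult_right_mono) auto
  have e0: "0 \<le> ?e" using \<eta> rate_nonneg by simp
  have le1: "norm (?E I) \<le> 1" for I
  proof -
    have "norm (?E I) \<le> (\<integral>x. norm (iexp (u * S I x)) \<partial>M)" by (rule integral_norm_bound)
    then show ?thesis by (simp add: prob_space)
  qed
  have dU: "?U \<inter> ?B = {}"
  proof -
    have "x \<notin> big p L" if "l < L" "x \<in> big p l" for l x
      using big_before[OF that(1,2), of x] by auto
    then show ?thesis by auto
  qed
  have cU: "card ?U = L * p"
    using disj_big[of p] by (subst card_UN_disjoint) (auto simp: big_def disjoint_family_on_def)
  have fU: "finite ?U" by (simp add: big_def)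
  have SU: "S (?U \<union> ?B) x = S ?U x + S ?B x" for x
    unfolding S_def using dU fU by (intro sum.union_disjoint) (auto simp: big_def)
  have main: "norm (?E (?U \<union> ?B) - ?E ?U * ?E ?B) \<le> ?e"
  proof (cases "L = 0")
    \<comment> \<open>No gap precedes the first block, and its factorization is exact.\<close>
    case True
    then show ?thesis using e0 by (simp add: S_def prob_space)
  next
    case False
    \<comment> \<open>b bounds the indices of the earlier blocks. As q = k + 2 k^2, the time b + k +
      2 k^2 that \<open>decorrelation\<close> refers to is exactly the start of the new
      block.\<close>
    define b where "b = L * (p + q) - q"
    have bq: "b + q = L * (p + q)"
    proof -
      have "q \<le> L * (p + q)" using False by (cases L) auto
      then show ?thesis by (simp add: b_def)
    qed
    have Ub: "?U \<subseteq> {..b}"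
    proof
      fix i assume "i \<in> ?U"
      then obtain l where l: "l < L" "i \<in> big p l" by blast
      have "Suc l * (p + q) \<le> L * (p + q)" using l(1) by (intro mult_le_mono1) simp
      then have "i + q < L * (p + q)" using l(2) by (simp add: big_def)
      then show "i \<in> {..b}" using bq by simp
    qed
    have oU: "osc (b + k) (real (L * p) * \<eta>) (S ?U)" using S_osc[OF Ub] unfolding cU .
    let ?F = "\<lambda>x. iexp (u * S ?U x)"
    have F: "osc (b + k) (\<bar>u\<bar> * (real (L * p) * \<eta>)) ?F"
    proof (rule osc_lipschitz[OF oU])
      show "norm (iexp (u * a) - iexp (u * b)) \<le> \<bar>u\<bar> * norm (a - b)" for a b :: real
        using norm_iexp_diff[of "u * a" "u * b"] by (simp add: abs_mult right_diff_distrib[symmetric])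
    qed auto
    \<comment> \<open>The new block as seen from its own starting time.\<close>
    define G where "G x = iexp (u * (\<Sum>j\<in>?B. h j ((T ^^ (j - L * (p + q))) x)))" for x
    have Gm: "G \<in> borel_measurable M" unfolding G_def[abs_def] by measurable
    have N: "b + k + 2 * k\<^sup>2 = L * (p + q)" using bq by (simp add: q_def)
    have GT: "G ((T ^^ (L * (p + q))) x) = iexp (u * S ?B x)" for x
    proof -
      have "(T ^^ (j - L * (p + q))) ((T ^^ (L * (p + q))) x) = (T ^^ j) x" if "j \<in> ?B" for j
        using funpow_add_apply[of "L * (p + q)" "j - L * (p + q)" x] that by (simp add: big_def)
      then show ?thesis unfolding G_def S_def by (simp cong: sum.cong)
    qed
    have "norm ((\<integral>x. ?F x * G ((T ^^ (b + k + 2 * k\<^sup>2)) x) \<partial>M) - ?E ?U * (\<integral>x. G x \<partial>M)) \<le> ?e"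
      by (rule decorrelation[OF F _ _ Gm]) (use k in \<open>auto simp: G_def\<close>)
    moreover have "(\<integral>x. G x \<partial>M) = ?E ?B"
      using integral_Tn[OF Gm, of "L * (p + q)"] unfolding GT by simp
    moreover have "?F x * G ((T ^^ (b + k + 2 * k\<^sup>2)) x) = iexp (u * S (?U \<union> ?B) x)" for x
      unfolding N GT SU by (simp add: exp_add[symmetric] algebra_simps)
    ultimately show ?thesis by simp
  qed
  have "norm (?E (?U \<union> ?B) - (\<Prod>l<L. ?E (big p l)) * ?E ?B)
    \<le> norm (?E (?U \<union> ?B) - ?E ?U * ?E ?B) + norm ((?E ?U - (\<Prod>l<L. ?E (big p l))) * ?E ?B)"
    using norm_triangle_ineq[of "?E (?U \<union> ?B) - ?E ?U * ?E ?B" "(?E ?U - (\<Prod>l<L. ?E (big p l))) * ?E ?B"]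
    by (simp add: left_diff_distrib)
  also have "\<dots> \<le> ?e + real L * ?e * 1"
    unfolding norm_mult using main Suc.IH le1[of ?B] e0 by (intro add_mono mult_mono) auto
  also have "\<dots> = real (Suc L) * ?e" by (simp add: algebra_simps)
  also have "\<dots> \<le> real (Suc L) * ?e'" using ee by (intro mult_left_mono) auto
  finally show ?case by (simp add: lessThan_Suc Un_commute mult.commute)
qed

lemma disj_gap: "disjoint_family (gap p)"
proof -
  have "gap p l \<inter> gap p l' = {}" if "l < l'" for l l'
  proof -
    have "Suc l * (p + q) \<le> l' * (p + q)" using that by (intro mult_le_mono1) simp
    then show ?thesis by (auto simp: gap_def)
  qed
  then show ?thesis unfolding disjoint_family_on_def by (metis Int_commute linorder_neqE_nat)
qed

lemma blocks_cover:
  "(\<Union>l<L. big p l) \<union> (\<Union>l<L. gap p l) = {..<L * (p + q)}" "(\<Union>l<L. big p l) \<inter> (\<Union>l<L. gap p l) = {}"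
proof -
  have pq: "p + q > 0" using q_pos by simp
  have 1: "j div (p + q) = l \<and> j mod (p + q) < p" if "j \<in> big p l" for j l
  proof -
    have "j = l * (p + q) + (j - l * (p + q))" "j - l * (p + q) < p" using that by (auto simp: big_def)
    moreover define r where "r = j - l * (p + q)"
    ultimately have "j = l * (p + q) + r" "r < p" by auto
    then show ?thesis using pq by simp
  qed
  have 2: "j div (p + q) = l \<and> \<not> j mod (p + q) < p" if "j \<in> gap p l" for j l
  proof -
    define r where "r = j - l * (p + q)"
    have "j = l * (p + q) + r" "p \<le> r" "r < p + q" using that by (auto simp: gap_def r_def)
    then show ?thesis using pq by simp
  qed
  show "(\<Union>l<L. big p l) \<inter> (\<Union>l<L. gap p l) = {}" using 1 2 by blast
  have "j \<in> big p (j div (p + q)) \<union> gap p (j div (p + q))" for j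
  proof -
    define D r where "D = j div (p + q) * (p + q)" and "r = j mod (p + q)"
    have "j = D + r" unfolding D_def r_def by (rule div_mult_mod_eq[symmetric])
    moreover have "r < p + q" unfolding r_def using pq by simp
    moreover have "Suc (j div (p + q)) * (p + q) = D + (p + q)" by (simp add: D_def)
    ultimately show ?thesis unfolding big_def gap_def D_def[symmetric] by auto
  qed
  moreover have "j div (p + q) < L \<longleftrightarrow> j < L * (p + q)" for j
    using pq by (simp add: div_less_iff_less_mult)
  ultimately show "(\<Union>l<L. big p l) \<union> (\<Union>l<L. gap p l) = {..<L * (p + q)}"
    using 1 2 by (intro equalityI subsetI) (auto, blast+)
qed

lemma block_cross_moment:
  assumes "l \<noteq> l'"
  shows "\<bar>\<integral>x. S (big p l) x * S (big p l') x \<partial>M\<bar> \<le> (real p)\<^sup>2 * \<tau>"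
proof -
  let ?c = "\<lambda>i j. \<integral>x. h i ((T ^^ i) x) * h j ((T ^^ j) x) \<partial>M"
  have "\<bar>\<Sum>i\<in>big p l. \<Sum>j\<in>big p l'. ?c i j\<bar> \<le> (\<Sum>i\<in>big p l. \<Sum>j\<in>big p l'. \<bar>?c i j\<bar>)"
    by (rule double_sum_abs_le)
  also have "\<dots> \<le> (\<Sum>i\<in>big p l. \<Sum>j\<in>big p l'. \<tau>)"
  proof (intro sum_mono cov_far)
    fix i j assume "i \<in> big p l" "j \<in> big p l'"
    then show "i + q \<le> j \<or> j + q \<le> i"
      using big_before[of l l' i p j] big_before[of l' l j p i] assms by (cases "l < l'") auto
  qed
  also have "\<dots> = (real p)\<^sup>2 * \<tau>" by (simp add: card_big power2_eq_square)
  finally show ?thesis unfolding S_cov .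
qed

lemma S_moment_integrable: "integrable M (\<lambda>x. (S I x)\<^sup>2)"
  using SS_integrable[of I I] by (simp add: power2_eq_square)

text \<open>The four summands are the prices of dropping the gaps, of factorizing over the blocks,
  of the Gaussian approximation of single blocks, and of the mismatch between s^2 and the sum of the
  block variances. Here \<beta> bounds the gaps in L^2 and D bounds the relative mismatch.\<close>

lemma char_sum_bound:
  fixes t s :: real and L p :: nat
  defines "N \<equiv> L * (p + q)"
    and "\<beta> \<equiv> sqrt (real (L * q) * (2 * real q) + (real (L * q))\<^sup>2 * \<tau>)"
  defines "D \<equiv> (2 * s * \<beta> + \<beta>\<^sup>2 + (real (L * p))\<^sup>2 * \<tau>) / s\<^sup>2"
  assumes s: "s > 0" and var: "(\<integral>x. (S {..<N} x)\<^sup>2 \<partial>M) = s\<^sup>2"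
  shows "norm ((\<integral>x. iexp (t / s * S {..<N} x) \<partial>M) - exp (- (t\<^sup>2 / 2)))
    \<le> \<bar>t\<bar> * \<beta> / s + real L * (2 * (\<bar>t / s\<bar> * (real (L * p) * \<eta>)) + rate k)
      + (\<bar>t\<bar> ^ 3 * (real p / s) + t ^ 4 * (real p / s)\<^sup>2) * (1 + D) + t\<^sup>2 / 2 * D"
proof -
  let ?U = "S (\<Union>l<L. big p l)" and ?V = "S (\<Union>l<L. gap p l)" and ?S = "S {..<N}"
  let ?u = "t / s"
  have N0: "L \<ge> 1"
  proof (rule ccontr)
    assume "\<not> ?thesis"
    then have "N = 0" by (simp add: N_def)
    then have "s\<^sup>2 = 0" using var by (simp add: S_def)
    then show False using s by simp
  qed
  have \<beta>2: "\<beta>\<^sup>2 = real (L * q) * (2 * real q) + (real (L * q))\<^sup>2 * \<tau>"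
    unfolding \<beta>_def using \<tau>_nonneg by simp
  have "0 < real (L * q) * (2 * real q)" using N0 q_pos by simp
  then have \<beta>: "\<beta> > 0" unfolding \<beta>_def using \<tau>_nonneg by (simp add: add_pos_nonneg)
  have fin: "finite (\<Union>l<L. big p l)" "finite (\<Union>l<L. gap p l)" by (simp_all add: big_def gap_def)
  have SUV: "?S x = ?U x + ?V x" for x
    unfolding N_def S_def blocks_cover(1)[of p L, symmetric]
    by (rule sum.union_disjoint[OF fin blocks_cover(2)])
  have cG: "card (\<Union>l<L. gap p l) = L * q"
  proof -
    have "finite (gap p l)" for l by (simp add: gap_def)
    then show ?thesis using disj_gap[of p]
      by (subst card_UN_disjoint) (simp_all add: card_gap disjoint_family_on_def)
  qed
  have EV2: "(\<integral>x. (?V x)\<^sup>2 \<partial>M) \<le> \<beta>\<^sup>2"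
    using S_second_moment[OF fin(2)] unfolding cG \<beta>2 .
  have EV: "(\<integral>x. \<bar>?V x\<bar> \<partial>M) \<le> \<beta>"
  proof -
    have "sqrt (\<integral>x. (?V x)\<^sup>2 \<partial>M) \<le> \<beta>" using real_sqrt_le_mono[OF EV2] \<beta> by simp
    then show ?thesis
      using square_mean_le[OF S_integrable S_moment_integrable, of "\<Union>l<L. gap p l"] by linarith
  qed
  have ESV: "\<bar>\<integral>x. 2 * (?S x * ?V x) \<partial>M\<bar> \<le> 2 * s * \<beta>"
  proof -
    have "\<bar>\<integral>x. 2 * (?S x * ?V x) \<partial>M\<bar> \<le> (\<integral>x. \<bar>2 * (?S x * ?V x)\<bar> \<partial>M)" by (rule integral_abs_bound)
    \<comment> \<open>A weighted arithmetic-geometric mean inequality, balanced so that both terms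
      integrate to at most s \<beta>; the result is the bound Cauchy-Schwarz would give.\<close>
    also have "\<dots> \<le> (\<integral>x. \<beta> / s * (?S x)\<^sup>2 + s / \<beta> * (?V x)\<^sup>2 \<partial>M)"
    proof (rule integral_mono)
      show "\<bar>2 * (?S x * ?V x)\<bar> \<le> \<beta> / s * (?S x)\<^sup>2 + s / \<beta> * (?V x)\<^sup>2" for x
      proof -
        have "0 \<le> (sqrt (\<beta> / s) * \<bar>?S x\<bar> - sqrt (s / \<beta>) * \<bar>?V x\<bar>)\<^sup>2" by simp
        also have "\<dots> = \<beta> / s * (?S x)\<^sup>2 + s / \<beta> * (?V x)\<^sup>2 - 2 * (sqrt (\<beta> / s) * sqrt (s / \<beta>)) * (\<bar>?S x\<bar> * \<bar>?V x\<bar>)"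
          using s \<beta> by (simp add: power2_diff power_mult_distrib)
        also have "sqrt (\<beta> / s) * sqrt (s / \<beta>) = 1" using s \<beta> by (simp add: real_sqrt_mult[symmetric])
        finally show ?thesis by (simp add: abs_mult)
      qed
    qed (use SS_integrable S_moment_integrable in auto)
    also have "\<dots> = \<beta> / s * s\<^sup>2 + s / \<beta> * (\<integral>x. (?V x)\<^sup>2 \<partial>M)"
      using S_moment_integrable by (simp add: var)
    also have "\<dots> \<le> \<beta> / s * s\<^sup>2 + s / \<beta> * \<beta>\<^sup>2"
      using EV2 s \<beta> by (intro add_left_mono mult_left_mono) auto
    also have "\<dots> = 2 * s * \<beta>" using s \<beta> by (simp add: power2_eq_square)
    finally show ?thesis .
  qed
  have EU: "\<bar>(\<integral>x. (?U x)\<^sup>2 \<partial>M) - s\<^sup>2\<bar> \<le> 2 * s * \<beta> + \<beta>\<^sup>2"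
  proof -
    have "(?U x)\<^sup>2 = (?S x)\<^sup>2 - 2 * (?S x * ?V x) + (?V x)\<^sup>2" for x
      unfolding SUV by (simp add: power2_eq_square algebra_simps)
    then have "(\<integral>x. (?U x)\<^sup>2 \<partial>M) = s\<^sup>2 - (\<integral>x. 2 * (?S x * ?V x) \<partial>M) + (\<integral>x. (?V x)\<^sup>2 \<partial>M)"
      using S_moment_integrable SS_integrable var by simp
    moreover have "0 \<le> (\<integral>x. (?V x)\<^sup>2 \<partial>M)" by simp
    ultimately show ?thesis using ESV EV2 by linarith
  qed
  define v where "v l = (\<integral>x. (S (big p l) x)\<^sup>2 \<partial>M)" for l
  have v0: "v l \<ge> 0" for l unfolding v_def by simp
  have cross: "\<bar>(\<integral>x. (?U x)\<^sup>2 \<partial>M) - (\<Sum>l<L. v l)\<bar> \<le> (real (L * p))\<^sup>2 * \<tau>"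
  proof -
    let ?e = "\<lambda>l l'. \<integral>x. S (big p l) x * S (big p l') x \<partial>M"
    have Usum: "?U x = (\<Sum>l<L. S (big p l) x)" for x
      unfolding S_def using disj_big[of p]
      by (subst sum.UNION_disjoint) (auto simp: big_def disjoint_family_on_def)
    have "(\<integral>x. (?U x)\<^sup>2 \<partial>M) = (\<Sum>l<L. \<Sum>l'<L. ?e l l')"
      unfolding Usum power2_eq_square sum_product using SS_integrable by (simp add: Bochner_Integration.integral_sum)
    moreover have "(\<Sum>l<L. v l) = (\<Sum>l<L. \<Sum>l'<L. if l' = l then ?e l l' else 0)"
      unfolding v_def power2_eq_square by simp
    ultimately have eq: "(\<integral>x. (?U x)\<^sup>2 \<partial>M) - (\<Sum>l<L. v l) = (\<Sum>l<L. \<Sum>l'<L. if l' = l then 0 else ?e l l')"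
      by (simp only: sum_subtractf[symmetric]) (intro sum.cong refl, simp)
    have "\<bar>(\<integral>x. (?U x)\<^sup>2 \<partial>M) - (\<Sum>l<L. v l)\<bar> \<le> (\<Sum>l<L. \<Sum>l'<L. \<bar>if l' = l then 0 else ?e l l'\<bar>)"
      unfolding eq by (rule double_sum_abs_le)
    also have "\<dots> \<le> (\<Sum>l<L. \<Sum>l'<L. (real p)\<^sup>2 * \<tau>)"
      using block_cross_moment \<tau>_nonneg by (intro sum_mono) auto
    also have "\<dots> = (real (L * p))\<^sup>2 * \<tau>" by (simp add: power2_eq_square)
    finally show ?thesis .
  qed
  have W: "\<bar>(\<Sum>l<L. v l) - s\<^sup>2\<bar> \<le> D * s\<^sup>2"
    using EU cross s by (simp add: D_def)
  have 1: "norm ((\<integral>x. iexp (?u * ?S x) \<partial>M) - (\<integral>x. iexp (?u * ?U x) \<partial>M)) \<le> \<bar>t\<bar> * \<beta> / s"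
  proof -
    have "norm ((\<integral>x. iexp (?u * ?S x) \<partial>M) - (\<integral>x. iexp (?u * ?U x) \<partial>M))
      = norm (\<integral>x. iexp (?u * ?S x) - iexp (?u * ?U x) \<partial>M)"
      using iexp_integrable[of "\<lambda>x. ?u * ?S x"] iexp_integrable[of "\<lambda>x. ?u * ?U x"] by simp
    also have "\<dots> \<le> (\<integral>x. norm (iexp (?u * ?S x) - iexp (?u * ?U x)) \<partial>M)" by (rule integral_norm_bound)
    also have "\<dots> \<le> (\<integral>x. \<bar>?u\<bar> * \<bar>?V x\<bar> \<partial>M)"
    proof (rule integral_mono[OF integrable_norm[OF Bochner_Integration.integrable_diff[OF iexp_integrable iexp_integrable]]])
      show "integrable M (\<lambda>x. \<bar>?u\<bar> * \<bar>?V x\<bar>)"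
        by (rule integrable_mult_right[OF integrable_abs[OF S_integrable]])
      show "norm (iexp (?u * ?S x) - iexp (?u * ?U x)) \<le> \<bar>?u\<bar> * \<bar>?V x\<bar>" for x
        using norm_iexp_diff[of "?u * ?S x" "?u * ?U x"] unfolding SUV by (simp add: abs_mult[symmetric] algebra_simps)
    qed measurable
    also have "\<dots> = \<bar>?u\<bar> * (\<integral>x. \<bar>?V x\<bar> \<partial>M)" by simp
    also have "\<dots> \<le> \<bar>?u\<bar> * \<beta>" by (rule mult_left_mono[OF EV]) simp
    finally show ?thesis using s by simp
  qed
  note 2 = block_factorization[of ?u p L]
  have 3: "norm ((\<Prod>l<L. \<integral>x. iexp (?u * S (big p l) x) \<partial>M) - (\<Prod>l<L. complex_of_real (exp (- (?u\<^sup>2 * v l / 2)))))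
    \<le> (\<bar>t\<bar> ^ 3 * (real p / s) + t ^ 4 * (real p / s)\<^sup>2) * (1 + D)"
  proof -
    let ?a = "\<bar>t\<bar> ^ 3 * (real p / s) + t ^ 4 * (real p / s)\<^sup>2"
    have a0: "?a \<ge> 0" using s by simp
    have le1: "norm (\<integral>x. iexp (?u * S I x) \<partial>M) \<le> 1" for I
    proof -
      have "norm (\<integral>x. iexp (?u * S I x) \<partial>M) \<le> (\<integral>x. norm (iexp (?u * S I x)) \<partial>M)" by (rule integral_norm_bound)
      then show ?thesis by (simp add: prob_space)
    qed
    \<comment> \<open>The difference of two products is bounded by the sum of the differences when
      all factors have modulus at most 1; the Gaussian factors do because the variances are
      nonnegative.\<close>
    have "norm ((\<Prod>l<L. \<integral>x. iexp (?u * S (big p l) x) \<partial>M) - (\<Prod>l<L. complex_of_real (exp (- (?u\<^sup>2 * v l / 2)))))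
      \<le> (\<Sum>l<L. norm ((\<integral>x. iexp (?u * S (big p l) x) \<partial>M) - complex_of_real (exp (- (?u\<^sup>2 * v l / 2)))))"
      by (rule norm_prod_diff) (use le1 v0 in auto)
    also have "\<dots> \<le> (\<Sum>l<L. (\<bar>?u\<bar> ^ 3 * card (big p l) + ?u ^ 4 * (real (card (big p l)))\<^sup>2) * v l)"
      unfolding v_def by (rule sum_mono, rule char_single_block)
    also have "\<dots> = ?a * ((\<Sum>l<L. v l) / s\<^sup>2)"
    proof -
      have "\<bar>?u\<bar> ^ 3 * real p + ?u ^ 4 * (real p)\<^sup>2 = ?a / s\<^sup>2"
        using s by (simp add: field_simps power2_eq_square power3_eq_cube power4_eq_xxxx)
      then show ?thesis unfolding card_big sum_distrib_left[symmetric] by simp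
    qed
    also have "\<dots> \<le> ?a * (1 + D)"
    proof (rule mult_left_mono[OF _ a0])
      show "(\<Sum>l<L. v l) / s\<^sup>2 \<le> 1 + D" using W s by (simp add: field_simps abs_le_iff)
    qed
    finally show ?thesis .
  qed
  have 4: "norm ((\<Prod>l<L. complex_of_real (exp (- (?u\<^sup>2 * v l / 2)))) - exp (- (t\<^sup>2 / 2))) \<le> t\<^sup>2 / 2 * D"
  proof -
    let ?w = "(\<Sum>l<L. v l) / s\<^sup>2"
    have w0: "?w \<ge> 0" using v0 by (simp add: sum_nonneg)
    have "(\<Prod>l<L. complex_of_real (exp (- (?u\<^sup>2 * v l / 2)))) = complex_of_real (exp (\<Sum>l<L. - (?u\<^sup>2 * v l / 2)))"
      by (simp add: exp_sum)
    also have "(\<Sum>l<L. - (?u\<^sup>2 * v l / 2)) = - (t\<^sup>2 / 2 * ?w)"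
      using s by (simp add: sum_negf sum_distrib_left[symmetric] sum_divide_distrib[symmetric] power_divide)
    finally have eq: "(\<Prod>l<L. complex_of_real (exp (- (?u\<^sup>2 * v l / 2)))) = complex_of_real (exp (- (t\<^sup>2 / 2 * ?w)))" .
    \<comment> \<open>On the half-line the function exp(-x) is 1-Lipschitz, so the two Gaussian
      factors are compared through their variances.\<close>
    have exp_lip: "\<bar>exp (- a) - exp (- b)\<bar> \<le> \<bar>a - b\<bar>" if "0 \<le> a" "0 \<le> b" for a b :: real
    proof -
      have le: "exp (- a) - exp (- b) \<le> b - a" if "0 \<le> a" "a \<le> b" for a b :: real
      proof -
        have "exp (- a) - exp (- b) = exp (- a) * (1 - exp (- (b - a)))" by (simp add: right_diff_distrib exp_add[symmetric])
        also have "\<dots> \<le> 1 * (b - a)"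
        proof (rule mult_mono)
          show "1 - exp (- (b - a)) \<le> b - a" using exp_ge_add_one_self[of "- (b - a)"] by linarith
        qed (use that in auto)
        finally show ?thesis by simp
      qed
      show ?thesis using le[of a b] le[of b a] that by (cases "a \<le> b") (auto simp: abs_if)
    qed
    have "\<bar>exp (- (t\<^sup>2 / 2 * ?w)) - exp (- (t\<^sup>2 / 2))\<bar> \<le> \<bar>t\<^sup>2 / 2 * ?w - t\<^sup>2 / 2\<bar>"
      by (rule exp_lip[OF mult_nonneg_nonneg[OF _ w0]]) simp_all
    also have "\<dots> = t\<^sup>2 / 2 * \<bar>?w - 1\<bar>"
    proof -
      have "t\<^sup>2 / 2 * ?w - t\<^sup>2 / 2 = t\<^sup>2 / 2 * (?w - 1)" by (simp only: right_diff_distrib mult_1_right)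
      moreover have "\<bar>t\<^sup>2 / 2\<bar> = t\<^sup>2 / 2" by simp
      ultimately show ?thesis by (simp only: abs_mult)
    qed
    also have "\<dots> \<le> t\<^sup>2 / 2 * D"
    proof (rule mult_left_mono)
      have "?w - 1 = ((\<Sum>l<L. v l) - s\<^sup>2) / s\<^sup>2" using s by (simp add: diff_divide_distrib)
      then show "\<bar>?w - 1\<bar> \<le> D" using W s by (simp add: abs_divide pos_divide_le_eq)
    qed simp
    finally show ?thesis unfolding eq of_real_diff[symmetric] norm_of_real .
  qed
  show ?thesis
    using 1 2 3 4
      norm_triangle_ineq[of "(\<integral>x. iexp (?u * ?S x) \<partial>M) - (\<integral>x. iexp (?u * ?U x) \<partial>M)" "(\<integral>x. iexp (?u * ?U x) \<partial>M) - exp (- (t\<^sup>2 / 2))"]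
      norm_triangle_ineq[of "(\<integral>x. iexp (?u * ?U x) \<partial>M) - (\<Prod>l<L. \<integral>x. iexp (?u * S (big p l) x) \<partial>M)" "(\<Prod>l<L. \<integral>x. iexp (?u * S (big p l) x) \<partial>M) - exp (- (t\<^sup>2 / 2))"]
      norm_triangle_ineq[of "(\<Prod>l<L. \<integral>x. iexp (?u * S (big p l) x) \<partial>M) - (\<Prod>l<L. complex_of_real (exp (- (?u\<^sup>2 * v l / 2))))" "(\<Prod>l<L. complex_of_real (exp (- (?u\<^sup>2 * v l / 2)))) - exp (- (t\<^sup>2 / 2))"]
    by (simp only: diff_add_cancel add_diff_eq)
qed

end

section \<open>Comparison probabilities\<close>

lemma borel_measurable_of_bool[measurable (raw)]:
  assumes "Measurable.pred M P"
  shows "(\<lambda>x. of_bool (P x) :: real) \<in> borel_measurable M"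
  unfolding of_bool_def using assms by measurable

context mixing_gibbs_markov
begin

text \<open>The event compares two random values, so the earlier one is frozen. On a cylinder
  \<psi>' stays within \<eta> of one value, and unless \<psi> and \<psi>' differ by at least
  \<epsilon> the inequality is enclosed between two inequalities with constant thresholds, to which
  cylinder mixing applies. Lipschitz continuity of H pays for moving the threshold, and \<delta> /
  \<epsilon> is Markov's bound for the excluded event. H is kept abstract so that a change of signs
  yields the reversed inequality.\<close>

lemma comparison_probability:
  fixes \<phi> \<psi> \<psi>' :: "'a \<Rightarrow> real" and H :: "real \<Rightarrow> real"
  assumes \<phi>[measurable]: "\<phi> \<in> borel_measurable M" and \<psi>[measurable]: "\<psi> \<in> borel_measurable M"
    and \<psi>': "osc s \<eta> \<psi>'" and s: "s \<ge> 1"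
    and H: "\<And>c. H c = (\<integral>x. of_bool (c \<le> \<phi> x) \<partial>M)"
    and lip: "\<And>a b. \<bar>H a - H b\<bar> \<le> Lc * \<bar>a - b\<bar>" and Lc: "Lc \<ge> 0" and \<epsilon>: "\<epsilon> > 0"
    and int: "integrable M (\<lambda>x. \<psi> x - \<psi>' x)" and \<delta>: "(\<integral>x. \<bar>\<psi> x - \<psi>' x\<bar> \<partial>M) = \<delta>"
    and l: "s + 2 * k\<^sup>2 \<le> l"
  shows "\<bar>(\<integral>x. of_bool (\<psi> x \<le> \<phi> ((T ^^ l) x)) \<partial>M) - (\<integral>x. H (\<psi> x) \<partial>M)\<bar>
    \<le> \<delta> / \<epsilon> + Lc * (\<delta> + 2 * \<eta> + \<epsilon>) + rate k"
proof -
  have [measurable]: "\<psi>' \<in> borel_measurable M" by (rule oscD[OF \<psi>'])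
  obtain d where d: "l = s + 2 * k\<^sup>2 + d" using le_Suc_ex[OF l] by auto
  have Tl: "(T ^^ l) x = (T ^^ d) ((T ^^ (s + 2 * k\<^sup>2)) x)" for x unfolding d by (rule funpow_add_apply)
  have H01: "0 \<le> H c" "H c \<le> 1" for c
  proof -
    show "0 \<le> H c" unfolding H by simp
    have "H c \<le> (\<integral>x. 1 \<partial>M)" unfolding H
      by (rule integral_mono) (auto intro!: integrable_const_bound[of _ 1])
    then show "H c \<le> 1" by (simp add: prob_space)
  qed
  have Hc: "continuous_on UNIV H"
    by (rule lipschitz_on_continuous_on[of Lc]) (use lip Lc in \<open>auto simp: lipschitz_on_def dist_real_def\<close>)
  then have Hm[measurable]: "H \<in> borel_measurable borel" by (rule borel_measurable_continuous_onI)
  have [measurable]: "(\<lambda>x. \<phi> ((T ^^ j) x)) \<in> borel_measurable M" for j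
    by (rule measurable_compose[OF Tn_meas \<phi>])
  obtain N where N: "N \<in> null_sets M"
    "\<And>w x y. w \<in> words \<alpha> s \<Longrightarrow> x \<in> cyl M T w - N \<Longrightarrow> y \<in> cyl M T w - N \<Longrightarrow> norm (\<psi>' x - \<psi>' y) \<le> \<eta>"
    by (rule oscE[OF \<psi>'], rule that)
  let ?f = "\<lambda>x. of_bool (\<psi> x \<le> \<phi> ((T ^^ l) x)) - H (\<psi> x)"
  let ?g = "\<lambda>x. \<bar>\<psi> x - \<psi>' x\<bar> / \<epsilon> + Lc * (\<bar>\<psi> x - \<psi>' x\<bar> + 2 * \<eta> + \<epsilon>)"
  let ?b = "\<lambda>c x. of_bool (c \<le> \<phi> ((T ^^ l) x)) :: real"
  have i1: "integrable M (\<lambda>x. of_bool (\<psi> x \<le> \<phi> ((T ^^ l) x)) :: real)"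
    by (rule integrable_const_bound[of _ 1]) auto
  have i2: "integrable M (\<lambda>x. H (\<psi> x))"
    by (rule integrable_const_bound[of _ 1]) (use H01 in auto)
  have iff: "integrable M ?f" by (rule Bochner_Integration.integrable_diff[OF i1 i2])
  have ib: "integrable M (?b c)" for c by (rule integrable_const_bound[of _ 1]) auto
  have ia: "integrable M (\<lambda>x. \<bar>\<psi> x - \<psi>' x\<bar>)" by (rule integrable_abs[OF int])
  have ig: "integrable M ?g"
    by (intro Bochner_Integration.integrable_add integrable_mult_right integrable_divide ia integrable_const)
  have igr: "integrable M (\<lambda>x. ?g x + rate k)"
    by (intro Bochner_Integration.integrable_add ig integrable_const)
  have "norm (\<integral>x. ?f x \<partial>M) \<le> (\<integral>x. ?g x + rate k \<partial>M)"
  proof (rule piecewise_integral_bound[OF countable_pwords[of s] cyl_meas[OF pwordsD(1)] pwords_AE[of s] iff igr], assumption)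
    fix w assume w: "w \<in> pwords s"
    let ?A = "cyl M T w"
    have A: "?A \<in> sets M" using cyl_meas[OF pwordsD(1)[OF w]] .
    have sI: "set_integrable M ?A g" if "integrable M g" for g :: "'a \<Rightarrow> real"
      unfolding set_integrable_def by (rule integrable_mult_indicator[OF A that])
    have "\<not> ?A \<subseteq> N"
    proof
      assume "?A \<subseteq> N"
      then have "?A \<in> null_sets M" using null_sets_subset[OF N(1) A] by blast
      then show False using pwordsD(2)[OF w] by (simp add: measure_eq_0_null_sets)
    qed
    then obtain z where z: "z \<in> ?A - N" by blast
    \<comment> \<open>The thresholds are shifted by \<eta> for the oscillation on the cylinder and
      by \<epsilon> for the distance of \<psi> to its approximation.\<close>
    define c1 c2 where "c1 = \<psi>' z - \<eta> - \<epsilon>" and "c2 = \<psi>' z + \<eta> + \<epsilon>"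
    have near: "\<bar>\<psi>' x - \<psi>' z\<bar> \<le> \<eta>" if "x \<in> ?A" "x \<notin> N" for x
      using N(2)[OF pwordsD(1)[OF w], of x z] that z by simp
    have mixc: "\<bar>(LINT x:?A|M. ?b c x) - measure M ?A * H c\<bar> \<le> rate k * measure M ?A" for c
    proof -
      have u: "(\<lambda>x. of_bool (c \<le> \<phi> ((T ^^ d) x))) \<in> unit_funs M" by (simp add: unit_funs_def)
      have "(\<integral>x. of_bool (c \<le> \<phi> ((T ^^ d) x)) \<partial>M) = H c"
        unfolding H using integral_Tn[of "\<lambda>x. of_bool (c \<le> \<phi> x) :: real" d] by simp
      then have "\<bar>(LINT x:?A|M. ?b c x) - measure M ?A * H c\<bar> \<le> rate k / 4 * measure M ?A"
        using cyl_mixing_unit[OF s pwordsD(1)[OF w] u, of k] unfolding Tl by simp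
      also have "\<dots> \<le> rate k * measure M ?A" using rate_nonneg by (intro mult_right_mono) auto
      finally show ?thesis .
    qed
    have lc: "(LINT x:?A|M. c) = measure M ?A * c" for c :: real using A by (simp add: set_lebesgue_integral_def)
    have bH: "(LINT x:?A|M. ?b c x - H c) = (LINT x:?A|M. ?b c x) - measure M ?A * H c" for c
      unfolding set_integral_diff(2)[OF sI[OF ib] set_integrable_const[OF A]] lc ..
    have gr: "(LINT x:?A|M. ?g x + rate k) = (LINT x:?A|M. ?g x) + measure M ?A * rate k"
      unfolding set_integral_add(2)[OF sI[OF ig] set_integrable_const[OF A]] lc ..
    have up: "(LINT x:?A|M. ?f x) \<le> (LINT x:?A|M. ?g x + (?b c1 x - H c1))"
    proof (rule set_integral_mono_AE[OF sI[OF iff] sI])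
      show "integrable M (\<lambda>x. ?g x + (?b c1 x - H c1))"
        by (intro Bochner_Integration.integrable_add Bochner_Integration.integrable_diff ig ib integrable_const)
      show "AE x\<in>?A in M. ?f x \<le> ?g x + (?b c1 x - H c1)"
        using AE_not_in[OF N(1)]
      proof (eventually_elim, intro impI)
        fix x assume x: "x \<notin> N" "x \<in> ?A"
        let ?a = "\<bar>\<psi> x - \<psi>' x\<bar>"
        have nr: "\<bar>\<psi>' x - \<psi>' z\<bar> \<le> \<eta>" by (rule near[OF x(2,1)])
        \<comment> \<open>On the excluded event the quotient by \<epsilon> is at least 1, so it
          dominates the indicator without a case distinction in the integral.\<close>
        have b1: "of_bool (\<psi> x \<le> \<phi> ((T ^^ l) x)) \<le> ?a / \<epsilon> + ?b c1 x"
        proof (cases "?a \<ge> \<epsilon>")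
          case True
          then have "1 \<le> ?a / \<epsilon>" using \<epsilon> by simp
          then show ?thesis by (auto simp: of_bool_def)
        next
          case False
          then have "c1 \<le> \<psi> x" using nr by (simp add: c1_def abs_if split: if_splits)
          then show ?thesis using \<epsilon> by (auto simp: of_bool_def)
        qed
        have "\<bar>c1 - \<psi> x\<bar> \<le> ?a + 2 * \<eta> + \<epsilon>" using nr \<epsilon> by (simp add: c1_def abs_if split: if_splits)
        then have "Lc * \<bar>c1 - \<psi> x\<bar> \<le> Lc * (?a + 2 * \<eta> + \<epsilon>)" using Lc by (rule mult_left_mono)
        then have "H c1 - H (\<psi> x) \<le> Lc * (?a + 2 * \<eta> + \<epsilon>)" using lip[of c1 "\<psi> x"] by linarith
        then show "?f x \<le> ?g x + (?b c1 x - H c1)" using b1 by linarith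
      qed
    qed
    have lo: "(LINT x:?A|M. (?b c2 x - H c2) - ?g x) \<le> (LINT x:?A|M. ?f x)"
    proof (rule set_integral_mono_AE[OF sI sI[OF iff]])
      show "integrable M (\<lambda>x. (?b c2 x - H c2) - ?g x)"
        by (intro Bochner_Integration.integrable_diff ig ib integrable_const)
      show "AE x\<in>?A in M. (?b c2 x - H c2) - ?g x \<le> ?f x"
        using AE_not_in[OF N(1)]
      proof (eventually_elim, intro impI)
        fix x assume x: "x \<notin> N" "x \<in> ?A"
        let ?a = "\<bar>\<psi> x - \<psi>' x\<bar>"
        have nr: "\<bar>\<psi>' x - \<psi>' z\<bar> \<le> \<eta>" by (rule near[OF x(2,1)])
        have b1: "?b c2 x - ?a / \<epsilon> \<le> of_bool (\<psi> x \<le> \<phi> ((T ^^ l) x))"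
        proof (cases "?a \<ge> \<epsilon>")
          case True
          then have "1 \<le> ?a / \<epsilon>" using \<epsilon> by simp
          moreover have "?b c2 x \<le> 1" "0 \<le> (of_bool (\<psi> x \<le> \<phi> ((T ^^ l) x)) :: real)" by simp_all
          ultimately show ?thesis by linarith
        next
          case False
          then have le: "\<psi> x \<le> c2" using nr by (simp add: c2_def abs_if split: if_splits)
          have nn: "0 \<le> ?a / \<epsilon>" using \<epsilon> by simp
          have "?b c2 x \<le> of_bool (\<psi> x \<le> \<phi> ((T ^^ l) x))" using le by (auto simp: of_bool_def)
          then show ?thesis using nn by linarith
        qed
        have "\<bar>\<psi> x - c2\<bar> \<le> ?a + 2 * \<eta> + \<epsilon>" using nr \<epsilon> by (simp add: c2_def abs_if split: if_splits)
        then have "Lc * \<bar>\<psi> x - c2\<bar> \<le> Lc * (?a + 2 * \<eta> + \<epsilon>)" using Lc by (rule mult_left_mono)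
        then have "H (\<psi> x) - H c2 \<le> Lc * (?a + 2 * \<eta> + \<epsilon>)" using lip[of "\<psi> x" c2] by linarith
        then show "(?b c2 x - H c2) - ?g x \<le> ?f x" using b1 by linarith
      qed
    qed
    have ibH: "integrable M (\<lambda>x. ?b c x - H c)" for c
      by (intro Bochner_Integration.integrable_diff ib integrable_const)
    have "(LINT x:?A|M. ?f x) \<le> (LINT x:?A|M. ?g x) + ((LINT x:?A|M. ?b c1 x) - measure M ?A * H c1)"
      using up unfolding set_integral_add(2)[OF sI[OF ig] sI[OF ibH]] bH .
    moreover have "((LINT x:?A|M. ?b c2 x) - measure M ?A * H c2) - (LINT x:?A|M. ?g x) \<le> (LINT x:?A|M. ?f x)"
      using lo unfolding set_integral_diff(2)[OF sI[OF ibH] sI[OF ig]] bH .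
    ultimately show "norm (LINT x:?A|M. ?f x) \<le> (LINT x:?A|M. ?g x + rate k)"
      unfolding gr real_norm_def using mixc[of c1] mixc[of c2] by (simp only: abs_le_iff mult.commute[of "measure M ?A" "rate k"]) linarith
  qed
  also have "(\<integral>x. ?f x \<partial>M) = (\<integral>x. of_bool (\<psi> x \<le> \<phi> ((T ^^ l) x)) \<partial>M) - (\<integral>x. H (\<psi> x) \<partial>M)"
    by (rule Bochner_Integration.integral_diff[OF i1 i2])
  also have "(\<integral>x. ?g x + rate k \<partial>M) = \<delta> / \<epsilon> + Lc * (\<delta> + 2 * \<eta> + \<epsilon>) + rate k"
    using ia ig \<delta> by (simp add: prob_space)
  finally show ?thesis by simp
qed

end

text \<open>In \<open>ennreal\<close> a quotient by zero is infinite unless the numerator vanishes,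
  so a finite bound forces a = 0 there. This is the case of points that are never separated.\<close>

lemma ennreal_quotient_le:
  assumes "ennreal a / ennreal b \<le> ennreal D" "0 \<le> a" "0 \<le> b" "0 \<le> D"
  shows "a \<le> D * b"
proof (cases "b = 0")
  case True
  then have "a = 0"
    using assms by (cases "a = 0") (auto simp: ennreal_divide_zero top_unique divide_ennreal_def ennreal_top_mult ennreal_mult_top)
  then show ?thesis using assms by simp
next
  case False
  then have "ennreal (a / b) \<le> ennreal D" using assms by (simp add: divide_ennreal)
  then show ?thesis using False assms by (simp add: pos_divide_le_eq)
qed

lemma Lq_norm_1_le:
  fixes f :: "'a \<Rightarrow> real"
  assumes f: "f \<in> borel_measurable M" and le: "Lq_norm M 1 f \<le> ennreal c" and c: "c \<ge> 0"
  shows "integrable M f" "(\<integral>x. \<bar>f x\<bar> \<partial>M) \<le> c"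
proof -
  have eq: "(\<integral>\<^sup>+x. ennreal (norm (f x) powr 1) \<partial>M) = (\<integral>\<^sup>+x. ennreal (norm (f x)) \<partial>M)"
    by (simp add: powr_one)
  have ne: "(\<integral>\<^sup>+x. ennreal (norm (f x)) \<partial>M) \<noteq> \<infinity>"
  proof
    assume "(\<integral>\<^sup>+x. ennreal (norm (f x)) \<partial>M) = \<infinity>"
    then have "Lq_norm M 1 f = \<infinity>" unfolding Lq_norm_def eq by simp
    then show False using le by (simp add: top_unique)
  qed
  then show i: "integrable M f"
    using f by (intro integrableI_bounded) (auto simp: less_top)
  have "enn2real (\<integral>\<^sup>+x. ennreal (norm (f x)) \<partial>M) = (\<integral>x. \<bar>f x\<bar> \<partial>M)"
    using f i by (subst integral_eq_nn_integral) auto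
  then have "ennreal (\<integral>x. \<bar>f x\<bar> \<partial>M) \<le> ennreal c"
    using le ne unfolding Lq_norm_def eq by (simp add: Let_def powr_one)
  then show "(\<integral>x. \<bar>f x\<bar> \<partial>M) \<le> c" using c by (simp add: ennreal_le_iff)
qed

text \<open>Without atoms the strict and the weak inequality have the same probability, so both
  tails can be written with a weak one.\<close>

lemma (in prob_space) cdf_law:
  assumes [measurable]: "f \<in> borel_measurable M" and atomless: "\<And>t. measure (law M f) {t} = 0"
  shows "cdf (law M f) c = (\<integral>x. of_bool (f x \<le> c) \<partial>M)" "1 - cdf (law M f) c = (\<integral>x. of_bool (c \<le> f x) \<partial>M)"
proof -
  have eq: "(\<integral>x. of_bool (P x) \<partial>M) = measure M {x\<in>space M. P x}" if "Measurable.pred M P" for P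
  proof -
    have "(\<integral>x. of_bool (P x) \<partial>M) = (\<integral>x. indicator {x\<in>space M. P x} x \<partial>M)"
      by (rule Bochner_Integration.integral_cong) (auto simp: indicator_def)
    also have "\<dots> = measure M {x\<in>space M. P x}" using that by simp
    finally show ?thesis .
  qed
  have 1: "cdf (law M f) c = measure M {x\<in>space M. f x \<le> c}"
    unfolding cdf_def by (subst measure_distr) (auto simp: vimage_def Int_def conj_commute)
  then show "cdf (law M f) c = (\<integral>x. of_bool (f x \<le> c) \<partial>M)" by (subst eq) auto
  have z: "measure M {x\<in>space M. f x = c} = 0"
    using atomless[of c] by (subst (asm) measure_distr) (auto simp: vimage_def Int_def conj_commute)
  have "1 - cdf (law M f) c = measure M {x\<in>space M. \<not> f x \<le> c}"
    unfolding 1 by (subst prob_neg) auto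
  also have "\<dots> = measure M {x\<in>space M. c < f x}" by (simp add: not_le)
  also have "\<dots> = measure M {x\<in>space M. c \<le> f x}"
  proof -
    have "{x\<in>space M. c \<le> f x} = {x\<in>space M. c < f x} \<union> {x\<in>space M. f x = c}" by auto
    moreover have "measure M ({x\<in>space M. c < f x} \<union> {x\<in>space M. f x = c})
      = measure M {x\<in>space M. c < f x} + measure M {x\<in>space M. f x = c}"
      by (rule finite_measure_Union) auto
    ultimately show ?thesis using z by simp
  qed
  finally show "1 - cdf (law M f) c = (\<integral>x. of_bool (c \<le> f x) \<partial>M)" by (subst eq) auto
qed

context gibbs_markov
begin

text \<open>The strict inequality provides one null set off which the supremum stays below D. The
  seminorm compares only points of one element of \<alpha>, which is the first letter of the word;
  hence i \<ge> 1.\<close>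

lemma osc_of_lip_seminorm:
  fixes f :: "'a \<Rightarrow> real"
  assumes f: "f \<in> borel_measurable M" and lip: "lip_seminorm M T \<alpha> r \<alpha> f < ennreal D" and D: "D \<ge> 0" and i: "i \<ge> 1"
  shows "\<exists>N\<in>null_sets M. \<forall>w\<in>words \<alpha> i. \<forall>x\<in>cyl M T w - N. \<forall>y\<in>cyl M T w - N. norm (f x - f y) \<le> D * r ^ i"
proof -
  obtain N where N: "N \<in> null_sets M"
    "(SUP b\<in>\<alpha>. SUP (x, y)\<in>{(x, y). x \<in> b - N \<and> y \<in> b - N \<and> x \<noteq> y}.
        ennreal (norm (f x - f y)) / ennreal (sep_dist T \<alpha> r x y)) < ennreal D"
    using lip unfolding lip_seminorm_def INF_less_iff by blast
  have le: "norm (f x - f y) \<le> D * sep_dist T \<alpha> r x y"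
    if b: "b \<in> \<alpha>" and x: "x \<in> b - N" and y: "y \<in> b - N" and ne: "x \<noteq> y" for b x y
  proof (rule ennreal_quotient_le[OF _ _ _ D])
    have "ennreal (norm (f x - f y)) / ennreal (sep_dist T \<alpha> r x y) \<le>
      (SUP (x, y)\<in>{(x, y). x \<in> b - N \<and> y \<in> b - N \<and> x \<noteq> y}. ennreal (norm (f x - f y)) / ennreal (sep_dist T \<alpha> r x y))"
      by (rule SUP_upper2[of "(x, y)"]) (use x y ne in auto)
    also have "\<dots> \<le> (SUP b\<in>\<alpha>. SUP (x, y)\<in>{(x, y). x \<in> b - N \<and> y \<in> b - N \<and> x \<noteq> y}.
        ennreal (norm (f x - f y)) / ennreal (sep_dist T \<alpha> r x y))"
      by (rule SUP_upper[OF b])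
    also have "\<dots> \<le> ennreal D" using N(2) by (rule less_imp_le)
    finally show "ennreal (norm (f x - f y)) / ennreal (sep_dist T \<alpha> r x y) \<le> ennreal D" .
    show "0 \<le> sep_dist T \<alpha> r x y" using r_pos by (auto simp: sep_dist_def split: enat.splits)
  qed simp
  define G where "G x \<longleftrightarrow> (\<forall>i a b. a \<in> \<alpha> \<longrightarrow> b \<in> \<alpha> \<longrightarrow> (T ^^ i) x \<in> a \<longrightarrow> (T ^^ i) x \<in> b \<longrightarrow> a = b)" for x
  have "AE x in M. G x" unfolding G_def by (rule AE_unique)
  then obtain U where U: "U \<in> null_sets M" "{x\<in>space M. \<not> G x} \<subseteq> U"
    by (rule AE_null_cover)
  have "G x" if "x \<in> space M" "x \<notin> U" for x using U(2) that by blast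
  note uq = this[unfolded G_def, rule_format]
  show ?thesis
  proof (rule bexI[OF _ null_sets.Un[OF N(1) U(1)]], intro ballI)
    fix w x y assume w: "w \<in> words \<alpha> i" and x: "x \<in> cyl M T w - (N \<union> U)" and y: "y \<in> cyl M T w - (N \<union> U)"
    have len: "0 < length w" using w i by (simp add: words_def)
    then have w0: "w ! 0 \<in> \<alpha>" using nth_mem[OF len] w unfolding words_def by blast
    have "(T ^^ 0) x \<in> w ! 0" "(T ^^ 0) y \<in> w ! 0"
      using x y len unfolding cyl_def by blast+
    then have xy: "x \<in> w ! 0 - N" "y \<in> w ! 0 - N" using x y by simp_all
    have sp: "x \<in> space M" "y \<in> space M" using x y by (auto simp: cyl_def)
    have "sep_dist T \<alpha> r x y \<le> r ^ i"
    proof (rule sep_dist_le[OF w])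
      show "x \<in> cyl M T w" "y \<in> cyl M T w" using x y by auto
    next
      fix j a b assume "a \<in> \<alpha>" "b \<in> \<alpha>" "(T ^^ j) x \<in> a" "(T ^^ j) x \<in> b"
      then show "a = b" using x by (intro uq[OF sp(1)]) auto
    next
      fix j a b assume "a \<in> \<alpha>" "b \<in> \<alpha>" "(T ^^ j) y \<in> a" "(T ^^ j) y \<in> b"
      then show "a = b" using y by (intro uq[OF sp(2)]) auto
    qed
    then have "D * sep_dist T \<alpha> r x y \<le> D * r ^ i" using D by (rule mult_left_mono)
    then show "norm (f x - f y) \<le> D * r ^ i"
      using le[OF w0 xy] D r_pos by (cases "x = y") auto
  qed
qed

end

section \<open>The rank statistic\<close>

text \<open>The two samples have different lengths and start at index 1. Padding with zeros puts
  both on a common index range.\<close>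

lemma sum_index_restrict:
  fixes g :: "nat \<Rightarrow> real"
  assumes "n < N"
  shows "(\<Sum>j<N. if 1 \<le> j \<and> j \<le> n then g j else 0) = (\<Sum>j=1..n. g j)"
proof -
  have "(\<Sum>j\<in>{j\<in>{..<N}. 1 \<le> j \<and> j \<le> n}. g j) = (\<Sum>j<N. if 1 \<le> j \<and> j \<le> n then g j else 0)"
    by (rule sum.inter_filter) simp
  moreover have "{j\<in>{..<N}. 1 \<le> j \<and> j \<le> n} = {1..n}" using assms by auto
  ultimately show ?thesis by simp
qed

lemma integrable_If: "integrable M f \<Longrightarrow> integrable M (\<lambda>x. if P then f x else 0)"
  by (cases P) auto

lemma integral_If_zero: "(\<integral>x. f x \<partial>M) = 0 \<Longrightarrow> (\<integral>x. (if P then f x else 0) \<partial>M) = 0"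
  for f :: "'a \<Rightarrow> real"
  by (cases P) auto

locale rank_statistic = mixing_gibbs_markov +
  fixes \<phi> \<psi> :: "'a \<Rightarrow> real" and \<phi>s \<psi>s :: "nat \<Rightarrow> 'a \<Rightarrow> real"
    and n :: "nat \<Rightarrow> nat" and c :: real and \<sigma> :: "nat \<Rightarrow> real" and L0 :: real
  assumes \<phi>_meas[measurable]: "\<phi> \<in> borel_measurable M" and \<psi>_meas[measurable]: "\<psi> \<in> borel_measurable M"
    and \<phi>s_meas: "\<And>m. m \<ge> 1 \<Longrightarrow> \<phi>s m \<in> borel_measurable M"
    and \<psi>s_meas: "\<And>m. m \<ge> 1 \<Longrightarrow> \<psi>s m \<in> borel_measurable M"
    and \<phi>_atomless: "\<And>t. measure (law M \<phi>) {t} = 0" and \<psi>_atomless: "\<And>t. measure (law M \<psi>) {t} = 0"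
    and \<phi>_lip: "\<And>a b. \<bar>cdf (law M \<phi>) a - cdf (law M \<phi>) b\<bar> \<le> L0 * \<bar>a - b\<bar>"
    and \<psi>_lip: "\<And>a b. \<bar>cdf (law M \<psi>) a - cdf (law M \<psi>) b\<bar> \<le> L0 * \<bar>a - b\<bar>"
    and L0: "L0 \<ge> 0" and c: "0 < c" "c < 1"
    and n: "\<And>m. m \<ge> 1 \<Longrightarrow> n m > 0 \<and> c \<le> real (n m) / real m \<and> real (n m) / real m \<le> 1 / c"
    and \<sigma>_def: "\<sigma> = stat_sigma M T \<phi> \<psi> \<phi>s \<psi>s n"
    and var_A: "(\<lambda>m. variance (stat_A M T \<phi> \<psi> m (n m))) \<in> o(\<lambda>m. (\<sigma> m)\<^sup>2)"
    and \<phi>_close: "ennreal_smallo (\<lambda>m. Lq_norm M 1 (\<lambda>x. \<phi> x - \<phi>s m x)) (\<lambda>m. \<sigma> m / (real (n m) * real m))"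
    and \<psi>_close: "ennreal_smallo (\<lambda>m. Lq_norm M 1 (\<lambda>x. \<psi> x - \<psi>s (n m) x)) (\<lambda>m. \<sigma> m / (real (n m) * real m))"
    and \<phi>_regular: "ennreal_smallo (\<lambda>m. lip_seminorm M T \<alpha> r \<alpha> (\<phi>s m)) (\<lambda>m. (real m)\<^sup>2)"
    and \<psi>_regular: "ennreal_smallo (\<lambda>m. lip_seminorm M T \<alpha> r \<alpha> (\<psi>s (n m))) (\<lambda>m. (real (n m))\<^sup>2)"
    and \<sigma>_lower: "liminf (\<lambda>m. ereal (\<sigma> m * real m powr (-3/2))) > 0"
begin

abbreviation F :: "real \<Rightarrow> real" where "F \<equiv> cdf (law M \<phi>)"
abbreviation G :: "real \<Rightarrow> real" where "G \<equiv> cdf (law M \<psi>)"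

lemma F_meas[measurable]: "F \<in> borel_measurable borel" and G_meas[measurable]: "G \<in> borel_measurable borel"
proof -
  have "continuous_on UNIV F" "continuous_on UNIV G"
    by (rule lipschitz_on_continuous_on[of L0]; use \<phi>_lip \<psi>_lip L0 in \<open>auto simp: lipschitz_on_def dist_real_def\<close>)+
  then show "F \<in> borel_measurable borel" "G \<in> borel_measurable borel"
    by (auto intro: borel_measurable_continuous_onI)
qed

lemma FG01: "0 \<le> F t" "F t \<le> 1" "0 \<le> G t" "G t \<le> 1"
proof -
  interpret X: real_distribution "law M \<phi>" by (rule real_distribution_distr) simp
  interpret Y: real_distribution "law M \<psi>" by (rule real_distribution_distr) simp
  show "0 \<le> F t" "F t \<le> 1" "0 \<le> G t" "G t \<le> 1"
    by (rule X.cdf_nonneg X.cdf_bounded_prob Y.cdf_nonneg Y.cdf_bounded_prob)+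
qed

text \<open>\<open>b\<close> and \<open>e\<close> are the kernels of the linear part: the
  probability that the comparison succeeds against an independent partner, given the value of one
  approximation.\<close>

definition b :: "nat \<Rightarrow> 'a \<Rightarrow> real" where "b m x = 1 - F (\<psi>s (n m) x)"
definition e :: "nat \<Rightarrow> 'a \<Rightarrow> real" where "e m x = G (\<phi>s m x)"
text \<open>Normalizes the summands to modulus at most 1: the kernel \<open>b\<close> contributes 1
  and the weight n / m of \<open>e\<close> at most 1 / c.\<close>

definition C0 :: real where "C0 = 1 + 1 / c"

lemma C0: "C0 \<ge> 1" "C0 > 0" using c by (auto simp: C0_def add_pos_pos)

lemma be_meas: "m \<ge> 1 \<Longrightarrow> b m \<in> borel_measurable M" "m \<ge> 1 \<Longrightarrow> e m \<in> borel_measurable M"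
  unfolding b_def[abs_def] e_def[abs_def]
  using \<psi>s_meas[of "n m"] \<phi>s_meas[of m] n[of m] by (auto intro!: borel_measurable_diff measurable_compose[OF _ F_meas] measurable_compose[OF _ G_meas])

lemma be01: "0 \<le> b m x" "b m x \<le> 1" "0 \<le> e m x" "e m x \<le> 1"
  using FG01 by (auto simp: b_def e_def)

lemma unit_mean: "g \<in> unit_funs M \<Longrightarrow> 0 \<le> (\<integral>x. g x \<partial>M) \<and> (\<integral>x. g x \<partial>M) \<le> 1"
proof -
  assume g: "g \<in> unit_funs M"
  have "(\<integral>x. g x \<partial>M) \<le> (\<integral>x. 1 \<partial>M)"
    by (rule integral_mono[OF unit_funs_integrable[OF g]]) (use unit_funsD(3)[OF g] in auto)
  moreover have "0 \<le> (\<integral>x. g x \<partial>M)" by (rule Bochner_Integration.integral_nonneg) (rule unit_funsD(2)[OF g])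
  ultimately show ?thesis by (simp add: prob_space)
qed

lemma be_unit: "m \<ge> 1 \<Longrightarrow> b m \<in> unit_funs M" "m \<ge> 1 \<Longrightarrow> e m \<in> unit_funs M"
  using be_meas be01 by (auto simp: unit_funs_def)

text \<open>Dividing m B + n C by m keeps both weights bounded, because n / m is. The index j enters
  only through the lengths of the two samples.\<close>

definition summand :: "nat \<Rightarrow> nat \<Rightarrow> 'a \<Rightarrow> real" where
  "summand m j x = (if 1 \<le> j \<and> j \<le> n m then b m x - (\<integral>x. b m x \<partial>M) else 0) / C0
    + (if 1 \<le> j \<and> j \<le> m then real (n m) / real m * (e m x - (\<integral>x. e m x \<partial>M)) else 0) / C0"

lemma unit_centered: "g \<in> unit_funs M \<Longrightarrow> \<bar>g x - (\<integral>x. g x \<partial>M)\<bar> \<le> 1"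
  using unit_mean[of g] unit_funsD(2,3)[of g M x] by (simp add: abs_le_iff)

lemma summand_bound:
  assumes "m \<ge> 1" shows "\<bar>summand m j x\<bar> \<le> 1"
proof -
  have 1: "\<bar>if 1 \<le> j \<and> j \<le> n m then b m x - (\<integral>x. b m x \<partial>M) else 0\<bar> \<le> 1"
    using unit_centered[OF be_unit(1)[OF assms], of x] by simp
  have "real (n m) / real m * \<bar>e m x - (\<integral>x. e m x \<partial>M)\<bar> \<le> 1 / c * 1"
    using unit_centered[OF be_unit(2)[OF assms], of x] n[OF assms] c by (intro mult_mono) auto
  then have 2: "\<bar>if 1 \<le> j \<and> j \<le> m then real (n m) / real m * (e m x - (\<integral>x. e m x \<partial>M)) else 0\<bar> \<le> 1 / c"
    using c by (simp add: abs_mult)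
  have "\<bar>summand m j x\<bar> \<le> 1 / C0 + (1 / c) / C0"
    unfolding summand_def using C0(2)
    by (intro order_trans[OF abs_triangle_ineq] add_mono) (simp_all only: abs_divide abs_of_pos, (intro divide_right_mono 1 2; simp)+)
  also have "\<dots> = (1 + 1 / c) / C0" by (simp only: add_divide_distrib)
  also have "\<dots> = 1" using C0(2) by (simp add: C0_def[symmetric])
  finally show ?thesis .
qed

lemma summand_meas: "m \<ge> 1 \<Longrightarrow> summand m j \<in> borel_measurable M"
  unfolding summand_def[abs_def] using be_meas by (auto intro!: borel_measurable_add borel_measurable_diff borel_measurable_divide borel_measurable_times)

lemma summand_mean:
  assumes "m \<ge> 1" shows "(\<integral>x. summand m j x \<partial>M) = 0"
proof -
  have i: "integrable M (b m)" "integrable M (e m)" using unit_funs_integrable be_unit[OF assms] by auto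
  have i1: "integrable M (\<lambda>x. if 1 \<le> j \<and> j \<le> n m then b m x - (\<integral>x. b m x \<partial>M) else 0)" and
    i2: "integrable M (\<lambda>x. if 1 \<le> j \<and> j \<le> m then real (n m) / real m * (e m x - (\<integral>x. e m x \<partial>M)) else 0)"
    by (rule integrable_If; simp add: i)+
  have "(\<integral>x. b m x - (\<integral>x. b m x \<partial>M) \<partial>M) = 0" "(\<integral>x. e m x - (\<integral>x. e m x \<partial>M) \<partial>M) = 0"
    using i by (simp_all add: prob_space)
  then have "(\<integral>x. (if 1 \<le> j \<and> j \<le> n m then b m x - (\<integral>x. b m x \<partial>M) else 0) \<partial>M) = 0"
    "(\<integral>x. (if 1 \<le> j \<and> j \<le> m then real (n m) / real m * (e m x - (\<integral>x. e m x \<partial>M)) else 0) \<partial>M) = 0"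
    by - (rule integral_If_zero; simp)+
  then show ?thesis unfolding summand_def
    by (subst Bochner_Integration.integral_add[OF integrable_divide[OF i1] integrable_divide[OF i2]]) simp
qed

text \<open>F and G are Lipschitz continuous, so the kernels inherit the oscillation of the
  approximations. Dividing by C0 \<ge> 1 only decreases it, and 1 / c bounds the weight n /
  m.\<close>

lemma summand_osc:
  assumes m: "m \<ge> 1" and f: "osc k D1 (\<phi>s m)" and g: "osc k D2 (\<psi>s (n m))"
  shows "osc k (L0 * D2 + L0 / c * D1) (summand m j)"
proof -
  have d1: "\<bar>a / C0\<bar> \<le> \<bar>a\<bar>" for a :: real
  proof -
    have "\<bar>a\<bar> / C0 \<le> \<bar>a\<bar> / 1" using C0 by (intro divide_left_mono) auto
    then show ?thesis using C0 by simp
  qed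
  have lF: "norm ((if P then 1 - F a - z else 0) / C0 - (if P then 1 - F a' - z else 0) / C0) \<le> L0 * norm (a - a')" for P a a' z
  proof -
    have "norm ((if P then 1 - F a - z else 0) / C0 - (if P then 1 - F a' - z else 0) / C0)
      = \<bar>(if P then F a' - F a else 0) / C0\<bar>" by (cases P) (simp_all add: diff_divide_distrib[symmetric])
    also have "\<dots> \<le> \<bar>if P then F a' - F a else 0\<bar>" by (rule d1)
    also have "\<dots> \<le> L0 * norm (a - a')" using \<phi>_lip[of a' a] L0 by (simp add: abs_minus_commute)
    finally show ?thesis .
  qed
  have lG: "norm ((if P then real (n m) / real m * (G a - z) else 0) / C0 - (if P then real (n m) / real m * (G a' - z) else 0) / C0)
     \<le> L0 / c * norm (a - a')" for P a a' z
  proof -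
    have "norm ((if P then real (n m) / real m * (G a - z) else 0) / C0 - (if P then real (n m) / real m * (G a' - z) else 0) / C0)
      = \<bar>(if P then real (n m) / real m * (G a - G a') else 0) / C0\<bar>"
      by (cases P) (simp_all add: diff_divide_distrib[symmetric] right_diff_distrib)
    also have "\<dots> \<le> \<bar>if P then real (n m) / real m * (G a - G a') else 0\<bar>" by (rule d1)
    also have "\<dots> \<le> real (n m) / real m * \<bar>G a - G a'\<bar>" by (simp add: abs_mult)
    also have "\<dots> \<le> 1 / c * (L0 * \<bar>a - a'\<bar>)" using n[OF m] \<psi>_lip[of a a'] c by (intro mult_mono) auto
    finally show ?thesis by simp
  qed
  have fm: "\<phi>s m \<in> borel_measurable M" and gm: "\<psi>s (n m) \<in> borel_measurable M"
    using oscD[OF f] oscD[OF g] by auto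
  have "osc k (L0 * D2) (\<lambda>x. (if 1 \<le> j \<and> j \<le> n m then 1 - F (\<psi>s (n m) x) - (\<integral>x. b m x \<partial>M) else 0) / C0)"
    by (rule osc_lipschitz[OF g _ lF L0]) (use gm in \<open>auto intro!: borel_measurable_diff borel_measurable_divide measurable_compose[OF _ F_meas]\<close>)
  moreover have "osc k (L0 / c * D1) (\<lambda>x. (if 1 \<le> j \<and> j \<le> m then real (n m) / real m * (G (\<phi>s m x) - (\<integral>x. e m x \<partial>M)) else 0) / C0)"
    by (rule osc_lipschitz[OF f _ lG]) (use fm L0 c in \<open>auto intro!: borel_measurable_diff borel_measurable_divide borel_measurable_times measurable_compose[OF _ G_meas]\<close>)
  ultimately show ?thesis
    using osc_add summand_meas[OF m, of j] unfolding summand_def[abs_def] b_def e_def by blast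
qed

lemma stat_B_eq:
  assumes m: "m \<ge> 1"
  shows "stat_B M T \<phi> \<psi>s (n m) x = (\<Sum>j=1..n m. b m ((T ^^ j) x) - (\<integral>x. b m x \<partial>M))"
proof -
  have "(\<integral>s. 1 - F s \<partial>law M (\<psi>s (n m))) = (\<integral>x. b m x \<partial>M)"
    using \<psi>s_meas[of "n m"] n[OF m] unfolding b_def by (subst integral_distr) auto
  then show ?thesis unfolding stat_B_def b_def[symmetric] by (simp add: sum_subtractf)
qed

lemma stat_C_eq:
  assumes m: "m \<ge> 1"
  shows "stat_C M T \<psi> \<phi>s m x = (\<Sum>j=1..m. e m ((T ^^ j) x) - (\<integral>x. e m x \<partial>M))"
proof -
  have "(\<integral>s. G s \<partial>law M (\<phi>s m)) = (\<integral>x. e m x \<partial>M)"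
    using \<phi>s_meas[OF m] unfolding e_def by (subst integral_distr) auto
  then show ?thesis unfolding stat_C_def e_def[symmetric] by (simp add: sum_subtractf)
qed

lemma stat_BC_eq:
  assumes m: "m \<ge> 1" and N: "m < N" "n m < N"
  shows "real m * stat_B M T \<phi> \<psi>s (n m) x + real (n m) * stat_C M T \<psi> \<phi>s m x
    = real m * C0 * (\<Sum>j<N. summand m j ((T ^^ j) x))"
proof -
  have "(\<Sum>j<N. summand m j ((T ^^ j) x)) = stat_B M T \<phi> \<psi>s (n m) x / C0
    + real (n m) / real m * stat_C M T \<psi> \<phi>s m x / C0"
    unfolding summand_def sum.distrib sum_divide_distrib[symmetric]
      sum_index_restrict[OF N(2)] sum_index_restrict[OF N(1)] stat_B_eq[OF m] stat_C_eq[OF m]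
      sum_distrib_left[symmetric] by simp
  then show ?thesis using m C0(2) by (simp add: field_simps)
qed

lemma BC_meas:
  assumes m: "m \<ge> 1"
  shows "stat_B M T \<phi> \<psi>s (n m) \<in> borel_measurable M" "stat_C M T \<psi> \<phi>s m \<in> borel_measurable M"
proof -
  have [measurable]: "(\<lambda>x. b m ((T ^^ j) x)) \<in> borel_measurable M" "(\<lambda>x. e m ((T ^^ j) x)) \<in> borel_measurable M" for j
    using measurable_compose[OF Tn_meas be_meas(1)[OF m]] measurable_compose[OF Tn_meas be_meas(2)[OF m]] by auto
  show "stat_B M T \<phi> \<psi>s (n m) \<in> borel_measurable M" "stat_C M T \<psi> \<phi>s m \<in> borel_measurable M"
    unfolding stat_B_eq[OF m, abs_def] stat_C_eq[OF m, abs_def] by measurable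
qed

lemma BC_bound:
  assumes m: "m \<ge> 1"
  shows "\<bar>stat_B M T \<phi> \<psi>s (n m) x\<bar> \<le> real (n m)" "\<bar>stat_C M T \<psi> \<phi>s m x\<bar> \<le> real m"
proof -
  have "\<bar>stat_B M T \<phi> \<psi>s (n m) x\<bar> \<le> (\<Sum>j=1..n m. 1)"
    unfolding stat_B_eq[OF m] by (rule order_trans[OF sum_abs sum_mono]) (rule unit_centered[OF be_unit(1)[OF m]])
  then show "\<bar>stat_B M T \<phi> \<psi>s (n m) x\<bar> \<le> real (n m)" by simp
  have "\<bar>stat_C M T \<psi> \<phi>s m x\<bar> \<le> (\<Sum>j=1..m. 1)"
    unfolding stat_C_eq[OF m] by (rule order_trans[OF sum_abs sum_mono]) (rule unit_centered[OF be_unit(2)[OF m]])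
  then show "\<bar>stat_C M T \<psi> \<phi>s m x\<bar> \<le> real m" by simp
qed

lemma BC_mean:
  assumes m: "m \<ge> 1"
  shows "(\<integral>x. stat_B M T \<phi> \<psi>s (n m) x \<partial>M) = 0" "(\<integral>x. stat_C M T \<psi> \<phi>s m x \<partial>M) = 0"
proof -
  have i: "integrable M (\<lambda>x. b m ((T ^^ j) x))" "integrable M (\<lambda>x. e m ((T ^^ j) x))" for j
    using unit_funs_integrable[OF unit_funs_Tn] be_unit[OF m] by auto
  show "(\<integral>x. stat_B M T \<phi> \<psi>s (n m) x \<partial>M) = 0" "(\<integral>x. stat_C M T \<psi> \<phi>s m x \<partial>M) = 0"
    unfolding stat_B_eq[OF m] stat_C_eq[OF m]
    using i integral_Tn[OF be_meas(1)[OF m]] integral_Tn[OF be_meas(2)[OF m]]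
    by (simp_all add: Bochner_Integration.integral_sum prob_space)
qed

text \<open>Both statistics are centred, so \<sigma> squared is the second moment of m B + n C,
  which is a multiple of the array sum. Any N beyond both sample sizes may be used, as the summands
  vanish there.\<close>

lemma sigma_square:
  assumes m: "m \<ge> 1" and N: "m < N" "n m < N"
  shows "\<sigma> m \<ge> 0" "(\<sigma> m)\<^sup>2 = (real m * C0)\<^sup>2 * (\<integral>x. (\<Sum>j<N. summand m j ((T ^^ j) x))\<^sup>2 \<partial>M)"
proof -
  let ?B = "stat_B M T \<phi> \<psi>s (n m)" and ?C = "stat_C M T \<psi> \<phi>s m"
  note meas[measurable] = BC_meas[OF m]
  have bB: "\<bar>?B x\<bar> \<le> real (n m)" and bC: "\<bar>?C x\<bar> \<le> real m" for x using BC_bound[OF m] by auto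
  have iBB: "integrable M (\<lambda>x. (?B x)\<^sup>2)"
    by (rule integrable_const_bound[of _ "(real (n m))\<^sup>2"]) (use bB in \<open>auto simp: abs_le_square_iff[symmetric]\<close>)
  have iCC: "integrable M (\<lambda>x. (?C x)\<^sup>2)"
    by (rule integrable_const_bound[of _ "(real m)\<^sup>2"]) (use bC in \<open>auto simp: abs_le_square_iff[symmetric]\<close>)
  have iBC: "integrable M (\<lambda>x. ?B x * ?C x)"
    by (rule integrable_const_bound[of _ "real (n m) * real m"]) (use bB bC in \<open>auto simp: abs_mult intro!: AE_I2 mult_mono\<close>)
  let ?Z = "\<integral>x. (real m * ?B x + real (n m) * ?C x)\<^sup>2 \<partial>M"
  have exp: "(real m * ?B x + real (n m) * ?C x)\<^sup>2
    = (real m)\<^sup>2 * (?B x)\<^sup>2 + (real (n m))\<^sup>2 * (?C x)\<^sup>2 + 2 * real (n m) * real m * (?B x * ?C x)" for x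
    by (simp add: power2_eq_square algebra_simps)
  have "?Z = (real m)\<^sup>2 * (\<integral>x. (?B x)\<^sup>2 \<partial>M) + (real (n m))\<^sup>2 * (\<integral>x. (?C x)\<^sup>2 \<partial>M)
    + 2 * real (n m) * real m * (\<integral>x. ?B x * ?C x \<partial>M)"
    unfolding exp using iBB iCC iBC by simp
  then have \<sigma>: "\<sigma> m = sqrt ?Z"
    unfolding \<sigma>_def stat_sigma_def covariance_def BC_mean[OF m] by simp
  have Z: "?Z \<ge> 0" by simp
  show "\<sigma> m \<ge> 0" unfolding \<sigma> using Z by simp
  have "(\<sigma> m)\<^sup>2 = ?Z" unfolding \<sigma> using Z by simp
  also have "\<dots> = (real m * C0)\<^sup>2 * (\<integral>x. (\<Sum>j<N. summand m j ((T ^^ j) x))\<^sup>2 \<partial>M)"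
    unfolding stat_BC_eq[OF m N] power_mult_distrib[of "real m * C0"] by simp
  finally show "(\<sigma> m)\<^sup>2 = (real m * C0)\<^sup>2 * (\<integral>x. (\<Sum>j<N. summand m j ((T ^^ j) x))\<^sup>2 \<partial>M)" .
qed

end

lemma powr_times_stretched_exp:
  "l < 0 \<Longrightarrow> (\<lambda>m. real m powr a * exp ((real m powr (1 / 20) - 1) * l)) \<longlonglongrightarrow> 0" for a l :: real
  by real_asymp

section \<open>Memory length, gaps and regularity constants\<close>

context rank_statistic
begin

text \<open>The memory length. The exponent 1/20 keeps the gap k + 2 k^2 of order m^(1/10), while
  \<open>\<rho> ^ \<kappa> m\<close> decays faster than every power of m, as \<open>tiny\<close>
  shows.\<close>

definition \<kappa> :: "nat \<Rightarrow> nat" where "\<kappa> m = nat \<lfloor>real m powr (1 / 20)\<rfloor>"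
definition \<rho> :: real where "\<rho> = max r \<theta>"

lemma \<rho>: "0 < \<rho>" "\<rho> < 1" "r \<le> \<rho>" "\<theta> \<le> \<rho>"
  using r_pos r_less_1 C_\<theta> by (auto simp: \<rho>_def)

lemma \<kappa>:
  assumes "m \<ge> 1"
  shows "\<kappa> m \<ge> 1" "real (\<kappa> m) \<le> real m powr (1 / 20)" "real m powr (1 / 20) - 1 \<le> real (\<kappa> m)"
proof -
  have 1: "1 \<le> real m powr (1 / 20)" using assms by (intro ge_one_powr_ge_zero) auto
  then have "1 \<le> \<lfloor>real m powr (1 / 20)\<rfloor>" by simp
  then show "\<kappa> m \<ge> 1" unfolding \<kappa>_def by linarith
  show "real (\<kappa> m) \<le> real m powr (1 / 20)" "real m powr (1 / 20) - 1 \<le> real (\<kappa> m)"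
    unfolding \<kappa>_def using 1 by linarith+
qed

lemma tiny: "(\<lambda>m. real m powr a * \<rho> ^ \<kappa> m) \<longlonglongrightarrow> 0"
proof (rule tendsto_sandwich[OF _ _ tendsto_const])
  show "\<forall>\<^sub>F m in sequentially. 0 \<le> real m powr a * \<rho> ^ \<kappa> m" using \<rho> by simp
  have le: "real m powr a * \<rho> ^ \<kappa> m \<le> real m powr a * exp ((real m powr (1 / 20) - 1) * ln \<rho>)" if m: "m \<ge> 1" for m
  proof -
    have "\<rho> ^ \<kappa> m = exp (real (\<kappa> m) * ln \<rho>)" using \<rho> by (simp add: powr_realpow[symmetric] powr_def)
    also have "\<dots> \<le> exp ((real m powr (1 / 20) - 1) * ln \<rho>)"
      using \<kappa>(3)[OF m] \<rho> by (simp add: mult_right_mono_neg)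
    finally show ?thesis by (rule mult_left_mono) simp
  qed
  show "\<forall>\<^sub>F m in sequentially. real m powr a * \<rho> ^ \<kappa> m \<le> real m powr a * exp ((real m powr (1 / 20) - 1) * ln \<rho>)"
    by (rule eventually_mono[OF eventually_ge_at_top[of 1]]) (rule le)
  have l: "ln \<rho> < 0" using \<rho> by simp
  show "(\<lambda>m. real m powr a * exp ((real m powr (1 / 20) - 1) * ln \<rho>)) \<longlonglongrightarrow> 0"
    by (rule powr_times_stretched_exp[OF l])
qed

definition q\<^sub>m :: "nat \<Rightarrow> nat" where "q\<^sub>m m = \<kappa> m + 2 * (\<kappa> m)\<^sup>2"

lemma q\<^sub>m_le:
  assumes m: "m \<ge> 1"
  shows "real (q\<^sub>m m) \<le> 3 * real m powr (1 / 10)" "q\<^sub>m m \<ge> 1"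
proof -
  have "real (\<kappa> m) \<le> (real (\<kappa> m))\<^sup>2" using \<kappa>(1)[OF m] by (simp add: power2_eq_square)
  then have "real (q\<^sub>m m) \<le> 3 * (real (\<kappa> m))\<^sup>2" by (simp add: q\<^sub>m_def)
  also have "\<dots> \<le> 3 * (real m powr (1 / 20))\<^sup>2" using \<kappa>(2)[OF m] by (intro mult_left_mono power_mono) auto
  also have "(real m powr (1 / 20))\<^sup>2 = real m powr (1 / 10)" using m by (simp add: power2_eq_square powr_add[symmetric])
  finally show "real (q\<^sub>m m) \<le> 3 * real m powr (1 / 10)" .
  show "q\<^sub>m m \<ge> 1" using \<kappa>(1)[OF m] by (simp add: q\<^sub>m_def)
qed

lemma n_le: "m \<ge> 1 \<Longrightarrow> real (n m) \<le> real m / c" and n_ge: "m \<ge> 1 \<Longrightarrow> c * real m \<le> real (n m)"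
  using n[of m] c by (auto simp: field_simps)

text \<open>1 / c^2 converts n^2 into m^2. The summand 2 covers the coefficient 1 of the other
  sample and leaves room for the strict inequality in \<open>osc_of_lip_seminorm\<close>.\<close>

definition CR :: real where "CR = 1 / c\<^sup>2 + 2"

text \<open>The word length i stays free because it is not always tied to the index:
  \<open>far_pairs\<close> uses the approximations with index m^8 on words of length
  \<open>\<kappa> m\<close>.\<close>

lemma regular_ev:
  "\<forall>\<^sub>F m in sequentially. \<forall>i\<ge>1. osc i (CR * (real m)\<^sup>2 * r ^ i) (\<phi>s m) \<and> osc i (CR * (real m)\<^sup>2 * r ^ i) (\<psi>s (n m))"
proof -
  have 1: "\<forall>\<^sub>F m in sequentially. lip_seminorm M T \<alpha> r \<alpha> (\<phi>s m) \<le> ennreal (1 * \<bar>(real m)\<^sup>2\<bar>)"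
    using \<phi>_regular unfolding ennreal_smallo_def by (elim allE[of _ 1]) simp
  have 2: "\<forall>\<^sub>F m in sequentially. lip_seminorm M T \<alpha> r \<alpha> (\<psi>s (n m)) \<le> ennreal (1 * \<bar>(real (n m))\<^sup>2\<bar>)"
    using \<psi>_regular unfolding ennreal_smallo_def by (elim allE[of _ 1]) simp
  show ?thesis
    using 1 2 eventually_ge_at_top[of 1]
  proof eventually_elim
    case (elim m)
    have m1: "1 \<le> (real m)\<^sup>2" using elim(3) by simp
    have "(real (n m))\<^sup>2 \<le> (real m / c)\<^sup>2" using n_le[OF elim(3)] by (intro power_mono) auto
    then have le: "(real (n m))\<^sup>2 \<le> (real m)\<^sup>2 / c\<^sup>2" by (simp add: power_divide)
    have eq: "CR * (real m)\<^sup>2 = (real m)\<^sup>2 / c\<^sup>2 + 2 * (real m)\<^sup>2" by (simp add: CR_def distrib_right)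
    have nn: "0 \<le> (real m)\<^sup>2 / c\<^sup>2" by simp
    have n2: "(real (n m))\<^sup>2 + 1 \<le> CR * (real m)\<^sup>2" and m2: "(real m)\<^sup>2 + 1 \<le> CR * (real m)\<^sup>2"
      using m1 le nn unfolding eq by linarith+
    have lt1: "lip_seminorm M T \<alpha> r \<alpha> (\<phi>s m) < ennreal (CR * (real m)\<^sup>2)"
      using elim(1) by (rule order.strict_trans1) (use m2 in \<open>simp add: ennreal_less_iff\<close>)
    have lt2: "lip_seminorm M T \<alpha> r \<alpha> (\<psi>s (n m)) < ennreal (CR * (real m)\<^sup>2)"
      using elim(2) by (rule order.strict_trans1) (use n2 in \<open>simp add: ennreal_less_iff\<close>)
    have D0: "0 \<le> CR * (real m)\<^sup>2" using m1 m2 by linarith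
    show ?case
    proof (intro allI impI)
      fix i :: nat assume i: "1 \<le> i"
      have n1: "n m \<ge> 1" using n[OF elim(3)] by simp
      show "osc i (CR * (real m)\<^sup>2 * r ^ i) (\<phi>s m) \<and> osc i (CR * (real m)\<^sup>2 * r ^ i) (\<psi>s (n m))"
        using osc_of_lip_seminorm[OF \<phi>s_meas[OF elim(3)] lt1 D0 i] osc_of_lip_seminorm[OF \<psi>s_meas[OF n1] lt2 D0 i]
          \<phi>s_meas[OF elim(3)] \<psi>s_meas[OF n1] unfolding osc_def by blast
    qed
  qed
qed

text \<open>The Lipschitz constants of the summand in its two approximations, times their regularity
  constant.\<close>

definition CL :: real where "CL = (L0 + L0 / c) * CR"

lemma CR_pos: "CR > 0" using c by (simp add: CR_def add_pos_pos)
lemma CL_nonneg: "CL \<ge> 0" using L0 c CR_pos by (simp add: CL_def)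

definition \<eta>\<^sub>m :: "nat \<Rightarrow> real" where "\<eta>\<^sub>m m = CL * (real m)\<^sup>2 * \<rho> ^ \<kappa> m"

lemma array_ev: "\<forall>\<^sub>F m in sequentially. bounded_array M T \<alpha> r (summand m) (\<kappa> m) (\<eta>\<^sub>m m)"
  using regular_ev eventually_ge_at_top[of 1]
proof eventually_elim
  case (elim m)
  have k: "\<kappa> m \<ge> 1" using \<kappa>(1)[OF elim(2)] .
  have o: "osc (\<kappa> m) (CR * (real m)\<^sup>2 * r ^ \<kappa> m) (\<phi>s m)" "osc (\<kappa> m) (CR * (real m)\<^sup>2 * r ^ \<kappa> m) (\<psi>s (n m))"
    using elim(1) k by auto
  have "CL * (real m)\<^sup>2 * r ^ \<kappa> m \<le> \<eta>\<^sub>m m"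
    unfolding \<eta>\<^sub>m_def using CL_nonneg \<rho> r_pos by (intro mult_left_mono power_mono) auto
  moreover have "L0 * (CR * (real m)\<^sup>2 * r ^ \<kappa> m) + L0 / c * (CR * (real m)\<^sup>2 * r ^ \<kappa> m) = CL * (real m)\<^sup>2 * r ^ \<kappa> m"
    by (simp add: CL_def algebra_simps)
  ultimately have le: "L0 * (CR * (real m)\<^sup>2 * r ^ \<kappa> m) + L0 / c * (CR * (real m)\<^sup>2 * r ^ \<kappa> m) \<le> \<eta>\<^sub>m m" by simp
  show ?case
  proof unfold_locales
    show "osc (\<kappa> m) (\<eta>\<^sub>m m) (summand m j)" for j
      by (rule osc_mono[OF summand_osc[OF elim(2) o] order_refl le])
    show "\<bar>summand m j x\<bar> \<le> 1" for j x by (rule summand_bound[OF elim(2)])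
    show "(\<integral>x. summand m j x \<partial>M) = 0" for j by (rule summand_mean[OF elim(2)])
    show "\<kappa> m \<ge> 1" by fact
    show "0 \<le> \<eta>\<^sub>m m" using CL_nonneg \<rho> by (simp add: \<eta>\<^sub>m_def)
  qed
qed

definition CT :: real where "CT = 2 * CL + 4 * C"

lemma rate_le: "rate k \<le> 4 * C * \<rho> ^ k"
  unfolding rate_def using C_\<theta> \<rho> by (intro mult_left_mono power_mono) auto

text \<open>The mixing rate carries no power of m; it is enlarged by m^2 so that one constant covers
  it together with the oscillation.\<close>

lemma \<tau>_le:
  assumes "m \<ge> 1"
  shows "2 * \<eta>\<^sub>m m + rate (\<kappa> m) \<le> CT * (real m)\<^sup>2 * \<rho> ^ \<kappa> m"
proof -
  have "1 \<le> (real m)\<^sup>2" using assms by simp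
  then have "4 * C * \<rho> ^ \<kappa> m * 1 \<le> 4 * C * \<rho> ^ \<kappa> m * (real m)\<^sup>2"
    using C_\<theta> \<rho> by (intro mult_left_mono) auto
  then show ?thesis using rate_le[of "\<kappa> m"] by (simp add: CT_def \<eta>\<^sub>m_def algebra_simps)
qed

lemma CT_nonneg: "CT \<ge> 0" using CL_nonneg C_\<theta> by (simp add: CT_def)

text \<open>Samples are indexed from 1, so a range starting at 0 has to be one longer than the
  longer sample.\<close>

definition N\<^sub>m :: "nat \<Rightarrow> nat" where "N\<^sub>m m = max m (n m) + 1"

lemma N\<^sub>m_le: "m \<ge> 1 \<Longrightarrow> real (N\<^sub>m m) \<le> 2 / c * real m"
proof -
  assume m: "m \<ge> 1"
  have "real m \<le> real m / c" using m c by (simp add: field_simps)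
  then have "real (max m (n m)) \<le> real m / c" using n_le[OF m] by simp
  moreover have "1 \<le> real m / c" using m c by (simp add: field_simps)
  ultimately show ?thesis unfolding N\<^sub>m_def by simp
qed

text \<open>The second moment of the array sum is at most of order m q with q of order m^(1/10), so
  \<sigma> is at most of order m^(31/20). Enlarging the exponent to 7/4 absorbs all constants; being
  below 2, it still makes \<sigma> / (n m) decay like a power of m.\<close>

lemma sigma_upper: "\<forall>\<^sub>F m in sequentially. \<sigma> m \<le> real m powr (7 / 4)"
proof -
  let ?g = "\<lambda>m. C0\<^sup>2 * (12 / c) * real m powr (- 2 / 5) + C0\<^sup>2 * (4 / c\<^sup>2) * CT * (real m powr (5 / 2) * \<rho> ^ \<kappa> m)"
  have "?g \<longlonglongrightarrow> C0\<^sup>2 * (12 / c) * 0 + C0\<^sup>2 * (4 / c\<^sup>2) * CT * 0"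
    by (intro tendsto_add tendsto_mult tendsto_const tiny) real_asymp
  then have "\<forall>\<^sub>F m in sequentially. ?g m < 1" by (intro order_tendstoD(2)) auto
  then show ?thesis
    using array_ev eventually_ge_at_top[of 1]
  proof eventually_elim
    case (elim m)
    interpret A: bounded_array M T \<alpha> r "summand m" "\<kappa> m" "\<eta>\<^sub>m m" by (rule elim(2))
    note m = elim(3)
    let ?x = "real m"
    have N: "m < N\<^sub>m m" "n m < N\<^sub>m m" by (auto simp: N\<^sub>m_def)
    have q: "A.q = q\<^sub>m m" by (simp add: A.q_def q\<^sub>m_def)
    have "(\<sigma> m)\<^sup>2 = (?x * C0)\<^sup>2 * (\<integral>x. (A.S {..<N\<^sub>m m} x)\<^sup>2 \<partial>M)"
      unfolding sigma_square(2)[OF m N] A.S_def ..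
    also have "\<dots> \<le> (?x * C0)\<^sup>2 * (real (N\<^sub>m m) * (2 * real (q\<^sub>m m)) + (real (N\<^sub>m m))\<^sup>2 * A.\<tau>)"
      using A.S_second_moment[of "{..<N\<^sub>m m}"] unfolding q by (intro mult_left_mono) auto
    also have "\<dots> \<le> (?x * C0)\<^sup>2 * ((2 / c * ?x) * (2 * (3 * ?x powr (1 / 10))) + (2 / c * ?x)\<^sup>2 * (CT * ?x\<^sup>2 * \<rho> ^ \<kappa> m))"
      using N\<^sub>m_le[OF m] q\<^sub>m_le[OF m] \<tau>_le[OF m] A.\<tau>_nonneg c CT_nonneg \<rho>
      by (intro mult_left_mono add_mono mult_mono power_mono) (auto simp: A.\<tau>_def)
    also have "\<dots> = ?x powr (7 / 2) * ?g m"
    proof -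
      have p: "?x powr (7 / 2) * ?x powr (- 2 / 5) = ?x ^ 3 * ?x powr (1 / 10)" "?x powr (7 / 2) * ?x powr (5 / 2) = ?x ^ 6"
      proof -
        have "?x ^ 3 = ?x powr 3" using m by simp
        then show "?x powr (7 / 2) * ?x powr (- 2 / 5) = ?x ^ 3 * ?x powr (1 / 10)"
          by (simp only: powr_add[symmetric]) simp
        have "?x powr (7 / 2) * ?x powr (5 / 2) = ?x powr 6" by (simp only: powr_add[symmetric]) simp
        then show "?x powr (7 / 2) * ?x powr (5 / 2) = ?x ^ 6" using m by simp
      qed
      have "?x powr (7 / 2) * ?g m = C0\<^sup>2 * (12 / c) * (?x powr (7 / 2) * ?x powr (- 2 / 5))
        + C0\<^sup>2 * (4 / c\<^sup>2) * CT * ((?x powr (7 / 2) * ?x powr (5 / 2)) * \<rho> ^ \<kappa> m)" by (simp add: algebra_simps)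
      also have "\<dots> = (?x * C0)\<^sup>2 * ((2 / c * ?x) * (2 * (3 * ?x powr (1 / 10))) + (2 / c * ?x)\<^sup>2 * (CT * ?x\<^sup>2 * \<rho> ^ \<kappa> m))"
        unfolding p using c by (simp add: field_simps power2_eq_square eval_nat_numeral)
      finally show ?thesis by simp
    qed
    also have "\<dots> \<le> ?x powr (7 / 2) * 1" using elim(1) by (intro mult_left_mono) auto
    also have "\<dots> = (?x powr (7 / 4))\<^sup>2" using m by (simp add: power2_eq_square powr_add[symmetric])
    finally show ?case by (rule power2_le_imp_le) simp
  qed
qed

lemma close_ev:
  assumes "\<epsilon> > 0"
  shows "\<forall>\<^sub>F m in sequentially. integrable M (\<lambda>x. \<phi> x - \<phi>s m x) \<and> (\<integral>x. \<bar>\<phi> x - \<phi>s m x\<bar> \<partial>M) \<le> \<epsilon> * (\<sigma> m / (real (n m) * real m))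
    \<and> integrable M (\<lambda>x. \<psi> x - \<psi>s (n m) x) \<and> (\<integral>x. \<bar>\<psi> x - \<psi>s (n m) x\<bar> \<partial>M) \<le> \<epsilon> * (\<sigma> m / (real (n m) * real m))"
proof -
  have 1: "\<forall>\<^sub>F m in sequentially. Lq_norm M 1 (\<lambda>x. \<phi> x - \<phi>s m x) \<le> ennreal (\<epsilon> * \<bar>\<sigma> m / (real (n m) * real m)\<bar>)"
    using \<phi>_close assms unfolding ennreal_smallo_def by blast
  have 2: "\<forall>\<^sub>F m in sequentially. Lq_norm M 1 (\<lambda>x. \<psi> x - \<psi>s (n m) x) \<le> ennreal (\<epsilon> * \<bar>\<sigma> m / (real (n m) * real m)\<bar>)"
    using \<psi>_close assms unfolding ennreal_smallo_def by blast
  show ?thesis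
    using 1 2 eventually_ge_at_top[of 1]
  proof eventually_elim
    case (elim m)
    have s: "\<sigma> m \<ge> 0" by (rule sigma_square(1)[OF elim(3), of "N\<^sub>m m"]) (auto simp: N\<^sub>m_def)
    have a: "\<bar>\<sigma> m / (real (n m) * real m)\<bar> = \<sigma> m / (real (n m) * real m)" using s by simp
    have n1: "n m \<ge> 1" using n[OF elim(3)] by simp
    have e0: "0 \<le> \<epsilon> * (\<sigma> m / (real (n m) * real m))" using assms s by simp
    have m1: "(\<lambda>x. \<phi> x - \<phi>s m x) \<in> borel_measurable M" using \<phi>s_meas[OF elim(3)] by simp
    have m2: "(\<lambda>x. \<psi> x - \<psi>s (n m) x) \<in> borel_measurable M" using \<psi>s_meas[OF n1] by simp
    show ?case
      using Lq_norm_1_le[OF m1 elim(1)[unfolded a] e0] Lq_norm_1_le[OF m2 elim(2)[unfolded a] e0] by blast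
  qed
qed

text \<open>The second bound is the first comparison for -X and -Y, where the tail probability of -X
  at a threshold is the distribution function of X at its negative.\<close>

lemma two_sided_comparison:
  fixes X Y Y' :: "'a \<Rightarrow> real"
  assumes [measurable]: "X \<in> borel_measurable M" "Y \<in> borel_measurable M"
    and at: "\<And>t. measure (law M X) {t} = 0"
    and lip: "\<And>a b. \<bar>cdf (law M X) a - cdf (law M X) b\<bar> \<le> L0 * \<bar>a - b\<bar>"
    and Y': "osc s \<eta> Y'" and s: "s \<ge> 1" and \<epsilon>: "\<epsilon> > 0"
    and int: "integrable M (\<lambda>x. Y x - Y' x)" and \<delta>: "(\<integral>x. \<bar>Y x - Y' x\<bar> \<partial>M) \<le> \<delta>" and l: "s + 2 * k\<^sup>2 \<le> l"
  shows "\<bar>(\<integral>x. of_bool (Y x \<le> X ((T ^^ l) x)) \<partial>M) - (\<integral>x. 1 - cdf (law M X) (Y x) \<partial>M)\<bar>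
      \<le> \<delta> / \<epsilon> + L0 * (\<delta> + 2 * \<eta> + \<epsilon>) + rate k"
    "\<bar>(\<integral>x. of_bool (X ((T ^^ l) x) \<le> Y x) \<partial>M) - (\<integral>x. cdf (law M X) (Y x) \<partial>M)\<bar>
      \<le> \<delta> / \<epsilon> + L0 * (\<delta> + 2 * \<eta> + \<epsilon>) + rate k"
proof -
  let ?d = "\<integral>x. \<bar>Y x - Y' x\<bar> \<partial>M"
  note cl = cdf_law[OF assms(1) at]
  have le: "?d / \<epsilon> + L0 * (?d + 2 * \<eta> + \<epsilon>) + rate k \<le> \<delta> / \<epsilon> + L0 * (\<delta> + 2 * \<eta> + \<epsilon>) + rate k"
    using \<delta> \<epsilon> L0 by (intro add_mono divide_right_mono mult_left_mono) auto
  have "\<bar>(\<integral>x. of_bool (Y x \<le> X ((T ^^ l) x)) \<partial>M) - (\<integral>x. 1 - cdf (law M X) (Y x) \<partial>M)\<bar>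
      \<le> ?d / \<epsilon> + L0 * (?d + 2 * \<eta> + \<epsilon>) + rate k"
  proof (rule comparison_probability[OF assms(1,2) Y' s _ _ L0 \<epsilon> int refl l])
    show "1 - cdf (law M X) c = (\<integral>x. of_bool (c \<le> X x) \<partial>M)" for c by (rule cl(2))
    show "\<bar>1 - cdf (law M X) a - (1 - cdf (law M X) b)\<bar> \<le> L0 * \<bar>a - b\<bar>" for a b
      using lip[of b a] by (simp add: abs_minus_commute)
  qed
  then show "\<bar>(\<integral>x. of_bool (Y x \<le> X ((T ^^ l) x)) \<partial>M) - (\<integral>x. 1 - cdf (law M X) (Y x) \<partial>M)\<bar>
      \<le> \<delta> / \<epsilon> + L0 * (\<delta> + 2 * \<eta> + \<epsilon>) + rate k" using le by linarith
  have mY': "osc s \<eta> (\<lambda>x. - Y' x)"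
    using osc_lipschitz[OF Y', of uminus 1] oscD[OF Y'] by (simp add: norm_minus_commute)
  have int': "integrable M (\<lambda>x. - Y x - - Y' x)"
  proof -
    have "integrable M (\<lambda>x. - (Y x - Y' x))" using int by (rule Bochner_Integration.integrable_minus)
    then show ?thesis by (simp add: algebra_simps)
  qed
  have d': "(\<integral>x. \<bar>- Y x - - Y' x\<bar> \<partial>M) = ?d" by (simp add: abs_minus_commute)
  have "\<bar>(\<integral>x. of_bool (- Y x \<le> - X ((T ^^ l) x)) \<partial>M) - (\<integral>x. cdf (law M X) (- (- Y x)) \<partial>M)\<bar>
      \<le> ?d / \<epsilon> + L0 * (?d + 2 * \<eta> + \<epsilon>) + rate k"
  proof (rule comparison_probability[OF _ _ mY' s _ _ L0 \<epsilon> int' d' l])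
    show "cdf (law M X) (- c) = (\<integral>x. of_bool (c \<le> - X x) \<partial>M)" for c
      unfolding cl(1) by (simp add: le_minus_iff)
    show "\<bar>cdf (law M X) (- a) - cdf (law M X) (- b)\<bar> \<le> L0 * \<bar>a - b\<bar>" for a b
      using lip[of "- a" "- b"] by (simp add: abs_minus_commute)
  qed simp_all
  then show "\<bar>(\<integral>x. of_bool (X ((T ^^ l) x) \<le> Y x) \<partial>M) - (\<integral>x. cdf (law M X) (Y x) \<partial>M)\<bar>
      \<le> \<delta> / \<epsilon> + L0 * (\<delta> + 2 * \<eta> + \<epsilon>) + rate k" using le by simp
qed

text \<open>To compare \<open>\<psi>\<close> with \<open>\<phi> \<circ> T\<^sup>l\<close> for sample size \<open>m\<close>, the approximations with index \<open>m\<^sup>8\<close> are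
  used: by \<open>sigma_upper\<close> their \<open>L\<^sup>1\<close> distance is \<open>O(m\<^sup>-\<^sup>2)\<close>, which the index \<open>m\<close> itself would not give.\<close>

definition err :: "nat \<Rightarrow> real" where
  "err m = 1 / c * real m powr (-1) + L0 * (1 / c * real m powr (-2) + 2 * (CR * real m powr 16 * \<rho> ^ \<kappa> m) + real m powr (-1))
    + 4 * C * \<rho> ^ \<kappa> m"

text \<open>The variable that is approximated on cylinders is always the earlier one, so either time
  order of the two samples has its own bound. The last two bounds concern \<phi> with itself and
  control ties.\<close>

lemma far_pairs:
  "\<forall>\<^sub>F m in sequentially. \<forall>l\<ge>q\<^sub>m m.
     \<bar>(\<integral>x. of_bool (\<psi> x \<le> \<phi> ((T ^^ l) x)) \<partial>M) - (\<integral>x. 1 - F (\<psi> x) \<partial>M)\<bar> \<le> err m \<and>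
     \<bar>(\<integral>x. of_bool (\<psi> ((T ^^ l) x) \<le> \<phi> x) \<partial>M) - (\<integral>x. G (\<phi> x) \<partial>M)\<bar> \<le> err m \<and>
     \<bar>(\<integral>x. of_bool (\<phi> x \<le> \<phi> ((T ^^ l) x)) \<partial>M) - (\<integral>x. 1 - F (\<phi> x) \<partial>M)\<bar> \<le> err m \<and>
     \<bar>(\<integral>x. of_bool (\<phi> ((T ^^ l) x) \<le> \<phi> x) \<partial>M) - (\<integral>x. F (\<phi> x) \<partial>M)\<bar> \<le> err m"
proof -
  have "\<forall>\<^sub>F j in sequentially. (\<forall>i\<ge>1. osc i (CR * (real j)\<^sup>2 * r ^ i) (\<phi>s j) \<and> osc i (CR * (real j)\<^sup>2 * r ^ i) (\<psi>s (n j)))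
     \<and> (integrable M (\<lambda>x. \<phi> x - \<phi>s j x) \<and> (\<integral>x. \<bar>\<phi> x - \<phi>s j x\<bar> \<partial>M) \<le> 1 * (\<sigma> j / (real (n j) * real j))
    \<and> integrable M (\<lambda>x. \<psi> x - \<psi>s (n j) x) \<and> (\<integral>x. \<bar>\<psi> x - \<psi>s (n j) x\<bar> \<partial>M) \<le> 1 * (\<sigma> j / (real (n j) * real j)))
     \<and> \<sigma> j \<le> real j powr (7 / 4)" (is "\<forall>\<^sub>F j in _. ?P j")
    using regular_ev close_ev[of 1, OF zero_less_one] sigma_upper by eventually_elim blast
  moreover have "filterlim (\<lambda>m. m ^ 8) sequentially (sequentially :: nat filter)"
    by (rule filterlim_subseq) (auto simp: strict_mono_def power_strict_mono)
  ultimately have "\<forall>\<^sub>F m in sequentially. ?P (m ^ 8)" by (rule eventually_compose_filterlim)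
  then show ?thesis
    using eventually_ge_at_top[of 1]
  proof (eventually_elim, intro allI impI)
    fix m l assume P: "?P (m ^ 8)" and m: "1 \<le> m" and l: "q\<^sub>m m \<le> l"
    let ?j = "m ^ 8" and ?\<delta> = "1 / c * real m powr (-2)" and ?\<eta> = "CR * real m powr 16 * \<rho> ^ \<kappa> m"
    have j: "?j \<ge> 1" using m by simp
    have k: "\<kappa> m \<ge> 1" by (rule \<kappa>(1)[OF m])
    have "\<sigma> ?j / (real (n ?j) * real ?j) \<le> real ?j powr (7 / 4) / ((c * real ?j) * real ?j)"
    proof -
      have p: "0 < (c * real ?j) * real ?j" using c m by simp
      have w: "(c * real ?j) * real ?j \<le> real (n ?j) * real ?j" using n_ge[OF j] by (intro mult_right_mono) auto
      show ?thesis by (rule frac_le[OF _ _ p w]) (use P in auto)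
    qed
    also have "\<dots> = ?\<delta>"
    proof -
      have e: "real ?j = real m powr 8" using m by simp
      have 1: "real ?j powr (7 / 4) = real m powr 14" unfolding e powr_powr by simp
      have 2: "real ?j * real ?j = real m powr 16" unfolding e powr_add[symmetric] by simp
      have 3: "real m powr 14 / real m powr 16 = real m powr (-2)" unfolding powr_diff[symmetric] by simp
      have "real ?j powr (7 / 4) / ((c * real ?j) * real ?j) = 1 / c * (real ?j powr (7 / 4) / (real ?j * real ?j))"
        by (simp add: mult.assoc)
      then show ?thesis unfolding 1 2 3 .
    qed
    finally have d: "1 * (\<sigma> ?j / (real (n ?j) * real ?j)) \<le> ?\<delta>" by simp
    have j16: "(real ?j)\<^sup>2 = real m powr 16" using m by (simp add: power_mult[symmetric])
    have he: "CR * (real ?j)\<^sup>2 * r ^ \<kappa> m \<le> ?\<eta>"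
      unfolding j16 using CR_pos \<rho> r_pos by (intro mult_left_mono power_mono) auto
    have o: "osc (\<kappa> m) ?\<eta> (\<phi>s ?j)" "osc (\<kappa> m) ?\<eta> (\<psi>s (n ?j))"
      using osc_mono[OF conjunct1[OF P[THEN conjunct1, rule_format, OF k]] order_refl he]
        osc_mono[OF conjunct2[OF P[THEN conjunct1, rule_format, OF k]] order_refl he] by blast+
    have i: "integrable M (\<lambda>x. \<phi> x - \<phi>s ?j x)" "integrable M (\<lambda>x. \<psi> x - \<psi>s (n ?j) x)" using P by auto
    have dd: "(\<integral>x. \<bar>\<phi> x - \<phi>s ?j x\<bar> \<partial>M) \<le> ?\<delta>" "(\<integral>x. \<bar>\<psi> x - \<psi>s (n ?j) x\<bar> \<partial>M) \<le> ?\<delta>"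
      using P d by (auto intro: order_trans)
    \<comment> \<open>With an L^1 distance of order m^(-2), the choice \<epsilon> = 1 / m makes
      \<delta> / \<epsilon> and \<epsilon> of the same order.\<close>
    have \<epsilon>: "real m powr (-1) > 0" using m by simp
    have l': "\<kappa> m + 2 * (\<kappa> m)\<^sup>2 \<le> l" using l by (simp add: q\<^sub>m_def)
    have "?\<delta> / real m powr (-1) = 1 / c * real m powr (-1)"
      unfolding times_divide_eq_right[symmetric] powr_diff[symmetric] by simp
    then have E: "?\<delta> / real m powr (-1) + L0 * (?\<delta> + 2 * ?\<eta> + real m powr (-1)) + rate (\<kappa> m) \<le> err m"
      unfolding err_def using rate_le[of "\<kappa> m"] by simp
    note c1 = two_sided_comparison[OF \<phi>_meas \<psi>_meas \<phi>_atomless \<phi>_lip o(2) k \<epsilon> i(2) dd(2) l', THEN order_trans, OF E]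
    note c2 = two_sided_comparison[OF \<psi>_meas \<phi>_meas \<psi>_atomless \<psi>_lip o(1) k \<epsilon> i(1) dd(1) l', THEN order_trans, OF E]
    note c3 = two_sided_comparison[OF \<phi>_meas \<phi>_meas \<phi>_atomless \<phi>_lip o(1) k \<epsilon> i(1) dd(1) l', THEN order_trans, OF E]
    show "\<bar>(\<integral>x. of_bool (\<psi> x \<le> \<phi> ((T ^^ l) x)) \<partial>M) - (\<integral>x. 1 - F (\<psi> x) \<partial>M)\<bar> \<le> err m \<and>
     \<bar>(\<integral>x. of_bool (\<psi> ((T ^^ l) x) \<le> \<phi> x) \<partial>M) - (\<integral>x. G (\<phi> x) \<partial>M)\<bar> \<le> err m \<and>
     \<bar>(\<integral>x. of_bool (\<phi> x \<le> \<phi> ((T ^^ l) x)) \<partial>M) - (\<integral>x. 1 - F (\<phi> x) \<partial>M)\<bar> \<le> err m \<and>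
     \<bar>(\<integral>x. of_bool (\<phi> ((T ^^ l) x) \<le> \<phi> x) \<partial>M) - (\<integral>x. F (\<phi> x) \<partial>M)\<bar> \<le> err m"
      by (intro conjI c1(1) c2(2) c3)
  qed
qed

end

lemma card_eq_sum_of_bool: "finite A \<Longrightarrow> real (card {k \<in> A. P k}) = (\<Sum>k\<in>A. of_bool (P k))"
  by (simp add: sum_of_bool_eq Int_def)

lemma double_sum_split:
  fixes a :: "'i \<Rightarrow> 'j \<Rightarrow> real"
  shows "(\<Sum>i\<in>I. \<Sum>k\<in>J. a i k - f k - g i + p) = (\<Sum>i\<in>I. \<Sum>k\<in>J. a i k)
    - real (card I) * (\<Sum>k\<in>J. f k) - real (card J) * (\<Sum>i\<in>I. g i) + real (card I) * real (card J) * p"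
  by (simp add: sum.distrib sum_subtractf sum_distrib_left[symmetric])

section \<open>Hoeffding decomposition, ties and the remainder\<close>

context rank_statistic
begin

definition p0 :: real where "p0 = (\<integral>x. 1 - F (\<psi> x) \<partial>M)"

lemma \<phi>T_meas[measurable]: "(\<lambda>x. \<phi> ((T ^^ i) x)) \<in> borel_measurable M"
  and \<psi>T_meas[measurable]: "(\<lambda>x. \<psi> ((T ^^ i) x)) \<in> borel_measurable M"
  by (rule measurable_compose[OF Tn_meas]; simp)+

lemma F_eq: "1 - F t = (\<integral>x. of_bool (t \<le> \<phi> x) \<partial>M)" "F t = (\<integral>x. of_bool (\<phi> x \<le> t) \<partial>M)"
  and G_eq: "1 - G t = (\<integral>x. of_bool (t \<le> \<psi> x) \<partial>M)" "G t = (\<integral>x. of_bool (\<psi> x \<le> t) \<partial>M)"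
  by (rule cdf_law[OF \<phi>_meas \<phi>_atomless] cdf_law[OF \<psi>_meas \<psi>_atomless])+

text \<open>Both are the probability of the comparison for independent copies, integrated in either
  order.\<close>

lemma p0_eq: "(\<integral>x. G (\<phi> x) \<partial>M) = p0"
proof -
  interpret P: pair_sigma_finite M M ..
  interpret PP: pair_prob_space M M ..
  have i: "integrable (M \<Otimes>\<^sub>M M) (\<lambda>(x, y). of_bool (\<psi> y \<le> \<phi> x) :: real)"
    by (rule PP.P.integrable_const_bound[of _ 1]) (auto simp: case_prod_beta)
  have "(\<integral>x. G (\<phi> x) \<partial>M) = (\<integral>x. (\<integral>y. of_bool (\<psi> y \<le> \<phi> x) \<partial>M) \<partial>M)" unfolding G_eq(2) ..
  also have "\<dots> = (\<integral>y. (\<integral>x. of_bool (\<psi> y \<le> \<phi> x) \<partial>M) \<partial>M)"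
    using P.Fubini_integral[OF i] by simp
  also have "\<dots> = p0" unfolding p0_def F_eq(1) ..
  finally show ?thesis .
qed

lemma law_integrals:
  "(\<integral>t. of_bool (s \<le> t) \<partial>law M \<phi>) = 1 - F s" "(\<integral>t. of_bool (t \<le> s) \<partial>law M \<psi>) = G s"
  "(\<integral>s. 1 - F s \<partial>law M \<psi>) = p0"
proof -
  show "(\<integral>t. of_bool (s \<le> t) \<partial>law M \<phi>) = 1 - F s"
    unfolding F_eq(1) by (subst integral_distr) auto
  show "(\<integral>t. of_bool (t \<le> s) \<partial>law M \<psi>) = G s"
    unfolding G_eq(2) by (subst integral_distr) auto
  show "(\<integral>s. 1 - F s \<partial>law M \<psi>) = p0"
    unfolding p0_def by (subst integral_distr) auto
qed

definition U :: "nat \<Rightarrow> 'a \<Rightarrow> real" where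
  "U m x = (\<Sum>i=1..m. \<Sum>k=1..n m. of_bool (\<psi> ((T ^^ k) x) \<le> \<phi> ((T ^^ i) x)))"

text \<open>The diagonal i = k is included, so the value is at least m.\<close>

definition ties :: "nat \<Rightarrow> 'a \<Rightarrow> real" where
  "ties m x = (\<Sum>i=1..m. \<Sum>k=1..m. of_bool (\<phi> ((T ^^ k) x) = \<phi> ((T ^^ i) x)))"

definition A :: "nat \<Rightarrow> 'a \<Rightarrow> real" where "A m = stat_A M T \<phi> \<psi> m (n m)"

lemma A_sum: "A m x = (\<Sum>i=1..m. \<Sum>k=1..n m. of_bool (\<psi> ((T ^^ k) x) \<le> \<phi> ((T ^^ i) x))
   - (1 - F (\<psi> ((T ^^ k) x))) - G (\<phi> ((T ^^ i) x)) + p0)"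
  unfolding A_def stat_A_def law_integrals ..

lemma A_eq: "A m x = U m x - real m * (\<Sum>k=1..n m. 1 - F (\<psi> ((T ^^ k) x)))
    - real (n m) * (\<Sum>i=1..m. G (\<phi> ((T ^^ i) x))) + real m * real (n m) * p0"
  unfolding A_sum U_def by (subst double_sum_split) simp

text \<open>Adding the comparisons within the first sample to their transpose counts every index
  pair once and every tie once more, so the comparisons are half of m^2 plus the ties.\<close>

lemma wilcoxon_eq: "wilcoxon T \<phi> \<psi> m (n m) x = U m x + ((real m)\<^sup>2 + ties m x) / 2"
proof -
  let ?V = "\<Sum>i=1..m. \<Sum>k=1..m. of_bool (\<phi> ((T ^^ k) x) \<le> \<phi> ((T ^^ i) x)) :: real"
  have W: "wilcoxon T \<phi> \<psi> m (n m) x = U m x + ?V"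
    unfolding wilcoxon_def rank_in_sample_def U_def of_nat_add card_eq_sum_of_bool[OF finite_atLeastAtMost] sum.distrib ..
  have "?V = (\<Sum>i=1..m. \<Sum>k=1..m. of_bool (\<phi> ((T ^^ i) x) \<le> \<phi> ((T ^^ k) x)))" by (rule sum.swap)
  then have "?V + ?V = (\<Sum>i=1..m. \<Sum>k=1..m. of_bool (\<phi> ((T ^^ k) x) \<le> \<phi> ((T ^^ i) x)) + of_bool (\<phi> ((T ^^ i) x) \<le> \<phi> ((T ^^ k) x)))"
    by (simp add: sum.distrib)
  also have "\<dots> = (\<Sum>i=1..m. \<Sum>k=1..m. 1 + of_bool (\<phi> ((T ^^ k) x) = \<phi> ((T ^^ i) x)))"
    by (intro sum.cong refl) auto
  also have "\<dots> = (real m)\<^sup>2 + ties m x" unfolding ties_def by (simp add: sum.distrib power2_eq_square)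
  finally show ?thesis unfolding W by simp
qed

lemma of_bool_integrable: "Measurable.pred M P \<Longrightarrow> integrable M (\<lambda>x. of_bool (P x) :: real)"
  by (rule integrable_const_bound[of _ 1]) auto

lemma ob_integrable[simp]: "integrable M (\<lambda>x. of_bool (\<psi> ((T ^^ k) x) \<le> \<phi> ((T ^^ i) x)) :: real)"
  "integrable M (\<lambda>x. of_bool (\<phi> ((T ^^ k) x) = \<phi> ((T ^^ i) x)) :: real)"
  by (rule of_bool_integrable; measurable)+

lemma FGT_integrable: "integrable M (\<lambda>x. F (\<psi> ((T ^^ k) x)))" "integrable M (\<lambda>x. G (\<phi> ((T ^^ k) x)))"
  "integrable M (\<lambda>x. F (\<phi> ((T ^^ k) x)))"
  by (rule integrable_const_bound[of _ 1]; use FG01 in \<open>auto\<close>)+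

lemma A_meas[measurable]: "A m \<in> borel_measurable M"
  unfolding A_sum[abs_def] by measurable

lemma A_bound: "\<bar>A m x\<bar> \<le> real m * (real (n m) * 4)"
proof -
  have p: "0 \<le> p0" "p0 \<le> 1"
  proof -
    have "(\<lambda>x. 1 - F (\<psi> x)) \<in> unit_funs M" using FG01 by (simp add: unit_funs_def)
    from unit_mean[OF this] show "0 \<le> p0" "p0 \<le> 1" by (auto simp: p0_def)
  qed
  have t: "\<bar>of_bool P - (1 - F y) - G z + p0\<bar> \<le> 4" for P y z
    using FG01(1,2)[of y] FG01(3,4)[of z] p by (cases P) auto
  have "\<bar>A m x\<bar> \<le> (\<Sum>i=1..m. \<Sum>k=1..n m. \<bar>of_bool (\<psi> ((T ^^ k) x) \<le> \<phi> ((T ^^ i) x))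
   - (1 - F (\<psi> ((T ^^ k) x))) - G (\<phi> ((T ^^ i) x)) + p0\<bar>)"
    unfolding A_sum by (rule double_sum_abs_le)
  also have "\<dots> \<le> (\<Sum>i=1..m. \<Sum>k=1..n m. 4)" by (intro sum_mono t)
  finally show ?thesis by simp
qed

lemma A_integrable: "integrable M (A m)"
  by (rule integrable_const_bound[of _ "real m * (real (n m) * 4)"]) (use A_bound in auto)

definition far :: "nat \<Rightarrow> bool" where
  "far m \<longleftrightarrow> (\<forall>l\<ge>q\<^sub>m m.
     \<bar>(\<integral>x. of_bool (\<psi> x \<le> \<phi> ((T ^^ l) x)) \<partial>M) - (\<integral>x. 1 - F (\<psi> x) \<partial>M)\<bar> \<le> err m \<and>
     \<bar>(\<integral>x. of_bool (\<psi> ((T ^^ l) x) \<le> \<phi> x) \<partial>M) - (\<integral>x. G (\<phi> x) \<partial>M)\<bar> \<le> err m \<and>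
     \<bar>(\<integral>x. of_bool (\<phi> x \<le> \<phi> ((T ^^ l) x)) \<partial>M) - (\<integral>x. 1 - F (\<phi> x) \<partial>M)\<bar> \<le> err m \<and>
     \<bar>(\<integral>x. of_bool (\<phi> ((T ^^ l) x) \<le> \<phi> x) \<partial>M) - (\<integral>x. F (\<phi> x) \<partial>M)\<bar> \<le> err m)"

lemma far_ev: "\<forall>\<^sub>F m in sequentially. far m"
  using far_pairs unfolding far_def .

lemma err_nonneg: "0 \<le> err m"
  unfolding err_def using c L0 CR_pos \<rho> C_\<theta> by (intro add_nonneg_nonneg mult_nonneg_nonneg) auto

lemma shift_back: "k \<le> i \<Longrightarrow> (T ^^ i) x = (T ^^ (i - k)) ((T ^^ k) x)"
  using funpow_add_apply[of k "i - k" x] by simp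

text \<open>Invariance moves the earlier of the two times to zero; the order of i and k decides
  which of the first two bounds in \<open>far\<close> applies.\<close>

lemma comparison_far:
  assumes "far m" "i + q\<^sub>m m \<le> k \<or> k + q\<^sub>m m \<le> i"
  shows "\<bar>(\<integral>x. of_bool (\<psi> ((T ^^ k) x) \<le> \<phi> ((T ^^ i) x)) \<partial>M) - p0\<bar> \<le> err m"
  using assms(2)
proof
  assume ik: "i + q\<^sub>m m \<le> k"
  then have "(\<integral>x. of_bool (\<psi> ((T ^^ k) x) \<le> \<phi> ((T ^^ i) x)) \<partial>M) = (\<integral>x. (of_bool (\<psi> ((T ^^ (k - i)) x) \<le> \<phi> x) :: real) \<partial>M)"
    using integral_Tn[of "\<lambda>x. of_bool (\<psi> ((T ^^ (k - i)) x) \<le> \<phi> x) :: real" i] by (simp add: shift_back[of i k])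
  moreover have "q\<^sub>m m \<le> k - i" using ik by simp
  ultimately show ?thesis using assms(1) unfolding far_def p0_eq by simp
next
  assume ik: "k + q\<^sub>m m \<le> i"
  then have "(\<integral>x. of_bool (\<psi> ((T ^^ k) x) \<le> \<phi> ((T ^^ i) x)) \<partial>M) = (\<integral>x. (of_bool (\<psi> x \<le> \<phi> ((T ^^ (i - k)) x)) :: real) \<partial>M)"
    using integral_Tn[of "\<lambda>x. of_bool (\<psi> x \<le> \<phi> ((T ^^ (i - k)) x)) :: real" k] by (simp add: shift_back[of k i])
  moreover have "q\<^sub>m m \<le> i - k" using ik by simp
  ultimately show ?thesis using assms(1) unfolding far_def p0_def[symmetric] by simp
qed

text \<open>Equality is the sum of the two weak inequalities minus one, and the limits of their
  probabilities add up to one. No joint density of the two values is involved.\<close>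

lemma tie_far_aux:
  assumes f: "far m" and l: "q\<^sub>m m \<le> l"
  shows "(\<integral>x. of_bool (\<phi> x = \<phi> ((T ^^ l) x)) \<partial>M) \<le> 2 * err m"
proof -
  let ?a = "\<lambda>x. of_bool (\<phi> x \<le> \<phi> ((T ^^ l) x)) :: real" and ?b = "\<lambda>x. of_bool (\<phi> ((T ^^ l) x) \<le> \<phi> x) :: real"
  have eq: "of_bool (\<phi> x = \<phi> ((T ^^ l) x)) = ?a x + ?b x - 1" for x by auto
  have i: "integrable M ?a" "integrable M ?b" by (rule of_bool_integrable; measurable)+
  have "(\<integral>x. of_bool (\<phi> x = \<phi> ((T ^^ l) x)) \<partial>M) = (\<integral>x. ?a x \<partial>M) + (\<integral>x. ?b x \<partial>M) - 1"
    unfolding eq using i by (simp add: prob_space)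
  moreover have "(\<integral>x. 1 - F (\<phi> x) \<partial>M) = 1 - (\<integral>x. F (\<phi> x) \<partial>M)"
    using FGT_integrable(3)[of 0] by (simp add: prob_space)
  moreover have "\<bar>(\<integral>x. ?a x \<partial>M) - (\<integral>x. 1 - F (\<phi> x) \<partial>M)\<bar> \<le> err m" "\<bar>(\<integral>x. ?b x \<partial>M) - (\<integral>x. F (\<phi> x) \<partial>M)\<bar> \<le> err m"
    using f l unfolding far_def by blast+
  ultimately show ?thesis by linarith
qed

lemma tie_far:
  assumes "far m" "i + q\<^sub>m m \<le> k \<or> k + q\<^sub>m m \<le> i"
  shows "(\<integral>x. of_bool (\<phi> ((T ^^ k) x) = \<phi> ((T ^^ i) x)) \<partial>M) \<le> 2 * err m"
  using assms(2)
proof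
  assume ik: "i + q\<^sub>m m \<le> k"
  have "(\<integral>x. of_bool (\<phi> ((T ^^ k) x) = \<phi> ((T ^^ i) x)) \<partial>M) = (\<integral>x. (of_bool (\<phi> x = \<phi> ((T ^^ (k - i)) x)) :: real) \<partial>M)"
    using ik integral_Tn[of "\<lambda>x. of_bool (\<phi> x = \<phi> ((T ^^ (k - i)) x)) :: real" i]
    by (simp add: shift_back[of i k] eq_commute)
  then show ?thesis using tie_far_aux[OF assms(1), of "k - i"] ik by simp
next
  assume ik: "k + q\<^sub>m m \<le> i"
  have "(\<integral>x. of_bool (\<phi> ((T ^^ k) x) = \<phi> ((T ^^ i) x)) \<partial>M) = (\<integral>x. (of_bool (\<phi> x = \<phi> ((T ^^ (i - k)) x)) :: real) \<partial>M)"
    using ik integral_Tn[of "\<lambda>x. of_bool (\<phi> x = \<phi> ((T ^^ (i - k)) x)) :: real" k]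
    by (simp add: shift_back[of k i])
  then show ?thesis using tie_far_aux[OF assms(1), of "i - k"] ik by simp
qed

lemma of_bool_mean: "Measurable.pred M P \<Longrightarrow> 0 \<le> (\<integral>x. (of_bool (P x) :: real) \<partial>M) \<and> (\<integral>x. (of_bool (P x) :: real) \<partial>M) \<le> 1"
  by (rule unit_mean) (simp add: unit_funs_def)

text \<open>Only the variance of A is assumed small, while X_i and Y_k may depend on each other at
  short distance and give A a nonzero mean. Close pairs are few, and distant pairs are almost
  independent.\<close>

lemma A_mean:
  assumes f: "far m"
  shows "\<bar>\<integral>x. A m x \<partial>M\<bar> \<le> real m * (2 * real (q\<^sub>m m)) + real m * real (n m) * err m"
proof -
  let ?a = "\<lambda>i k. (\<integral>x. of_bool (\<psi> ((T ^^ k) x) \<le> \<phi> ((T ^^ i) x)) \<partial>M) - p0"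
  have e1: "(\<integral>x. 1 - F (\<psi> ((T ^^ k) x)) \<partial>M) = p0" for k
    unfolding p0_def by (rule integral_Tn) measurable
  have e2: "(\<integral>x. G (\<phi> ((T ^^ k) x)) \<partial>M) = p0" for k
    unfolding p0_eq[symmetric] by (rule integral_Tn) measurable
  have p: "0 \<le> p0 \<and> p0 \<le> 1"
    unfolding p0_def by (rule unit_mean) (use FG01 in \<open>simp add: unit_funs_def\<close>)
  have t: "(\<integral>x. of_bool (\<psi> ((T ^^ k) x) \<le> \<phi> ((T ^^ i) x)) - (1 - F (\<psi> ((T ^^ k) x))) - G (\<phi> ((T ^^ i) x)) + p0 \<partial>M) = ?a i k" for i k
  proof -
    have i: "integrable M (\<lambda>x. 1 - F (\<psi> ((T ^^ k) x)))" using FGT_integrable(1) by simp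
    have "(\<integral>x. of_bool (\<psi> ((T ^^ k) x) \<le> \<phi> ((T ^^ i) x)) - (1 - F (\<psi> ((T ^^ k) x))) - G (\<phi> ((T ^^ i) x)) + p0 \<partial>M)
      = (\<integral>x. of_bool (\<psi> ((T ^^ k) x) \<le> \<phi> ((T ^^ i) x)) \<partial>M) - (\<integral>x. 1 - F (\<psi> ((T ^^ k) x)) \<partial>M) - (\<integral>x. G (\<phi> ((T ^^ i) x)) \<partial>M) + p0"
      using Bochner_Integration.integral_diff[OF ob_integrable(1)[of k i] i]
        Bochner_Integration.integral_diff[OF Bochner_Integration.integrable_diff[OF ob_integrable(1)[of k i] i] FGT_integrable(2)[of i]]
        Bochner_Integration.integral_add[OF Bochner_Integration.integrable_diff[OF Bochner_Integration.integrable_diff[OF ob_integrable(1)[of k i] i] FGT_integrable(2)[of i]] integrable_const[of p0]]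
      by (simp only: lebesgue_integral_const prob_space scaleR_one)
    then show ?thesis unfolding e1 e2 by simp
  qed
  have it: "integrable M (\<lambda>x. of_bool (\<psi> ((T ^^ k) x) \<le> \<phi> ((T ^^ i) x)) - (1 - F (\<psi> ((T ^^ k) x))) - G (\<phi> ((T ^^ i) x)) + p0)" for i k
    by (intro Bochner_Integration.integrable_add Bochner_Integration.integrable_diff ob_integrable FGT_integrable integrable_const)
  have eq: "(\<integral>x. A m x \<partial>M) = (\<Sum>i=1..m. \<Sum>k=1..n m. ?a i k)"
    unfolding A_sum t[symmetric]
    by (subst Bochner_Integration.integral_sum, rule Bochner_Integration.integrable_sum, rule it,
      rule sum.cong[OF refl], rule Bochner_Integration.integral_sum, rule it)
  have "\<bar>\<integral>x. A m x \<partial>M\<bar> \<le> (\<Sum>i=1..m. \<Sum>k=1..n m. \<bar>?a i k\<bar>)"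
    unfolding eq by (rule double_sum_abs_le)
  also have "\<dots> \<le> real (card {1..m}) * (2 * real (q\<^sub>m m)) + real (card {1..m}) * real (card {1..n m}) * err m"
  proof (rule near_diagonal_sum)
    show "\<bar>?a i k\<bar> \<le> 1" for i k
    proof -
      have "0 \<le> (\<integral>x. (of_bool (\<psi> ((T ^^ k) x) \<le> \<phi> ((T ^^ i) x)) :: real) \<partial>M) \<and> (\<integral>x. (of_bool (\<psi> ((T ^^ k) x) \<le> \<phi> ((T ^^ i) x)) :: real) \<partial>M) \<le> 1"
        by (rule of_bool_mean) measurable
      then show ?thesis using p by linarith
    qed
    show "\<bar>?a i k\<bar> \<le> err m" if "i + q\<^sub>m m \<le> k \<or> k + q\<^sub>m m \<le> i" for i k
      by (rule comparison_far[OF f that])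
  qed (auto simp: err_nonneg)
  finally show ?thesis by simp
qed

text \<open>Ties at short distance may have positive probability and are merely counted; distant
  ones are improbable by \<open>tie_far\<close>.\<close>

lemma ties_mean:
  assumes f: "far m"
  shows "(\<integral>x. ties m x \<partial>M) \<le> real m * (2 * real (q\<^sub>m m)) + real m * real m * (2 * err m)"
proof -
  have "(\<integral>x. ties m x \<partial>M) = (\<Sum>i=1..m. \<Sum>k=1..m. \<integral>x. of_bool (\<phi> ((T ^^ k) x) = \<phi> ((T ^^ i) x)) \<partial>M)"
    unfolding ties_def
    by (subst Bochner_Integration.integral_sum, rule Bochner_Integration.integrable_sum, rule ob_integrable,
      rule sum.cong[OF refl], rule Bochner_Integration.integral_sum, rule ob_integrable)
  also have "\<dots> \<le> real (card {1..m}) * (2 * real (q\<^sub>m m)) + real (card {1..m}) * real (card {1..m}) * (2 * err m)"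
  proof (rule near_diagonal_sum)
    show "(\<integral>x. (of_bool (\<phi> ((T ^^ k) x) = \<phi> ((T ^^ i) x)) :: real) \<partial>M) \<le> 1" for i k
      using of_bool_mean[of "\<lambda>x. \<phi> ((T ^^ k) x) = \<phi> ((T ^^ i) x)"] by simp
  qed (auto simp: err_nonneg intro: tie_far[OF f])
  finally show ?thesis by simp
qed

definition Rest :: "nat \<Rightarrow> 'a \<Rightarrow> real" where
  "Rest m x = wilcoxon T \<phi> \<psi> m (n m) x - stat_D M \<phi> \<psi> m (n m)
     - (real m * stat_B M T \<phi> \<psi>s (n m) x + real (n m) * stat_C M T \<psi> \<phi>s m x)"

definition dF :: "nat \<Rightarrow> 'a \<Rightarrow> real" where "dF m x = (1 - F (\<psi> x)) - b m x"
definition dG :: "nat \<Rightarrow> 'a \<Rightarrow> real" where "dG m x = G (\<phi> x) - e m x"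

text \<open>Passing to the approximations changes the kernels, through \<open>dF\<close> and
  \<open>dG\<close>, and also their means, whence the differences to \<open>p0\<close>. The last
  term is half of m^2 plus the ties minus the term m (m - 1) / 2 of \<open>stat_D\<close>.\<close>

lemma Rest_eq:
  assumes m: "m \<ge> 1"
  shows "Rest m x = A m x + real m * (\<Sum>k=1..n m. dF m ((T ^^ k) x) + ((\<integral>x. b m x \<partial>M) - p0))
    + real (n m) * (\<Sum>i=1..m. dG m ((T ^^ i) x) + ((\<integral>x. e m x \<partial>M) - p0)) + (real m + ties m x) / 2"
proof -
  have D: "stat_D M \<phi> \<psi> m (n m) = real m * real (n m) * p0 + real m * (real m - 1) / 2"
    unfolding stat_D_def law_integrals ..
  show ?thesis
    unfolding Rest_def wilcoxon_eq D A_eq stat_B_eq[OF m] stat_C_eq[OF m] dF_def dG_def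
    by (simp add: sum.distrib sum_subtractf field_simps power2_eq_square)
qed

lemma dF_dG:
  assumes m: "m \<ge> 1" and i1: "integrable M (\<lambda>x. \<phi> x - \<phi>s m x)" and i2: "integrable M (\<lambda>x. \<psi> x - \<psi>s (n m) x)"
    and d1: "(\<integral>x. \<bar>\<phi> x - \<phi>s m x\<bar> \<partial>M) \<le> \<delta>" and d2: "(\<integral>x. \<bar>\<psi> x - \<psi>s (n m) x\<bar> \<partial>M) \<le> \<delta>"
  shows "integrable M (dF m)" "integrable M (dG m)"
    "(\<integral>x. \<bar>dF m x\<bar> \<partial>M) \<le> L0 * \<delta>" "(\<integral>x. \<bar>dG m x\<bar> \<partial>M) \<le> L0 * \<delta>"
    "\<bar>(\<integral>x. b m x \<partial>M) - p0\<bar> \<le> L0 * \<delta>" "\<bar>(\<integral>x. e m x \<partial>M) - p0\<bar> \<le> L0 * \<delta>"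
proof -
  have ib: "integrable M (b m)" "integrable M (e m)" using unit_funs_integrable be_unit[OF m] by auto
  have iF: "integrable M (\<lambda>x. 1 - F (\<psi> x))" "integrable M (\<lambda>x. G (\<phi> x))"
    using FGT_integrable(1)[of 0] FGT_integrable(2)[of 0] by simp_all
  show iF': "integrable M (dF m)" unfolding dF_def[abs_def] by (rule Bochner_Integration.integrable_diff[OF iF(1) ib(1)])
  show iG': "integrable M (dG m)" unfolding dG_def[abs_def] by (rule Bochner_Integration.integrable_diff[OF iF(2) ib(2)])
  have "(\<integral>x. \<bar>dF m x\<bar> \<partial>M) \<le> (\<integral>x. L0 * \<bar>\<psi> x - \<psi>s (n m) x\<bar> \<partial>M)"
  proof (rule integral_mono[OF integrable_abs[OF iF'] integrable_mult_right[OF integrable_abs[OF i2]]])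
    show "\<bar>dF m x\<bar> \<le> L0 * \<bar>\<psi> x - \<psi>s (n m) x\<bar>" for x
      using \<phi>_lip[of "\<psi> x" "\<psi>s (n m) x"] by (simp add: dF_def b_def abs_minus_commute)
  qed
  also have "\<dots> \<le> L0 * \<delta>" using d2 L0 by (simp add: mult_left_mono)
  finally show a: "(\<integral>x. \<bar>dF m x\<bar> \<partial>M) \<le> L0 * \<delta>" .
  have "(\<integral>x. \<bar>dG m x\<bar> \<partial>M) \<le> (\<integral>x. L0 * \<bar>\<phi> x - \<phi>s m x\<bar> \<partial>M)"
  proof (rule integral_mono[OF integrable_abs[OF iG'] integrable_mult_right[OF integrable_abs[OF i1]]])
    show "\<bar>dG m x\<bar> \<le> L0 * \<bar>\<phi> x - \<phi>s m x\<bar>" for x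
      using \<psi>_lip[of "\<phi> x" "\<phi>s m x"] by (simp add: dG_def e_def)
  qed
  also have "\<dots> \<le> L0 * \<delta>" using d1 L0 by (simp add: mult_left_mono)
  finally show b': "(\<integral>x. \<bar>dG m x\<bar> \<partial>M) \<le> L0 * \<delta>" .
  have "(\<integral>x. dF m x \<partial>M) = p0 - (\<integral>x. b m x \<partial>M)"
    unfolding dF_def p0_def by (rule Bochner_Integration.integral_diff[OF iF(1) ib(1)])
  then show "\<bar>(\<integral>x. b m x \<partial>M) - p0\<bar> \<le> L0 * \<delta>"
    using integral_abs_bound[of M "dF m"] a by linarith
  have "(\<integral>x. dG m x \<partial>M) = p0 - (\<integral>x. e m x \<partial>M)"
    unfolding dG_def p0_eq[symmetric] by (rule Bochner_Integration.integral_diff[OF iF(2) ib(2)])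
  then show "\<bar>(\<integral>x. e m x \<partial>M) - p0\<bar> \<le> L0 * \<delta>"
    using integral_abs_bound[of M "dG m"] b' by linarith
qed

text \<open>In L^1 invariance removes the iterates from the kernel errors. The factor 4 counts two
  kernels, each with its own error and the error of its mean.\<close>

lemma Rest_L1:
  assumes m: "m \<ge> 1" and f: "far m" and i1: "integrable M (\<lambda>x. \<phi> x - \<phi>s m x)" and i2: "integrable M (\<lambda>x. \<psi> x - \<psi>s (n m) x)"
    and d1: "(\<integral>x. \<bar>\<phi> x - \<phi>s m x\<bar> \<partial>M) \<le> \<delta>" and d2: "(\<integral>x. \<bar>\<psi> x - \<psi>s (n m) x\<bar> \<partial>M) \<le> \<delta>"
  shows "integrable M (Rest m)" "(\<integral>x. \<bar>Rest m x\<bar> \<partial>M) \<le> sqrt (variance (A m))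
    + (real m * (2 * real (q\<^sub>m m)) + real m * real (n m) * err m) + 4 * L0 * (real m * real (n m) * \<delta>)
    + (real m + (real m * (2 * real (q\<^sub>m m)) + real m * real m * (2 * err m))) / 2"
proof -
  note dd = dF_dG[OF m i1 i2 d1 d2]
  let ?mA = "\<integral>x. A m x \<partial>M" and ?\<beta> = "(\<integral>x. b m x \<partial>M) - p0" and ?\<gamma> = "(\<integral>x. e m x \<partial>M) - p0"
  have iT: "integrable M (\<lambda>x. g ((T ^^ k) x))" "(\<integral>x. g ((T ^^ k) x) \<partial>M) = (\<integral>x. g x \<partial>M)" if g: "integrable M g" for g :: "'a \<Rightarrow> real" and k
  proof -
    have gm: "g \<in> borel_measurable M" using g by auto
    show "integrable M (\<lambda>x. g ((T ^^ k) x))"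
      using integrable_distr_eq[OF Tn_meas[of k] gm] g unfolding distr_Tn by simp
    show "(\<integral>x. g ((T ^^ k) x) \<partial>M) = (\<integral>x. g x \<partial>M)" by (rule integral_Tn[OF gm])
  qed
  have it: "integrable M (ties m)" unfolding ties_def[abs_def] by (intro Bochner_Integration.integrable_sum ob_integrable)
  have iFs: "integrable M (\<lambda>x. \<Sum>k=1..n m. dF m ((T ^^ k) x) + ?\<beta>)"
    by (rule Bochner_Integration.integrable_sum, rule Bochner_Integration.integrable_add, rule iT(1)[OF dd(1)], rule integrable_const)
  have iGs: "integrable M (\<lambda>x. \<Sum>k=1..m. dG m ((T ^^ k) x) + ?\<gamma>)"
    by (rule Bochner_Integration.integrable_sum, rule Bochner_Integration.integrable_add, rule iT(1)[OF dd(2)], rule integrable_const)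
  show iR: "integrable M (Rest m)"
    unfolding Rest_eq[OF m, abs_def]
    by (intro Bochner_Integration.integrable_add integrable_mult_right integrable_divide A_integrable iFs iGs it integrable_const)
  let ?u = "\<lambda>x. \<bar>A m x - ?mA\<bar> + \<bar>?mA\<bar> + real m * (\<Sum>k=1..n m. \<bar>dF m ((T ^^ k) x)\<bar> + \<bar>?\<beta>\<bar>)
    + real (n m) * (\<Sum>k=1..m. \<bar>dG m ((T ^^ k) x)\<bar> + \<bar>?\<gamma>\<bar>) + (real m + ties m x) / 2"
  have iaF: "integrable M (\<lambda>x. \<bar>dF m x\<bar>)" "integrable M (\<lambda>x. \<bar>dG m x\<bar>)" by (rule integrable_abs[OF dd(1)], rule integrable_abs[OF dd(2)])
  have j1: "integrable M (\<lambda>x. \<bar>A m x - ?mA\<bar>)"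
    by (intro integrable_abs Bochner_Integration.integrable_diff A_integrable integrable_const)
  have j2: "integrable M (\<lambda>x. \<Sum>k=1..n m. \<bar>dF m ((T ^^ k) x)\<bar> + \<bar>?\<beta>\<bar>)"
    by (rule Bochner_Integration.integrable_sum, rule Bochner_Integration.integrable_add, rule iT(1)[OF iaF(1)], rule integrable_const)
  have j3: "integrable M (\<lambda>x. \<Sum>k=1..m. \<bar>dG m ((T ^^ k) x)\<bar> + \<bar>?\<gamma>\<bar>)"
    by (rule Bochner_Integration.integrable_sum, rule Bochner_Integration.integrable_add, rule iT(1)[OF iaF(2)], rule integrable_const)
  have iu: "integrable M ?u"
    by (intro Bochner_Integration.integrable_add integrable_mult_right integrable_divide j1 j2 j3 it integrable_const)
  have le: "\<bar>Rest m x\<bar> \<le> ?u x" for x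
  proof -
    have t0: "0 \<le> ties m x" unfolding ties_def by (intro sum_nonneg) simp
    have a1: "\<bar>\<Sum>k=1..n m. dF m ((T ^^ k) x) + ?\<beta>\<bar> \<le> (\<Sum>k=1..n m. \<bar>dF m ((T ^^ k) x)\<bar> + \<bar>?\<beta>\<bar>)"
      by (rule order_trans[OF sum_abs sum_mono]) (rule abs_triangle_ineq)
    have a2: "\<bar>\<Sum>k=1..m. dG m ((T ^^ k) x) + ?\<gamma>\<bar> \<le> (\<Sum>k=1..m. \<bar>dG m ((T ^^ k) x)\<bar> + \<bar>?\<gamma>\<bar>)"
      by (rule order_trans[OF sum_abs sum_mono]) (rule abs_triangle_ineq)
    have b1: "\<bar>real m * (\<Sum>k=1..n m. dF m ((T ^^ k) x) + ?\<beta>)\<bar> \<le> real m * (\<Sum>k=1..n m. \<bar>dF m ((T ^^ k) x)\<bar> + \<bar>?\<beta>\<bar>)"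
      unfolding abs_mult abs_of_nat by (rule mult_left_mono[OF a1]) simp
    have b2: "\<bar>real (n m) * (\<Sum>k=1..m. dG m ((T ^^ k) x) + ?\<gamma>)\<bar> \<le> real (n m) * (\<Sum>k=1..m. \<bar>dG m ((T ^^ k) x)\<bar> + \<bar>?\<gamma>\<bar>)"
      unfolding abs_mult abs_of_nat by (rule mult_left_mono[OF a2]) simp
    have "\<bar>(real m + ties m x) / 2\<bar> = (real m + ties m x) / 2" using t0 by simp
    then show ?thesis unfolding Rest_eq[OF m] using b1 b2 by linarith
  qed
  have "(\<integral>x. \<bar>Rest m x\<bar> \<partial>M) \<le> (\<integral>x. ?u x \<partial>M)"
    by (rule integral_mono[OF integrable_abs[OF iR] iu le])
  also have "(\<integral>x. ?u x \<partial>M) = (\<integral>x. \<bar>A m x - ?mA\<bar> \<partial>M) + \<bar>?mA\<bar>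
    + real m * (\<integral>x. (\<Sum>k=1..n m. \<bar>dF m ((T ^^ k) x)\<bar> + \<bar>?\<beta>\<bar>) \<partial>M)
    + real (n m) * (\<integral>x. (\<Sum>k=1..m. \<bar>dG m ((T ^^ k) x)\<bar> + \<bar>?\<gamma>\<bar>) \<partial>M) + (real m + (\<integral>x. ties m x \<partial>M)) / 2"
    using j1 j2 j3 it by (simp add: prob_space del: Bochner_Integration.integral_sum)
  also have "(\<integral>x. (\<Sum>k=1..n m. \<bar>dF m ((T ^^ k) x)\<bar> + \<bar>?\<beta>\<bar>) \<partial>M) = real (n m) * ((\<integral>x. \<bar>dF m x\<bar> \<partial>M) + \<bar>?\<beta>\<bar>)"
    using iT[OF iaF(1)] by (simp add: prob_space Bochner_Integration.integral_sum)
  also have "(\<integral>x. (\<Sum>k=1..m. \<bar>dG m ((T ^^ k) x)\<bar> + \<bar>?\<gamma>\<bar>) \<partial>M) = real m * ((\<integral>x. \<bar>dG m x\<bar> \<partial>M) + \<bar>?\<gamma>\<bar>)"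
    using iT[OF iaF(2)] by (simp add: prob_space Bochner_Integration.integral_sum)
  finally have main: "(\<integral>x. \<bar>Rest m x\<bar> \<partial>M) \<le> (\<integral>x. \<bar>A m x - ?mA\<bar> \<partial>M) + \<bar>?mA\<bar>
    + real m * (real (n m) * ((\<integral>x. \<bar>dF m x\<bar> \<partial>M) + \<bar>?\<beta>\<bar>))
    + real (n m) * (real m * ((\<integral>x. \<bar>dG m x\<bar> \<partial>M) + \<bar>?\<gamma>\<bar>)) + (real m + (\<integral>x. ties m x \<partial>M)) / 2" .
  \<comment> \<open>A is split into fluctuation and mean: the assumption on the variance controls
    the former, \<open>A_mean\<close> the latter.\<close>
  have k1: "(\<integral>x. \<bar>A m x - ?mA\<bar> \<partial>M) \<le> sqrt (variance (A m))"
  proof (rule square_mean_le)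
    show "integrable M (\<lambda>x. A m x - ?mA)" using A_integrable by simp
    have bd: "\<bar>A m x - ?mA\<bar> \<le> 2 * (real m * (real (n m) * 4))" for x
    proof -
      have "\<bar>?mA\<bar> \<le> (\<integral>x. \<bar>A m x\<bar> \<partial>M)" by (rule integral_abs_bound)
      also have "\<dots> \<le> (\<integral>x. real m * (real (n m) * 4) \<partial>M)"
        by (rule integral_mono[OF integrable_abs[OF A_integrable] integrable_const A_bound])
      finally show ?thesis using A_bound[of m x] by (simp add: prob_space)
    qed
    show "integrable M (\<lambda>x. (A m x - ?mA)\<^sup>2)"
    proof (rule integrable_const_bound[of _ "(2 * (real m * (real (n m) * 4)))\<^sup>2"])
      show "AE x in M. norm ((A m x - ?mA)\<^sup>2) \<le> (2 * (real m * (real (n m) * 4)))\<^sup>2"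
      proof (rule AE_I2)
        fix x
        have "\<bar>A m x - ?mA\<bar>\<^sup>2 \<le> (2 * (real m * (real (n m) * 4)))\<^sup>2" by (rule power_mono[OF bd]) simp
        then show "norm ((A m x - ?mA)\<^sup>2) \<le> (2 * (real m * (real (n m) * 4)))\<^sup>2" by simp
      qed
    qed measurable
  qed
  have k2: "real m * (real (n m) * ((\<integral>x. \<bar>dF m x\<bar> \<partial>M) + \<bar>?\<beta>\<bar>)) \<le> real m * (real (n m) * (L0 * \<delta> + L0 * \<delta>))"
    by (intro mult_left_mono add_mono dd) auto
  have k3: "real (n m) * (real m * ((\<integral>x. \<bar>dG m x\<bar> \<partial>M) + \<bar>?\<gamma>\<bar>)) \<le> real (n m) * (real m * (L0 * \<delta> + L0 * \<delta>))"
    by (intro mult_left_mono add_mono dd) auto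
  have k4: "real m * (real (n m) * (L0 * \<delta> + L0 * \<delta>)) + real (n m) * (real m * (L0 * \<delta> + L0 * \<delta>)) = 4 * L0 * (real m * real (n m) * \<delta>)"
    by (simp add: algebra_simps)
  show "(\<integral>x. \<bar>Rest m x\<bar> \<partial>M) \<le> sqrt (variance (A m))
    + (real m * (2 * real (q\<^sub>m m)) + real m * real (n m) * err m) + 4 * L0 * (real m * real (n m) * \<delta>)
    + (real m + (real m * (2 * real (q\<^sub>m m)) + real m * real m * (2 * err m))) / 2"
    unfolding k4[symmetric]
  proof -
    have "(\<integral>x. \<bar>Rest m x\<bar> \<partial>M) \<le> sqrt (variance (A m))
      + (real m * (2 * real (q\<^sub>m m)) + real m * real (n m) * err m)
      + real m * (real (n m) * (L0 * \<delta> + L0 * \<delta>)) + real (n m) * (real m * (L0 * \<delta> + L0 * \<delta>))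
      + (real m + (real m * (2 * real (q\<^sub>m m)) + real m * real m * (2 * err m))) / 2"
      by (rule order_trans[OF main])
        (intro add_mono k1 k2 k3 A_mean[OF f] divide_right_mono order_refl ties_mean[OF f], simp)
    then show "(\<integral>x. \<bar>Rest m x\<bar> \<partial>M) \<le> sqrt (variance (A m))
      + (real m * (2 * real (q\<^sub>m m)) + real m * real (n m) * err m)
      + (real m * (real (n m) * (L0 * \<delta> + L0 * \<delta>)) + real (n m) * (real m * (L0 * \<delta> + L0 * \<delta>)))
      + (real m + (real m * (2 * real (q\<^sub>m m)) + real m * real m * (2 * err m))) / 2"
      by (simp only: add.assoc)
  qed
qed

end

section \<open>Negligibility of the remainder and the normal limit\<close>

context rank_statistic
begin

lemma sigma_lower: "\<exists>c1>0. \<forall>\<^sub>F m in sequentially. c1 * real m powr (3 / 2) \<le> \<sigma> m"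
proof -
  obtain c1 where c1: "0 < ereal c1" "ereal c1 < liminf (\<lambda>m. ereal (\<sigma> m * real m powr (-3/2)))"
    using ereal_dense2[OF \<sigma>_lower] by auto
  have "\<forall>\<^sub>F m in sequentially. ereal c1 < ereal (\<sigma> m * real m powr (-3/2))"
    by (rule less_LiminfD[OF c1(2)])
  then have "\<forall>\<^sub>F m in sequentially. c1 * real m powr (3 / 2) \<le> \<sigma> m"
    using eventually_ge_at_top[of 1]
  proof eventually_elim
    case (elim m)
    have "c1 * real m powr (3 / 2) \<le> (\<sigma> m * real m powr (-3/2)) * real m powr (3 / 2)"
      using elim(1) by (intro mult_right_mono) auto
    also have "\<dots> = \<sigma> m * (real m powr (-3/2) * real m powr (3 / 2))" by (rule mult.assoc)
    also have "real m powr (-3/2) * real m powr (3 / 2) = 1"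
      unfolding powr_add[symmetric] using elim(2) by simp
    finally show ?case by simp
  qed
  then show ?thesis using c1(1) by auto
qed

text \<open>There are of order m^2 pairs and \<sigma> is at least of order m^(3/2), so the error per
  pair has to be o(m^(-1/2)).\<close>

lemma err_small: "(\<lambda>m. real m powr (1 / 2) * err m) \<longlonglongrightarrow> 0"
proof -
  have "(\<lambda>m. 1 / c * real m powr (-1/2) + L0 * (1 / c * real m powr (-3/2) + 2 * CR * (real m powr (33/2) * \<rho> ^ \<kappa> m) + real m powr (-1/2))
    + 4 * C * (real m powr (1/2) * \<rho> ^ \<kappa> m)) \<longlonglongrightarrow> 1 / c * 0 + L0 * (1 / c * 0 + 2 * CR * 0 + 0) + 4 * C * 0"
    by (intro tendsto_add tendsto_mult tendsto_const tiny) real_asymp+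
  moreover have "real m powr (1 / 2) * err m = 1 / c * real m powr (-1/2) + L0 * (1 / c * real m powr (-3/2) + 2 * CR * (real m powr (33/2) * \<rho> ^ \<kappa> m) + real m powr (-1/2))
    + 4 * C * (real m powr (1/2) * \<rho> ^ \<kappa> m)" for m
  proof -
    have p: "real m powr (-1/2) = real m powr (1/2) * real m powr (-1)" "real m powr (-3/2) = real m powr (1/2) * real m powr (-2)"
      "real m powr (33/2) = real m powr (1/2) * real m powr 16"
      unfolding powr_add[symmetric] by simp_all
    show ?thesis unfolding err_def p by (simp only: distrib_left mult.assoc mult.left_commute mult.commute)
  qed
  ultimately show ?thesis by simp
qed

lemma Rest_small:
  "(\<lambda>m. (\<integral>x. \<bar>Rest m x\<bar> \<partial>M) / \<sigma> m) \<longlonglongrightarrow> 0" "\<forall>\<^sub>F m in sequentially. integrable M (Rest m)"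
proof -
  obtain c1 where c1: "c1 > 0" and low: "\<forall>\<^sub>F m in sequentially. c1 * real m powr (3 / 2) \<le> \<sigma> m"
    using sigma_lower by blast
  let ?Q = "\<lambda>m. (real m * (2 * real (q\<^sub>m m)) + real m * real (n m) * err m)
    + (real m + (real m * (2 * real (q\<^sub>m m)) + real m * real m * (2 * err m))) / 2"
  \<comment> \<open>Close pairs contribute at most order m^(11/10) and distant pairs m^2 times
    \<open>err m\<close>, both negligible against m^(3/2). The coefficient 9 is 6 from the mean of A
    plus half of 6 from the ties.\<close>
  have Q: "\<forall>\<^sub>F m in sequentially. ?Q m \<le> \<epsilon> * \<sigma> m" if \<epsilon>: "\<epsilon> > 0" for \<epsilon>
  proof -
    let ?g = "\<lambda>m. 9 * real m powr (- 2 / 5) + real m powr (- 1 / 2) / 2 + (1 / c + 1) * (real m powr (1 / 2) * err m)"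
    have "?g \<longlonglongrightarrow> 9 * 0 + 0 / 2 + (1 / c + 1) * 0"
      by (intro tendsto_add tendsto_mult tendsto_divide tendsto_const err_small) (real_asymp | simp)+
    then have "\<forall>\<^sub>F m in sequentially. ?g m < \<epsilon> * c1" using \<epsilon> c1 by (intro order_tendstoD(2)) auto
    then show ?thesis
      using low eventually_ge_at_top[of 1]
    proof eventually_elim
      case (elim m)
      note m = elim(3)
      let ?x = "real m"
      have q: "real (q\<^sub>m m) \<le> 3 * ?x powr (1 / 10)" by (rule q\<^sub>m_le(1)[OF m])
      have "?x * (2 * real (q\<^sub>m m)) \<le> ?x * (2 * (3 * ?x powr (1 / 10)))" using q by (intro mult_left_mono) auto
      then have a: "?x * (2 * real (q\<^sub>m m)) \<le> 6 * (?x * ?x powr (1 / 10))" by simp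
      have "?x * real (n m) * err m \<le> ?x * (?x / c) * err m"
        using n_le[OF m] err_nonneg by (intro mult_right_mono mult_left_mono) auto
      then have b: "?x * real (n m) * err m \<le> 1 / c * (?x * ?x * err m)" by simp
      have d: "?x * ?x * (2 * err m) = 2 * (?x * ?x * err m)" by simp
      have "?Q m \<le> 9 * (?x * ?x powr (1 / 10)) + ?x / 2 + (1 / c + 1) * (?x * ?x * err m)"
        unfolding d distrib_right[of "1 / c"]
      proof -
        have "a + b + (x + (a + 2 * w)) / 2 \<le> 9 * u + x / 2 + (z + 1 * w)" if "a \<le> 6 * u" "b \<le> z" for a b u w x z :: real
        proof -
          have "(x + (a + 2 * w)) / 2 = x / 2 + a / 2 + w" by (simp add: add_divide_distrib)
          then show ?thesis using that by linarith
        qed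
        from this[OF a b]
        show "?x * (2 * real (q\<^sub>m m)) + ?x * real (n m) * err m + (?x + (?x * (2 * real (q\<^sub>m m)) + 2 * (?x * ?x * err m))) / 2
          \<le> 9 * (?x * ?x powr (1 / 10)) + ?x / 2 + (1 / c * (?x * ?x * err m) + 1 * (?x * ?x * err m))" .
      qed
      also have "\<dots> = ?x powr (3 / 2) * ?g m"
      proof -
        have x1: "?x = ?x powr 1" using m by simp
        have p: "?x powr (3 / 2) * ?x powr (- 2 / 5) = ?x * ?x powr (1 / 10)" "?x powr (3 / 2) * ?x powr (- 1 / 2) = ?x"
          "?x powr (3 / 2) * ?x powr (1 / 2) = ?x * ?x"
        proof -
          show "?x powr (3 / 2) * ?x powr (- 2 / 5) = ?x * ?x powr (1 / 10)"
            by (subst (3) x1) (simp only: powr_add[symmetric], simp)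
          show "?x powr (3 / 2) * ?x powr (- 1 / 2) = ?x"
            by (subst (3) x1) (simp only: powr_add[symmetric], simp)
          have "?x powr (3 / 2) * ?x powr (1 / 2) = ?x powr 2" by (simp only: powr_add[symmetric]) simp
          then show "?x powr (3 / 2) * ?x powr (1 / 2) = ?x * ?x" using m by (simp add: power2_eq_square)
        qed
        have "?x powr (3 / 2) * ?g m = 9 * (?x powr (3 / 2) * ?x powr (- 2 / 5)) + (?x powr (3 / 2) * ?x powr (- 1 / 2)) / 2
          + (1 / c + 1) * ((?x powr (3 / 2) * ?x powr (1 / 2)) * err m)" by (simp add: algebra_simps)
        then show ?thesis unfolding p by simp
      qed
      also have "\<dots> \<le> ?x powr (3 / 2) * (\<epsilon> * c1)" using elim(1) by (intro mult_left_mono) auto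
      also have "\<dots> = \<epsilon> * (c1 * ?x powr (3 / 2))" by simp
      also have "\<dots> \<le> \<epsilon> * \<sigma> m" using elim(2) \<epsilon> by (intro mult_left_mono) auto
      finally show ?case .
    qed
  qed
  have V: "\<forall>\<^sub>F m in sequentially. sqrt (variance (A m)) \<le> \<epsilon> * \<sigma> m" if \<epsilon>: "\<epsilon> > 0" for \<epsilon>
  proof -
    have "\<forall>\<^sub>F m in sequentially. norm (variance (A m)) \<le> \<epsilon>\<^sup>2 * norm ((\<sigma> m)\<^sup>2)"
      using landau_o.smallD[OF var_A, of "\<epsilon>\<^sup>2"] \<epsilon> by (simp add: A_def)
    then show ?thesis
      using eventually_ge_at_top[of 1]
    proof eventually_elim
      case (elim m)
      have s: "\<sigma> m \<ge> 0" by (rule sigma_square(1)[OF elim(2), of "N\<^sub>m m"]) (auto simp: N\<^sub>m_def)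
      have "variance (A m) \<le> (\<epsilon> * \<sigma> m)\<^sup>2" using elim(1) by (simp add: power_mult_distrib)
      then have "sqrt (variance (A m)) \<le> sqrt ((\<epsilon> * \<sigma> m)\<^sup>2)" by (rule real_sqrt_le_mono)
      then show ?case using s \<epsilon> by simp
    qed
  qed
  have R: "\<forall>\<^sub>F m in sequentially. integrable M (Rest m) \<and> (\<integral>x. \<bar>Rest m x\<bar> \<partial>M) \<le> (2 + 4 * L0) * \<epsilon> * \<sigma> m" if \<epsilon>: "\<epsilon> > 0" for \<epsilon>
    using Q[OF \<epsilon>] V[OF \<epsilon>] close_ev[OF \<epsilon>] far_ev eventually_ge_at_top[of 1]
  proof eventually_elim
    case (elim m)
    note m = elim(5)
    have n1: "n m > 0" using n[OF m] by simp
    let ?\<delta> = "\<epsilon> * (\<sigma> m / (real (n m) * real m))"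
    have i: "integrable M (\<lambda>x. \<phi> x - \<phi>s m x)" "integrable M (\<lambda>x. \<psi> x - \<psi>s (n m) x)"
      "(\<integral>x. \<bar>\<phi> x - \<phi>s m x\<bar> \<partial>M) \<le> ?\<delta>" "(\<integral>x. \<bar>\<psi> x - \<psi>s (n m) x\<bar> \<partial>M) \<le> ?\<delta>" using elim(3) by auto
    note RL = Rest_L1[OF m elim(4) i]
    have eq: "real m * real (n m) * ?\<delta> = \<epsilon> * \<sigma> m" using m n1 by simp
    have "R \<le> d + y + d" if "R \<le> v + x + y + z" "x + z \<le> d" "v \<le> d" for R v x y z d :: real
      using that by linarith
    from this[OF RL(2)[unfolded eq] elim(1,2)]
    have "(\<integral>x. \<bar>Rest m x\<bar> \<partial>M) \<le> \<epsilon> * \<sigma> m + 4 * L0 * (\<epsilon> * \<sigma> m) + \<epsilon> * \<sigma> m" .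
    then show ?case using RL(1) by (simp add: algebra_simps)
  qed
  show "\<forall>\<^sub>F m in sequentially. integrable M (Rest m)"
    using R[of 1] by (auto elim: eventually_mono)
  show "(\<lambda>m. (\<integral>x. \<bar>Rest m x\<bar> \<partial>M) / \<sigma> m) \<longlonglongrightarrow> 0"
  proof (rule tendstoI)
    fix \<epsilon> :: real assume \<epsilon>: "\<epsilon> > 0"
    \<comment> \<open>The additional factor 2 leaves half of \<epsilon> for the strict
      inequality.\<close>
    define \<epsilon>' where "\<epsilon>' = \<epsilon> / (2 * (2 + 4 * L0))"
    have L: "2 + 4 * L0 > 0" using L0 by simp
    have e': "\<epsilon>' > 0" using \<epsilon> L by (simp add: \<epsilon>'_def)
    have e2: "(2 + 4 * L0) * \<epsilon>' = \<epsilon> / 2" using L by (simp add: \<epsilon>'_def field_simps)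
    show "\<forall>\<^sub>F m in sequentially. dist ((\<integral>x. \<bar>Rest m x\<bar> \<partial>M) / \<sigma> m) 0 < \<epsilon>"
      using R[OF e'] low eventually_ge_at_top[of 1]
    proof eventually_elim
      case (elim m)
      have "0 < c1 * real m powr (3 / 2)" using c1 elim(3) by simp
      then have s: "\<sigma> m > 0" using elim(2) by linarith
      have "(\<integral>x. \<bar>Rest m x\<bar> \<partial>M) / \<sigma> m \<le> \<epsilon> / 2"
        using elim(1) s unfolding e2 by (simp add: pos_divide_le_eq)
      moreover have "0 \<le> (\<integral>x. \<bar>Rest m x\<bar> \<partial>M) / \<sigma> m" using s by simp
      moreover have "dist X 0 < \<epsilon>" if "X \<le> \<epsilon> / 2" "0 \<le> X" for X :: real
        using that \<epsilon> by (simp add: dist_real_def)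
      ultimately show ?case by blast
    qed
  qed
qed

text \<open>The block length must be of smaller order than the standard deviation
  \<open>s\<^sub>m\<close> of the array sum, which is at least of order m^(1/2). The gaps, of order
  m^(3/5) in number and of length m^(1/10), have total variance O(m^(4/5)), negligible against its
  square. The additional block in \<open>L\<^sub>m\<close> lets the blocks overshoot both samples,
  where the summands vanish.\<close>

definition p\<^sub>m :: "nat \<Rightarrow> nat" where "p\<^sub>m m = nat \<lfloor>real m powr (2 / 5)\<rfloor>"
definition L\<^sub>m :: "nat \<Rightarrow> nat" where "L\<^sub>m m = N\<^sub>m m div (p\<^sub>m m + q\<^sub>m m) + 1"
definition s\<^sub>m :: "nat \<Rightarrow> real" where "s\<^sub>m m = \<sigma> m / (real m * C0)"
definition c\<^sub>L :: real where "c\<^sub>L = 4 / c + 1"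

lemma block_lengths:
  "\<forall>\<^sub>F m in sequentially. real (p\<^sub>m m) \<le> real m powr (2 / 5) \<and> real (L\<^sub>m m) \<le> c\<^sub>L * real m powr (3 / 5)
     \<and> N\<^sub>m m < L\<^sub>m m * (p\<^sub>m m + q\<^sub>m m)"
proof -
  have "\<forall>\<^sub>F m in sequentially. (2::real) \<le> real m powr (2 / 5)" by real_asymp
  then show ?thesis
    using eventually_ge_at_top[of 1]
  proof eventually_elim
    case (elim m)
    note m = elim(2)
    let ?x = "real m" and ?d = "p\<^sub>m m + q\<^sub>m m"
    have p: "real (p\<^sub>m m) \<le> ?x powr (2 / 5)" "?x powr (2 / 5) - 1 \<le> real (p\<^sub>m m)"
      unfolding p\<^sub>m_def using elim(1) by linarith+
    have d: "?d > 0" using q\<^sub>m_le(2)[OF m] by simp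
    have dl: "?x powr (2 / 5) / 2 \<le> real ?d" using p(2) elim(1) by simp
    have "real (N\<^sub>m m div ?d) \<le> real (N\<^sub>m m) / real ?d" by (rule of_nat_div_le_of_nat)
    also have "\<dots> \<le> (2 / c * ?x) / (?x powr (2 / 5) / 2)"
      using N\<^sub>m_le[OF m] dl m c by (intro frac_le) auto
    also have "\<dots> = 4 / c * (?x powr 1 / ?x powr (2 / 5))" using m by simp
    also have "?x powr 1 / ?x powr (2 / 5) = ?x powr (3 / 5)" unfolding powr_diff[symmetric] by simp
    finally have "real (L\<^sub>m m) \<le> 4 / c * ?x powr (3 / 5) + 1" by (simp add: L\<^sub>m_def)
    moreover have "1 \<le> ?x powr (3 / 5)" using m by (intro ge_one_powr_ge_zero) auto
    ultimately have L: "real (L\<^sub>m m) \<le> c\<^sub>L * ?x powr (3 / 5)" by (simp add: c\<^sub>L_def distrib_right)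
    have "N\<^sub>m m < (N\<^sub>m m div ?d + 1) * ?d"
      using d by (metis Suc_eq_plus1 dividend_less_div_times add.commute mult_Suc)
    then show ?case using p(1) L by (simp add: L\<^sub>m_def)
  qed
qed

lemma c\<^sub>L: "c\<^sub>L > 0" using c by (simp add: c\<^sub>L_def add_pos_pos)

text \<open>The bound of \<open>char_sum_bound\<close> is evaluated in powers of m. Terms with
  \<open>\<rho> ^ \<kappa> m\<close> vanish whatever power accompanies them, so the choice of the
  block length matters only for the remaining two negative powers.\<close>

lemma char_array:
  "(\<lambda>m. \<integral>x. iexp (t / s\<^sub>m m * (\<Sum>j<L\<^sub>m m * (p\<^sub>m m + q\<^sub>m m). summand m j ((T ^^ j) x))) \<partial>M) \<longlonglongrightarrow> exp (- (t\<^sup>2 / 2))"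
proof -
  obtain c1 where c1: "c1 > 0" and low: "\<forall>\<^sub>F m in sequentially. c1 * real m powr (3 / 2) \<le> \<sigma> m"
    using sigma_lower by blast
  define c2 where "c2 = c1 / C0"
  have c2: "c2 > 0" using c1 C0 by (simp add: c2_def)
  \<comment> \<open>\<open>bb\<close> bounds \<beta> / s, \<open>DD\<close> the relative mismatch of
    the variances, \<open>PP\<close> the ratio of block length to standard deviation and
    \<open>EE\<close> the factorization error. The exponent -1/5 is 3/5 + 1/5 - 1, and -1/10 is 2/5
    - 1/2.\<close>
  define bb where "bb m = sqrt (18 * c\<^sub>L * real m powr (- 1 / 5) + 9 * c\<^sub>L\<^sup>2 * CT * (real m powr (12 / 5) * \<rho> ^ \<kappa> m)) / c2" for m
  define DD where "DD m = 2 * bb m + (bb m)\<^sup>2 + c\<^sub>L\<^sup>2 * CT / c2\<^sup>2 * (real m powr 3 * \<rho> ^ \<kappa> m)" for m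
  define PP where "PP m = real m powr (- 1 / 10) / c2" for m
  define EE where "EE m = 2 * \<bar>t\<bar> * c\<^sub>L\<^sup>2 * CL / c2 * (real m powr (31 / 10) * \<rho> ^ \<kappa> m) + 4 * C * c\<^sub>L * (real m powr (3 / 5) * \<rho> ^ \<kappa> m)" for m
  have bb0: "bb \<longlonglongrightarrow> 0"
  proof -
    have "bb \<longlonglongrightarrow> sqrt (18 * c\<^sub>L * 0 + 9 * c\<^sub>L\<^sup>2 * CT * 0) / c2"
      unfolding bb_def
      by (intro tendsto_divide tendsto_real_sqrt tendsto_add tendsto_mult tendsto_const tiny) (use c2 in \<open>real_asymp | simp\<close>)+
    then show ?thesis by simp
  qed
  have DD0: "DD \<longlonglongrightarrow> 0"
  proof -
    have "DD \<longlonglongrightarrow> 2 * 0 + 0\<^sup>2 + c\<^sub>L\<^sup>2 * CT / c2\<^sup>2 * 0"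
      unfolding DD_def by (intro tendsto_add tendsto_mult tendsto_power tendsto_const tiny bb0)
    then show ?thesis by simp
  qed
  have PP0: "PP \<longlonglongrightarrow> 0"
  proof -
    have "PP \<longlonglongrightarrow> 0 / c2" unfolding PP_def by (intro tendsto_divide tendsto_const) (use c2 in \<open>real_asymp | simp\<close>)+
    then show ?thesis by simp
  qed
  have EE0: "EE \<longlonglongrightarrow> 0"
  proof -
    have "EE \<longlonglongrightarrow> 2 * \<bar>t\<bar> * c\<^sub>L\<^sup>2 * CL / c2 * 0 + 4 * C * c\<^sub>L * 0"
      unfolding EE_def by (intro tendsto_add tendsto_mult tendsto_const tiny)
    then show ?thesis by simp
  qed
  define BB where "BB m = \<bar>t\<bar> * bb m + EE m + (\<bar>t\<bar> ^ 3 * PP m + t ^ 4 * (PP m)\<^sup>2) * (1 + DD m) + t\<^sup>2 / 2 * DD m" for m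
  have "BB \<longlonglongrightarrow> \<bar>t\<bar> * 0 + 0 + (\<bar>t\<bar> ^ 3 * 0 + t ^ 4 * 0\<^sup>2) * (1 + 0) + t\<^sup>2 / 2 * 0"
    unfolding BB_def by (intro tendsto_add tendsto_mult tendsto_power tendsto_const bb0 DD0 PP0 EE0)
  then have BB0: "BB \<longlonglongrightarrow> 0" by simp
  have bound: "\<forall>\<^sub>F m in sequentially. norm ((\<integral>x. iexp (t / s\<^sub>m m * (\<Sum>j<L\<^sub>m m * (p\<^sub>m m + q\<^sub>m m). summand m j ((T ^^ j) x))) \<partial>M) - exp (- (t\<^sup>2 / 2))) \<le> BB m"
    using array_ev low block_lengths eventually_ge_at_top[of 1]
  proof eventually_elim
    case (elim m)
    interpret B: bounded_array M T \<alpha> r "summand m" "\<kappa> m" "\<eta>\<^sub>m m" by (rule elim(1))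
    note m = elim(4)
    let ?x = "real m" and ?N = "L\<^sub>m m * (p\<^sub>m m + q\<^sub>m m)" and ?s = "s\<^sub>m m" and ?E = "\<rho> ^ \<kappa> m"
    let ?L = "real (L\<^sub>m m)" and ?p = "real (p\<^sub>m m)" and ?q = "real (q\<^sub>m m)"
    have x0: "?x > 0" using m by simp
    have q: "B.q = q\<^sub>m m" by (simp add: B.q_def q\<^sub>m_def)
    have S: "B.S {..<?N} = (\<lambda>x. \<Sum>j<?N. summand m j ((T ^^ j) x))" unfolding B.S_def[abs_def] ..
    have E0: "0 \<le> ?E" using \<rho> by simp
    have pL: "?p \<le> ?x powr (2 / 5)" "?L \<le> c\<^sub>L * ?x powr (3 / 5)" and Nl: "m < ?N" "n m < ?N"
      using elim(3) by (auto simp: N\<^sub>m_def)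
    have slow: "c2 * ?x powr (1 / 2) \<le> ?s"
    proof -
      have "c2 * ?x powr (1 / 2) = c1 * (?x powr (3 / 2) / ?x powr 1) / C0"
        unfolding c2_def powr_diff[symmetric] by simp
      also have "\<dots> = c1 * ?x powr (3 / 2) / (?x * C0)" using m by simp
      also have "\<dots> \<le> ?s" unfolding s\<^sub>m_def using elim(2) C0 m by (intro divide_right_mono) auto
      finally show ?thesis .
    qed
    have l0: "0 < c2 * ?x powr (1 / 2)" using c2 m by simp
    then have s0: "?s > 0" using slow by linarith
    have var: "(\<integral>x. (B.S {..<?N} x)\<^sup>2 \<partial>M) = ?s\<^sup>2"
    proof -
      have "(\<sigma> m)\<^sup>2 = (?x * C0)\<^sup>2 * (\<integral>x. (B.S {..<?N} x)\<^sup>2 \<partial>M)"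
        unfolding S by (rule sigma_square(2)[OF m Nl])
      then show ?thesis using m C0 by (simp add: s\<^sub>m_def power_divide)
    qed
    have \<tau>: "B.\<tau> \<le> CT * ?x\<^sup>2 * ?E" unfolding B.\<tau>_def by (rule \<tau>_le[OF m])
    have q1: "?q \<le> 3 * ?x powr (1 / 10)" by (rule q\<^sub>m_le(1)[OF m])
    have Lp: "?L * ?p \<le> c\<^sub>L * ?x"
    proof -
      have "?L * ?p \<le> (c\<^sub>L * ?x powr (3 / 5)) * ?x powr (2 / 5)" using pL c\<^sub>L by (intro mult_mono) auto
      also have "\<dots> = c\<^sub>L * ?x powr 1" unfolding mult.assoc powr_add[symmetric] by simp
      finally show ?thesis using m by simp
    qed
    have Lq: "?L * ?q \<le> 3 * c\<^sub>L * ?x powr (7 / 10)"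
    proof -
      have "?L * ?q \<le> (c\<^sub>L * ?x powr (3 / 5)) * (3 * ?x powr (1 / 10))" using pL q1 c\<^sub>L by (intro mult_mono) auto
      also have "\<dots> = 3 * c\<^sub>L * (?x powr (3 / 5) * ?x powr (1 / 10))" by simp
      also have "?x powr (3 / 5) * ?x powr (1 / 10) = ?x powr (7 / 10)" unfolding powr_add[symmetric] by simp
      finally show ?thesis .
    qed
    let ?\<beta> = "sqrt (real (L\<^sub>m m * B.q) * (2 * real B.q) + (real (L\<^sub>m m * B.q))\<^sup>2 * B.\<tau>)"
    have \<beta>s: "?\<beta> / ?s \<le> bb m"
    proof -
      have "real (L\<^sub>m m * B.q) * (2 * real B.q) + (real (L\<^sub>m m * B.q))\<^sup>2 * B.\<tau>
        \<le> (3 * c\<^sub>L * ?x powr (7 / 10)) * (2 * (3 * ?x powr (1 / 10))) + (3 * c\<^sub>L * ?x powr (7 / 10))\<^sup>2 * (CT * ?x\<^sup>2 * ?E)"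
        unfolding q of_nat_mult
      proof (rule add_mono)
        show "?L * ?q * (2 * ?q) \<le> (3 * c\<^sub>L * ?x powr (7 / 10)) * (2 * (3 * ?x powr (1 / 10)))"
          by (rule mult_mono[OF Lq]) (use q1 c\<^sub>L in auto)
        show "(?L * ?q)\<^sup>2 * B.\<tau> \<le> (3 * c\<^sub>L * ?x powr (7 / 10))\<^sup>2 * (CT * ?x\<^sup>2 * ?E)"
          by (rule mult_mono[OF power_mono[OF Lq] \<tau>]) (use B.\<tau>_nonneg in auto)
      qed
      also have "\<dots> = ?x * (18 * c\<^sub>L * ?x powr (- 1 / 5) + 9 * c\<^sub>L\<^sup>2 * CT * (?x powr (12 / 5) * ?E))"
      proof -
        have x1: "?x = ?x powr 1" and x2: "?x\<^sup>2 = ?x powr 2" using m by simp_all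
        have p: "?x powr (7 / 10) * ?x powr (1 / 10) = ?x * ?x powr (- 1 / 5)" "(?x powr (7 / 10))\<^sup>2 * ?x\<^sup>2 = ?x * ?x powr (12 / 5)"
        proof -
          show "?x powr (7 / 10) * ?x powr (1 / 10) = ?x * ?x powr (- 1 / 5)"
            by (subst (3) x1) (simp only: powr_add[symmetric], simp)
          have "(?x powr (7 / 10))\<^sup>2 * ?x\<^sup>2 = ?x powr (17 / 5)"
            unfolding x2 by (simp only: power2_eq_square powr_add[symmetric]) simp
          also have "\<dots> = ?x powr 1 * ?x powr (12 / 5)" unfolding powr_add[symmetric] by simp
          finally show "(?x powr (7 / 10))\<^sup>2 * ?x\<^sup>2 = ?x * ?x powr (12 / 5)" using m by simp
        qed
        have "(3 * c\<^sub>L * ?x powr (7 / 10)) * (2 * (3 * ?x powr (1 / 10))) + (3 * c\<^sub>L * ?x powr (7 / 10))\<^sup>2 * (CT * ?x\<^sup>2 * ?E)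
          = 18 * c\<^sub>L * (?x powr (7 / 10) * ?x powr (1 / 10)) + 9 * c\<^sub>L\<^sup>2 * CT * (((?x powr (7 / 10))\<^sup>2 * ?x\<^sup>2) * ?E)"
          by (simp add: power_mult_distrib)
        then show ?thesis unfolding p by (simp add: algebra_simps)
      qed
      finally have "?\<beta> \<le> sqrt (?x * (18 * c\<^sub>L * ?x powr (- 1 / 5) + 9 * c\<^sub>L\<^sup>2 * CT * (?x powr (12 / 5) * ?E)))" by simp
      also have "\<dots> = ?x powr (1 / 2) * (c2 * bb m)"
        unfolding bb_def real_sqrt_mult using c2 x0 by (simp add: powr_half_sqrt)
      finally have \<beta>le: "?\<beta> \<le> ?x powr (1 / 2) * (c2 * bb m)" .
      have "0 \<le> ?\<beta>" using B.\<tau>_nonneg by simp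
      from frac_le[OF order_trans[OF this \<beta>le] \<beta>le l0 slow]
      have "?\<beta> / ?s \<le> ?x powr (1 / 2) * (c2 * bb m) / (c2 * ?x powr (1 / 2))" .
      then show ?thesis using c2 m by simp
    qed
    have \<beta>0: "0 \<le> ?\<beta> / ?s" using s0 B.\<tau>_nonneg by simp
    have s2: "c2\<^sup>2 * ?x \<le> ?s\<^sup>2"
    proof -
      have "(c2 * ?x powr (1 / 2))\<^sup>2 \<le> ?s\<^sup>2" using slow l0 by (intro power_mono) auto
      moreover have "(?x powr (1 / 2))\<^sup>2 = ?x" using x0 by (simp add: powr_half_sqrt)
      ultimately show ?thesis by (simp add: power_mult_distrib)
    qed
    have D: "(2 * ?s * ?\<beta> + ?\<beta>\<^sup>2 + (real (L\<^sub>m m * p\<^sub>m m))\<^sup>2 * B.\<tau>) / ?s\<^sup>2 \<le> DD m"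
    proof -
      have "(real (L\<^sub>m m * p\<^sub>m m))\<^sup>2 * B.\<tau> / ?s\<^sup>2 \<le> ((c\<^sub>L * ?x)\<^sup>2 * (CT * ?x\<^sup>2 * ?E)) / (c2\<^sup>2 * ?x)"
        using Lp \<tau> B.\<tau>_nonneg c\<^sub>L s2 c2 x0 CT_nonneg E0
        by (intro frac_le mult_mono power_mono) auto
      also have "\<dots> = c\<^sub>L\<^sup>2 * CT / c2\<^sup>2 * (?x powr 3 * ?E)"
        using x0 c2 by (simp add: power2_eq_square power3_eq_cube field_simps)
      finally have 3: "(real (L\<^sub>m m * p\<^sub>m m))\<^sup>2 * B.\<tau> / ?s\<^sup>2 \<le> c\<^sub>L\<^sup>2 * CT / c2\<^sup>2 * (?x powr 3 * ?E)" .
      have "(2 * ?s * ?\<beta> + ?\<beta>\<^sup>2 + (real (L\<^sub>m m * p\<^sub>m m))\<^sup>2 * B.\<tau>) / ?s\<^sup>2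
        = 2 * (?\<beta> / ?s) + (?\<beta> / ?s)\<^sup>2 + (real (L\<^sub>m m * p\<^sub>m m))\<^sup>2 * B.\<tau> / ?s\<^sup>2"
        using s0 by (simp add: add_divide_distrib power_divide power2_eq_square del: real_sqrt_pow2 real_sqrt_mult_self)
      also have "\<dots> \<le> 2 * bb m + (bb m)\<^sup>2 + c\<^sub>L\<^sup>2 * CT / c2\<^sup>2 * (?x powr 3 * ?E)"
        using \<beta>s \<beta>0 3 by (intro add_mono mult_left_mono power_mono) auto
      finally show ?thesis unfolding DD_def .
    qed
    have P: "?p / ?s \<le> PP m" "0 \<le> ?p / ?s"
    proof -
      have "?p / ?s \<le> ?x powr (2 / 5) / (c2 * ?x powr (1 / 2))" using pL(1) slow l0 by (intro frac_le) auto
      also have "\<dots> = ?x powr (2 / 5) / ?x powr (1 / 2) / c2" by simp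
      also have "?x powr (2 / 5) / ?x powr (1 / 2) = ?x powr (- 1 / 10)" unfolding powr_diff[symmetric] by simp
      finally show "?p / ?s \<le> PP m" unfolding PP_def .
      show "0 \<le> ?p / ?s" using s0 by simp
    qed
    have E: "?L * (2 * (\<bar>t / ?s\<bar> * (real (L\<^sub>m m * p\<^sub>m m) * \<eta>\<^sub>m m)) + rate (\<kappa> m)) \<le> EE m"
    proof -
      have ts: "\<bar>t / ?s\<bar> \<le> \<bar>t\<bar> / (c2 * ?x powr (1 / 2))"
        using slow l0 s0 by (simp add: abs_divide) (intro divide_left_mono; simp)
      have "?L * (2 * (\<bar>t / ?s\<bar> * (real (L\<^sub>m m * p\<^sub>m m) * \<eta>\<^sub>m m)) + rate (\<kappa> m))
        \<le> (c\<^sub>L * ?x powr (3 / 5)) * (2 * (\<bar>t\<bar> / (c2 * ?x powr (1 / 2)) * ((c\<^sub>L * ?x) * (CL * ?x\<^sup>2 * ?E))) + 4 * C * ?E)"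
        using pL(2) ts Lp rate_le[of "\<kappa> m"] rate_nonneg[of "\<kappa> m"] CL_nonneg c\<^sub>L E0 x0 l0 C_\<theta>
        by (intro mult_mono add_mono) (auto simp: \<eta>\<^sub>m_def)
      also have "\<dots> = EE m"
      proof -
        have p: "?x powr (3 / 5) / ?x powr (1 / 2) * (?x * ?x\<^sup>2) = ?x powr (31 / 10)"
        proof -
          have "?x * ?x\<^sup>2 = ?x powr 3" using x0 by (simp add: power3_eq_cube power2_eq_square)
          then show ?thesis by (simp only: powr_diff[symmetric] powr_add[symmetric]) simp
        qed
        have "(c\<^sub>L * ?x powr (3 / 5)) * (2 * (\<bar>t\<bar> / (c2 * ?x powr (1 / 2)) * ((c\<^sub>L * ?x) * (CL * ?x\<^sup>2 * ?E))) + 4 * C * ?E)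
          = 2 * \<bar>t\<bar> * c\<^sub>L\<^sup>2 * CL / c2 * ((?x powr (3 / 5) / ?x powr (1 / 2) * (?x * ?x\<^sup>2)) * ?E) + 4 * C * c\<^sub>L * (?x powr (3 / 5) * ?E)"
          using c2 by (simp add: distrib_left power2_eq_square mult_ac)
        then show ?thesis unfolding p EE_def .
      qed
      finally show ?thesis .
    qed
    have DDn: "0 \<le> DD m"
      by (rule order_trans[OF _ D]) (use s0 B.\<tau>_nonneg in auto)
    have "norm ((\<integral>x. iexp (t / ?s * B.S {..<?N} x) \<partial>M) - exp (- (t\<^sup>2 / 2)))
      \<le> \<bar>t\<bar> * ?\<beta> / ?s + ?L * (2 * (\<bar>t / ?s\<bar> * (real (L\<^sub>m m * p\<^sub>m m) * \<eta>\<^sub>m m)) + rate (\<kappa> m))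
      + (\<bar>t\<bar> ^ 3 * (?p / ?s) + t ^ 4 * (?p / ?s)\<^sup>2) * (1 + (2 * ?s * ?\<beta> + ?\<beta>\<^sup>2 + (real (L\<^sub>m m * p\<^sub>m m))\<^sup>2 * B.\<tau>) / ?s\<^sup>2)
      + t\<^sup>2 / 2 * ((2 * ?s * ?\<beta> + ?\<beta>\<^sup>2 + (real (L\<^sub>m m * p\<^sub>m m))\<^sup>2 * B.\<tau>) / ?s\<^sup>2)"
      using B.char_sum_bound[OF s0, of "L\<^sub>m m" "p\<^sub>m m" t] var unfolding q by blast
    also have "\<dots> \<le> \<bar>t\<bar> * bb m + EE m + (\<bar>t\<bar> ^ 3 * PP m + t ^ 4 * (PP m)\<^sup>2) * (1 + DD m) + t\<^sup>2 / 2 * DD m"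
    proof (rule add_mono[OF add_mono[OF add_mono[OF _ E] mult_mono] mult_left_mono[OF D]])
      show "\<bar>t\<bar> * ?\<beta> / ?s \<le> \<bar>t\<bar> * bb m" using mult_left_mono[OF \<beta>s, of "\<bar>t\<bar>"] by simp
      show "\<bar>t\<bar> ^ 3 * (?p / ?s) + t ^ 4 * (?p / ?s)\<^sup>2 \<le> \<bar>t\<bar> ^ 3 * PP m + t ^ 4 * (PP m)\<^sup>2"
        by (rule add_mono[OF mult_left_mono[OF P(1)] mult_left_mono[OF power_mono[OF P]]]) simp_all
      show "1 + (2 * ?s * ?\<beta> + ?\<beta>\<^sup>2 + (real (L\<^sub>m m * p\<^sub>m m))\<^sup>2 * B.\<tau>) / ?s\<^sup>2 \<le> 1 + DD m" using D by simp
      have "0 \<le> PP m" using P by linarith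
      then show "0 \<le> \<bar>t\<bar> ^ 3 * PP m + t ^ 4 * (PP m)\<^sup>2" by simp
      show "0 \<le> 1 + (2 * ?s * ?\<beta> + ?\<beta>\<^sup>2 + (real (L\<^sub>m m * p\<^sub>m m))\<^sup>2 * B.\<tau>) / ?s\<^sup>2"
        using s0 B.\<tau>_nonneg by simp
    qed simp
    finally show ?case unfolding S BB_def .
  qed
  have "(\<lambda>m. (\<integral>x. iexp (t / s\<^sub>m m * (\<Sum>j<L\<^sub>m m * (p\<^sub>m m + q\<^sub>m m). summand m j ((T ^^ j) x))) \<partial>M) - exp (- (t\<^sup>2 / 2))) \<longlonglongrightarrow> 0"
    by (rule Lim_null_comparison[OF bound BB0])
  then show ?thesis by (simp add: LIM_zero_iff)
qed

lemma wilcoxon_meas: "(\<lambda>x. (wilcoxon T \<phi> \<psi> m (n m) x - stat_D M \<phi> \<psi> m (n m)) / \<sigma> m) \<in> borel_measurable M"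
  unfolding wilcoxon_eq U_def ties_def by measurable

text \<open>A remainder that is small in L^1 relative to \<sigma> moves the characteristic function
  at t by at most the modulus of t times its relative size, so the limit is that of the linear
  part.\<close>

theorem rank_CLT:
  "weak_conv_m (\<lambda>m. distr M borel (\<lambda>x. (wilcoxon T \<phi> \<psi> m (n m) x - stat_D M \<phi> \<psi> m (n m)) / \<sigma> m)) std_normal_distribution"
proof (rule levy_continuity)
  show "real_distribution (distr M borel (\<lambda>x. (wilcoxon T \<phi> \<psi> m (n m) x - stat_D M \<phi> \<psi> m (n m)) / \<sigma> m))" for m
    by (rule real_distribution_distr[OF wilcoxon_meas])
  show "real_distribution std_normal_distribution" by (rule real_dist_normal_dist)
  fix t :: real
  let ?Z = "\<lambda>m x. (wilcoxon T \<phi> \<psi> m (n m) x - stat_D M \<phi> \<psi> m (n m)) / \<sigma> m"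
  let ?S = "\<lambda>m x. \<Sum>j<L\<^sub>m m * (p\<^sub>m m + q\<^sub>m m). summand m j ((T ^^ j) x)"
  let ?R = "\<lambda>m. \<bar>t\<bar> * ((\<integral>x. \<bar>Rest m x\<bar> \<partial>M) / \<sigma> m)"
  obtain c1 where c1: "c1 > 0" and low: "\<forall>\<^sub>F m in sequentially. c1 * real m powr (3 / 2) \<le> \<sigma> m"
    using sigma_lower by blast
  have char: "char (distr M borel (?Z m)) t = (\<integral>x. iexp (t * ?Z m x) \<partial>M)" for m
    unfolding char_def by (rule integral_distr[OF wilcoxon_meas]) measurable
  have "\<forall>\<^sub>F m in sequentially. norm ((\<integral>x. iexp (t * ?Z m x) \<partial>M) - (\<integral>x. iexp (t / s\<^sub>m m * ?S m x) \<partial>M)) \<le> ?R m"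
    using low block_lengths Rest_small(2) eventually_ge_at_top[of 1]
  proof eventually_elim
    case (elim m)
    note m = elim(4)
    have "0 < c1 * real m powr (3 / 2)" using c1 m by simp
    then have s: "\<sigma> m > 0" using elim(1) by linarith
    have N: "m < L\<^sub>m m * (p\<^sub>m m + q\<^sub>m m)" "n m < L\<^sub>m m * (p\<^sub>m m + q\<^sub>m m)"
      using elim(2) by (auto simp: N\<^sub>m_def)
    \<comment> \<open>The linear part is m C0 times the array sum, and \<sigma> is m C0 times
      \<open>s\<^sub>m\<close>, so the two quotients agree.\<close>
    have Z: "?Z m x = ?S m x / s\<^sub>m m + Rest m x / \<sigma> m" for x
    proof -
      have "?S m x / s\<^sub>m m = (real m * C0 * ?S m x) / \<sigma> m" by (simp add: s\<^sub>m_def)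
      also have "\<dots> = (wilcoxon T \<phi> \<psi> m (n m) x - stat_D M \<phi> \<psi> m (n m) - Rest m x) / \<sigma> m"
        unfolding stat_BC_eq[OF m N, symmetric] Rest_def by simp
      finally show ?thesis by (simp add: diff_divide_distrib)
    qed
    have hm: "(\<lambda>x. summand m j ((T ^^ j) x)) \<in> borel_measurable M" for j
      by (rule measurable_compose[OF Tn_meas summand_meas[OF m]])
    have Sm: "?S m \<in> borel_measurable M" using hm by (rule borel_measurable_sum)
    have ie: "integrable M (\<lambda>x. iexp (f x))" if "f \<in> borel_measurable M" for f :: "'a \<Rightarrow> real"
      by (rule integrable_const_bound[of _ 1]) (use that in auto)
    have i1: "integrable M (\<lambda>x. iexp (t * ?Z m x))"
      by (rule ie[OF borel_measurable_times[OF borel_measurable_const wilcoxon_meas]])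
    have i2: "integrable M (\<lambda>x. iexp (t / s\<^sub>m m * ?S m x))"
      by (rule ie[OF borel_measurable_times[OF borel_measurable_const Sm]])
    have "norm ((\<integral>x. iexp (t * ?Z m x) \<partial>M) - (\<integral>x. iexp (t / s\<^sub>m m * ?S m x) \<partial>M))
      = norm (\<integral>x. iexp (t * ?Z m x) - iexp (t / s\<^sub>m m * ?S m x) \<partial>M)"
      by (subst Bochner_Integration.integral_diff[OF i1 i2]) (rule refl)
    also have "\<dots> \<le> (\<integral>x. norm (iexp (t * ?Z m x) - iexp (t / s\<^sub>m m * ?S m x)) \<partial>M)" by (rule integral_norm_bound)
    also have "\<dots> \<le> (\<integral>x. \<bar>t\<bar> / \<sigma> m * \<bar>Rest m x\<bar> \<partial>M)"
    proof (rule integral_mono[OF integrable_norm[OF Bochner_Integration.integrable_diff[OF i1 i2]]])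
      show "integrable M (\<lambda>x. \<bar>t\<bar> / \<sigma> m * \<bar>Rest m x\<bar>)" by (rule integrable_mult_right[OF integrable_abs[OF elim(3)]])
      fix x
      have "t * ?Z m x - t / s\<^sub>m m * ?S m x = t / \<sigma> m * Rest m x" unfolding Z by (simp add: distrib_left)
      then have "\<bar>t * ?Z m x - t / s\<^sub>m m * ?S m x\<bar> = \<bar>t\<bar> / \<sigma> m * \<bar>Rest m x\<bar>" using s by (simp add: abs_mult)
      then show "norm (iexp (t * ?Z m x) - iexp (t / s\<^sub>m m * ?S m x)) \<le> \<bar>t\<bar> / \<sigma> m * \<bar>Rest m x\<bar>"
        using norm_iexp_diff[of "t * ?Z m x" "t / s\<^sub>m m * ?S m x"] by simp
    qed
    also have "\<dots> = ?R m" by simp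
    finally show ?case .
  qed
  moreover have "?R \<longlonglongrightarrow> 0" using tendsto_mult[OF tendsto_const Rest_small(1), of "\<bar>t\<bar>"] by simp
  ultimately have "(\<lambda>m. (\<integral>x. iexp (t * ?Z m x) \<partial>M) - (\<integral>x. iexp (t / s\<^sub>m m * ?S m x) \<partial>M)) \<longlonglongrightarrow> 0"
    by (rule Lim_null_comparison)
  from tendsto_add[OF this char_array[of t]]
  have "(\<lambda>m. char (distr M borel (?Z m)) t) \<longlonglongrightarrow> exp (- (t\<^sup>2 / 2))" unfolding char by simp
  then show "(\<lambda>m. char (distr M borel (?Z m)) t) \<longlonglongrightarrow> char std_normal_distribution t"
    unfolding char_std_normal_distribution by (simp add: exp_of_real)
qed

end

section \<open>The central limit theorem\<close>

theorem proposition6p3: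
  fixes M :: "'a measure" and T :: "'a \<Rightarrow> 'a" and \<alpha> \<beta> :: "'a set set" and r :: real
    and \<phi> \<psi> :: "'a \<Rightarrow> real" and \<phi>s \<psi>s :: "nat \<Rightarrow> 'a \<Rightarrow> real"
    and n :: "nat \<Rightarrow> nat" and c :: real and \<sigma> :: "nat \<Rightarrow> real"
  assumes "gibbs_markov M T \<alpha> r"
    and "measure_preserving M T"
    and "topologically_mixing M T \<alpha>"
    and "image_partition M T \<alpha> \<beta>"
    and "\<phi> \<in> L_tilde M T \<alpha> r \<beta>" and "\<psi> \<in> L_tilde M T \<alpha> r \<beta>"
    and "\<And>t. measure (law M \<phi>) {t} = 0" and "\<And>t. measure (law M \<psi>) {t} = 0"
    and "\<exists>K. K-lipschitz_on UNIV (cdf (law M \<phi>))"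
    and "\<exists>K. K-lipschitz_on UNIV (cdf (law M \<psi>))"
    and "\<And>m. m \<ge> 1 \<Longrightarrow> (\<lambda>x. complex_of_real (\<phi>s m x)) \<in> L_space M T \<alpha> r \<beta>"
    and "\<And>k. k \<ge> 1 \<Longrightarrow> (\<lambda>x. complex_of_real (\<psi>s k x)) \<in> L_space M T \<alpha> r \<beta>"
    and "(\<lambda>m. Lq_norm M 2 (\<lambda>x. \<phi> x - \<phi>s m x)) \<longlonglongrightarrow> 0"
    and "(\<lambda>k. Lq_norm M 2 (\<lambda>x. \<psi> x - \<psi>s k x)) \<longlonglongrightarrow> 0"
    and "0 < c" and "c < 1"
    and "\<And>m. m \<ge> 1 \<Longrightarrow> n m > 0 \<and> c \<le> real (n m) / real m \<and> real (n m) / real m \<le> 1 / c"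
  defines "\<sigma> \<equiv> stat_sigma M T \<phi> \<psi> \<phi>s \<psi>s n"
  assumes "(\<lambda>m. prob_space.variance M (stat_A M T \<phi> \<psi> m (n m))) \<in> o(\<lambda>m. (\<sigma> m)\<^sup>2)"
    and "ennreal_smallo (\<lambda>m. Lq_norm M 1 (\<lambda>x. \<phi> x - \<phi>s m x))
           (\<lambda>m. \<sigma> m / (real (n m) * real m))"
    and "ennreal_smallo (\<lambda>m. Lq_norm M 1 (\<lambda>x. \<psi> x - \<psi>s (n m) x))
           (\<lambda>m. \<sigma> m / (real (n m) * real m))"
    and "ennreal_smallo (\<lambda>m. lip_seminorm M T \<alpha> r \<alpha> (\<phi>s m)) (\<lambda>m. (real m)\<^sup>2)"
    and "ennreal_smallo (\<lambda>m. lip_seminorm M T \<alpha> r \<alpha> (\<psi>s (n m))) (\<lambda>m. (real (n m))\<^sup>2)"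
    and "liminf (\<lambda>m. ereal (\<sigma> m * real m powr (-3/2))) > 0"
  shows "weak_conv_m
           (\<lambda>m. distr M borel (\<lambda>x. (wilcoxon T \<phi> \<psi> m (n m) x - stat_D M \<phi> \<psi> m (n m)) / \<sigma> m))
           std_normal_distribution"
proof -
  obtain K1 K2 where lipK: "K1-lipschitz_on UNIV (cdf (law M \<phi>))" "K2-lipschitz_on UNIV (cdf (law M \<psi>))"
    using assms(9,10) by blast
  have "mixing_gibbs_markov M T \<alpha> r"
    using assms(1-3) by (simp add: mixing_gibbs_markov_def mixing_gibbs_markov_axioms_def)
  then interpret mixing_gibbs_markov M T \<alpha> r .
  have real_part: "f \<in> borel_measurable M" if "(\<lambda>x. complex_of_real (f x)) \<in> L_space M T \<alpha> r \<beta>" for f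
  proof -
    have "(\<lambda>x. complex_of_real (f x)) \<in> borel_measurable M" using that by (simp add: L_space_def)
    then have "(\<lambda>x. Re (complex_of_real (f x))) \<in> borel_measurable M" by measurable
    then show ?thesis by simp
  qed
  have lip: "\<bar>f a - f b\<bar> \<le> max K1 K2 * \<bar>a - b\<bar>" if "L-lipschitz_on UNIV f" "L \<le> max K1 K2" for L a b and f :: "real \<Rightarrow> real"
  proof -
    have "\<bar>f a - f b\<bar> \<le> L * \<bar>a - b\<bar>" using lipschitz_onD[OF that(1), of a b] by (simp add: dist_real_def)
    also have "\<dots> \<le> max K1 K2 * \<bar>a - b\<bar>" using that(2) by (intro mult_right_mono) auto
    finally show ?thesis .
  qed
  \<comment> \<open>The larger of the two Lipschitz constants serves both distribution
    functions.\<close>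
  interpret rank_statistic M T \<alpha> r \<phi> \<psi> \<phi>s \<psi>s n c \<sigma> "max K1 K2"
  proof
    show "\<phi> \<in> borel_measurable M" "\<psi> \<in> borel_measurable M" using assms(5,6) by (simp_all add: L_tilde_def)
    show "\<phi>s m \<in> borel_measurable M" if "m \<ge> 1" for m using real_part assms(11)[OF that] by blast
    show "\<psi>s m \<in> borel_measurable M" if "m \<ge> 1" for m using real_part assms(12)[OF that] by blast
    show "\<bar>cdf (law M \<phi>) a - cdf (law M \<phi>) b\<bar> \<le> max K1 K2 * \<bar>a - b\<bar>" for a b by (rule lip[OF lipK(1)]) simp
    show "\<bar>cdf (law M \<psi>) a - cdf (law M \<psi>) b\<bar> \<le> max K1 K2 * \<bar>a - b\<bar>" for a b by (rule lip[OF lipK(2)]) simp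
    show "0 \<le> max K1 K2" using lipschitz_on_nonneg[OF lipK(1)] by simp
    show "\<sigma> = stat_sigma M T \<phi> \<psi> \<phi>s \<psi>s n" by (simp add: \<sigma>_def)
  qed (use assms in auto)
  show ?thesis by (rule rank_CLT)
qed

end
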